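(* Let $u\in V$ be the solution of the Kirchhoff plate problem $a(u,v)=l(v)$ for all $v\in V$. There is a constant $C>0$ independent of the finite element mesh such that for all $v_h\in V_h$: $$h_K^2\|\mathcal A(v_h)-f\|_{0,K}\le C\big(\|u-v_h\|_{2,K}+\mathrm{osc}_K(f)\big),\qquad K\in\mathcal C_h,$$ $$h_E^{1/2}\|\llbracket M_{nn}(v_h)\rrbracket\|_{0,E}\le C\Big(\|u-v_h\|_{2,\omega_E}+\sum_{K\subset\omega_E}\mathrm{osc}_K(f)\Big),\qquad E\in\mathcal E_h^i,$$ $$h_E^{3/2}\|\llbracket V_n(v_h)\rrbracket\|_{0,E}\le C\Big(\|u-v_h\|_{2,\omega_E}+\sum_{K\subset\omega_E}\mathrm{osc}_K(f)\Big),\qquad E\in\mathcal E_h^i\setminus\mathcal E_h^S,$$ $$h_E^{3/2}\|\llbracket V_n(v_h)\rrbracket-g\|_{0,E}\le C\Big(\|u-v_h\|_{2,\omega_E}+\sum_{K\subset\omega_E}\mathrm{osc}_K(f)+\mathrm{osc}_E(g)\Big),\qquad E\in\mathcal E_h^S,$$ $$h_E^{1/2}\|M_{nn}(v_h)\|_{0,E}\le C\Big(\|u-v_h\|_{2,\omega_E}+\sum_{K\subset\omega_E}\mathrm{osc}_K(f)\Big),\qquad E\in\mathcal E_h^f\cup\mathcal E_h^s,$$ $$h_E^{3/2}\|V_n(v_h)\|_{0,E}\le C\Big(\|u-v_h\|_{2,\omega_E}+\sum_{K\subset\omega_E}\mathrm{osc}_K(f)\Big),\qquad E\in\mathcal 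E_h^f.$$
   Context: **Plate model.** $\Omega\subset\mathbb R^2$ is a polygonal domain with $\partial\Omega=\Gamma_{\mathrm c}\cup\Gamma_{\mathrm s}\cup\Gamma_{\mathrm f}$ (clamped, simply supported and free parts). The plate thickness is $d>0$, Young's modulus is $E>0$ and Poisson ratio is $\nu$ (with the usual admissible range $-1<\nu\le 1/2$). For $A\in\mathbb R^{2\times2}$, $\mathbb C A=\frac{E}{1+\nu}\big(A+\frac{\nu}{1-\nu}(\operatorname{tr}A)I\big)$. For a scalar function $w$: curvature $\boldsymbol K(w)=-\boldsymbol\varepsilon(\nabla w)$, with $\boldsymbol\varepsilon(\boldsymbol v)=\frac12(\nabla\boldsymbol v+\nabla\boldsymbol v^T)$; moment tensor $\boldsymbol M(w)=\frac{d^3}{12}\mathbb C\boldsymbol K(w)$; shear force $\boldsymbol Q(w)=\operatorname{\mathbf{div}}\boldsymbol M(w)$ (row-wise divergence); $\mathcal A(w)=-\operatorname{div}\boldsymbol Q(w)=D\Delta^2w$ with $D=\frac{Ed^3}{12(1-\nu^2)}$. The expression $\mathcal A(v_h)$ for finite element functions is understood elementwise. The loads are $f\in L^2(\Omega)$, a line load $g\in L^2(S)$ along a line $S\subset\Omega$, and a point load $F\in\mathbb R$ at an interior point $x_0\in\Omega$. Set $$V=\{v\in H^2(\Omega): v|_{\Gamma_{\mathrm c}\cup\Gamma_{\mathrm s}}=0,\ \nabla v\cdot\boldsymbol n|_{\Gamma_{\mathrm c}}=0\},$$ $$a(w,v)=\int_\Omega\boldsymbol M(w):\boldsymbol K(v)\,dx,\qquad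 l(v)=\int_\Omega fv\,dx+\int_Sgv\,ds+Fv(x_0).$$ The boundary conditions are assumed to be such that $a$ is coercive on $V$ with respect to the $H^2(\Omega)$-norm. **Boundary quantities.** On the boundary of a (sub)domain with unit outward normal $\boldsymbol n$ and unit tangent $\boldsymbol s$: $Q_n(w)=\boldsymbol Q(w)\cdot\boldsymbol n$, $M_{nn}(w)=\boldsymbol n\cdot\boldsymbol M(w)\boldsymbol n$, $M_{ns}(w)=\boldsymbol s\cdot\boldsymbol M(w)\boldsymbol n$, and the Kirchhoff shear force is $V_n(w)=Q_n(w)+\frac{\partial M_{ns}(w)}{\partial s}$. **Mesh.** $\mathcal C_h$ is a shape regular (conforming) triangulation of $\Omega$, with $x_0$ a mesh node, $S$ a union of (interior) element edges, and each boundary edge contained in one of $\Gamma_{\mathrm c},\Gamma_{\mathrm s},\Gamma_{\mathrm f}$. $h_K$, $h_E$ are the sizes (diameters) of the triangle $K$ and the edge $E$. $\mathcal E_h^i$ is the set of interior edges, $\mathcal E_h^S\subset\mathcal E_h^i$ the edges on $S$, $\mathcal E_h^f$ the edges on $\Gamma_{\mathrm f}$, and $\mathcal E_h^s$ the edges on $\Gamma_{\mathrm s}$. $\omega_E$ is the union of the elements having $E$ as an edge (two triangles for an interior edge, one for a boundary edge). $\|\cdot\|_{0,K}$, $\|\cdot\|_{0,E}$ are $L^2$-norms and $\|\cdot\|_{2,K}$, $\|\cdot\|_{2,\omega_E}$ are $H^2$-norms. For an interior edge $E=K\cap K'$ with outward normals $\boldsymbol n,\boldsymbol n'$ of $K,K'$,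 $$\llbracket M_{nn}(v)\rrbracket|_E=M_{nn}(v)-M_{n'n'}(v),\qquad \llbracket V_n(v)\rrbracket|_E=V_n(v)+V_{n'}(v),$$ where the unprimed quantities are computed from $v|_K$ and the primed ones from $v|_{K'}$. **Finite element space.** $V_h\subset V$ is a conforming space of $C^1$ functions that are polynomials of a fixed maximal degree on each $K\in\mathcal C_h$, e.g. built from Bell triangles (polynomials in $P_5(K)$ with normal derivative in $P_3(E)$ on each edge; degrees of freedom: values, first and second derivatives at the vertices), from Argyris triangles ($P_5(K)$; the Bell degrees of freedom plus normal derivatives at edge midpoints), or from higher-order generalizations of the Argyris triangle. **Data oscillation.** $f_h\in V_h$ is a fixed interpolant (approximation) of $f$ in $V_h$, and for each $E\in\mathcal E_h^S$, $g_h$ is a polynomial approximation of $g$ on $E$ of fixed maximal degree. Then $$\mathrm{osc}_K(f)=h_K^2\|f-f_h\|_{0,K},\qquad \mathrm{osc}_E(g)=h_E^{3/2}\|g-g_h\|_{0,E}.$$ "Independent of the mesh" means: depending only on $\Omega$, the boundary partition, the material parameters, the shape-regularity constant, the type/degree of element and the maximal degree of $g_h$, and not on the loads, the functions involved, or the mesh sizes. *)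

theory Defs
  imports "HOL-Analysis.Analysis"
begin

type_synonym plane = "real^2"
type_synonym field = "plane \<Rightarrow> real"

section \<open>Lebesgue and Sobolev spaces on plane domains\<close>

text \<open>Elements of \<open>L\<^sup>2(A)\<close> are functions on the whole plane; only their values almost everywhere
  in \<open>A\<close> matter.\<close>

definition L2 :: "plane set \<Rightarrow> field set" where
  "L2 A = {w. w \<in> borel_measurable (lebesgue_on A) \<and> integrable (lebesgue_on A) (\<lambda>x. (w x)\<^sup>2)}"

definition L2norm :: "plane set \<Rightarrow> field \<Rightarrow> real" where
  "L2norm A w = sqrt (\<integral>x. (w x)\<^sup>2 \<partial>lebesgue_on A)"

definition pd :: "2 \<Rightarrow> field \<Rightarrow> field" where
  "pd i w = (\<lambda>x. frechet_derivative w (at x) (axis i 1))"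

primrec Ck :: "nat \<Rightarrow> field \<Rightarrow> bool" where
  "Ck 0 w \<longleftrightarrow> continuous_on UNIV w"
| "Ck (Suc k) w \<longleftrightarrow> w differentiable_on UNIV \<and> (\<forall>i. Ck k (pd i w))"

definition test_function :: "plane set \<Rightarrow> field \<Rightarrow> bool" where
  "test_function \<Omega> \<phi> \<longleftrightarrow> (\<forall>k. Ck k \<phi>) \<and>
     compact (closure {x. \<phi> x \<noteq> 0}) \<and> closure {x. \<phi> x \<noteq> 0} \<subseteq> \<Omega>"

definition locally_integrable :: "plane set \<Rightarrow> field \<Rightarrow> bool" where
  "locally_integrable \<Omega> w \<longleftrightarrow> (\<forall>B. compact B \<and> B \<subseteq> \<Omega> \<longrightarrow> integrable (lebesgue_on B) w)"

definition has_weak_pd :: "plane set \<Rightarrow> 2 \<Rightarrow> field \<Rightarrow> field \<Rightarrow> bool" where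
  "has_weak_pd \<Omega> i w g \<longleftrightarrow> locally_integrable \<Omega> w \<and> locally_integrable \<Omega> g \<and>
     (\<forall>\<phi>. test_function \<Omega> \<phi> \<longrightarrow>
        (\<integral>x. w x * pd i \<phi> x \<partial>lebesgue_on \<Omega>) = - (\<integral>x. g x * \<phi> x \<partial>lebesgue_on \<Omega>))"

text \<open>The weak derivative is unique up to a null set of \<open>\<Omega>\<close>; a representative is chosen.\<close>

definition wpd :: "plane set \<Rightarrow> 2 \<Rightarrow> field \<Rightarrow> field" where
  "wpd \<Omega> i w = (SOME g. has_weak_pd \<Omega> i w g)"

definition H1 :: "plane set \<Rightarrow> field set" where
  "H1 \<Omega> = {w \<in> L2 \<Omega>. \<forall>i. \<exists>g \<in> L2 \<Omega>. has_weak_pd \<Omega> i w g}"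

definition H1norm :: "plane set \<Rightarrow> field \<Rightarrow> real" where
  "H1norm \<Omega> w = sqrt ((L2norm \<Omega> w)\<^sup>2 + (\<Sum>i\<in>UNIV. (L2norm \<Omega> (wpd \<Omega> i w))\<^sup>2))"

text \<open>By the Sobolev embedding in two dimensions every class in \<open>H\<^sup>2(\<Omega>)\<close> has exactly one
  representative that is continuous on \<open>\<Omega>\<close>. Requiring this representative gives a meaning to point
  values and to integrals along lines.\<close>

definition H2 :: "plane set \<Rightarrow> field set" where
  "H2 \<Omega> = {w \<in> H1 \<Omega>. continuous_on \<Omega> w \<and> (\<forall>i. wpd \<Omega> i w \<in> H1 \<Omega>)}"

text \<open>\<open>H2norm \<Omega> A w\<close> is the \<open>H\<^sup>2(A)\<close>-norm of \<open>w \<in> H\<^sup>2(\<Omega>)\<close>, where \<open>A\<close> is \<open>\<Omega>\<close>, an element, or a union of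
  elements (closed sets, which differ from a subset of \<open>\<Omega>\<close> by a null set only).\<close>

definition H2norm :: "plane set \<Rightarrow> plane set \<Rightarrow> field \<Rightarrow> real" where
  "H2norm \<Omega> A w = sqrt ((L2norm A w)\<^sup>2 + (\<Sum>i\<in>UNIV. (L2norm A (wpd \<Omega> i w))\<^sup>2)
     + (\<Sum>i\<in>UNIV. \<Sum>j\<in>UNIV. (L2norm A (wpd \<Omega> j (wpd \<Omega> i w)))\<^sup>2))"


section \<open>Segments: arc length integrals and traces\<close>

definition is_segment :: "plane set \<Rightarrow> bool" where
  "is_segment E \<longleftrightarrow> (\<exists>a b. a \<noteq> b \<and> E = closed_segment a b)"

text \<open>End points of a segment, in some order; the notions below do not depend on the order.\<close>

definition seg_ends :: "plane set \<Rightarrow> plane \<times> plane" where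
  "seg_ends E = (SOME p. E = closed_segment (fst p) (snd p))"

definition seg_param :: "plane set \<Rightarrow> real \<Rightarrow> plane" where
  "seg_param E t = fst (seg_ends E) + t *\<^sub>R (snd (seg_ends E) - fst (seg_ends E))"

definition seg_int :: "plane set \<Rightarrow> field \<Rightarrow> real" where
  "seg_int E w = dist (fst (seg_ends E)) (snd (seg_ends E)) *
     (\<integral>t. w (seg_param E t) \<partial>lebesgue_on {0..1})"

definition seg_L2 :: "plane set \<Rightarrow> field set" where
  "seg_L2 E = {w. (\<lambda>t. w (seg_param E t)) \<in> borel_measurable (lebesgue_on {0..1}) \<and>
     integrable (lebesgue_on {0..1}) (\<lambda>t. (w (seg_param E t))\<^sup>2)}"

definition seg_norm :: "plane set \<Rightarrow> field \<Rightarrow> real" where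
  "seg_norm E w = sqrt (seg_int E (\<lambda>x. (w x)\<^sup>2))"

text \<open>The trace \<open>H\<^sup>1(\<Omega>) \<rightarrow> L\<^sup>2(\<partial>\<Omega>)\<close> is the continuous extension of the restriction of
  \<open>H\<^sup>1(\<Omega>) \<inter> C(closure \<Omega>)\<close> to the boundary; here: the trace of \<open>w\<close> on the segment \<open>E \<subseteq> \<partial>\<Omega>\<close> vanishes.\<close>

definition zero_trace :: "plane set \<Rightarrow> plane set \<Rightarrow> field \<Rightarrow> bool" where
  "zero_trace \<Omega> E w \<longleftrightarrow> w \<in> H1 \<Omega> \<and>
     (\<exists>\<phi> :: nat \<Rightarrow> field. (\<forall>k. \<phi> k \<in> H1 \<Omega> \<and> continuous_on (closure \<Omega>) (\<phi> k)) \<and>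
        (\<lambda>k. H1norm \<Omega> (\<lambda>x. w x - \<phi> k x)) \<longlonglongrightarrow> 0 \<and> (\<lambda>k. seg_norm E (\<phi> k)) \<longlonglongrightarrow> 0)"


section \<open>Domain and boundary partition\<close>

definition segment_union :: "plane set \<Rightarrow> bool" where
  "segment_union \<Gamma> \<longleftrightarrow> (\<exists>\<S>. finite \<S> \<and> (\<forall>E\<in>\<S>. is_segment E) \<and> \<Gamma> = \<Union>\<S>)"

text \<open>The condition \<open>interior (closure \<Omega>) = \<Omega>\<close> excludes slits: the domain lies on one side of
  its boundary.\<close>

definition polygonal_domain :: "plane set \<Rightarrow> bool" where
  "polygonal_domain \<Omega> \<longleftrightarrow> open \<Omega> \<and> connected \<Omega> \<and> bounded \<Omega> \<and> \<Omega> \<noteq> {} \<and>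
     interior (closure \<Omega>) = \<Omega> \<and> segment_union (frontier \<Omega>)"

text \<open>Clamped, simply supported and free part; each of them may be empty.\<close>

definition boundary_partition :: "plane set \<Rightarrow> plane set \<Rightarrow> plane set \<Rightarrow> plane set \<Rightarrow> bool" where
  "boundary_partition \<Omega> \<Gamma>c \<Gamma>s \<Gamma>f \<longleftrightarrow>
     segment_union \<Gamma>c \<and> segment_union \<Gamma>s \<and> segment_union \<Gamma>f \<and>
     frontier \<Omega> = \<Gamma>c \<union> \<Gamma>s \<union> \<Gamma>f \<and>
     finite (\<Gamma>c \<inter> \<Gamma>s) \<and> finite (\<Gamma>c \<inter> \<Gamma>f) \<and> finite (\<Gamma>s \<inter> \<Gamma>f)"


section \<open>The plate operators\<close>

record plate =
  thickness :: real
  young :: real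
  poisson :: real

definition admissible :: "plate \<Rightarrow> bool" where
  "admissible P \<longleftrightarrow> thickness P > 0 \<and> young P > 0 \<and> - 1 < poisson P \<and> poisson P \<le> 1/2"

definition elasticity :: "plate \<Rightarrow> real^2^2 \<Rightarrow> real^2^2" where
  "elasticity P A = (young P / (1 + poisson P)) *\<^sub>R
     (A + (poisson P / (1 - poisson P) * trace A) *\<^sub>R mat 1)"

text \<open>Curvature and moment are parametrised by the partial derivatives \<open>D\<close> to be used: \<open>wpd \<Omega>\<close> for
  Sobolev functions and \<open>pd\<close> for polynomials.\<close>

definition grad :: "(2 \<Rightarrow> field \<Rightarrow> field) \<Rightarrow> field \<Rightarrow> plane \<Rightarrow> plane" where
  "grad D w x = (\<chi> i. D i w x)"

definition strain :: "(2 \<Rightarrow> field \<Rightarrow> field) \<Rightarrow> (plane \<Rightarrow> plane) \<Rightarrow> plane \<Rightarrow> real^2^2" where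
  "strain D v x = (1/2) *\<^sub>R ((\<chi> i j. D j (\<lambda>y. v y $ i) x) + transpose (\<chi> i j. D j (\<lambda>y. v y $ i) x))"

definition curvature :: "(2 \<Rightarrow> field \<Rightarrow> field) \<Rightarrow> field \<Rightarrow> plane \<Rightarrow> real^2^2" where
  "curvature D w x = - strain D (grad D w) x"

definition moment :: "plate \<Rightarrow> (2 \<Rightarrow> field \<Rightarrow> field) \<Rightarrow> field \<Rightarrow> plane \<Rightarrow> real^2^2" where
  "moment P D w x = ((thickness P)^3 / 12) *\<^sub>R elasticity P (curvature D w x)"

definition shear :: "plate \<Rightarrow> field \<Rightarrow> plane \<Rightarrow> plane" where
  "shear P w x = (\<chi> i. \<Sum>j\<in>UNIV. pd j (\<lambda>y. moment P pd w y $ i $ j) x)"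

definition plate_op :: "plate \<Rightarrow> field \<Rightarrow> field" where
  "plate_op P w x = - (\<Sum>i\<in>UNIV. pd i (\<lambda>y. shear P w y $ i) x)"

definition tangent :: "plane \<Rightarrow> plane" where
  "tangent n = vector [- (n $ 2), n $ 1]"

definition Q_n :: "plate \<Rightarrow> plane \<Rightarrow> field \<Rightarrow> field" where
  "Q_n P n w x = shear P w x \<bullet> n"

definition M_nn :: "plate \<Rightarrow> plane \<Rightarrow> field \<Rightarrow> field" where
  "M_nn P n w x = n \<bullet> (moment P pd w x *v n)"

definition M_ns :: "plate \<Rightarrow> plane \<Rightarrow> field \<Rightarrow> field" where
  "M_ns P n w x = tangent n \<bullet> (moment P pd w x *v n)"

text \<open>The opposite choice of the unit tangent gives the same \<open>V_n\<close>.\<close>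

definition V_n :: "plate \<Rightarrow> plane \<Rightarrow> field \<Rightarrow> field" where
  "V_n P n w x = Q_n P n w x + tangent n \<bullet> grad pd (M_ns P n w) x"


section \<open>The continuous problem\<close>

text \<open>The normal derivative on a boundary segment is formed with either unit normal of the segment; its
  sign is irrelevant for a vanishing trace.\<close>

definition plate_space :: "plane set \<Rightarrow> plane set \<Rightarrow> plane set \<Rightarrow> field set" where
  "plate_space \<Omega> \<Gamma>c \<Gamma>s = {v \<in> H2 \<Omega>.
     (\<forall>E. is_segment E \<and> E \<subseteq> \<Gamma>c \<union> \<Gamma>s \<longrightarrow> zero_trace \<Omega> E v) \<and>
     (\<forall>E n. is_segment E \<and> E \<subseteq> \<Gamma>c \<and> norm n = 1 \<and> (\<forall>x\<in>E. \<forall>y\<in>E. n \<bullet> (y - x) = 0) \<longrightarrow>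
        zero_trace \<Omega> E (\<lambda>x. grad (wpd \<Omega>) v x \<bullet> n))}"

text \<open>The inner product of the type of matrices is the double contraction.\<close>

definition plate_form :: "plate \<Rightarrow> plane set \<Rightarrow> field \<Rightarrow> field \<Rightarrow> real" where
  "plate_form P \<Omega> w v =
     (\<integral>x. moment P (wpd \<Omega>) w x \<bullet> curvature (wpd \<Omega>) v x \<partial>lebesgue_on \<Omega>)"

definition coercive_form :: "plate \<Rightarrow> plane set \<Rightarrow> field set \<Rightarrow> bool" where
  "coercive_form P \<Omega> V \<longleftrightarrow>
     (\<exists>\<alpha>>0. \<forall>v\<in>V. \<alpha> * (H2norm \<Omega> \<Omega> v)\<^sup>2 \<le> plate_form P \<Omega> v v)"

text \<open>The line carrying \<open>g\<close> is the union of the non-overlapping segments in \<open>\<S>\<close>.\<close>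

definition load :: "plane set \<Rightarrow> field \<Rightarrow> plane set set \<Rightarrow> field \<Rightarrow> real \<Rightarrow> plane \<Rightarrow> field \<Rightarrow> real" where
  "load \<Omega> f \<S> g F x\<^sub>0 v =
     (\<integral>x. f x * v x \<partial>lebesgue_on \<Omega>) + (\<Sum>E\<in>\<S>. seg_int E (\<lambda>x. g x * v x)) + F * v x\<^sub>0"


section \<open>Meshes\<close>

definition mesh_edges :: "plane set set \<Rightarrow> plane set set" where
  "mesh_edges \<C> = {E. \<exists>K\<in>\<C>. E edge_of K}"

definition elements_at :: "plane set set \<Rightarrow> plane set \<Rightarrow> plane set set" where
  "elements_at \<C> E = {K\<in>\<C>. E edge_of K}"

definition patch :: "plane set set \<Rightarrow> plane set \<Rightarrow> plane set" where
  "patch \<C> E = \<Union>(elements_at \<C> E)"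

definition interior_edges :: "plane set set \<Rightarrow> plane set set" where
  "interior_edges \<C> = {E. \<exists>K\<in>elements_at \<C> E. \<exists>K'\<in>elements_at \<C> E. K \<noteq> K'}"

definition line_edges :: "plane set set \<Rightarrow> plane set \<Rightarrow> plane set set" where
  "line_edges \<C> S = {E \<in> interior_edges \<C>. E \<subseteq> S}"

definition boundary_edges :: "plane set set \<Rightarrow> plane set \<Rightarrow> plane set set" where
  "boundary_edges \<C> \<Gamma> = {E \<in> mesh_edges \<C>. E \<subseteq> \<Gamma>}"

text \<open>Shape regularity: the ratio of the diameter of an element to the diameter of a suitable disc
  contained in it is at most \<open>\<kappa>\<close>.\<close>

definition shape_regular :: "real \<Rightarrow> plane set set \<Rightarrow> bool" where
  "shape_regular \<kappa> \<C> \<longleftrightarrow> (\<forall>K\<in>\<C>. \<exists>x r. r > 0 \<and> cball x r \<subseteq> K \<and> diameter K \<le> \<kappa> * (2 * r))"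

definition plate_mesh ::
  "real \<Rightarrow> plane set \<Rightarrow> plane set \<Rightarrow> plane set \<Rightarrow> plane set \<Rightarrow> plane set set \<Rightarrow> bool" where
  "plate_mesh \<kappa> \<Omega> \<Gamma>c \<Gamma>s \<Gamma>f \<C> \<longleftrightarrow>
     triangulation \<C> \<and> (\<forall>K\<in>\<C>. 2 simplex K) \<and> \<Union>\<C> = closure \<Omega> \<and> shape_regular \<kappa> \<C> \<and>
     (\<forall>E \<in> boundary_edges \<C> (frontier \<Omega>). E \<subseteq> \<Gamma>c \<or> E \<subseteq> \<Gamma>s \<or> E \<subseteq> \<Gamma>f)"

text \<open>On an edge \<open>E\<close> of the triangle \<open>K\<close> this characterises the unit outward normal; that it is
  orthogonal to \<open>E\<close> follows since \<open>E \<subseteq> K\<close>.\<close>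

definition outward_normal :: "plane set \<Rightarrow> plane set \<Rightarrow> plane" where
  "outward_normal K E = (THE n. norm n = 1 \<and> (\<forall>x\<in>E. \<forall>y\<in>K. n \<bullet> (y - x) \<le> 0))"


section \<open>Finite element spaces\<close>

definition poly_le :: "nat \<Rightarrow> field \<Rightarrow> bool" where
  "poly_le m p \<longleftrightarrow> (\<exists>c :: nat \<Rightarrow> nat \<Rightarrow> real. \<forall>x.
     p x = (\<Sum>i\<le>m. \<Sum>j\<le>m - i. c i j * (x $ 1) ^ i * (x $ 2) ^ j))"

text \<open>The polynomial that agrees with \<open>v\<close> on \<open>K\<close>. Its derivatives on \<open>\<partial>K\<close> are the one-sided
  derivatives of \<open>v\<close> restricted to \<open>K\<close>.\<close>

definition elem_poly :: "field \<Rightarrow> plane set \<Rightarrow> field" where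
  "elem_poly v K = (THE p. (\<exists>m. poly_le m p) \<and> (\<forall>x\<in>K. p x = v x))"

definition C1_closure :: "plane set \<Rightarrow> field \<Rightarrow> bool" where
  "C1_closure \<Omega> v \<longleftrightarrow> continuous_on (closure \<Omega>) v \<and>
     (\<exists>G :: plane \<Rightarrow> plane. continuous_on (closure \<Omega>) G \<and>
        (\<forall>x\<in>\<Omega>. (v has_derivative (\<lambda>h. G x \<bullet> h)) (at x)))"

text \<open>Any conforming space is covered, in particular the Bell and Argyris spaces (\<open>m = 5\<close>) and the
  higher-order Argyris spaces.\<close>

definition conforming_space :: "nat \<Rightarrow> plane set \<Rightarrow> field set \<Rightarrow> plane set set \<Rightarrow> field set \<Rightarrow> bool" where
  "conforming_space m \<Omega> V \<C> Vh \<longleftrightarrow> Vh \<subseteq> V \<and>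
     (\<lambda>x. 0) \<in> Vh \<and> (\<forall>v\<in>Vh. \<forall>w\<in>Vh. (\<lambda>x. v x + w x) \<in> Vh) \<and> (\<forall>c. \<forall>v\<in>Vh. (\<lambda>x. c * v x) \<in> Vh) \<and>
     (\<forall>v\<in>Vh. C1_closure \<Omega> v \<and> (\<forall>K\<in>\<C>. \<exists>p. poly_le m p \<and> (\<forall>x\<in>K. v x = p x)))"

definition elem_op :: "plate \<Rightarrow> field \<Rightarrow> plane set \<Rightarrow> field" where
  "elem_op P v K = plate_op P (elem_poly v K)"

definition elem_Mnn :: "plate \<Rightarrow> field \<Rightarrow> plane set \<Rightarrow> plane set \<Rightarrow> field" where
  "elem_Mnn P v K E = M_nn P (outward_normal K E) (elem_poly v K)"

definition elem_Vn :: "plate \<Rightarrow> field \<Rightarrow> plane set \<Rightarrow> plane set \<Rightarrow> field" where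
  "elem_Vn P v K E = V_n P (outward_normal K E) (elem_poly v K)"

definition jump_Mnn :: "plate \<Rightarrow> field \<Rightarrow> plane set \<Rightarrow> plane set \<Rightarrow> plane set \<Rightarrow> field" where
  "jump_Mnn P v K K' E x = elem_Mnn P v K E x - elem_Mnn P v K' E x"

definition jump_Vn :: "plate \<Rightarrow> field \<Rightarrow> plane set \<Rightarrow> plane set \<Rightarrow> plane set \<Rightarrow> field" where
  "jump_Vn P v K K' E x = elem_Vn P v K E x + elem_Vn P v K' E x"

definition osc_elem :: "field \<Rightarrow> field \<Rightarrow> plane set \<Rightarrow> real" where
  "osc_elem f fh K = (diameter K)\<^sup>2 * L2norm K (\<lambda>x. f x - fh x)"

definition osc_patch :: "field \<Rightarrow> field \<Rightarrow> plane set set \<Rightarrow> plane set \<Rightarrow> real" where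
  "osc_patch f fh \<C> E = (\<Sum>K\<in>elements_at \<C> E. osc_elem f fh K)"

definition osc_edge :: "field \<Rightarrow> field \<Rightarrow> plane set \<Rightarrow> real" where
  "osc_edge g gh E = diameter E powr (3/2) * seg_norm E (\<lambda>x. g x - gh x)"

end

theory Submission
  imports Defs
begin

text \<open>The estimates are lower bounds for the error, and they are local: a residual that is large on one
element or one edge forces the error to be large nearby. Let \<open>e = u - v\<^sub>h\<close> and let \<open>w\<close> be an admissible
displacement. The equation for \<open>u\<close> and integration by parts on each element give
\<open>a(e, w) = \<Sum>\<^sub>K \<integral>\<^sub>K (f - A(v\<^sub>h)) w + (load on S) + F w(x\<^sub>0) - \<Sum>\<^sub>K \<integral>\<^sub>\<partial>\<^sub>K (V\<^sub>n w - M\<^sub>n\<^sub>n \<partial>\<^sub>n w)\<close>.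
The left side is at most a constant times the \<open>H\<^sup>2\<close>-norm of \<open>e\<close> on the support of \<open>w\<close> times the norm of
the second derivatives of \<open>w\<close>. So it suffices to find, for each residual, a test function with small
support that meets this residual and nothing else and reproduces its square.

The supports are squares. The square of an element lies in a disc contained in it (\<open>element_estimate\<close>);
the square of an edge is centred at the midpoint of the edge, is aligned with it and is so small,
relative to the edge and the shape constant, that its halves lie in the adjacent elements
(\<open>edge_frame_exists\<close>). Hence a test function supported in the square of an interior edge does not see any other
edge or any mesh node, in particular not the point load; and inside the square an element coincides
with a half plane, so that Green's formula is needed for half planes only (\<open>green_halfplane\<close>). In
coordinates \<open>(a, b)\<close> along and across the edge, scaled by the half side length \<open>\<rho>\<close> of the square, the
test functions are \<open>weight a * weight b\<close> times a polynomial, with the standard bump \<open>weight\<close>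
(\<open>edge_test\<close>). They are smooth and their second derivatives are bounded by \<open>\<rho>\<^sup>-\<^sup>2\<close> times the
coefficients (\<open>edge_test_bounds\<close>).

For an element the polynomial is the residual \<open>A(v\<^sub>h) - f\<^sub>h\<close> itself. For an edge it is independent of \<open>b\<close>
when the shear force is tested: then \<open>w\<close> is even in \<open>b\<close>, so \<open>\<partial>\<^sub>n w = 0\<close> on the edge. It is \<open>b\<close> times a
polynomial in \<open>a\<close> when the bending moment is tested: then \<open>w = 0\<close> on the edge, while \<open>\<partial>\<^sub>n w\<close> is
prescribed. In either case the test yields a weighted integral of the square of the residual, which
controls the squares of all coefficients (\<open>coeff_le_weighted_L2\<close>, \<open>coeff_le_weighted_L2_plane\<close>) with a
constant that depends on the degree only. The coefficients bound the residual on the whole element or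
edge because its size is at most a multiple of \<open>\<rho>\<close>. All powers of the mesh size come from counting
powers of \<open>\<rho>\<close>. The terms \<open>f - f\<^sub>h\<close> and \<open>g - g\<^sub>h\<close> remain and make up the data oscillation. An edge
estimate contains the element residuals of its patch, which the element estimate has already bounded.

At a boundary edge half of the square lies outside the domain, or even in another part of it. The test
function is therefore truncated to the element (\<open>cut\<close>). No point of the square belongs both to this
element and to another one, so that the truncation does not produce any discontinuity inside the domain, and on the simply supported part
only test functions that vanish on the edge are used; this makes it admissible (\<open>boundary_cut\<close>).

Sobolev functions enter only through the chosen weak derivatives of \<open>u\<close>, \<open>v\<^sub>h\<close> and \<open>w\<close>. By the
fundamental lemma of the calculus of variations these are unique almost everywhere; so they are the
classical derivatives for \<open>w\<close>, are those of the element polynomial for \<open>v\<^sub>h\<close> inside each element, and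
are linear in the function.\<close>

section \<open>Smooth functions and their partial derivatives\<close>

lemma pd_eqI: "(w has_derivative D) (at x) \<Longrightarrow> pd i w x = D (axis i 1)"
  unfolding pd_def using frechet_derivative_at by metis

lemma has_derivative_pd:
  assumes "w differentiable (at x)"
  shows "(w has_derivative (\<lambda>h. grad pd w x \<bullet> h)) (at x)"
proof -
  obtain D where D: "(w has_derivative D) (at x)" using assms by (auto simp: differentiable_def)
  interpret bounded_linear D using D has_derivative_bounded_linear by blast
  have "D h = grad pd w x \<bullet> h" for h
  proof -
    have "D h = D (\<Sum>i\<in>UNIV. (h $ i) *\<^sub>R axis i 1)"
      by (simp add: basis_expansion flip: scalar_mult_eq_scaleR)
    also have "\<dots> = (\<Sum>i\<in>UNIV. h $ i * D (axis i 1))" by (simp add: sum scaleR)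
    finally show ?thesis by (simp add: inner_vec_def grad_def pd_eqI[OF D] mult.commute)
  qed
  then have "D = (\<lambda>h. grad pd w x \<bullet> h)" by (rule ext)
  with D show ?thesis by simp
qed

lemma pd_eqI_grad: "(w has_derivative (\<lambda>h. g \<bullet> h)) (at x) \<Longrightarrow> pd i w x = g $ i"
  by (simp add: pd_eqI inner_axis)

lemma Ck_lower: "Ck (Suc k) w \<Longrightarrow> Ck k w"
proof (induction k arbitrary: w)
  case 0
  then show ?case using differentiable_imp_continuous_on by auto
next
  case (Suc k)
  then show ?case by (metis Ck.simps(2))
qed

definition smooth :: "field \<Rightarrow> bool" where
  "smooth w \<longleftrightarrow> (\<forall>k. Ck k w)"

lemma smooth_pd: "smooth w \<Longrightarrow> smooth (pd i w)"
  unfolding smooth_def by (metis Ck.simps(2))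

lemma smooth_differentiable: "smooth w \<Longrightarrow> w differentiable (at x)"
  unfolding smooth_def by (metis Ck.simps(2) UNIV_I differentiable_on_def)

lemma smooth_has_derivative: "smooth w \<Longrightarrow> (w has_derivative (\<lambda>h. grad pd w x \<bullet> h)) (at x)"
  by (simp add: has_derivative_pd smooth_differentiable)

lemma smooth_continuous: "smooth w \<Longrightarrow> continuous_on A w"
  unfolding smooth_def by (metis Ck.simps(1) continuous_on_subset top_greatest)

lemma Ck_add: "Ck k f \<Longrightarrow> Ck k g \<Longrightarrow> Ck k (\<lambda>x. f x + g x)"
proof (induction k arbitrary: f g)
  case 0 then show ?case by (auto intro: continuous_intros)
next
  case (Suc k)
  have "pd i (\<lambda>x. f x + g x) = (\<lambda>x. pd i f x + pd i g x)" for i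
  proof
    fix x
    have "(f has_derivative (\<lambda>h. grad pd f x \<bullet> h)) (at x)" "(g has_derivative (\<lambda>h. grad pd g x \<bullet> h)) (at x)"
      using Suc.prems by (auto intro!: has_derivative_pd simp: differentiable_on_def)
    from has_derivative_add[OF this]
    show "pd i (\<lambda>x. f x + g x) x = pd i f x + pd i g x"
      by (subst pd_eqI, assumption) (simp add: inner_axis grad_def)
  qed
  then show ?case using Suc.prems by (auto intro!: Suc.IH simp: differentiable_on_add)
qed

lemma Ck_mult: "Ck k f \<Longrightarrow> Ck k g \<Longrightarrow> Ck k (\<lambda>x. f x * g x)"
proof (induction k arbitrary: f g)
  case 0 then show ?case by (auto intro: continuous_intros)
next
  case (Suc k)
  have "pd i (\<lambda>x. f x * g x) = (\<lambda>x. f x * pd i g x + pd i f x * g x)" for i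
  proof
    fix x
    have "(f has_derivative (\<lambda>h. grad pd f x \<bullet> h)) (at x)" "(g has_derivative (\<lambda>h. grad pd g x \<bullet> h)) (at x)"
      using Suc.prems by (auto intro!: has_derivative_pd simp: differentiable_on_def)
    from has_derivative_mult[OF this]
    show "pd i (\<lambda>x. f x * g x) x = f x * pd i g x + pd i f x * g x"
      by (subst pd_eqI, assumption) (simp add: inner_axis grad_def)
  qed
  moreover have "Ck k f" "Ck k g" using Suc.prems Ck_lower by blast+
  moreover have "(\<lambda>x. f x * g x) differentiable_on UNIV"
    using Suc.prems by (auto intro!: differentiable_on_mult)
  ultimately show ?case using Suc.prems by (auto intro!: Ck_add Suc.IH)
qed

lemma Ck_const: "Ck k (\<lambda>x. c)"
proof (induction k arbitrary: c)
  case (Suc k)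
  have "pd i (\<lambda>x. c) = (\<lambda>x. 0)" for i
    by (rule ext, subst pd_eqI[OF has_derivative_const]) simp
  then show ?case using Suc by auto
qed auto

lemma smooth_const: "smooth (\<lambda>x. c)" by (simp add: smooth_def Ck_const)
lemma smooth_add: "smooth f \<Longrightarrow> smooth g \<Longrightarrow> smooth (\<lambda>x. f x + g x)" by (simp add: smooth_def Ck_add)
lemma smooth_mult: "smooth f \<Longrightarrow> smooth g \<Longrightarrow> smooth (\<lambda>x. f x * g x)" by (simp add: smooth_def Ck_mult)
lemma smooth_cmult: "smooth f \<Longrightarrow> smooth (\<lambda>x. c * f x)" by (simp add: smooth_mult smooth_const)
lemma smooth_minus: "smooth f \<Longrightarrow> smooth (\<lambda>x. - f x)" using smooth_cmult[of f "-1"] by simp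
lemma smooth_diff: "smooth f \<Longrightarrow> smooth g \<Longrightarrow> smooth (\<lambda>x. f x - g x)"
  using smooth_add[of f "\<lambda>x. - g x"] smooth_minus by simp
lemma smooth_sum: "(\<And>i. i \<in> I \<Longrightarrow> smooth (f i)) \<Longrightarrow> smooth (\<lambda>x. \<Sum>i\<in>I. f i x)"
  by (induction I rule: infinite_finite_induct) (auto intro: smooth_const smooth_add)

lemma smooth_component: "smooth (\<lambda>x. x $ i)"
proof -
  have "Ck k (\<lambda>x::plane. x $ i)" for k
  proof (cases k)
    case (Suc l)
    have d: "((\<lambda>x::plane. x $ i) has_derivative (\<lambda>h. h $ i)) (at x)" for x
      by (intro bounded_linear_imp_has_derivative bounded_linear_vec_nth)
    have "pd j (\<lambda>x. x $ i) = (\<lambda>x. axis j 1 $ i)" for j by (rule ext, subst pd_eqI[OF d]) simp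
    then show ?thesis using Suc d by (auto simp: Ck_const differentiable_on_def differentiable_def)
  qed (auto intro: continuous_intros)
  then show ?thesis by (simp add: smooth_def)
qed

lemma smooth_power: "smooth f \<Longrightarrow> smooth (\<lambda>x. f x ^ k)"
  by (induction k) (auto intro: smooth_const smooth_mult)

lemmas smooth_intros = smooth_const smooth_add smooth_mult smooth_minus smooth_diff smooth_sum
  smooth_component smooth_power smooth_pd

lemma pd_add: "smooth f \<Longrightarrow> smooth g \<Longrightarrow> pd i (\<lambda>x. f x + g x) x = pd i f x + pd i g x"
  using pd_eqI[OF has_derivative_add[OF smooth_has_derivative smooth_has_derivative]]
  by (simp add: inner_axis grad_def)

lemma pd_mult: "smooth f \<Longrightarrow> smooth g \<Longrightarrow> pd i (\<lambda>x. f x * g x) x = f x * pd i g x + pd i f x * g x"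
  using pd_eqI[OF has_derivative_mult[OF smooth_has_derivative smooth_has_derivative]]
  by (simp add: inner_axis grad_def)

lemma pd_const: "pd i (\<lambda>x. c) x = 0"
  by (subst pd_eqI[OF has_derivative_const]) simp

lemma pd_cmult: "smooth f \<Longrightarrow> pd i (\<lambda>x. c * f x) x = c * pd i f x"
  by (subst pd_mult) (auto simp: smooth_const pd_const)

lemma pd_minus: "smooth f \<Longrightarrow> pd i (\<lambda>x. - f x) x = - pd i f x"
  using pd_cmult[of f i "-1"] by simp

lemma pd_diff: "smooth f \<Longrightarrow> smooth g \<Longrightarrow> pd i (\<lambda>x. f x - g x) x = pd i f x - pd i g x"
  using pd_add[of f "\<lambda>x. - g x"] by (simp add: pd_minus smooth_minus)

lemma pd_sum: "(\<And>k. k \<in> I \<Longrightarrow> smooth (f k)) \<Longrightarrow> pd i (\<lambda>x. \<Sum>k\<in>I. f k x) x = (\<Sum>k\<in>I. pd i (f k) x)"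
  by (induction I rule: infinite_finite_induct) (auto simp: pd_const pd_add smooth_sum)

lemma pd_component: "pd j (\<lambda>x. x $ i) x = (if i = j then 1 else 0)"
proof -
  have d: "((\<lambda>x::plane. x $ i) has_derivative (\<lambda>h. h $ i)) (at x)"
      by (intro bounded_linear_imp_has_derivative bounded_linear_vec_nth)
  show ?thesis by (subst pd_eqI[OF d]) (auto simp: axis_def)
qed

lemma pd_cong_open:
  assumes "open U" "x \<in> U" "\<And>y. y \<in> U \<Longrightarrow> f y = g y"
  shows "pd i f x = pd i g x"
proof -
  have "(f has_derivative D) (at x) \<longleftrightarrow> (g has_derivative D) (at x)" for D
    using has_derivative_transform_within_open[of f D x UNIV U g]
      has_derivative_transform_within_open[of g D x UNIV U f] assms by auto
  then show ?thesis by (simp add: pd_def frechet_derivative_def)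
qed

section \<open>Smooth functions of one variable\<close>

text \<open>All derivatives are bundled in one sequence, so that smoothness is proved by exhibiting the sequence and no iterated \<open>deriv\<close> has to be computed.\<close>

definition smooth1 :: "(real \<Rightarrow> real) \<Rightarrow> bool" where
  "smooth1 h \<longleftrightarrow> (\<exists>g :: nat \<Rightarrow> real \<Rightarrow> real. g 0 = h \<and>
     (\<forall>k t. (g k has_real_derivative g (Suc k) t) (at t)))"

lemma smooth1_deriv:
  assumes "smooth1 h"
  shows "smooth1 (deriv h)" "(h has_real_derivative deriv h t) (at t)"
proof -
  obtain g where g: "g 0 = h" "\<And>k t. (g k has_real_derivative g (Suc k) t) (at t)"
    using assms by (auto simp: smooth1_def)
  have d: "deriv h = g 1" using g(1) g(2)[of 0] by (auto intro!: DERIV_imp_deriv)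
  show "(h has_real_derivative deriv h t) (at t)" using d g(1) g(2)[of 0] by auto
  show "smooth1 (deriv h)" unfolding smooth1_def
    by (rule exI[of _ "\<lambda>k. g (Suc k)"]) (use d g(2) in auto)
qed

lemma has_derivative_ridge:
  fixes z a x :: plane
  assumes "smooth1 h"
  shows "((\<lambda>x. h ((x - z) \<bullet> a)) has_derivative (\<lambda>v. (deriv h ((x - z) \<bullet> a) *\<^sub>R a) \<bullet> v)) (at x)"
proof -
  have "(h has_derivative (\<lambda>v. v * deriv h ((x - z) \<bullet> a))) (at ((x - z) \<bullet> a))"
    using has_field_derivative_imp_has_derivative[OF smooth1_deriv(2)[OF assms, of "(x - z) \<bullet> a"]]
    by (simp only: mult.commute[of _ "deriv h ((x - z) \<bullet> a)"])
  moreover have "((\<lambda>x. (x - z) \<bullet> a) has_derivative (\<lambda>v. v \<bullet> a)) (at x)"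
    by (auto intro!: derivative_eq_intros)
  ultimately have "((\<lambda>x. h ((x - z) \<bullet> a)) has_derivative (\<lambda>v. (v \<bullet> a) * deriv h ((x - z) \<bullet> a))) (at x)"
    by (rule has_derivative_compose[rotated])
  then show ?thesis by (simp only: inner_scaleR_left inner_commute[of a] mult.commute[of "deriv h ((x - z) \<bullet> a)"])
qed

lemma pd_ridge: "smooth1 h \<Longrightarrow> pd i (\<lambda>x. h ((x - z) \<bullet> a)) x = a $ i * deriv h ((x - z) \<bullet> a)"
  by (subst pd_eqI_grad[OF has_derivative_ridge]) auto

text \<open>A function of one linear form: every further derivative multiplies by a component of \<open>a\<close>, so that smoothness is inherited from the one-dimensional profile.\<close>

lemma smooth_ridge:
  assumes "smooth1 h" shows "smooth (\<lambda>x. h ((x - z) \<bullet> a))"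
proof -
  have "Ck k (\<lambda>x. h ((x - z) \<bullet> a))" for k
    using assms
  proof (induction k arbitrary: h)
    case 0
    have "(\<lambda>x. h ((x - z) \<bullet> a)) differentiable_on UNIV"
      using has_derivative_ridge[OF 0] by (force simp: differentiable_on_def differentiable_def)
    then show ?case by (simp add: differentiable_imp_continuous_on)
  next
    case (Suc k)
    have "(\<lambda>x. h ((x - z) \<bullet> a)) differentiable_on UNIV"
      using has_derivative_ridge[OF Suc.prems] by (force simp: differentiable_on_def differentiable_def)
    moreover have "pd i (\<lambda>x. h ((x - z) \<bullet> a)) = (\<lambda>x. a $ i * deriv h ((x - z) \<bullet> a))" for i
      by (rule ext) (rule pd_ridge[OF Suc.prems])
    ultimately show ?case using Suc.IH[OF smooth1_deriv(1)[OF Suc.prems]] by (simp add: Ck_mult Ck_const)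
  qed
  then show ?thesis by (simp add: smooth_def)
qed

text \<open>The family is closed under differentiation: each derivative of \<open>exp (- c / (1 - t\<^sup>2))\<close> is a rational function times the same exponential, with a power of \<open>1 - t\<^sup>2\<close> as denominator.\<close>

definition bump :: "real \<Rightarrow> real poly \<Rightarrow> nat \<Rightarrow> real \<Rightarrow> real" where
  "bump c p k t = (if \<bar>t\<bar> < 1 then poly p t / (1 - t\<^sup>2) ^ k * exp (- c / (1 - t\<^sup>2)) else 0)"

lemma exp_le_power:
  assumes "0 < (y::real)" shows "exp (- y) \<le> fact n / y ^ n"
proof -
  have "(\<Sum>k\<in>{n}. y ^ k /\<^sub>R fact k) \<le> (\<Sum>k. y ^ k /\<^sub>R fact k)"
    by (rule sum_le_suminf[OF summable_exp_generic]) (use assms in auto)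
  then have "y ^ n / fact n \<le> exp y" by (simp add: exp_def divide_inverse mult.commute)
  then show ?thesis using assms by (simp add: exp_minus field_simps)
qed

text \<open>The exponential beats every power of \<open>1 - t\<^sup>2\<close>; two powers are kept, because a quadratic bound at \<open>t = 1\<close> and \<open>t = -1\<close> gives the derivative zero there.\<close>

lemma bump_bound:
  assumes "c > 0"
  obtains C where "C \<ge> 0" "\<And>t u. \<bar>t\<bar> = 1 \<Longrightarrow> \<bar>bump c p k u\<bar> \<le> C * (u - t)\<^sup>2"
proof -
  have "compact (poly p ` {-1..1})" by (intro compact_continuous_image continuous_intros) auto
  then obtain A where A: "\<And>t. t \<in> {-1..1} \<Longrightarrow> \<bar>poly p t\<bar> \<le> A"
    using compact_imp_bounded bounded_iff by (metis imageI real_norm_def)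
  have A0: "A \<ge> 0" using A[of 0] by auto
  define C where "C = A * (fact (k+2) / c ^ (k+2)) * 4"
  have C0: "C \<ge> 0" using A0 assms by (simp add: C_def)
  moreover have "\<bar>bump c p k u\<bar> \<le> C * (u - t)\<^sup>2" if t: "\<bar>t\<bar> = 1" for t u
  proof (cases "\<bar>u\<bar> < 1")
    case True
    define s where "s = 1 - u\<^sup>2"
    have s: "s > 0" using True by (simp add: s_def abs_square_less_1)
    have su: "s \<le> 2 * \<bar>u - t\<bar>"
    proof -
      have "s = (t - u) * (t + u)" using t unfolding s_def by (auto simp: algebra_simps power2_eq_square abs_if split: if_splits)
      then have "s \<le> \<bar>t - u\<bar> * \<bar>t + u\<bar>" by (simp add: abs_mult[symmetric])
      also have "\<dots> \<le> \<bar>t - u\<bar> * 2" using t True by (intro mult_left_mono) auto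
      finally show ?thesis by (simp add: abs_minus_commute mult.commute)
    qed
    have "exp (- c / s) \<le> fact (k+2) / (c/s) ^ (k+2)" using exp_le_power[of "c/s" "k+2"] assms s by simp
    also have "\<dots> = (fact (k+2) / c ^ (k+2)) * s\<^sup>2 * s ^ k"
      using s assms by (simp add: power_divide power_add divide_simps power2_eq_square)
    finally have e: "exp (- c / s) / s ^ k \<le> (fact (k+2) / c ^ (k+2)) * s\<^sup>2"
      using s by (simp only: pos_divide_le_eq zero_less_power)
    have "\<bar>bump c p k u\<bar> = \<bar>poly p u\<bar> * (exp (- c / s) / s ^ k)"
      using True s by (simp add: bump_def s_def[symmetric] abs_mult)
    also have "\<dots> \<le> A * ((fact (k+2) / c ^ (k+2)) * s\<^sup>2)"
      using A[of u] True e s A0 by (intro mult_mono) (auto simp: abs_less_iff)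
    also have "\<dots> \<le> A * ((fact (k+2) / c ^ (k+2)) * (4 * (u - t)\<^sup>2))"
    proof -
      have "s\<^sup>2 \<le> (2 * \<bar>u - t\<bar>)\<^sup>2" using s su by (intro power_mono) auto
      then have "s\<^sup>2 \<le> 4 * (u-t)\<^sup>2" by (simp add: power_mult_distrib)
      then show ?thesis using A0 assms by (intro mult_left_mono) auto
    qed
    finally show ?thesis by (simp add: C_def algebra_simps)
  qed (use C0 in \<open>simp add: bump_def\<close>)
  ultimately show ?thesis using that by blast
qed

text \<open>The numerator and the exponent of the derivative, by the quotient rule.\<close>

definition bump_step :: "real \<Rightarrow> real poly \<times> nat \<Rightarrow> real poly \<times> nat" where
  "bump_step c = (\<lambda>(p, k). (pderiv p * [:1, 0, -1:]\<^sup>2 + [:0, 2 * real k:] * [:1, 0, -1:] * p - [:0, 2 * c:] * p, k + 2))"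

lemma bump_has_derivative:
  assumes "c > 0"
  shows "(bump c p k has_real_derivative (case bump_step c (p, k) of (q, l) \<Rightarrow> bump c q l t)) (at t)"
proof -
  consider "\<bar>t\<bar> < 1" | "\<bar>t\<bar> = 1" | "\<bar>t\<bar> > 1" by linarith
  then show ?thesis
  proof cases
    case 1
    define s where "s = 1 - t\<^sup>2"
    have s: "s > 0" using 1 by (simp add: s_def abs_square_less_1)
    have s': "1 - t\<^sup>2 \<noteq> 0" using s s_def by simp
    define i where "i = inverse (1 - t\<^sup>2)"
    have si: "s * i = 1" using s by (simp add: i_def s_def)
    have di: "((\<lambda>t. inverse (1 - t\<^sup>2)) has_real_derivative (2 * t * i\<^sup>2)) (at t)"
      by (rule derivative_eq_intros refl s')+ (simp add: i_def power2_eq_square)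
    have dp: "((\<lambda>t. inverse (1 - t\<^sup>2) ^ k) has_real_derivative (real k * (2 * t * i ^ (k + 1)))) (at t)"
      by (rule DERIV_cong[OF DERIV_power[OF di]])
         (cases k; simp add: i_def power2_eq_square)
    have de: "((\<lambda>t. exp (- c * inverse (1 - t\<^sup>2))) has_real_derivative (exp (- c * i) * (- c * (2 * t * i\<^sup>2)))) (at t)"
      using DERIV_fun_exp[OF DERIV_cmult[OF di, of "- c"]] by (simp add: i_def)
    have eq: "poly p t * (i ^ k * (exp (- c * i) * (- c * (2 * t * i\<^sup>2))) + real k * (2 * t * i ^ (k + 1)) * exp (- c * i))
         + poly (pderiv p) t * (i ^ k * exp (- c * i))
         = (poly (pderiv p) t * s\<^sup>2 + 2 * real k * t * s * poly p t - 2 * c * t * poly p t) * i ^ (k + 2) * exp (- c * i)"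
      (is "?L = ?R")
    proof -
      have si': "i * (s * X) = X" for X using arg_cong[OF si, of "\<lambda>y. y * X"] by (simp add: ac_simps)
      have "?R = exp (- c * i) * i ^ k * (poly (pderiv p) t * (s * i)\<^sup>2 + 2 * real k * t * (s * i) * i * poly p t - 2 * c * t * poly p t * i\<^sup>2)"
        by (simp add: power_add power2_eq_square algebra_simps)
      also have "\<dots> = ?L" by (simp add: si' power2_eq_square algebra_simps)
      finally show ?thesis by simp
    qed
    have "((\<lambda>t. poly p t * (inverse (1 - t\<^sup>2) ^ k * exp (- c * inverse (1 - t\<^sup>2)))) has_real_derivative
       (poly (pderiv p) t * s\<^sup>2 + 2 * real k * t * s * poly p t - 2 * c * t * poly p t) * i ^ (k + 2) * exp (- c * i)) (at t)"
      by (rule DERIV_cong[OF DERIV_mult'[OF poly_DERIV DERIV_mult'[OF dp de]]])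
         (simp only: i_def[symmetric] eq)
    moreover have "(poly (pderiv p) t * s\<^sup>2 + 2 * real k * t * s * poly p t - 2 * c * t * poly p t) * i ^ (k + 2) * exp (- c * i)
      = (case bump_step c (p, k) of (q, l) \<Rightarrow> bump c q l t)"
      using 1 by (simp add: bump_step_def bump_def i_def s_def power2_eq_square divide_inverse power_inverse)
         (simp add: algebra_simps power_inverse)
    ultimately have "((\<lambda>t. poly p t * (inverse (1 - t\<^sup>2) ^ k * exp (- c * inverse (1 - t\<^sup>2)))) has_real_derivative
       (case bump_step c (p, k) of (q, l) \<Rightarrow> bump c q l t)) (at t)" by simp
    then have "((\<lambda>t. poly p t / (1 - t\<^sup>2) ^ k * exp (- c / (1 - t\<^sup>2))) has_real_derivative
       (case bump_step c (p, k) of (q, l) \<Rightarrow> bump c q l t)) (at t)"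
      by (simp add: divide_inverse power_inverse mult.assoc)
    then show ?thesis
    proof (rule has_field_derivative_transform_within_open)
      show "open {-1<..<1::real}" by simp
    qed (use 1 in \<open>auto simp: bump_def\<close>)
  next
    case 2
    obtain C where C: "C \<ge> 0" "\<And>t u. \<bar>t\<bar> = 1 \<Longrightarrow> \<bar>bump c p k u\<bar> \<le> C * (u - t)\<^sup>2"
      using bump_bound[OF assms] by metis
    have "((\<lambda>h. (bump c p k (t + h) - bump c p k t) / h) \<longlongrightarrow> 0) (at 0)"
    proof (rule Lim_null_comparison[where g = "\<lambda>h. C * \<bar>h\<bar>"])
      show "\<forall>\<^sub>F h in at 0. norm ((bump c p k (t + h) - bump c p k t) / h) \<le> C * \<bar>h\<bar>"
      proof (intro always_eventually allI)
        fix h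
        have "bump c p k t = 0" using 2 by (simp add: bump_def)
        moreover have "\<bar>bump c p k (t + h)\<bar> \<le> C * h\<^sup>2" using C(2)[OF 2, of "t+h"] by simp
        ultimately show "norm ((bump c p k (t + h) - bump c p k t) / h) \<le> C * \<bar>h\<bar>"
          by (cases "h = 0") (auto simp: field_simps power2_eq_square abs_mult[symmetric])
      qed
      show "((\<lambda>h. C * \<bar>h\<bar>) \<longlongrightarrow> 0) (at 0)" by (auto intro!: tendsto_eq_intros)
    qed
    then show ?thesis using 2 by (simp add: DERIV_def bump_step_def bump_def)
  next
    case 3
    have "((\<lambda>t. 0) has_real_derivative 0) (at t)" by simp
    then have "(bump c p k has_real_derivative 0) (at t)"
    proof (rule has_field_derivative_transform_within_open)
      show "open (- {-1..1::real})" by auto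
    qed (use 3 in \<open>auto simp: bump_def\<close>)
    then show ?thesis using 3 by (simp add: bump_step_def bump_def)
  qed
qed

lemma bump_has_derivative_step:
  "c > 0 \<Longrightarrow> bump_step c (p, k) = (q, l) \<Longrightarrow> (bump c p k has_real_derivative bump c q l t) (at t)"
  using bump_has_derivative[of c p k t] by simp

lemma smooth1_bump: "c > 0 \<Longrightarrow> smooth1 (bump c p k)"
  unfolding smooth1_def
  by (rule exI[of _ "\<lambda>n. case (bump_step c ^^ n) (p, k) of (q, l) \<Rightarrow> bump c q l"])
     (simp add: bump_has_derivative_step split: prod.splits)

section \<open>Integration in rotated coordinates\<close>

lemma integral_Cauchy_Schwarz:
  fixes f g :: "'a \<Rightarrow> real"
  assumes [measurable]: "f \<in> borel_measurable M" "g \<in> borel_measurable M"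
    and f: "integrable M (\<lambda>x. (f x)\<^sup>2)" and g: "integrable M (\<lambda>x. (g x)\<^sup>2)"
  shows "integrable M (\<lambda>x. f x * g x)"
    and "\<bar>\<integral>x. f x * g x \<partial>M\<bar> \<le> sqrt (\<integral>x. (f x)\<^sup>2 \<partial>M) * sqrt (\<integral>x. (g x)\<^sup>2 \<partial>M)"
proof -
  show fg: "integrable M (\<lambda>x. f x * g x)"
  proof (rule Bochner_Integration.integrable_bound[OF Bochner_Integration.integrable_add[OF f g]])
    have "\<bar>f x * g x\<bar> \<le> (f x)\<^sup>2 + (g x)\<^sup>2" for x
    proof -
      have "0 \<le> (\<bar>f x\<bar> - \<bar>g x\<bar>)\<^sup>2" by simp
      then have "2 * (\<bar>f x\<bar> * \<bar>g x\<bar>) \<le> (f x)\<^sup>2 + (g x)\<^sup>2" by (simp add: power2_diff)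
      then show ?thesis unfolding abs_mult
        using mult_nonneg_nonneg[of "\<bar>f x\<bar>" "\<bar>g x\<bar>"] by linarith
    qed
    then show "AE x in M. norm (f x * g x) \<le> norm ((f x)\<^sup>2 + (g x)\<^sup>2)" by auto
  qed auto
  define a b c where "a = (\<integral>x. (f x)\<^sup>2 \<partial>M)" and "b = (\<integral>x. (g x)\<^sup>2 \<partial>M)" and "c = (\<integral>x. f x * g x \<partial>M)"
  have ab: "a \<ge> 0" "b \<ge> 0" by (auto simp: a_def b_def)
  have q: "0 \<le> t\<^sup>2 * a + 2 * t * c + b" for t
  proof -
    have "(\<integral>x. (t * f x + g x)\<^sup>2 \<partial>M) = (\<integral>x. t\<^sup>2 * (f x)\<^sup>2 + 2 * t * (f x * g x) + (g x)\<^sup>2 \<partial>M)"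
      by (intro Bochner_Integration.integral_cong) (auto simp: power2_eq_square algebra_simps)
    also have "\<dots> = t\<^sup>2 * a + 2 * t * c + b" using f g fg by (simp add: a_def b_def c_def)
    finally have "t\<^sup>2 * a + 2 * t * c + b = (\<integral>x. (t * f x + g x)\<^sup>2 \<partial>M)" by simp
    then show ?thesis by simp
  qed
  have "c\<^sup>2 \<le> a * b"
  proof (cases "a = 0")
    case True
    have "c = 0"
    proof (rule ccontr)
      assume "c \<noteq> 0"
      then show False using q[of "- (b + 1) / (2 * c)"] True ab by (simp add: field_simps)
    qed
    then show ?thesis using True by simp
  next
    case False
    then have "a > 0" using ab by simp
    then show ?thesis using q[of "- c / a"] by (simp add: field_simps power2_eq_square)
  qed
  then have "\<bar>c\<bar> \<le> sqrt (a * b)" using real_le_rsqrt[of "\<bar>c\<bar>"] by simp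
  then show "\<bar>\<integral>x. f x * g x \<partial>M\<bar> \<le> sqrt (\<integral>x. (f x)\<^sup>2 \<partial>M) * sqrt (\<integral>x. (g x)\<^sup>2 \<partial>M)"
    by (simp add: a_def b_def c_def real_sqrt_mult)
qed

lemma tangent_simps:
  fixes n :: plane
  assumes "norm n = 1"
  shows "tangent n \<bullet> n = 0" "n \<bullet> tangent n = 0" "tangent n \<bullet> tangent n = 1" "n \<bullet> n = 1" "norm (tangent n) = 1"
proof -
  have *: "tangent m \<bullet> m = 0" "tangent m \<bullet> tangent m = m \<bullet> m" for m
    by (auto simp: tangent_def inner_vec_def sum_2)
  show "n \<bullet> n = 1" using assms by (simp add: norm_eq_1)
  then show "tangent n \<bullet> n = 0" "n \<bullet> tangent n = 0" "tangent n \<bullet> tangent n = 1" "norm (tangent n) = 1"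
    using * by (auto simp: inner_commute norm_eq_1)
qed

lemma tangent_uminus: "tangent (- n) = - tangent n"
  by (simp add: tangent_def vec_eq_iff forall_2)

lemma frame_decompose:
  fixes n x :: plane
  assumes "norm n = 1"
  shows "x = (x \<bullet> tangent n) *\<^sub>R tangent n + (x \<bullet> n) *\<^sub>R n"
proof -
  have n: "n $ 1 * n $ 1 + n $ 2 * n $ 2 = 1" using tangent_simps(4)[OF assms] by (simp add: inner_vec_def sum_2)
  have "x $ 1 = x $ 1 * (n $ 1 * n $ 1 + n $ 2 * n $ 2)" "x $ 2 = x $ 2 * (n $ 1 * n $ 1 + n $ 2 * n $ 2)"
    using n by simp_all
  then show ?thesis by (simp add: vec_eq_iff forall_2 tangent_def inner_vec_def sum_2 algebra_simps)
qed

definition frame :: "plane \<Rightarrow> plane \<Rightarrow> real \<times> real \<Rightarrow> plane" where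
  "frame z n p = z + fst p *\<^sub>R tangent n + snd p *\<^sub>R n"

lemma frame_coords:
  assumes "norm n = 1"
  shows "(frame z n p - z) \<bullet> tangent n = fst p" "(frame z n p - z) \<bullet> n = snd p"
  using tangent_simps[OF assms] by (simp_all add: frame_def inner_add_left algebra_simps)

lemma frame_measurable [measurable]: "frame z n \<in> borel_measurable (lborel \<Otimes>\<^sub>M lborel)"
  unfolding frame_def by measurable

lemma Basis_plane: "(Basis :: plane set) = {axis 1 1, axis 2 1}"
  by (auto simp: Basis_vec_def) (metis exhaust_2)

lemma frame_axis: "frame 0 (axis 1 1) p $ 1 = snd p" "frame 0 (axis 1 1) p $ 2 = fst p"
  by (simp_all add: frame_def tangent_def axis_def)

lemma lborel_plane: "lborel = distr (lborel \<Otimes>\<^sub>M lborel) borel (frame 0 (axis 1 1))"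
proof (rule lborel_eqI)
  fix l u :: plane assume lu: "\<And>b. b \<in> Basis \<Longrightarrow> l \<bullet> b \<le> u \<bullet> b"
  have lu': "l $ 1 \<le> u $ 1" "l $ 2 \<le> u $ 2" using lu[of "axis 1 1"] lu[of "axis 2 1"] by (auto simp: Basis_plane inner_axis)
  have "frame 0 (axis 1 1) -` box l u = {l $ 2<..<u $ 2} \<times> {l $ 1<..<u $ 1}"
    by (auto simp: mem_box_cart forall_2 frame_axis)
  then have "emeasure (distr (lborel \<Otimes>\<^sub>M lborel) borel (frame 0 (axis 1 1))) (box l u)
      = emeasure (lborel \<Otimes>\<^sub>M lborel) ({l $ 2<..<u $ 2} \<times> {l $ 1<..<u $ 1})"
    by (subst emeasure_distr) (auto simp: space_pair_measure)
  also have "\<dots> = ennreal (u $ 2 - l $ 2) * ennreal (u $ 1 - l $ 1)"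
    using lu' by (subst lborel.emeasure_pair_measure_Times) auto
  also have "\<dots> = (\<Prod>b\<in>Basis. (u - l) \<bullet> b)"
    using lu' by (simp add: Basis_plane axis_eq_axis inner_axis ennreal_mult mult.commute)
  finally show "emeasure (distr (lborel \<Otimes>\<^sub>M lborel) borel (frame 0 (axis 1 1))) (box l u) = (\<Prod>b\<in>Basis. (u - l) \<bullet> b)" .
qed simp

text \<open>Open boxes generate the measure, and the preimage of a box under a rigid motion is a congruent set, whose measure is known from the invariance under orthogonal maps.\<close>

lemma lborel_rigid_motion:
  fixes R :: "plane \<Rightarrow> plane"
  assumes R: "orthogonal_transformation R"
  shows "lborel = distr lborel borel (\<lambda>y. z + R y)"
proof (rule lborel_eqI)
  fix l u :: plane assume lu: "\<And>b. b \<in> Basis \<Longrightarrow> l \<bullet> b \<le> u \<bullet> b"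
  have cR: "continuous_on UNIV R" using R by (intro linear_continuous_on) (simp add: orthogonal_transformation_linear linear_conv_bounded_linear[symmetric])
  define S where "S = (\<lambda>y. z + R y) -` box l u"
  have oS: "open S" unfolding S_def by (intro open_vimage continuous_intros cR) auto
  obtain B where B: "\<And>x. x \<in> box l u \<Longrightarrow> norm x \<le> B" using bounded_box bounded_iff by metis
  have "norm y \<le> B + norm z" if "y \<in> S" for y
  proof -
    have "norm y = norm (R y)" using R by (simp add: orthogonal_transformation_norm)
    also have "R y = (z + R y) - z" by simp
    also have "norm \<dots> \<le> norm (z + R y) + norm z" by (rule norm_triangle_ineq4)
    finally show ?thesis using B[of "z + R y"] that by (auto simp: S_def)
  qed
  then have "bounded S" using bounded_iff by blast
  then have S: "S \<in> lmeasurable" using oS lmeasurable_open by blast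
  have surj: "surj R" using R orthogonal_transformation_surj by blast
  have img: "(+) z ` (R ` S) = box l u"
  proof
    show "box l u \<subseteq> (+) z ` R ` S"
    proof
      fix x assume x: "x \<in> box l u"
      obtain y where "R y = x - z" using surj by (metis surjD)
      then have "z + R y = x" by simp
      then show "x \<in> (+) z ` R ` S" using x by (force simp: S_def)
    qed
  qed (auto simp: S_def)
  have "emeasure (distr lborel borel (\<lambda>y. z + R y)) (box l u) = emeasure lborel S"
    using cR by (subst emeasure_distr) (auto simp: S_def intro!: borel_measurable_continuous_onI continuous_intros)
  also have "\<dots> = emeasure lebesgue S" using oS by (simp add: borel_open)
  also have "\<dots> = ennreal (measure lebesgue S)"
    using S by (simp add: emeasure_eq_measure2)
  also have "measure lebesgue S = measure lebesgue (box l u)"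
    using S R measure_translation[of z "R ` S"] by (simp add: img measure_orthogonal_image)
  also have "\<dots> = (\<Prod>b\<in>Basis. (u - l) \<bullet> b)" using lu by simp
  finally show "emeasure (distr lborel borel (\<lambda>y. z + R y)) (box l u) = (\<Prod>b\<in>Basis. (u - l) \<bullet> b)" .
qed simp

lemma lborel_frame:
  assumes n: "norm n = 1"
  shows "lborel = distr (lborel \<Otimes>\<^sub>M lborel) borel (frame z n)"
proof -
  define R where "R = (\<lambda>y::plane. (y $ 2) *\<^sub>R tangent n + (y $ 1) *\<^sub>R n)"
  have lin: "linear R" by (auto simp: R_def linear_iff algebra_simps)
  have "R v \<bullet> R w = v \<bullet> w" for v w
    using tangent_simps[OF n] by (simp add: R_def inner_vec_def[of v w] sum_2 inner_add_left inner_add_right)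
  with lin have R: "orthogonal_transformation R" by (simp add: orthogonal_transformation_def)
  have R1: "R \<in> borel_measurable borel"
    unfolding R_def by (intro borel_measurable_continuous_onI continuous_intros)
  have "(lborel :: plane measure) = distr lborel borel (\<lambda>y. z + R y)" by (rule lborel_rigid_motion[OF R])
  also have "\<dots> = distr (distr (lborel \<Otimes>\<^sub>M lborel) borel (frame 0 (axis 1 1))) borel (\<lambda>y. z + R y)"
    by (subst lborel_plane) simp
  also have "\<dots> = distr (lborel \<Otimes>\<^sub>M lborel) borel (\<lambda>p. z + R (frame 0 (axis 1 1) p))"
    using R1 by (subst distr_distr) (auto simp: comp_def)
  also have "(\<lambda>p. z + R (frame 0 (axis 1 1) p)) = frame z n"
    by (simp only: R_def frame_axis) (simp add: frame_def fun_eq_iff)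
  finally show ?thesis .
qed

lemma integral_frame:
  fixes f :: field
  assumes n: "norm n = 1" and f[measurable]: "f \<in> borel_measurable borel"
  shows "(\<integral>x. f x \<partial>lborel) = (\<integral>p. f (frame z n p) \<partial>(lborel \<Otimes>\<^sub>M lborel))"
    and "integrable lborel f \<longleftrightarrow> integrable (lborel \<Otimes>\<^sub>M lborel) (\<lambda>p. f (frame z n p))"
proof -
  show "(\<integral>x. f x \<partial>lborel) = (\<integral>p. f (frame z n p) \<partial>(lborel \<Otimes>\<^sub>M lborel))"
    by (subst lborel_frame[OF n, of z]) (auto intro!: integral_distr)
  show "integrable lborel f \<longleftrightarrow> integrable (lborel \<Otimes>\<^sub>M lborel) (\<lambda>p. f (frame z n p))"
    by (subst lborel_frame[OF n, of z]) (auto intro!: integrable_distr_eq)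
qed

lemma integrable_compact_support:
  fixes f :: "'a::euclidean_space \<Rightarrow> real"
  assumes f: "continuous_on UNIV f" and z: "\<And>x. f x \<noteq> 0 \<Longrightarrow> norm (x - z) \<le> R"
  shows "integrable lborel f"
proof -
  have "integrable lborel (\<lambda>x. indicator (cball z R) x *\<^sub>R f x)"
    by (rule borel_integrable_compact) (auto intro: continuous_on_subset[OF f])
  also have "(\<lambda>x. indicator (cball z R) x *\<^sub>R f x) = f"
    using z by (auto simp: fun_eq_iff indicator_def dist_norm norm_minus_commute)
  finally show ?thesis .
qed

lemma integral_derivative_compact_support:
  fixes F f :: "real \<Rightarrow> real"
  assumes d: "\<And>t. (F has_real_derivative f t) (at t)" and c: "continuous_on UNIV f"
    and z: "\<And>t. F t \<noteq> 0 \<Longrightarrow> \<bar>t\<bar> \<le> R"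
  shows "(\<integral>t. f t \<partial>lborel) = 0" "(\<integral>t. indicator {..0} t * f t \<partial>lborel) = F 0"
proof -
  define A where "A = \<bar>R\<bar> + 1"
  have f0: "f t = 0" if "\<bar>t\<bar> > \<bar>R\<bar>" for t
  proof -
    have "((\<lambda>t. 0) has_real_derivative f t) (at t)"
    proof (rule has_field_derivative_transform_within_open[OF d])
      show "open (- {-\<bar>R\<bar>..\<bar>R\<bar>})" by auto
      show "t \<in> - {-\<bar>R\<bar>..\<bar>R\<bar>}" using that by auto
      show "F x = 0" if "x \<in> - {-\<bar>R\<bar>..\<bar>R\<bar>}" for x using z[of x] that by force
    qed
    then show ?thesis by (rule DERIV_unique) simp
  qed
  have f0': "f t \<noteq> 0 \<Longrightarrow> \<bar>t\<bar> \<le> \<bar>R\<bar>" for t using f0[of t] by linarith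
  have FA: "F A = 0" "F (- A) = 0" using z[of A] z[of "-A"] by (fastforce simp: A_def)+
  have cf: "isCont f t" for t using c by (simp add: continuous_on_eq_continuous_at)
  have "(\<integral>t. f t * indicator {-A..A} t \<partial>lborel) = F A - F (-A)"
    by (rule integral_FTC_Icc_real) (auto simp: A_def d cf)
  moreover have "(\<lambda>t. f t * indicator {-A..A} t) = f"
    using f0' by (force simp: fun_eq_iff indicator_def A_def)
  ultimately show "(\<integral>t. f t \<partial>lborel) = 0" using FA by simp
  have "(\<integral>t. f t * indicator {-A..0} t \<partial>lborel) = F 0 - F (-A)"
    by (rule integral_FTC_Icc_real) (auto simp: A_def d cf)
  moreover have "(\<lambda>t. f t * indicator {-A..0} t) = (\<lambda>t. indicator {..0} t * f t)"
    using f0' by (force simp: fun_eq_iff indicator_def A_def)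
  ultimately show "(\<integral>t. indicator {..0} t * f t \<partial>lborel) = F 0" using FA by simp
qed

definition line_int :: "plane \<Rightarrow> plane \<Rightarrow> field \<Rightarrow> real" where
  "line_int z n F = (\<integral>t. F (z + t *\<^sub>R tangent n) \<partial>lborel)"

definition halfplane :: "plane \<Rightarrow> plane \<Rightarrow> plane set" where
  "halfplane z n = {x. (x - z) \<bullet> n \<le> 0}"

lemma line_int_uminus: "line_int z (- n) F = line_int z n F"
  using lborel_integral_real_affine[of "-1" "\<lambda>t. F (z + t *\<^sub>R tangent n)" 0]
  by (simp add: line_int_def tangent_uminus)

lemma halfplane_borel [measurable]: "halfplane z n \<in> sets borel"
proof -
  have "closed (halfplane z n)" unfolding halfplane_def
    by (intro closed_Collect_le continuous_intros)
  then show ?thesis by auto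
qed

lemma frame_deriv:
  assumes F: "\<And>x. (F has_derivative (\<lambda>h. G x \<bullet> h)) (at x)"
  shows "((\<lambda>a. F (frame z n (a, b))) has_real_derivative (G (frame z n (a, b)) \<bullet> tangent n)) (at a)"
    and "((\<lambda>b. F (frame z n (a, b))) has_real_derivative (G (frame z n (a, b)) \<bullet> n)) (at b)"
proof -
  have "((\<lambda>a. frame z n (a, b)) has_derivative (\<lambda>h. h *\<^sub>R tangent n)) (at a)"
    by (auto simp: frame_def intro!: derivative_eq_intros)
  from has_derivative_compose[OF this F]
  show "((\<lambda>a. F (frame z n (a, b))) has_real_derivative (G (frame z n (a, b)) \<bullet> tangent n)) (at a)"
    by (rule has_derivative_imp_has_field_derivative) simp
  have "((\<lambda>b. frame z n (a, b)) has_derivative (\<lambda>h. h *\<^sub>R n)) (at b)"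
    by (auto simp: frame_def intro!: derivative_eq_intros)
  from has_derivative_compose[OF this F]
  show "((\<lambda>b. F (frame z n (a, b))) has_real_derivative (G (frame z n (a, b)) \<bullet> n)) (at b)"
    by (rule has_derivative_imp_has_field_derivative) simp
qed

text \<open>Fubini in the rotated coordinates and the fundamental theorem of calculus: the tangential derivative integrates to zero along every parallel of the boundary line, the normal derivative leaves the boundary values.\<close>

lemma integral_frame_derivatives:
  fixes F :: field and G :: "plane \<Rightarrow> plane"
  assumes n: "norm n = 1" and F: "\<And>x. (F has_derivative (\<lambda>h. G x \<bullet> h)) (at x)"
    and G: "continuous_on UNIV G" and z: "\<And>x. F x \<noteq> 0 \<Longrightarrow> norm (x - z) \<le> R"
  shows "(\<integral>x. indicator (halfplane z n) x * (G x \<bullet> tangent n) \<partial>lborel) = 0" (is ?A)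
    and "(\<integral>x. indicator (halfplane z n) x * (G x \<bullet> n) \<partial>lborel) = line_int z n F" (is ?B)
    and "(\<integral>x. G x \<bullet> n \<partial>lborel) = 0" (is ?C)
    and "G x \<noteq> 0 \<Longrightarrow> norm (x - z) \<le> R"
proof -
  have G0: "norm (x - z) \<le> R" if "G x \<noteq> 0" for x
  proof (rule ccontr)
    assume "\<not> norm (x - z) \<le> R"
    then have "((\<lambda>x. 0) has_derivative (\<lambda>h. G x \<bullet> h)) (at x)"
      using z by (intro has_derivative_transform_within_open[OF F, of "- cball z R"])
        (auto simp: dist_norm norm_minus_commute)
    then have "(\<lambda>h. G x \<bullet> h) = (\<lambda>h. 0)" by (rule has_derivative_unique) simp
    then have "G x \<bullet> G x = 0" by meson
    then show False using that by simp
  qed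
  then show "G x \<noteq> 0 \<Longrightarrow> norm (x - z) \<le> R" .
  have [measurable]: "G \<in> borel_measurable borel" using G borel_measurable_continuous_onI by blast
  have Gi: "integrable lborel (\<lambda>x. G x \<bullet> a)" for a
    by (rule integrable_compact_support[where z=z and R=R])
       (intro continuous_intros G, use G0[of x for x] in force)
  have HGi: "integrable lborel (\<lambda>x. indicator (halfplane z n) x * (G x \<bullet> a))" for a
    by (rule Bochner_Integration.integrable_bound[OF Gi[of a]]) (auto simp: indicator_def)
  have co: "\<bar>fst p\<bar> \<le> norm (frame z n p - z)" "\<bar>snd p\<bar> \<le> norm (frame z n p - z)" for p
    using Cauchy_Schwarz_ineq2[of "frame z n p - z" "tangent n"] Cauchy_Schwarz_ineq2[of "frame z n p - z" n]
    by (simp_all add: frame_coords[OF n] tangent_simps[OF n] n)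
  have Fz: "F (frame z n (a, b)) \<noteq> 0 \<Longrightarrow> \<bar>a\<bar> \<le> R" "F (frame z n (a, b)) \<noteq> 0 \<Longrightarrow> \<bar>b\<bar> \<le> R" for a b
    using z[of "frame z n (a, b)"] co[of "(a, b)"] by auto
  have ind: "indicator (halfplane z n) (frame z n p) = indicator {..0} (snd p)" for p
    by (simp add: halfplane_def indicator_def frame_coords[OF n])
  have cf: "continuous_on UNIV (\<lambda>a. G (frame z n (a, b)) \<bullet> c)" "continuous_on UNIV (\<lambda>b. G (frame z n (a, b)) \<bullet> c)" for a b c
    by (auto simp: frame_def intro!: continuous_intros continuous_on_compose2[OF G])
  have "(\<integral>x. indicator (halfplane z n) x * (G x \<bullet> tangent n) \<partial>lborel)
      = (\<integral>p. indicator {..0} (snd p) * (G (frame z n p) \<bullet> tangent n) \<partial>(lborel \<Otimes>\<^sub>M lborel))"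
    by (subst integral_frame(1)[OF n, of _ z]) (auto simp: ind)
  also have "\<dots> = (\<integral>b. (\<integral>a. indicator {..0} b * (G (frame z n (a, b)) \<bullet> tangent n) \<partial>lborel) \<partial>lborel)"
  proof (subst lborel_pair.integral_snd)
    show "integrable (lborel \<Otimes>\<^sub>M lborel) (\<lambda>(x, y). indicator {..0} y * (G (frame z n (x, y)) \<bullet> tangent n))"
      using HGi[of "tangent n", THEN integral_frame(2)[OF n, of _ z, THEN iffD1, rotated]]
      by (simp add: ind case_prod_beta')
  qed (simp add: case_prod_beta')
  also have "\<dots> = 0"
  proof -
    have "(\<integral>a. (G (frame z n (a, b)) \<bullet> tangent n) \<partial>lborel) = 0" for b
      by (rule integral_derivative_compact_support(1)[OF frame_deriv(1)[OF F] cf(1) Fz(1)])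
    then show ?thesis by simp
  qed
  finally show ?A .
  have "(\<integral>x. indicator (halfplane z n) x * (G x \<bullet> n) \<partial>lborel)
      = (\<integral>p. indicator {..0} (snd p) * (G (frame z n p) \<bullet> n) \<partial>(lborel \<Otimes>\<^sub>M lborel))"
    by (subst integral_frame(1)[OF n, of _ z]) (auto simp: ind)
  also have "\<dots> = (\<integral>a. (\<integral>b. indicator {..0} b * (G (frame z n (a, b)) \<bullet> n) \<partial>lborel) \<partial>lborel)"
  proof (subst lborel_pair.integral_fst)
    show "integrable (lborel \<Otimes>\<^sub>M lborel) (\<lambda>(x, y). indicator {..0} y * (G (frame z n (x, y)) \<bullet> n))"
      using HGi[of n, THEN integral_frame(2)[OF n, of _ z, THEN iffD1, rotated]]
      by (simp add: ind case_prod_beta')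
  qed (simp add: case_prod_beta')
  also have "\<dots> = (\<integral>a. F (frame z n (a, 0)) \<partial>lborel)"
  proof -
    have "(\<integral>b. indicator {..0} b * (G (frame z n (a, b)) \<bullet> n) \<partial>lborel) = F (frame z n (a, 0))" for a
      by (rule integral_derivative_compact_support(2)[OF frame_deriv(2)[OF F] cf(2) Fz(2)])
    then show ?thesis by simp
  qed
  finally show ?B by (simp add: line_int_def frame_def)
  have "(\<integral>x. G x \<bullet> n \<partial>lborel) = (\<integral>p. G (frame z n p) \<bullet> n \<partial>(lborel \<Otimes>\<^sub>M lborel))"
    by (subst integral_frame(1)[OF n, of _ z]) auto
  also have "\<dots> = (\<integral>a. (\<integral>b. G (frame z n (a, b)) \<bullet> n \<partial>lborel) \<partial>lborel)"
  proof (subst lborel_pair.integral_fst)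
    show "integrable (lborel \<Otimes>\<^sub>M lborel) (\<lambda>(x, y). G (frame z n (x, y)) \<bullet> n)"
      using Gi[of n, THEN integral_frame(2)[OF n, of _ z, THEN iffD1, rotated]]
      by (simp add: case_prod_beta')
  qed (simp add: case_prod_beta')
  also have "\<dots> = 0"
  proof -
    have "(\<integral>b. G (frame z n (a, b)) \<bullet> n \<partial>lborel) = 0" for a
      by (rule integral_derivative_compact_support(1)[OF frame_deriv(2)[OF F] cf(2) Fz(2)])
    then show ?thesis by simp
  qed
  finally show ?C .
qed

section \<open>Integrals over Lebesgue measurable sets\<close>

lemma AE_not_negligible: "negligible N \<Longrightarrow> AE x in lebesgue. x \<notin> N"
  by (simp add: negligible_iff_null_sets AE_not_in)

lemma AE_on_subset:
  assumes "AE x in lebesgue_on S. P x" "T \<subseteq> S" "S \<in> sets lebesgue" "T \<in> sets lebesgue"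
  shows "AE x in lebesgue_on T. P x"
  using assms by (auto simp: AE_restrict_space_iff)

lemma borel_measurable_AE_on:
  fixes f g :: field
  assumes f: "f \<in> borel_measurable (lebesgue_on S)" and S: "S \<in> sets lebesgue"
    and ae: "AE x in lebesgue_on S. f x = g x"
  shows "g \<in> borel_measurable (lebesgue_on S)"
proof -
  have "(\<lambda>x. if x \<in> S then f x else 0) \<in> borel_measurable lebesgue"
    using f S by (simp add: borel_measurable_if)
  moreover have "AE x in lebesgue. (if x \<in> S then f x else 0) = (if x \<in> S then g x else 0)"
    using ae S by (simp add: AE_restrict_space_iff)
  ultimately have "(\<lambda>x. if x \<in> S then g x else 0) \<in> borel_measurable lebesgue"
    by (rule borel_measurable_AE)
  then show ?thesis using S by (simp add: borel_measurable_if)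
qed

lemma integrable_AE_on:
  fixes f g :: field
  assumes "integrable (lebesgue_on S) f" "S \<in> sets lebesgue" "AE x in lebesgue_on S. f x = g x"
  shows "integrable (lebesgue_on S) g"
  by (rule integrable_cong_AE_imp[OF assms(1) borel_measurable_AE_on[OF borel_measurable_integrable[OF assms(1)] assms(2,3)] assms(3)])

lemma integral_AE_on:
  fixes f g :: field
  assumes "AE x in lebesgue_on S. f x = g x"  "S \<in> sets lebesgue"
  shows "(\<integral>x. f x \<partial>lebesgue_on S) = (\<integral>x. g x \<partial>lebesgue_on S)"
proof (cases "f \<in> borel_measurable (lebesgue_on S)")
  case True
  then show ?thesis using assms borel_measurable_AE_on[OF True] by (intro integral_cong_AE) auto
next
  case False
  moreover have "g \<notin> borel_measurable (lebesgue_on S)"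
  proof
    assume "g \<in> borel_measurable (lebesgue_on S)"
    moreover have "AE x in lebesgue_on S. g x = f x" using assms(1) by eventually_elim simp
    ultimately show False using False borel_measurable_AE_on[of g S f] assms(2) by simp
  qed
  ultimately have "\<not> integrable (lebesgue_on S) f" "\<not> integrable (lebesgue_on S) g" by auto
  then show ?thesis by (simp add: not_integrable_integral_eq)
qed

lemma integral_on_subset:
  fixes f :: field
  assumes "T \<subseteq> S" "S \<in> sets lebesgue" "T \<in> sets lebesgue" "\<And>x. x \<in> S - T \<Longrightarrow> f x = 0"
  shows "(\<integral>x. f x \<partial>lebesgue_on S) = (\<integral>x. f x \<partial>lebesgue_on T)"
    and "integrable (lebesgue_on S) f \<longleftrightarrow> integrable (lebesgue_on T) f"
proof -
  have *: "(\<lambda>x. if x \<in> S then f x else 0) = (\<lambda>x. if x \<in> T then f x else 0)"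
    using assms by (auto simp: fun_eq_iff)
  show "(\<integral>x. f x \<partial>lebesgue_on S) = (\<integral>x. f x \<partial>lebesgue_on T)"
    using assms * by (simp flip: Lebesgue_Measure.integral_restrict_UNIV)
  show "integrable (lebesgue_on S) f \<longleftrightarrow> integrable (lebesgue_on T) f"
    using assms * by (simp flip: Lebesgue_Measure.integrable_restrict_UNIV)
qed

lemma integrable_on_continuous_compact:
  fixes f :: field
  assumes "compact B" "continuous_on B f"
  shows "integrable (lebesgue_on B) f"
proof -
  have "integrable lborel (\<lambda>x. indicator B x *\<^sub>R f x)" using assms by (rule borel_integrable_compact)
  then have "integrable lebesgue (\<lambda>x. indicator B x *\<^sub>R f x)" by (simp add: integrable_completion)
  then show ?thesis using assms
    by (subst integrable_restrict_space) (auto simp: borel_compact)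
qed

lemma integral_lebesgue_on_lborel:
  fixes f :: field
  assumes f: "f \<in> borel_measurable borel" and A: "A \<in> sets borel"
  shows "(\<integral>x. f x \<partial>lebesgue_on A) = (\<integral>x. indicator A x * f x \<partial>lborel)"
proof -
  have "(\<integral>x. f x \<partial>lebesgue_on A) = (\<integral>x. indicator A x *\<^sub>R f x \<partial>lebesgue)"
    using A by (subst integral_restrict_space) auto
  also have "\<dots> = (\<integral>x. indicator A x *\<^sub>R f x \<partial>lborel)"
    using f A by (intro integral_completion) auto
  finally show ?thesis by simp
qed

lemma borel_measurable_lebesgue_on:
  fixes f :: field
  assumes "continuous_on UNIV f"
  shows "f \<in> borel_measurable (lebesgue_on B)"
  using borel_measurable_continuous_onI[OF assms]
  by (simp add: measurable_completion measurable_restrict_space1)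

section \<open>Test functions\<close>

lemma test_function_smooth: "test_function \<Omega> \<phi> \<Longrightarrow> smooth \<phi>"
  by (simp add: test_function_def smooth_def)

lemma test_functionD:
  assumes "test_function \<Omega> \<phi>"
  shows "compact (closure {x. \<phi> x \<noteq> 0})" "closure {x. \<phi> x \<noteq> 0} \<subseteq> \<Omega>"
  using assms unfolding test_function_def by blast+

lemma compact_closed_subset: "closed S \<Longrightarrow> compact T \<Longrightarrow> S \<subseteq> T \<Longrightarrow> compact S"
  using compact_Int_closed[of T S] by (simp add: Int_absorb1)

lemma zero_off_closure: "x \<notin> closure {x. \<phi> x \<noteq> 0} \<Longrightarrow> \<phi> x = 0"
  using closure_subset[of "{x. \<phi> x \<noteq> 0}"] by auto

lemma not_zero_closure: "\<phi> x \<noteq> 0 \<Longrightarrow> x \<in> closure {x. \<phi> x \<noteq> 0}"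
  using zero_off_closure[of x \<phi>] by auto

text \<open>Off the closed support the function vanishes on a neighbourhood.\<close>

lemma pd_zero_off_closure:
  assumes "x \<notin> closure {x. \<phi> x \<noteq> 0}"
  shows "pd i \<phi> x = 0"
proof -
  have "pd i \<phi> x = pd i (\<lambda>x. 0) x"
    by (rule pd_cong_open[of "- closure {x. \<phi> x \<noteq> 0}"]) (use assms zero_off_closure in auto)
  then show ?thesis by (simp add: pd_const)
qed

lemma test_function_pd:
  assumes "test_function \<Omega> \<phi>" shows "test_function \<Omega> (pd i \<phi>)"
proof -
  have sub: "closure {x. pd i \<phi> x \<noteq> 0} \<subseteq> closure {x. \<phi> x \<noteq> 0}"
    by (rule closure_minimal) (use pd_zero_off_closure in auto)
  moreover have "compact (closure {x. pd i \<phi> x \<noteq> 0})"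
    by (rule compact_closed_subset[OF closed_closure test_functionD(1)[OF assms] sub])
  moreover have "\<forall>k. Ck k (pd i \<phi>)" using smooth_pd[OF test_function_smooth[OF assms]] by (simp add: smooth_def)
  moreover have "closure {x. \<phi> x \<noteq> 0} \<subseteq> \<Omega>" by (rule test_functionD(2)[OF assms])
  ultimately show ?thesis unfolding test_function_def by blast
qed

lemma test_functionI:
  assumes "smooth \<phi>" "\<And>x. \<phi> x \<noteq> 0 \<Longrightarrow> x \<in> B" "compact B" "B \<subseteq> \<Omega>"
  shows "test_function \<Omega> \<phi>"
proof -
  have "closure {x. \<phi> x \<noteq> 0} \<subseteq> B"
    using assms by (intro closure_minimal) (auto intro: compact_imp_closed)
  then show ?thesis using assms compact_closed_subset[OF closed_closure, of B]
    unfolding test_function_def smooth_def by auto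
qed

lemma locally_integrable_mult_test:
  assumes w: "locally_integrable \<Omega> w" and \<phi>: "test_function \<Omega> \<phi>" and o: "open \<Omega>"
  shows "integrable (lebesgue_on \<Omega>) (\<lambda>x. w x * \<phi> x)"
proof -
  define B where "B = closure {x. \<phi> x \<noteq> 0}"
  have B: "compact B" "B \<subseteq> \<Omega>" and sm: "smooth \<phi>" using test_functionD[OF \<phi>] test_function_smooth[OF \<phi>] by (auto simp: B_def)
  have wi: "integrable (lebesgue_on B) w" using w B by (simp add: locally_integrable_def)
  have "compact (\<phi> ` B)" using B sm by (intro compact_continuous_image smooth_continuous)
  then obtain c where c: "\<And>x. x \<in> B \<Longrightarrow> \<bar>\<phi> x\<bar> \<le> c"
    using compact_imp_bounded[of "\<phi> ` B"] unfolding bounded_iff by auto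
  have m: "\<phi> \<in> borel_measurable (lebesgue_on B)"
    by (rule borel_measurable_lebesgue_on[OF smooth_continuous[OF sm]])
  have "integrable (lebesgue_on B) (\<lambda>x. c * w x)" using wi by simp
  then have "integrable (lebesgue_on B) (\<lambda>x. w x * \<phi> x)"
  proof (rule Bochner_Integration.integrable_bound)
    show "(\<lambda>x. w x * \<phi> x) \<in> borel_measurable (lebesgue_on B)" using wi m by auto
    show "AE x in lebesgue_on B. norm (w x * \<phi> x) \<le> norm (c * w x)"
    proof (rule AE_I2)
      fix x assume "x \<in> space (lebesgue_on B)"
      then have "\<bar>\<phi> x\<bar> \<le> \<bar>c\<bar>" using c[of x] by force
      then show "norm (w x * \<phi> x) \<le> norm (c * w x)"
        by (simp add: abs_mult mult.commute mult_right_mono)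
    qed
  qed
  moreover have "\<phi> x = 0" if "x \<notin> B" for x using that closure_subset by (force simp: B_def)
  ultimately show ?thesis using B o
    by (subst integral_on_subset(2)[of B]) (auto simp: borel_compact)
qed

section \<open>The fundamental lemma\<close>

text \<open>As \<open>c\<close> tends to zero these functions increase to the indicator of the open box.\<close>

definition box_bump :: "plane \<Rightarrow> plane \<Rightarrow> real \<Rightarrow> field" where
  "box_bump l u c x = (\<Prod>i\<in>UNIV. bump c 1 0 ((x - (1/2) *\<^sub>R (l + u)) \<bullet> axis i (2 / (u $ i - l $ i))))"

lemma bump_one: "bump c 1 0 t = (if \<bar>t\<bar> < 1 then exp (- c / (1 - t\<^sup>2)) else 0)"
  by (simp add: bump_def)

lemma box_bump_props:
  assumes lu: "\<And>i. l $ i < u $ i"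
  shows "c > 0 \<Longrightarrow> smooth (box_bump l u c)"
    and "box_bump l u c x \<noteq> 0 \<Longrightarrow> x \<in> box l u"
    and "c > 0 \<Longrightarrow> \<bar>box_bump l u c x\<bar> \<le> 1"
    and "(\<lambda>n. box_bump l u (inverse (real (Suc n))) x) \<longlonglongrightarrow> indicator (box l u) x"
proof -
  define T where "T i x = (x - (1/2) *\<^sub>R (l + u)) \<bullet> axis i (2 / (u $ i - l $ i))" for i :: 2 and x :: plane
  have bb: "box_bump l u c x = bump c 1 0 (T 1 x) * bump c 1 0 (T 2 x)" for c x
    by (simp add: box_bump_def UNIV_2 T_def)
  have T: "\<bar>T i x\<bar> < 1 \<longleftrightarrow> l $ i < x $ i \<and> x $ i < u $ i" for i x
  proof -
    have "T i x = (2 * x $ i - l $ i - u $ i) / (u $ i - l $ i)"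
      using lu[of i] by (simp add: T_def inner_axis divide_simps) (simp add: algebra_simps)
    then have "\<bar>T i x\<bar> < 1 \<longleftrightarrow> \<bar>2 * x $ i - l $ i - u $ i\<bar> < u $ i - l $ i"
      using lu[of i] by (simp add: abs_divide)
    then show ?thesis using lu[of i] by auto
  qed
  have box: "x \<in> box l u \<longleftrightarrow> \<bar>T 1 x\<bar> < 1 \<and> \<bar>T 2 x\<bar> < 1" for x
    by (auto simp: mem_box_cart forall_2 T)
  show "smooth (box_bump l u c)" if "c > 0"
    unfolding bb[abs_def] T_def by (intro smooth_mult smooth_ridge smooth1_bump that)
  show "box_bump l u c x \<noteq> 0 \<Longrightarrow> x \<in> box l u" unfolding bb box by (auto simp: bump_one split: if_splits)
  show "\<bar>box_bump l u c x\<bar> \<le> 1" if "c > 0"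
  proof -
    have "0 \<le> bump c 1 0 t" "bump c 1 0 t \<le> 1" for t
    proof -
      have "0 < 1 - t\<^sup>2" if "\<bar>t\<bar> < 1" using that by (simp add: abs_square_less_1)
      then show "0 \<le> bump c 1 0 t" "bump c 1 0 t \<le> 1" using that by (auto simp: bump_one)
    qed
    then show ?thesis unfolding bb by (simp add: abs_mult mult_le_one)
  qed
  show "(\<lambda>n. box_bump l u (inverse (real (Suc n))) x) \<longlonglongrightarrow> indicator (box l u) x"
  proof (cases "x \<in> box l u")
    case False
    then have "box_bump l u c x = 0" for c unfolding bb box by (auto simp: bump_one)
    then show ?thesis using False by simp
  next
    case True
    have "(\<lambda>n. bump (inverse (real (Suc n))) 1 0 t) \<longlonglongrightarrow> 1" if t: "\<bar>t\<bar> < 1" for t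
    proof -
      have "(\<lambda>n. exp (- inverse (real (Suc n)) / (1 - t\<^sup>2))) \<longlonglongrightarrow> exp (- 0 / (1 - t\<^sup>2))"
        using t by (intro tendsto_intros LIMSEQ_inverse_real_of_nat) (auto simp: abs_square_less_1[symmetric])
      then show ?thesis using t by (simp add: bump_one)
    qed
    then have "(\<lambda>n. box_bump l u (inverse (real (Suc n))) x) \<longlonglongrightarrow> 1 * 1"
      unfolding bb using True by (intro tendsto_mult) (auto simp: box)
    then show ?thesis using True by simp
  qed
qed

text \<open>The indicator of the box is a bounded pointwise limit of test functions.\<close>

lemma integral_cbox_eq_0:
  assumes o: "open \<Omega>" and h: "locally_integrable \<Omega> h"
    and 0: "\<And>\<phi>. test_function \<Omega> \<phi> \<Longrightarrow> (\<integral>x. h x * \<phi> x \<partial>lebesgue_on \<Omega>) = 0"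
    and sub: "cbox l u \<subseteq> \<Omega>" and lu: "\<And>i. l $ i < u $ i"
  shows "integral (cbox l u) h = 0"
proof -
  note bp = box_bump_props[of l u, OF lu]
  have bsub: "box_bump l u c x \<noteq> 0 \<Longrightarrow> x \<in> cbox l u" for c x
    using bp(2) box_subset_cbox by blast
  have hi: "integrable (lebesgue_on (cbox l u)) h" using h sub by (simp add: locally_integrable_def)
  define \<phi> where "\<phi> n = box_bump l u (inverse (real (Suc n)))" for n
  have sm: "smooth (\<phi> n)" for n unfolding \<phi>_def by (rule bp(1)) simp
  have tf: "test_function \<Omega> (\<phi> n)" for n
    by (rule test_functionI[OF sm, of _ "cbox l u"]) (use sub bsub in \<open>auto simp: \<phi>_def\<close>)
  have m: "\<phi> n \<in> borel_measurable (lebesgue_on (cbox l u))" for n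
    by (rule borel_measurable_lebesgue_on[OF smooth_continuous[OF sm]])
  have z: "(\<integral>x. h x * \<phi> n x \<partial>lebesgue_on (cbox l u)) = 0" for n
  proof -
    have "(\<integral>x. h x * \<phi> n x \<partial>lebesgue_on \<Omega>) = (\<integral>x. h x * \<phi> n x \<partial>lebesgue_on (cbox l u))"
      using sub o bsub by (intro integral_on_subset) (auto simp: \<phi>_def)
    then show ?thesis using 0[OF tf] by simp
  qed
  have "(\<lambda>n. \<integral>x. h x * \<phi> n x \<partial>lebesgue_on (cbox l u)) \<longlonglongrightarrow> (\<integral>x. h x * indicator (box l u) x \<partial>lebesgue_on (cbox l u))"
  proof (rule integral_dominated_convergence)
    show "integrable (lebesgue_on (cbox l u)) (\<lambda>x. \<bar>h x\<bar>)" using hi by simp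
    show "AE x in lebesgue_on (cbox l u). (\<lambda>n. h x * \<phi> n x) \<longlonglongrightarrow> h x * indicator (box l u) x"
      using bp(4) by (intro AE_I2 tendsto_intros) (auto simp: \<phi>_def)
    show "AE x in lebesgue_on (cbox l u). norm (h x * \<phi> n x) \<le> \<bar>h x\<bar>" for n
      using bp(3) by (intro AE_I2) (auto simp: \<phi>_def abs_mult mult_left_le)
    show "(\<lambda>x. h x * indicator (box l u) x) \<in> borel_measurable (lebesgue_on (cbox l u))"
      by (intro borel_measurable_times borel_measurable_integrable[OF hi] measurable_restrict_space1 borel_measurable_indicator) auto
    show "(\<lambda>x. h x * \<phi> n x) \<in> borel_measurable (lebesgue_on (cbox l u))" for n
      using borel_measurable_integrable[OF hi] m by auto
  qed
  then have i0: "(\<integral>x. h x * indicator (box l u) x \<partial>lebesgue_on (cbox l u)) = 0"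
    unfolding z by (simp add: LIMSEQ_const_iff)
  have "negligible (cbox l u - box l u)" by (rule negligible_frontier_interval)
  then have "AE x in lebesgue. x \<notin> cbox l u - box l u" by (rule AE_not_negligible)
  then have "AE x in lebesgue_on (cbox l u). h x * indicator (box l u) x = h x"
    by (auto simp: AE_restrict_space_iff elim!: eventually_mono)
  then have "(\<integral>x. h x \<partial>lebesgue_on (cbox l u)) = 0"
    using i0 integral_AE_on[of "\<lambda>x. h x * indicator (box l u) x" h "cbox l u"] by simp
  then show ?thesis using lebesgue_integral_eq_integral[OF hi] by simp
qed

text \<open>Since the integral of \<open>h\<close> over every small box vanishes, \<open>h = 0\<close> at each point where the averages over boxes shrinking to the point converge to the value, which by the Lebesgue differentiation theorem are almost all points.\<close>

lemma fundamental_lemma: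
  assumes o: "open \<Omega>" and h: "locally_integrable \<Omega> h"
    and 0: "\<And>\<phi>. test_function \<Omega> \<phi> \<Longrightarrow> (\<integral>x. h x * \<phi> x \<partial>lebesgue_on \<Omega>) = 0"
  shows "AE x in lebesgue_on \<Omega>. h x = 0"
proof -
  have box: "AE x in lebesgue. x \<in> cbox a b \<longrightarrow> h x = 0" if sub: "cbox a b \<subseteq> \<Omega>" for a b
  proof -
    define f where "f x = (if x \<in> cbox a b then h x else 0)" for x
    have "integrable (lebesgue_on (cbox a b)) h" using h sub by (simp add: locally_integrable_def)
    then have "integrable lebesgue f" unfolding f_def by (simp add: Lebesgue_Measure.integrable_restrict_UNIV)
    then have "f integrable_on UNIV" using integrable_on_lebesgue by blast
    then have "f integrable_on cbox c d" for c d using integrable_on_subcbox by blast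
    then obtain N where N: "negligible N" and
      lim: "\<And>x e. \<lbrakk>x \<notin> N; 0 < e\<rbrakk> \<Longrightarrow> \<exists>d>0. \<forall>h. 0 < h \<and> h < d \<longrightarrow>
                         norm(integral (cbox x (x + h *\<^sub>R One)) f /\<^sub>R h ^ DIM(plane) - f x) < e"
      using integrable_ccontinuous_explicit[of f] by metis
    have "h x = 0" if x: "x \<in> box a b" "x \<notin> N" for x
    proof (rule ccontr)
      assume hx: "h x \<noteq> 0"
      have fx: "f x = h x" using x box_subset_cbox by (auto simp: f_def)
      obtain d where d: "d > 0" and dl: "\<And>k. 0 < k \<Longrightarrow> k < d \<Longrightarrow>
          norm (integral (cbox x (x + k *\<^sub>R One)) f /\<^sub>R k ^ DIM(plane) - f x) < \<bar>h x\<bar>"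
        using lim[of x "\<bar>h x\<bar>"] x hx by auto
      obtain r where r: "r > 0" "\<forall>i. x $ i + r < b $ i"
      proof -
        have xb: "x $ i < b $ i" for i using x by (auto simp: mem_box_cart)
        show thesis
          by (rule that[of "min (b $ 1 - x $ 1) (b $ 2 - x $ 2) / 2"])
             (unfold forall_2, use xb[of 1] xb[of 2] in \<open>simp_all add: min_def field_simps\<close>)
      qed
      define k where "k = min r (d / 2)"
      have k: "0 < k" "k < d" "k \<le> r" using d r by (auto simp: k_def)
      have oc: "(x + k *\<^sub>R One) $ i = x $ i + k" for i
      proof -
        have "(One :: plane) $ i = 1" using exhaust_2[of i] by (auto simp: Basis_plane axis_eq_axis, auto simp: axis_def)
        then show ?thesis by simp
      qed
      have ss: "cbox x (x + k *\<^sub>R One) \<subseteq> cbox a b"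
      proof
        fix y assume y: "y \<in> cbox x (x + k *\<^sub>R One)"
        have "a $ i \<le> y $ i \<and> y $ i \<le> b $ i" for i
        proof -
          have "x $ i \<le> y $ i \<and> y $ i \<le> (x + k *\<^sub>R One) $ i" using y unfolding mem_box_cart by blast
          then have "x $ i \<le> y $ i" "y $ i \<le> x $ i + k" by (simp_all only: oc)
          moreover have "a $ i < x $ i" using x by (auto simp: mem_box_cart)
          ultimately show ?thesis using r(2)[rule_format, of i] k by linarith
        qed
        then show "y \<in> cbox a b" by (simp add: mem_box_cart)
      qed
      have "integral (cbox x (x + k *\<^sub>R One)) f = integral (cbox x (x + k *\<^sub>R One)) h"
        by (rule Henstock_Kurzweil_Integration.integral_cong) (use ss in \<open>auto simp: f_def\<close>)
      also have "\<dots> = 0"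
      proof (rule integral_cbox_eq_0[OF o h 0])
        show "cbox x (x + k *\<^sub>R One) \<subseteq> \<Omega>" using ss sub by blast
        show "x $ i < (x + k *\<^sub>R One) $ i" for i unfolding oc using k by simp
      qed
      finally show False using dl[OF k(1,2)] fx by simp
    qed
    then have "{x. \<not> (x \<in> cbox a b \<longrightarrow> h x = 0)} \<subseteq> N \<union> (cbox a b - box a b)" by auto
    moreover have "negligible (N \<union> (cbox a b - box a b))"
      using N negligible_frontier_interval by (intro negligible_Un) auto
    ultimately have "negligible {x. \<not> (x \<in> cbox a b \<longrightarrow> h x = 0)}" by (rule negligible_subset[rotated])
    from AE_not_negligible[OF this] show ?thesis by simp
  qed
  obtain D where D: "countable D" "D \<subseteq> Pow \<Omega>" "\<And>X. X \<in> D \<Longrightarrow> \<exists>a b. X = cbox a b" "\<Union>D = \<Omega>"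
    using open_countable_Union_open_cbox[OF o] by metis
  have "AE x in lebesgue. \<forall>X\<in>D. x \<in> X \<longrightarrow> h x = 0"
    using D(1) box D(2,3) by (subst AE_ball_countable) (auto, blast)
  then have "AE x in lebesgue. x \<in> \<Omega> \<longrightarrow> h x = 0" using D(4) by (auto elim!: eventually_mono)
  then show ?thesis using o by (simp add: AE_restrict_space_iff)
qed

section \<open>Weak derivatives\<close>

lemma locally_integrable_diff:
  "locally_integrable \<Omega> f \<Longrightarrow> locally_integrable \<Omega> g \<Longrightarrow> locally_integrable \<Omega> (\<lambda>x. f x - g x)"
  by (auto simp: locally_integrable_def)

text \<open>The difference of two weak derivatives is orthogonal to all test functions.\<close>

lemma weak_pd_unique:
  assumes o: "open \<Omega>" and w: "has_weak_pd \<Omega> i w g" "has_weak_pd \<Omega> i w' g'"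
    and ae: "AE x in lebesgue_on \<Omega>. w x = w' x"
  shows "AE x in lebesgue_on \<Omega>. g x = g' x"
proof -
  have "AE x in lebesgue_on \<Omega>. g x - g' x = 0"
  proof (rule fundamental_lemma[OF o])
    show "locally_integrable \<Omega> (\<lambda>x. g x - g' x)" using w by (auto simp: has_weak_pd_def locally_integrable_diff)
    fix \<phi> assume t: "test_function \<Omega> \<phi>"
    have "(\<integral>x. (g x - g' x) * \<phi> x \<partial>lebesgue_on \<Omega>) = (\<integral>x. g x * \<phi> x \<partial>lebesgue_on \<Omega>) - (\<integral>x. g' x * \<phi> x \<partial>lebesgue_on \<Omega>)"
      unfolding left_diff_distrib using w t o
      by (intro Bochner_Integration.integral_diff locally_integrable_mult_test) (auto simp: has_weak_pd_def)
    moreover have "(\<integral>x. w x * pd i \<phi> x \<partial>lebesgue_on \<Omega>) = (\<integral>x. w' x * pd i \<phi> x \<partial>lebesgue_on \<Omega>)"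
    proof -
      have "AE x in lebesgue_on \<Omega>. w x * pd i \<phi> x = w' x * pd i \<phi> x" using ae by eventually_elim simp
      then show ?thesis using o by (simp add: integral_AE_on)
    qed
    moreover have "(\<integral>x. w x * pd i \<phi> x \<partial>lebesgue_on \<Omega>) = - (\<integral>x. g x * \<phi> x \<partial>lebesgue_on \<Omega>)"
      "(\<integral>x. w' x * pd i \<phi> x \<partial>lebesgue_on \<Omega>) = - (\<integral>x. g' x * \<phi> x \<partial>lebesgue_on \<Omega>)"
      using w t by (auto simp: has_weak_pd_def)
    ultimately show "(\<integral>x. (g x - g' x) * \<phi> x \<partial>lebesgue_on \<Omega>) = 0" by linarith
  qed
  then show ?thesis by simp
qed

lemma has_weak_pd_AE:
  assumes o: "open \<Omega>" and w: "has_weak_pd \<Omega> i w g" and ae: "AE x in lebesgue_on \<Omega>. w x = w' x"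
  shows "has_weak_pd \<Omega> i w' g"
proof -
  have "locally_integrable \<Omega> w'"
    unfolding locally_integrable_def
  proof (intro allI impI, elim conjE)
    fix B assume B: "compact B" "B \<subseteq> \<Omega>"
    have "AE x in lebesgue_on B. w x = w' x" using ae B o by (intro AE_on_subset[OF ae]) (auto simp: borel_compact)
    moreover have "integrable (lebesgue_on B) w" using w B by (auto simp: has_weak_pd_def locally_integrable_def)
    moreover have "B \<in> sets lebesgue" using B by (simp add: borel_compact)
    ultimately show "integrable (lebesgue_on B) w'" using integrable_AE_on[of B w w'] by simp
  qed
  moreover have "(\<integral>x. w x * pd i \<phi> x \<partial>lebesgue_on \<Omega>) = (\<integral>x. w' x * pd i \<phi> x \<partial>lebesgue_on \<Omega>)" for \<phi>
  proof -
    have "AE x in lebesgue_on \<Omega>. w x * pd i \<phi> x = w' x * pd i \<phi> x" using ae by eventually_elim simp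
    then show ?thesis using o by (simp add: integral_AE_on)
  qed
  ultimately show ?thesis using w unfolding has_weak_pd_def by simp
qed

lemma has_weak_pd_diff:
  assumes o: "open \<Omega>" and w: "has_weak_pd \<Omega> i w g" "has_weak_pd \<Omega> i w' g'"
  shows "has_weak_pd \<Omega> i (\<lambda>x. w x - w' x) (\<lambda>x. g x - g' x)"
  unfolding has_weak_pd_def
proof (intro conjI allI impI)
  show "locally_integrable \<Omega> (\<lambda>x. w x - w' x)" "locally_integrable \<Omega> (\<lambda>x. g x - g' x)"
    using w by (auto simp: has_weak_pd_def locally_integrable_diff)
  fix \<phi> assume t: "test_function \<Omega> \<phi>"
  have "(\<integral>x. (g x - g' x) * \<phi> x \<partial>lebesgue_on \<Omega>) = (\<integral>x. g x * \<phi> x \<partial>lebesgue_on \<Omega>) - (\<integral>x. g' x * \<phi> x \<partial>lebesgue_on \<Omega>)"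
    unfolding left_diff_distrib using w t o
    by (intro Bochner_Integration.integral_diff locally_integrable_mult_test) (auto simp: has_weak_pd_def)
  moreover have "(\<integral>x. (w x - w' x) * pd i \<phi> x \<partial>lebesgue_on \<Omega>) = (\<integral>x. w x * pd i \<phi> x \<partial>lebesgue_on \<Omega>) - (\<integral>x. w' x * pd i \<phi> x \<partial>lebesgue_on \<Omega>)"
    unfolding left_diff_distrib using w t o
    by (intro Bochner_Integration.integral_diff locally_integrable_mult_test test_function_pd) (auto simp: has_weak_pd_def)
  ultimately show "(\<integral>x. (w x - w' x) * pd i \<phi> x \<partial>lebesgue_on \<Omega>) = - (\<integral>x. (g x - g' x) * \<phi> x \<partial>lebesgue_on \<Omega>)"
    using w t by (auto simp: has_weak_pd_def)
qed

text \<open>A test function of the smaller domain is a test function of the larger one.\<close>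

lemma has_weak_pd_subset:
  assumes o: "open \<Omega>" "open \<Omega>'" "\<Omega>' \<subseteq> \<Omega>" and w: "has_weak_pd \<Omega> i w g"
  shows "has_weak_pd \<Omega>' i w g"
  unfolding has_weak_pd_def
proof (intro conjI allI impI)
  show "locally_integrable \<Omega>' w" "locally_integrable \<Omega>' g"
    using w o by (auto simp: has_weak_pd_def locally_integrable_def)
  fix \<phi> assume t: "test_function \<Omega>' \<phi>"
  then have t': "test_function \<Omega> \<phi>" using o unfolding test_function_def by blast
  have z: "x \<notin> \<Omega>' \<Longrightarrow> x \<notin> closure {x. \<phi> x \<noteq> 0}" for x using test_functionD(2)[OF t] by auto
  then have z': "x \<notin> \<Omega>' \<Longrightarrow> \<phi> x = 0 \<and> pd i \<phi> x = 0" for x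
    using pd_zero_off_closure[OF z] zero_off_closure[OF z] by simp
  have "(\<integral>x. w x * pd i \<phi> x \<partial>lebesgue_on \<Omega>) = (\<integral>x. w x * pd i \<phi> x \<partial>lebesgue_on \<Omega>')"
    "(\<integral>x. g x * \<phi> x \<partial>lebesgue_on \<Omega>) = (\<integral>x. g x * \<phi> x \<partial>lebesgue_on \<Omega>')"
    using o z' by (auto intro!: integral_on_subset)
  then show "(\<integral>x. w x * pd i \<phi> x \<partial>lebesgue_on \<Omega>') = - (\<integral>x. g x * \<phi> x \<partial>lebesgue_on \<Omega>')"
    using w t' by (auto simp: has_weak_pd_def)
qed

lemma continuous_on_extend_0:
  fixes w \<phi> :: field
  assumes "open \<Omega>" "continuous_on \<Omega> w" "continuous_on UNIV \<phi>" "closure {x. \<phi> x \<noteq> 0} \<subseteq> \<Omega>"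
  shows "continuous_on UNIV (\<lambda>x. if x \<in> \<Omega> then w x * \<phi> x else 0)"
proof -
  let ?f = "\<lambda>x. if x \<in> \<Omega> then w x * \<phi> x else 0" and ?C = "- closure {x. \<phi> x \<noteq> 0}"
  have "continuous_on \<Omega> ?f"
  proof -
    have "continuous_on \<Omega> (\<lambda>x. w x * \<phi> x)"
      using assms(2) continuous_on_subset[OF assms(3)] by (intro continuous_intros) auto
    then show ?thesis by (rule continuous_on_eq) simp
  qed
  moreover have "continuous_on ?C ?f"
  proof -
    have "0 = ?f x" if "x \<in> ?C" for x using zero_off_closure[of x \<phi>] that by simp
    then show ?thesis by (rule continuous_on_eq[OF continuous_on_const])
  qed
  ultimately have "continuous_on (\<Omega> \<union> ?C) ?f" using assms(1) by (intro continuous_on_open_Un) auto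
  moreover have "\<Omega> \<union> ?C = UNIV" using assms(4) by auto
  ultimately show ?thesis by simp
qed

lemma integral_extend_0:
  fixes w \<phi> :: field
  assumes o: "open \<Omega>" and w: "continuous_on \<Omega> w" and t: "test_function \<Omega> \<phi>"
  shows "integrable lborel (\<lambda>x. if x \<in> \<Omega> then w x * \<phi> x else 0)"
    "(\<integral>x. (if x \<in> \<Omega> then w x * \<phi> x else 0) \<partial>lborel) = (\<integral>x. w x * \<phi> x \<partial>lebesgue_on \<Omega>)"
proof -
  have cl: "closure {x. \<phi> x \<noteq> 0} \<subseteq> \<Omega>" "compact (closure {x. \<phi> x \<noteq> 0})" using test_functionD[OF t] by auto
  have c: "continuous_on UNIV (\<lambda>x. if x \<in> \<Omega> then w x * \<phi> x else 0)"
    by (rule continuous_on_extend_0[OF o w _ cl(1)]) (use t in \<open>auto intro: smooth_continuous test_function_smooth\<close>)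
  obtain R where R: "\<And>x. x \<in> closure {x. \<phi> x \<noteq> 0} \<Longrightarrow> norm x \<le> R"
    using compact_imp_bounded[OF cl(2)] unfolding bounded_iff by auto
  show "integrable lborel (\<lambda>x. if x \<in> \<Omega> then w x * \<phi> x else 0)"
    by (rule integrable_compact_support[OF c, of 0 R])
       (use R in \<open>auto split: if_splits dest: not_zero_closure\<close>)
  have "(\<integral>x. (if x \<in> \<Omega> then w x * \<phi> x else 0) \<partial>lborel) = (\<integral>x. (if x \<in> \<Omega> then w x * \<phi> x else 0) \<partial>lebesgue)"
    using c by (intro integral_completion[symmetric]) (auto intro: borel_measurable_continuous_onI)
  then show "(\<integral>x. (if x \<in> \<Omega> then w x * \<phi> x else 0) \<partial>lborel) = (\<integral>x. w x * \<phi> x \<partial>lebesgue_on \<Omega>)"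
    using o by (simp add: Lebesgue_Measure.integral_restrict_UNIV)
qed

text \<open>The product with a test function, extended by zero, is continuously differentiable with compact support on the whole plane; hence its derivatives integrate to zero, which is the defining identity.\<close>

lemma has_weak_pd_classical:
  assumes o: "open \<Omega>" and v: "\<And>x. x \<in> \<Omega> \<Longrightarrow> (v has_derivative (\<lambda>h. G x \<bullet> h)) (at x)"
    and G: "continuous_on \<Omega> G"
  shows "has_weak_pd \<Omega> i v (\<lambda>x. G x $ i)"
  unfolding has_weak_pd_def
proof (intro conjI allI impI)
  have cv: "continuous_on \<Omega> v"
    using v o by (auto intro!: continuous_at_imp_continuous_on has_derivative_continuous)
  have cG: "continuous_on \<Omega> (\<lambda>x. G x $ j)" for j using G by (rule continuous_on_component)
  show "locally_integrable \<Omega> v" "locally_integrable \<Omega> (\<lambda>x. G x $ i)"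
    unfolding locally_integrable_def
    by (auto intro!: integrable_on_continuous_compact intro: continuous_on_subset[OF cv] continuous_on_subset[OF cG])
  fix \<phi> assume t: "test_function \<Omega> \<phi>"
  have sm: "smooth \<phi>" using t by (rule test_function_smooth)
  have cl: "closure {x. \<phi> x \<noteq> 0} \<subseteq> \<Omega>" "compact (closure {x. \<phi> x \<noteq> 0})" using test_functionD[OF t] by auto
  obtain R where R: "\<And>x. x \<in> closure {x. \<phi> x \<noteq> 0} \<Longrightarrow> norm x \<le> R"
    using compact_imp_bounded[OF cl(2)] unfolding bounded_iff by auto
  define F where "F x = (if x \<in> \<Omega> then v x * \<phi> x else 0)" for x
  define H where "H x = (\<chi> j. (if x \<in> \<Omega> then v x * pd j \<phi> x else 0) + (if x \<in> \<Omega> then G x $ j * \<phi> x else 0))" for x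
  have Fd: "(F has_derivative (\<lambda>h. H x \<bullet> h)) (at x)" for x
  proof (cases "x \<in> \<Omega>")
    case True
    have "((\<lambda>x. v x * \<phi> x) has_derivative (\<lambda>h. v x * (grad pd \<phi> x \<bullet> h) + (G x \<bullet> h) * \<phi> x)) (at x)"
      by (rule has_derivative_mult[OF v[OF True] smooth_has_derivative[OF sm]])
    also have "(\<lambda>h. v x * (grad pd \<phi> x \<bullet> h) + (G x \<bullet> h) * \<phi> x) = (\<lambda>h. H x \<bullet> h)"
      using True by (simp add: H_def grad_def inner_vec_def sum_2 algebra_simps)
    finally show ?thesis by (rule has_derivative_transform_within_open[OF _ o True]) (simp add: F_def)
  next
    case False
    then have "H x = 0" by (simp add: H_def vec_eq_iff)
    moreover have "(F has_derivative (\<lambda>h. 0)) (at x)"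
    proof (rule has_derivative_transform_within_open[of "\<lambda>x. 0" _ _ _ "- closure {x. \<phi> x \<noteq> 0}"])
      show "x \<in> - closure {x. \<phi> x \<noteq> 0}" using False cl by auto
      show "0 = F y" if "y \<in> - closure {x. \<phi> x \<noteq> 0}" for y
        using that closure_subset[of "{x. \<phi> x \<noteq> 0}"] by (auto simp: F_def)
    qed auto
    ultimately show ?thesis by simp
  qed
  have cl': "closure {x. pd j \<phi> x \<noteq> 0} \<subseteq> \<Omega>" for j by (rule test_functionD(2)[OF test_function_pd[OF t]])
  have cH: "continuous_on UNIV H" unfolding H_def
    by (intro continuous_on_vec_lambda continuous_on_add continuous_on_extend_0 o cv cG cl cl' smooth_continuous smooth_pd sm)
  have "(\<integral>x. H x \<bullet> axis i 1 \<partial>lborel) = 0"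
    by (rule integral_frame_derivatives(3)[where F = F and z = 0 and R = R, OF _ Fd cH])
       (use R in \<open>auto simp: F_def split: if_splits dest: not_zero_closure\<close>)
  moreover have "(\<integral>x. H x \<bullet> axis i 1 \<partial>lborel) = (\<integral>x. v x * pd i \<phi> x \<partial>lebesgue_on \<Omega>) + (\<integral>x. G x $ i * \<phi> x \<partial>lebesgue_on \<Omega>)"
    using integral_extend_0[OF o cv test_function_pd[OF t]] integral_extend_0[OF o cG t]
    by (simp add: H_def inner_axis Bochner_Integration.integral_add)
  ultimately show "(\<integral>x. v x * pd i \<phi> x \<partial>lebesgue_on \<Omega>) = - (\<integral>x. G x $ i * \<phi> x \<partial>lebesgue_on \<Omega>)" by simp
qed

section \<open>Square integrability\<close>

lemma L2_AE:
  assumes "w \<in> L2 A" "A \<in> sets lebesgue" "AE x in lebesgue_on A. w x = w' x"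
  shows "w' \<in> L2 A"
proof -
  have "AE x in lebesgue_on A. (w x)\<^sup>2 = (w' x)\<^sup>2" using assms(3) by eventually_elim simp
  then show ?thesis
    using assms borel_measurable_AE_on[of w A w'] integrable_AE_on[of A "\<lambda>x. (w x)\<^sup>2" "\<lambda>x. (w' x)\<^sup>2"]
    by (simp add: L2_def)
qed

lemma L2norm_AE:
  assumes "A \<in> sets lebesgue" "AE x in lebesgue_on A. w x = w' x"
  shows "L2norm A w = L2norm A w'"
proof -
  have "AE x in lebesgue_on A. (w x)\<^sup>2 = (w' x)\<^sup>2" using assms(2) by eventually_elim simp
  then show ?thesis unfolding L2norm_def using assms(1) by (simp add: integral_AE_on)
qed

lemma has_weak_pd_wpd: "has_weak_pd \<Omega> i w g \<Longrightarrow> has_weak_pd \<Omega> i w (wpd \<Omega> i w)"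
  unfolding wpd_def by (rule someI[of "has_weak_pd \<Omega> i w"])

lemma wpd_AE:
  assumes "open \<Omega>" "has_weak_pd \<Omega> i w g" "AE x in lebesgue_on \<Omega>. w x = w' x"
  shows "AE x in lebesgue_on \<Omega>. wpd \<Omega> i w' x = g x"
proof -
  have "AE x in lebesgue_on \<Omega>. w' x = w x" using assms(3) by eventually_elim simp
  then show ?thesis
    by (rule weak_pd_unique[OF assms(1) has_weak_pd_wpd[OF has_weak_pd_AE[OF assms]] assms(2)])
qed

lemma H1_wpd:
  assumes o: "open \<Omega>" and w: "w \<in> H1 \<Omega>"
  shows "has_weak_pd \<Omega> i w (wpd \<Omega> i w)" "wpd \<Omega> i w \<in> L2 \<Omega>"
proof -
  obtain g where g: "g \<in> L2 \<Omega>" "has_weak_pd \<Omega> i w g" using w by (auto simp: H1_def)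
  show 1: "has_weak_pd \<Omega> i w (wpd \<Omega> i w)" using g(2) by (rule has_weak_pd_wpd)
  have "AE x in lebesgue_on \<Omega>. wpd \<Omega> i w x = g x" by (rule wpd_AE[OF o g(2)]) simp
  then have "AE x in lebesgue_on \<Omega>. g x = wpd \<Omega> i w x" by eventually_elim simp
  then show "wpd \<Omega> i w \<in> L2 \<Omega>" using L2_AE[OF g(1)] o by auto
qed

section \<open>Polynomials\<close>

lemma poly_le_monom:
  assumes "a + b \<le> m"
  shows "poly_le m (\<lambda>x. k * (x $ 1) ^ a * (x $ 2) ^ b)"
proof -
  define c where "c i j = (if j = b then if i = a then k else 0 else 0)" for i j
  have "(\<Sum>i\<le>m. \<Sum>j\<le>m - i. c i j * (x $ 1) ^ i * (x $ 2) ^ j) = k * (x $ 1) ^ a * (x $ 2) ^ b" for x :: plane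
  proof -
    have "(\<Sum>j\<le>m - i. c i j * (x $ 1) ^ i * (x $ 2) ^ j) = (if i = a then k * (x $ 1) ^ a * (x $ 2) ^ b else 0)" for i
    proof -
      have "(\<Sum>j\<le>m - i. c i j * (x $ 1) ^ i * (x $ 2) ^ j)
          = (\<Sum>j\<le>m - i. if j = b then (if i = a then k else 0) * (x $ 1) ^ i * (x $ 2) ^ j else 0)"
        by (rule sum.cong) (auto simp: c_def)
      also have "\<dots> = (if i = a then k * (x $ 1) ^ a * (x $ 2) ^ b else 0)"
        using assms by (subst sum.delta) auto
      finally show ?thesis .
    qed
    then show ?thesis using assms by simp
  qed
  then show ?thesis unfolding poly_le_def by (intro exI[of _ c]) simp
qed

lemma poly_le_add:
  assumes "poly_le m p" "poly_le m q" shows "poly_le m (\<lambda>x. p x + q x)"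
proof -
  obtain c d where "\<And>x. p x = (\<Sum>i\<le>m. \<Sum>j\<le>m - i. c i j * (x $ 1) ^ i * (x $ 2) ^ j)"
    "\<And>x. q x = (\<Sum>i\<le>m. \<Sum>j\<le>m - i. d i j * (x $ 1) ^ i * (x $ 2) ^ j)"
    using assms by (auto simp: poly_le_def)
  then show ?thesis unfolding poly_le_def
    by (intro exI[of _ "\<lambda>i j. c i j + d i j"]) (simp add: sum.distrib distrib_right)
qed

lemma poly_le_0: "poly_le m (\<lambda>x. 0)"
  using poly_le_monom[of 0 0 m 0] by simp

lemma poly_le_const: "poly_le m (\<lambda>x. k)"
  using poly_le_monom[of 0 0 m k] by simp

lemma poly_le_sum: "(\<And>i. i \<in> I \<Longrightarrow> poly_le m (f i)) \<Longrightarrow> poly_le m (\<lambda>x. \<Sum>i\<in>I. f i x)"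
  by (induction I rule: infinite_finite_induct) (auto intro: poly_le_0 poly_le_add)

lemma poly_leE:
  assumes "poly_le m p"
  obtains c where "p = (\<lambda>x. \<Sum>i\<le>m. \<Sum>j\<le>m - i. c i j * (x $ 1) ^ i * (x $ 2) ^ j)"
  using assms by (auto simp: poly_le_def)

lemma poly_le_cmult: "poly_le m p \<Longrightarrow> poly_le m (\<lambda>x. k * p x)"
  by (erule poly_leE) (auto simp: sum_distrib_left mult.assoc[symmetric] intro!: poly_le_sum poly_le_monom)

lemma poly_le_minus: "poly_le m p \<Longrightarrow> poly_le m (\<lambda>x. - p x)"
  using poly_le_cmult[of m p "-1"] by simp

lemma poly_le_diff: "poly_le m p \<Longrightarrow> poly_le m q \<Longrightarrow> poly_le m (\<lambda>x. p x - q x)"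
  using poly_le_add[of m p "\<lambda>x. - q x"] poly_le_minus by simp

lemma poly_le_mono: "poly_le m p \<Longrightarrow> m \<le> m' \<Longrightarrow> poly_le m' p"
  by (erule poly_leE) (auto intro!: poly_le_sum poly_le_monom)

lemma poly_le_mult:
  assumes p: "poly_le a p" and q: "poly_le b q"
  shows "poly_le (a + b) (\<lambda>x. p x * q x)"
proof -
  obtain d where d: "q = (\<lambda>x. \<Sum>i\<le>b. \<Sum>j\<le>b - i. d i j * (x $ 1) ^ i * (x $ 2) ^ j)" using q by (rule poly_leE)
  have *: "poly_le (a + b) (\<lambda>x. k * (x $ 1) ^ i * (x $ 2) ^ j * q x)" if "i + j \<le> a" for k i j
  proof -
    have "k * (x $ 1) ^ i * (x $ 2) ^ j * q x =
       (\<Sum>i'\<le>b. \<Sum>j'\<le>b - i'. (k * d i' j') * (x $ 1) ^ (i + i') * (x $ 2) ^ (j + j'))" for x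
      by (simp add: d sum_distrib_left power_add algebra_simps)
    then show ?thesis using that by (auto intro!: poly_le_sum poly_le_monom)
  qed
  obtain c where c: "p = (\<lambda>x. \<Sum>i\<le>a. \<Sum>j\<le>a - i. c i j * (x $ 1) ^ i * (x $ 2) ^ j)" using p by (rule poly_leE)
  have "p x * q x = (\<Sum>i\<le>a. \<Sum>j\<le>a - i. c i j * (x $ 1) ^ i * (x $ 2) ^ j * q x)" for x
    by (simp add: c sum_distrib_right)
  then show ?thesis by (auto intro!: poly_le_sum *)
qed

lemma poly_le_power: "poly_le a p \<Longrightarrow> poly_le (k * a) (\<lambda>x. p x ^ k)"
  by (induction k) (auto intro: poly_le_const poly_le_mult)

text \<open>Substituting affine coordinates does not raise the total degree.\<close>

lemma poly_le_compose:
  assumes p: "poly_le m p" and f: "poly_le 1 (\<lambda>y. f y $ 1)" "poly_le 1 (\<lambda>y. f y $ 2)"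
  shows "poly_le m (\<lambda>y. p (f y))"
proof -
  obtain c where c: "p = (\<lambda>x. \<Sum>i\<le>m. \<Sum>j\<le>m - i. c i j * (x $ 1) ^ i * (x $ 2) ^ j)" using p by (rule poly_leE)
  have "poly_le m (\<lambda>y. c i j * (f y $ 1) ^ i * (f y $ 2) ^ j)" if "i \<le> m" "j \<le> m - i" for i j
  proof -
    have "poly_le (i * 1 + j * 1) (\<lambda>y. (f y $ 1) ^ i * (f y $ 2) ^ j)"
      using f by (intro poly_le_mult poly_le_power)
    then have "poly_le m (\<lambda>y. (f y $ 1) ^ i * (f y $ 2) ^ j)"
      by (rule poly_le_mono) (use that in auto)
    then show ?thesis using poly_le_cmult[of m _ "c i j"] by (simp add: mult.assoc)
  qed
  then show ?thesis unfolding c by (auto intro!: poly_le_sum)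
qed

lemma smooth_poly_le: "poly_le m p \<Longrightarrow> smooth p"
  by (erule poly_leE) (auto intro!: smooth_intros)

lemma pd_power: "smooth f \<Longrightarrow> pd i (\<lambda>x. f x ^ k) x = real k * f x ^ (k - 1) * pd i f x"
proof (induction k)
  case (Suc k)
  have "pd i (\<lambda>x. f x ^ Suc k) x = f x * pd i (\<lambda>x. f x ^ k) x + pd i f x * f x ^ k"
    using pd_mult[OF Suc.prems smooth_power[OF Suc.prems]] by simp
  then show ?case using Suc by (cases k) (simp_all add: algebra_simps)
qed (simp add: pd_const)

lemma poly_le_pd:
  assumes p: "poly_le m p" shows "poly_le m (pd i p)"
proof -
  obtain c where c: "p = (\<lambda>x. \<Sum>i\<le>m. \<Sum>j\<le>m - i. c i j * (x $ 1) ^ i * (x $ 2) ^ j)" using p by (rule poly_leE)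
  have mon: "poly_le m (pd i (\<lambda>x. c a b * (x $ 1) ^ a * (x $ 2) ^ b))" if "a \<le> m" "b \<le> m - a" for a b
  proof -
    have "pd i (\<lambda>x. c a b * (x $ 1) ^ a * (x $ 2) ^ b) =
       (\<lambda>x. (if i = 1 then c a b * real a * (x $ 1) ^ (a - 1) * (x $ 2) ^ b else 0)
          + (if i = 2 then c a b * real b * (x $ 1) ^ a * (x $ 2) ^ (b - 1) else 0))"
    proof
      fix x :: plane
      show "pd i (\<lambda>x. c a b * (x $ 1) ^ a * (x $ 2) ^ b) x = 
       (if i = 1 then c a b * real a * (x $ 1) ^ (a - 1) * (x $ 2) ^ b else 0)
          + (if i = 2 then c a b * real b * (x $ 1) ^ a * (x $ 2) ^ (b - 1) else 0)"
        by (simp add: pd_mult pd_const pd_power pd_component smooth_intros algebra_simps)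
    qed
    then show ?thesis using that by (cases "i = 1"; cases "i = 2") (auto intro!: poly_le_monom poly_le_0 poly_le_add)
  qed
  have "pd i p = (\<lambda>x. \<Sum>a\<le>m. \<Sum>b\<le>m - a. pd i (\<lambda>x. c a b * (x $ 1) ^ a * (x $ 2) ^ b) x)"
    unfolding c by (rule ext) (simp add: pd_sum smooth_intros)
  then show ?thesis by (auto intro!: poly_le_sum mon)
qed

text \<open>In scaled coordinates attached to an edge a polynomial is again one; its restriction to the line of the edge is obtained at \<open>b = 0\<close>.\<close>

lemma poly_le_frame:
  assumes p: "poly_le m p"
  obtains c where "\<And>a b. p (frame z n (\<rho> * a, \<rho> * b)) = (\<Sum>i\<le>m. \<Sum>j\<le>m. c i j * a ^ i * b ^ j)"
    "\<And>a. p (z + (\<rho> * a) *\<^sub>R tangent n) = (\<Sum>i\<le>m. c i 0 * a ^ i)"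
proof -
  define f where "f y = frame z n (\<rho> * y $ 1, \<rho> * y $ 2)" for y :: plane
  have lin: "poly_le 1 (\<lambda>y. u + v * y $ 1 + w * y $ 2)" for u v w
    using poly_le_monom[of 1 0 1 v] poly_le_monom[of 0 1 1 w] by (auto intro!: poly_le_add poly_le_const)
  have fi: "f y $ i = z $ i + (\<rho> * tangent n $ i) * y $ 1 + (\<rho> * n $ i) * y $ 2" for y i
    by (simp add: f_def frame_def algebra_simps)
  have "poly_le m (\<lambda>y. p (f y))" by (rule poly_le_compose[OF p]; unfold fi; rule lin)
  then obtain c where c: "\<And>y. p (f y) = (\<Sum>i\<le>m. \<Sum>j\<le>m - i. c i j * (y $ 1) ^ i * (y $ 2) ^ j)"
    unfolding poly_le_def by blast
  define c' where "c' i j = (if i + j \<le> m then c i j else 0)" for i j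
  have *: "p (frame z n (\<rho> * a, \<rho> * b)) = (\<Sum>i\<le>m. \<Sum>j\<le>m. c' i j * a ^ i * b ^ j)" for a b
  proof -
    have "p (frame z n (\<rho> * a, \<rho> * b)) = (\<Sum>i\<le>m. \<Sum>j\<le>m - i. c i j * a ^ i * b ^ j)"
      using c[of "vector [a, b]"] by (simp add: f_def)
    also have "\<dots> = (\<Sum>i\<le>m. \<Sum>j\<le>m. c' i j * a ^ i * b ^ j)"
      by (intro sum.cong refl sum.mono_neutral_cong_left) (auto simp: c'_def)
    finally show ?thesis .
  qed
  moreover have "p (z + (\<rho> * a) *\<^sub>R tangent n) = (\<Sum>i\<le>m. c' i 0 * a ^ i)" for a
  proof -
    have "(\<Sum>j\<le>m. c' i j * a ^ i * 0 ^ j) = c' i 0 * a ^ i" for i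
      by (subst sum.atMost_shift) simp
    then show ?thesis using *[of a 0] by (simp add: frame_def)
  qed
  ultimately show thesis by (rule that)
qed

section \<open>Norm equivalence for polynomials\<close>

text \<open>A difference quotient lowers the degree and multiplies the leading coefficient by a known factor; this drives the induction below.\<close>

lemma poly_difference:
  fixes c :: "nat \<Rightarrow> real"
  shows "\<exists>d. (\<forall>x. (\<Sum>i\<le>Suc M. c i * (x + \<eta>) ^ i) - (\<Sum>i\<le>Suc M. c i * x ^ i) = (\<Sum>k\<le>M. d k * x ^ k))
     \<and> d M = real (Suc M) * \<eta> * c (Suc M)"
proof (induction M)
  case 0
  show ?case by (rule exI[of _ "\<lambda>_. \<eta> * c 1"]) (auto simp: algebra_simps)
next
  case (Suc M)
  then obtain d where d: "\<And>x. (\<Sum>i\<le>Suc M. c i * (x + \<eta>) ^ i) - (\<Sum>i\<le>Suc M. c i * x ^ i) = (\<Sum>k\<le>M. d k * x ^ k)" by blast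
  let ?n = "Suc (Suc M)"
  define e where "e k = (if k \<le> M then d k else 0) + c ?n * (real (?n choose k) * \<eta> ^ (?n - k))" for k
  have "(\<Sum>i\<le>?n. c i * (x + \<eta>) ^ i) - (\<Sum>i\<le>?n. c i * x ^ i) = (\<Sum>k\<le>Suc M. e k * x ^ k)" for x
  proof -
    have "(x + \<eta>) ^ ?n = (\<Sum>k\<le>?n. real (?n choose k) * x ^ k * \<eta> ^ (?n - k))" by (rule binomial_ring)
    also have "\<dots> = (\<Sum>k\<le>Suc M. real (?n choose k) * x ^ k * \<eta> ^ (?n - k)) + x ^ ?n"
      by (subst sum.atMost_Suc) simp
    finally have b: "(x + \<eta>) ^ ?n - x ^ ?n = (\<Sum>k\<le>Suc M. real (?n choose k) * x ^ k * \<eta> ^ (?n - k))" by simp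
    have "(\<Sum>i\<le>?n. c i * (x + \<eta>) ^ i) - (\<Sum>i\<le>?n. c i * x ^ i)
       = (\<Sum>k\<le>M. d k * x ^ k) + c ?n * ((x + \<eta>) ^ ?n - x ^ ?n)"
      unfolding d[symmetric] sum.atMost_Suc[of _ "Suc M"] by (simp only: algebra_simps)
    also have "(\<Sum>k\<le>M. d k * x ^ k) = (\<Sum>k\<le>Suc M. (if k \<le> M then d k else 0) * x ^ k)"
      by simp
    finally show ?thesis unfolding b by (simp only: e_def distrib_left distrib_right sum.distrib sum_distrib_left mult_ac)
  qed
  moreover have "e (Suc M) = real ?n * \<eta> * c ?n" by (simp add: e_def)
  ultimately show ?case by blast
qed

text \<open>All norms on a finite-dimensional space are equivalent; here is an elementary proof by induction on the degree.
The difference \<open>p(x + \<eta>) - p(x)\<close>, where \<open>\<eta>\<close> is half the length of the interval, has lower degree on the left half,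
and its square is controlled by \<open>p\<^sup>2\<close> on the two halves. Its leading coefficient bounds that of \<open>p\<close>, and
subtracting the leading term leaves a polynomial of lower degree.\<close>

lemma coeff_le_L2_interval:
  fixes a b :: real
  assumes "a < b"
  shows "\<exists>C\<ge>0. \<forall>c. \<forall>i\<le>M. (c i)\<^sup>2 \<le> C * integral {a..b} (\<lambda>x. (\<Sum>i\<le>M. c i * x ^ i)\<^sup>2)"
  using assms
proof (induction M arbitrary: a b)
  case 0
  show ?case by (rule exI[of _ "1 / (b - a)"]) (use 0 in auto)
next
  case (Suc M)
  define \<eta> where "\<eta> = (b - a) / 2"
  define mid where "mid = a + \<eta>"
  have eta: "\<eta> > 0" "a < mid" "mid < b" "mid + \<eta> = b" "a \<le> b" "a \<le> mid" "mid \<le> b" using Suc.prems by (auto simp: \<eta>_def mid_def field_simps)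
  obtain C1 where C1: "C1 \<ge> 0" "\<And>c i. i \<le> M \<Longrightarrow> (c i)\<^sup>2 \<le> C1 * integral {a..mid} (\<lambda>x. (\<Sum>i\<le>M. c i * x ^ i)\<^sup>2)"
    using Suc.IH[OF eta(2)] by blast
  obtain C2 where C2: "C2 \<ge> 0" "\<And>c i. i \<le> M \<Longrightarrow> (c i)\<^sup>2 \<le> C2 * integral {a..b} (\<lambda>x. (\<Sum>i\<le>M. c i * x ^ i)\<^sup>2)"
    using Suc.IH[OF Suc.prems] by blast
  define K where "K = 2 * C1 / (real (Suc M) * \<eta>)\<^sup>2"
  define J where "J = integral {a..b} (\<lambda>x. (x ^ Suc M)\<^sup>2)"
  have J0: "J \<ge> 0" unfolding J_def by (intro Henstock_Kurzweil_Integration.integral_nonneg integrable_continuous_real continuous_intros) auto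
  have K0: "K \<ge> 0" using C1 by (simp add: K_def)
  have two: "(u + v)\<^sup>2 \<le> 2 * u\<^sup>2 + 2 * v\<^sup>2" "(u - v)\<^sup>2 \<le> 2 * u\<^sup>2 + 2 * v\<^sup>2" for u v :: real
    using sum_squares_bound[of u v] sum_squares_bound[of u "-v"] by (auto simp: power2_sum power2_diff)
  show ?case
  proof (intro exI[of _ "K + C2 * (2 + 2 * K * J)"] conjI allI impI)
    show "0 \<le> K + C2 * (2 + 2 * K * J)" using K0 C2 J0 by simp
    fix c :: "nat \<Rightarrow> real" and i assume i: "i \<le> Suc M"
    define p where "p x = (\<Sum>i\<le>Suc M. c i * x ^ i)" for x
    define I where "I = integral {a..b} (\<lambda>x. (p x)\<^sup>2)"
    have cp: "continuous_on A p" for A unfolding p_def by (intro continuous_intros)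
    have int: "(\<lambda>x. (p x)\<^sup>2) integrable_on {u..v}" for u v by (intro integrable_continuous_real continuous_intros cp)
    have int': "(\<lambda>x. (p (x + \<eta>))\<^sup>2) integrable_on {u..v}" for u v
      by (intro integrable_continuous_real continuous_intros continuous_on_compose2[OF cp[of UNIV]]) auto
    have I0: "I \<ge> 0" unfolding I_def by (intro Henstock_Kurzweil_Integration.integral_nonneg int) auto
    have I2: "I = integral {a..mid} (\<lambda>x. (p x)\<^sup>2) + integral {a..mid} (\<lambda>x. (p (x + \<eta>))\<^sup>2)"
    proof -
      have "integral {a..mid} ((\<lambda>x. (p x)\<^sup>2) \<circ> ((+) \<eta>)) = integral {a + \<eta>..mid + \<eta>} (\<lambda>x. (p x)\<^sup>2)"
        by (rule integral_shift_Icc_real)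
      then have "integral {a..mid} (\<lambda>x. (p (x + \<eta>))\<^sup>2) = integral {mid..b} (\<lambda>x. (p x)\<^sup>2)"
        using eta by (simp add: comp_def mid_def add.commute)
      then show ?thesis unfolding I_def
        using Henstock_Kurzweil_Integration.integral_combine[OF eta(6) eta(7) int] by simp
    qed
    obtain d where d: "\<And>x. p (x + \<eta>) - p x = (\<Sum>k\<le>M. d k * x ^ k)" "d M = real (Suc M) * \<eta> * c (Suc M)"
      using poly_difference[where M=M and c=c and \<eta>=\<eta>] unfolding p_def by blast
    have "(d M)\<^sup>2 \<le> C1 * integral {a..mid} (\<lambda>x. (p (x + \<eta>) - p x)\<^sup>2)"
      using C1(2)[of M d] by (simp add: d(1))
    also have "\<dots> \<le> C1 * integral {a..mid} (\<lambda>x. 2 * (p (x + \<eta>))\<^sup>2 + 2 * (p x)\<^sup>2)"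
      using C1(1) int int'
      by (intro mult_left_mono integral_le two integrable_continuous_real continuous_intros cp continuous_on_compose2[OF cp[of UNIV]]) auto
    also have "integral {a..mid} (\<lambda>x. 2 * (p (x + \<eta>))\<^sup>2 + 2 * (p x)\<^sup>2) = 2 * I"
      unfolding I2 by (subst Henstock_Kurzweil_Integration.integral_add) (use int int' in auto)
    finally have "(d M)\<^sup>2 \<le> 2 * C1 * I" by (simp add: mult_ac)
    then have "(real (Suc M) * \<eta>)\<^sup>2 * (c (Suc M))\<^sup>2 \<le> 2 * C1 * I" unfolding d(2) power_mult_distrib .
    moreover have "(real (Suc M) * \<eta>)\<^sup>2 > 0" using eta by simp
    ultimately have "(c (Suc M))\<^sup>2 \<le> 2 * C1 * I / (real (Suc M) * \<eta>)\<^sup>2"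
      using pos_le_divide_eq[of "(real (Suc M) * \<eta>)\<^sup>2" "(c (Suc M))\<^sup>2"] by (simp only: mult.commute)
    then have top: "(c (Suc M))\<^sup>2 \<le> K * I" by (simp only: K_def times_divide_eq_left)
    show "(c i)\<^sup>2 \<le> (K + C2 * (2 + 2 * K * J)) * integral {a..b} (\<lambda>x. (\<Sum>i\<le>Suc M. c i * x ^ i)\<^sup>2)"
    proof (cases "i = Suc M")
      case True
      have "K * I \<le> (K + C2 * (2 + 2 * K * J)) * I" using K0 C2 J0 I0 by (intro mult_right_mono) auto
      then show ?thesis using top True unfolding I_def p_def by simp
    next
      case False
      then have iM: "i \<le> M" using i by simp
      have ir: "(\<lambda>x. (\<Sum>i\<le>M. c i * x ^ i)\<^sup>2) integrable_on {a..b}" by (intro integrable_continuous_real continuous_intros)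
      have ix: "(\<lambda>x. (x ^ Suc M)\<^sup>2) integrable_on {a..b}" by (intro integrable_continuous_real continuous_intros)
      have "integral {a..b} (\<lambda>x. (\<Sum>i\<le>M. c i * x ^ i)\<^sup>2) \<le> integral {a..b} (\<lambda>x. 2 * (p x)\<^sup>2 + (2 * (c (Suc M))\<^sup>2) * (x ^ Suc M)\<^sup>2)"
      proof (rule integral_le[OF ir])
        show "(\<lambda>x. 2 * (p x)\<^sup>2 + (2 * (c (Suc M))\<^sup>2) * (x ^ Suc M)\<^sup>2) integrable_on {a..b}"
          by (intro integrable_continuous_real continuous_intros cp)
        fix x
        have "(\<Sum>i\<le>M. c i * x ^ i) = p x - c (Suc M) * x ^ Suc M" by (simp add: p_def)
        then show "(\<Sum>i\<le>M. c i * x ^ i)\<^sup>2 \<le> 2 * (p x)\<^sup>2 + (2 * (c (Suc M))\<^sup>2) * (x ^ Suc M)\<^sup>2"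
          using two(2)[of "p x" "c (Suc M) * x ^ Suc M"] by (simp only: power_mult_distrib mult.assoc)
      qed
      also have "\<dots> = 2 * I + (2 * (c (Suc M))\<^sup>2) * J"
        unfolding I_def J_def
        by (subst Henstock_Kurzweil_Integration.integral_add) (use int ix in \<open>auto intro!: integrable_on_mult_right simp del: power_Suc\<close>)
      also have "\<dots> \<le> 2 * I + (2 * (K * I)) * J" using top J0 by (intro add_left_mono mult_right_mono mult_left_mono) auto
      finally have "(c i)\<^sup>2 \<le> C2 * (2 * I + (2 * (K * I)) * J)"
        using C2(2)[OF iM, of c] C2(1) by (meson mult_left_mono order_trans)
      also have "\<dots> \<le> (K + C2 * (2 + 2 * K * J)) * I" using K0 I0 by (simp add: algebra_simps)
      finally show ?thesis unfolding I_def p_def .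
    qed
  qed
qed

text \<open>The standard bump \<open>exp (- 1 / (1 - t\<^sup>2))\<close>.\<close>

definition weight :: "real \<Rightarrow> real" where
  "weight = bump 1 1 0"

lemma weight_eq: "weight t = (if \<bar>t\<bar> < 1 then exp (- 1 / (1 - t\<^sup>2)) else 0)"
  by (simp add: weight_def bump_one)

lemma smooth1_continuous: "smooth1 h \<Longrightarrow> continuous_on A h"
  using smooth1_deriv(2) by (meson DERIV_isCont continuous_at_imp_continuous_on)

lemma weight_continuous: "continuous_on A weight"
  unfolding weight_def by (intro smooth1_continuous smooth1_bump) simp

lemma weight_nonneg: "weight t \<ge> 0"
  by (simp add: weight_eq)

lemma weighted_continuous_integrable:
  fixes f :: "real \<Rightarrow> real"
  assumes "continuous_on UNIV f"
  shows "integrable lborel (\<lambda>t. weight t * f t)"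
proof (rule integrable_compact_support[where z = 0 and R = 1])
  show "continuous_on UNIV (\<lambda>t. weight t * f t)" by (intro continuous_intros weight_continuous assms)
qed (auto simp: weight_eq split: if_splits)

text \<open>On the inner half of its support the weight is bounded below by \<open>exp (- 2)\<close>.\<close>

lemma coeff_le_weighted_L2:
  "\<exists>C>0. \<forall>c. \<forall>i\<le>M. (c i)\<^sup>2 \<le> C * (\<integral>t. weight t * (\<Sum>i\<le>M. c i * t ^ i)\<^sup>2 \<partial>lborel)"
proof -
  obtain C where C: "C \<ge> 0" "\<And>c i. i \<le> M \<Longrightarrow> (c i)\<^sup>2 \<le> C * integral {-(1/2)..1/2::real} (\<lambda>x. (\<Sum>i\<le>M. c i * x ^ i)\<^sup>2)"
    using coeff_le_L2_interval[of "-(1/2)" "1/2" M] by auto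
  show ?thesis
  proof (intro exI[of _ "exp 2 * (C + 1)"] conjI allI impI)
    show "0 < exp 2 * (C + 1)" using C by (simp add: add_nonneg_pos)
    fix c :: "nat \<Rightarrow> real" and i assume i: "i \<le> M"
    define f where "f t = (\<Sum>i\<le>M. c i * t ^ i)\<^sup>2" for t
    have cf: "continuous_on A f" for A unfolding f_def by (intro continuous_intros)
    have f0: "f t \<ge> 0" for t by (simp add: f_def)
    have si: "set_integrable lborel {-(1/2)..1/2} f"
      unfolding set_integrable_def by (rule borel_integrable_compact) (auto intro: cf)
    have "integral {-(1/2)..1/2} f = (\<integral>t. indicator {-(1/2)..1/2} t * f t \<partial>lborel)"
      using set_borel_integral_eq_integral(2)[OF si] by (simp add: set_lebesgue_integral_def)
    also have "\<dots> \<le> (\<integral>t. exp 2 * (weight t * f t) \<partial>lborel)"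
    proof (rule Bochner_Integration.integral_mono)
      show "integrable lborel (\<lambda>t. indicator {-(1/2)..1/2} t * f t)" using si by (simp add: set_integrable_def)
      show "integrable lborel (\<lambda>t. exp 2 * (weight t * f t))"
        by (intro integrable_mult_right weighted_continuous_integrable cf)
      fix t :: real
      have "1 \<le> exp 2 * weight t" if t: "t \<in> {-(1/2)..1/2}"
      proof -
        have "\<bar>t\<bar> \<le> 1/2" using t by auto
        then have "t\<^sup>2 \<le> (1/2)\<^sup>2" by (simp add: abs_le_square_iff[symmetric])
        then have "1 - t\<^sup>2 \<ge> 1/2" by (simp add: power2_eq_square)
        then have "1 / (1 - t\<^sup>2) \<le> 2" by (simp add: field_simps)
        then have "1 \<le> exp (2 + - 1 / (1 - t\<^sup>2))" by simp
        then have "1 \<le> exp 2 * exp (- 1 / (1 - t\<^sup>2))" by (simp only: exp_add)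
        moreover have "\<bar>t\<bar> < 1" using \<open>\<bar>t\<bar> \<le> 1/2\<close> by simp
        ultimately show ?thesis by (simp add: weight_eq)
      qed
      then show "indicator {-(1/2)..1/2} t * f t \<le> exp 2 * (weight t * f t)"
        using f0[of t] weight_nonneg[of t] mult_right_mono[of 1 "exp 2 * weight t" "f t"]
        by (auto simp: indicator_def mult.assoc)
    qed
    also have "\<dots> = exp 2 * (\<integral>t. weight t * f t \<partial>lborel)" by simp
    finally have le: "integral {-(1/2)..1/2} f \<le> exp 2 * (\<integral>t. weight t * f t \<partial>lborel)" .
    have n: "(\<integral>t. weight t * f t \<partial>lborel) \<ge> 0" using f0 weight_nonneg by simp
    have "(c i)\<^sup>2 \<le> C * integral {-(1/2)..1/2} f" using C(2)[OF i, of c] unfolding f_def[abs_def] .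
    also have "\<dots> \<le> C * (exp 2 * (\<integral>t. weight t * f t \<partial>lborel))" using le C(1) by (rule mult_left_mono)
    also have "\<dots> \<le> exp 2 * (C + 1) * (\<integral>t. weight t * f t \<partial>lborel)"
      using n by (simp add: algebra_simps)
    finally show "(c i)\<^sup>2 \<le> exp 2 * (C + 1) * (\<integral>t. weight t * (\<Sum>i\<le>M. c i * t ^ i)\<^sup>2 \<partial>lborel)" by (simp add: f_def)
  qed
qed

lemma weighted_continuous_integrable2:
  fixes f :: "real \<times> real \<Rightarrow> real"
  assumes "continuous_on UNIV f"
  shows "integrable (lborel \<Otimes>\<^sub>M lborel) (\<lambda>p. weight (fst p) * weight (snd p) * f p)"
  unfolding lborel_prod
proof (rule integrable_compact_support[where z = 0 and R = 2])
  show "continuous_on UNIV (\<lambda>p. weight (fst p) * weight (snd p) * f p)"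
    by (intro continuous_intros continuous_on_compose2[OF weight_continuous[of UNIV]] assms) auto
  fix p :: "real \<times> real" assume "weight (fst p) * weight (snd p) * f p \<noteq> 0"
  then have "\<bar>fst p\<bar> < 1" "\<bar>snd p\<bar> < 1" by (auto simp: weight_eq split: if_splits)
  then show "norm (p - 0) \<le> 2" using norm_Pair_le[of "fst p" "snd p"] by simp
qed

text \<open>The one-dimensional bound is applied in the first variable for each fixed second one, and then to the resulting coefficients as polynomials in the second variable.\<close>

lemma coeff_le_weighted_L2_plane:
  "\<exists>C>0. \<forall>c. \<forall>i\<le>M. \<forall>j\<le>M. (c i j)\<^sup>2 \<le> C * (\<integral>p. weight (fst p) * weight (snd p) *
      (\<Sum>i\<le>M. \<Sum>j\<le>M. c i j * fst p ^ i * snd p ^ j)\<^sup>2 \<partial>(lborel \<Otimes>\<^sub>M lborel))"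
proof -
  obtain C where C: "C > 0" "\<And>c i. i \<le> M \<Longrightarrow> (c i)\<^sup>2 \<le> C * (\<integral>t. weight t * (\<Sum>i\<le>M. c i * t ^ i)\<^sup>2 \<partial>lborel)"
    using coeff_le_weighted_L2[of M] by auto
  show ?thesis
  proof (intro exI[of _ "C * C"] conjI allI impI)
    show "0 < C * C" using C by simp
    fix c :: "nat \<Rightarrow> nat \<Rightarrow> real" and i j assume ij: "i \<le> M" "j \<le> M"
    define q where "q i b = (\<Sum>j\<le>M. c i j * b ^ j)" for i b
    define P where "P a b = (\<Sum>i\<le>M. q i b * a ^ i)\<^sup>2" for a b :: real
    have cP: "continuous_on UNIV (\<lambda>p. P (fst p) (snd p))" unfolding P_def q_def by (intro continuous_intros)
    have int: "integrable (lborel \<Otimes>\<^sub>M lborel) (\<lambda>(a, b). weight a * weight b * P a b)"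
      using weighted_continuous_integrable2[OF cP] by (simp add: case_prod_beta')
    have "(\<integral>p. weight (fst p) * weight (snd p) * (\<Sum>i\<le>M. \<Sum>j\<le>M. c i j * fst p ^ i * snd p ^ j)\<^sup>2 \<partial>(lborel \<Otimes>\<^sub>M lborel))
        = (\<integral>(a, b). weight a * weight b * P a b \<partial>(lborel \<Otimes>\<^sub>M lborel))"
      by (intro Bochner_Integration.integral_cong)
         (simp_all add: P_def q_def sum_distrib_left case_prod_beta' mult_ac)
    also have "\<dots> = (\<integral>b. (\<integral>a. weight a * weight b * P a b \<partial>lborel) \<partial>lborel)"
      by (rule lborel_pair.integral_snd[symmetric]) (use int in simp)
    finally have I: "(\<integral>p. weight (fst p) * weight (snd p) * (\<Sum>i\<le>M. \<Sum>j\<le>M. c i j * fst p ^ i * snd p ^ j)\<^sup>2 \<partial>(lborel \<Otimes>\<^sub>M lborel))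
        = (\<integral>b. (\<integral>a. weight a * weight b * P a b \<partial>lborel) \<partial>lborel)" .
    have "(c i j)\<^sup>2 \<le> C * (\<integral>b. weight b * (q i b)\<^sup>2 \<partial>lborel)" using C(2)[OF ij(2), of "c i"] by (simp add: q_def)
    also have "\<dots> \<le> C * (\<integral>b. C * (\<integral>a. weight a * weight b * P a b \<partial>lborel) \<partial>lborel)"
    proof (intro mult_left_mono Bochner_Integration.integral_mono)
      show "integrable lborel (\<lambda>b. weight b * (q i b)\<^sup>2)"
        unfolding q_def by (intro weighted_continuous_integrable continuous_intros)
      show "integrable lborel (\<lambda>b. C * (\<integral>a. weight a * weight b * P a b \<partial>lborel))"
        using lborel_pair.integrable_snd[OF int] by (intro integrable_mult_right)
      fix b :: real
      have "(q i b)\<^sup>2 \<le> C * (\<integral>a. weight a * P a b \<partial>lborel)" using C(2)[OF ij(1), of "\<lambda>i. q i b"] by (simp add: P_def)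
      then have "weight b * (q i b)\<^sup>2 \<le> weight b * (C * (\<integral>a. weight a * P a b \<partial>lborel))"
        using weight_nonneg by (intro mult_left_mono) auto
      also have "(\<integral>a. weight a * weight b * P a b \<partial>lborel) = weight b * (\<integral>a. weight a * P a b \<partial>lborel)"
        by (simp add: mult.commute mult.left_commute flip: integral_mult_right_zero)
      then have "weight b * (C * (\<integral>a. weight a * P a b \<partial>lborel)) = C * (\<integral>a. weight a * weight b * P a b \<partial>lborel)" by simp
      finally show "weight b * (q i b)\<^sup>2 \<le> C * (\<integral>a. weight a * weight b * P a b \<partial>lborel)" .
    qed (use C in simp)
    finally show "(c i j)\<^sup>2 \<le> C * C * (\<integral>p. weight (fst p) * weight (snd p) * (\<Sum>i\<le>M. \<Sum>j\<le>M. c i j * fst p ^ i * snd p ^ j)\<^sup>2 \<partial>(lborel \<Otimes>\<^sub>M lborel))"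
      unfolding I by simp
  qed
qed

section \<open>Green's formula\<close>

text \<open>With this factor and \<open>coupling\<close> the moment is \<open>stiffness * (K + coupling * tr K * I)\<close> for the curvature \<open>K\<close>.\<close>

definition stiffness :: "plate \<Rightarrow> real" where
  "stiffness P = (thickness P) ^ 3 / 12 * (young P / (1 + poisson P))"

definition coupling :: "plate \<Rightarrow> real" where
  "coupling P = poisson P / (1 - poisson P)"

lemma curvature_component:
  "curvature D w x $ i $ j = - (1/2) * (D j (D i w) x + D i (D j w) x)"
  by (simp add: curvature_def strain_def grad_def transpose_def)

lemma moment_component:
  "moment P D w x $ i $ j = stiffness P * (curvature D w x $ i $ j
     + coupling P * (curvature D w x $ 1 $ 1 + curvature D w x $ 2 $ 2) * (if i = j then 1 else 0))"
  by (simp add: moment_def elasticity_def stiffness_def coupling_def trace_def sum_2 mat_def)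

lemma moment_sym: "moment P D w x $ i $ j = moment P D w x $ j $ i"
  by (simp add: moment_component curvature_component add.commute)

lemma smooth_moment:
  assumes "smooth p" shows "smooth (\<lambda>x. moment P pd p x $ i $ j)"
  unfolding moment_component curvature_component by (intro smooth_intros assms)

lemma smooth_shear: "smooth p \<Longrightarrow> smooth (\<lambda>x. shear P p x $ i)"
  by (simp add: shear_def smooth_sum smooth_pd smooth_moment)

lemma smooth_M_ns: "smooth p \<Longrightarrow> smooth (M_ns P n p)"
  unfolding M_ns_def[abs_def] by (simp add: inner_vec_def sum_2 matrix_vector_mult_def smooth_intros smooth_moment)

lemma smooth_M_nn: "smooth p \<Longrightarrow> smooth (M_nn P n p)"
  unfolding M_nn_def[abs_def] by (simp add: inner_vec_def sum_2 matrix_vector_mult_def smooth_intros smooth_moment)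

lemma smooth_grad_inner: "smooth v \<Longrightarrow> smooth (\<lambda>x. grad pd v x \<bullet> a)"
  by (simp add: grad_def inner_vec_def smooth_intros)

lemma smooth_V_n: "smooth p \<Longrightarrow> smooth (V_n P n p)"
  unfolding V_n_def[abs_def] Q_n_def
  by (simp add: inner_vec_def sum_2 smooth_intros smooth_shear smooth_M_ns grad_def)

lemma smooth_plate_op: "smooth p \<Longrightarrow> smooth (plate_op P p)"
  unfolding plate_op_def[abs_def] by (simp add: smooth_intros smooth_shear)

lemma grad_continuous: "smooth v \<Longrightarrow> continuous_on A (grad pd v)"
  unfolding grad_def[abs_def] by (intro continuous_on_vec_lambda smooth_continuous smooth_pd)

lemma smooth_integrable:
  "smooth f \<Longrightarrow> (\<And>x. f x \<noteq> 0 \<Longrightarrow> norm (x - z) \<le> R) \<Longrightarrow> integrable lborel f"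
  by (rule integrable_compact_support[OF smooth_continuous])

lemma integrable_halfplane: "integrable lborel f \<Longrightarrow> integrable lborel (\<lambda>x. indicator (halfplane z n) x * f x :: real)"
  by (rule Bochner_Integration.integrable_bound[where f = f]) (auto simp: indicator_def)

lemma pd_support:
  assumes "\<And>x. v x \<noteq> 0 \<Longrightarrow> norm (x - z) \<le> R" "pd i v x \<noteq> 0"
  shows "norm (x - z) \<le> R"
proof (rule ccontr)
  assume *: "\<not> norm (x - z) \<le> R"
  have "pd i v x = pd i (\<lambda>x. 0) x"
  proof (rule pd_cong_open[of "- cball z R"])
    show "v y = 0" if "y \<in> - cball z R" for y using assms(1)[of y] that by (auto simp: dist_norm norm_minus_commute)
  qed (use * in \<open>auto simp: dist_norm norm_minus_commute\<close>)
  then show False using assms(2) by (simp add: pd_const)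
qed

text \<open>The divergence is the sum of the tangential derivative of the tangential component and the normal derivative of the normal component.\<close>

lemma halfplane_divergence:
  assumes n: "norm n = 1" and W: "smooth W1" "smooth W2"
    and z: "\<And>x. W1 x \<noteq> 0 \<Longrightarrow> norm (x - z) \<le> R" "\<And>x. W2 x \<noteq> 0 \<Longrightarrow> norm (x - z) \<le> R"
  shows "(\<integral>x. indicator (halfplane z n) x * (pd 1 W1 x + pd 2 W2 x) \<partial>lborel)
     = line_int z n (\<lambda>x. W1 x * n $ 1 + W2 x * n $ 2)"
proof -
  define F where "F a x = W1 x * a $ 1 + W2 x * a $ 2" for a :: plane and x
  have sF: "smooth (F a)" for a unfolding F_def[abs_def] by (intro smooth_intros W)
  have zF: "F a x \<noteq> 0 \<Longrightarrow> norm (x - z) \<le> R" for a x using z(1)[of x] z(2)[of x] by (force simp: F_def)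
  note ifd_t = integral_frame_derivatives[OF n smooth_has_derivative[OF sF] grad_continuous[OF sF] zF[of "tangent n"]]
  note ifd_n = integral_frame_derivatives[OF n smooth_has_derivative[OF sF] grad_continuous[OF sF] zF[of n]]
  have gF: "grad pd (F a) x $ i = pd i W1 x * a $ 1 + pd i W2 x * a $ 2" for a x i
    by (simp add: grad_def F_def[abs_def] pd_add pd_mult pd_const smooth_intros W)
  have int: "integrable lborel (\<lambda>x. grad pd (F a) x \<bullet> b)" for a b
  proof (rule smooth_integrable[OF smooth_grad_inner[OF sF], of _ _ z R])
    fix x assume "grad pd (F a) x \<bullet> b \<noteq> 0"
    then have "pd 1 (F a) x \<noteq> 0 \<or> pd 2 (F a) x \<noteq> 0" by (auto simp: grad_def inner_vec_def sum_2)
    then show "norm (x - z) \<le> R" using pd_support[of "F a" z R _ x, OF zF[of a]] by blast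
  qed
  have nn: "n $ 1 * n $ 1 + n $ 2 * n $ 2 = 1" using tangent_simps(4)[OF n] by (simp add: inner_vec_def sum_2)
  have div: "pd 1 W1 x + pd 2 W2 x = grad pd (F (tangent n)) x \<bullet> tangent n + grad pd (F n) x \<bullet> n" for x
  proof -
    have "grad pd (F (tangent n)) x \<bullet> tangent n + grad pd (F n) x \<bullet> n
       = (pd 1 W1 x + pd 2 W2 x) * (n $ 1 * n $ 1 + n $ 2 * n $ 2)"
      by (simp add: inner_vec_def sum_2 gF tangent_def algebra_simps)
    then show ?thesis using nn by simp
  qed
  have "(\<integral>x. indicator (halfplane z n) x * (pd 1 W1 x + pd 2 W2 x) \<partial>lborel)
    = (\<integral>x. indicator (halfplane z n) x * (grad pd (F (tangent n)) x \<bullet> tangent n) \<partial>lborel)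
      + (\<integral>x. indicator (halfplane z n) x * (grad pd (F n) x \<bullet> n) \<partial>lborel)"
    unfolding div distrib_left by (intro Bochner_Integration.integral_add integrable_halfplane int)
  also have "\<dots> = line_int z n (F n)" using ifd_t(1) ifd_n(2) by simp
  finally show ?thesis by (simp add: F_def[abs_def])
qed

lemma line_int_diff:
  assumes n: "norm n = 1" and f: "smooth f" "smooth g"
    and z: "\<And>x. f x \<noteq> 0 \<Longrightarrow> norm (x - z) \<le> R" "\<And>x. g x \<noteq> 0 \<Longrightarrow> norm (x - z) \<le> R"
  shows "line_int z n (\<lambda>x. f x - g x) = line_int z n f - line_int z n g"
proof -
  have *: "integrable lborel (\<lambda>t. h (z + t *\<^sub>R tangent n))" if "smooth h" "\<And>x. h x \<noteq> 0 \<Longrightarrow> norm (x - z) \<le> R" for h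
  proof (rule integrable_compact_support[where z=0 and R=R])
    show "continuous_on UNIV (\<lambda>t. h (z + t *\<^sub>R tangent n))"
      by (intro continuous_on_compose2[OF smooth_continuous[OF that(1), of UNIV]] continuous_intros) auto
    show "norm (t - 0) \<le> R" if "h (z + t *\<^sub>R tangent n) \<noteq> 0" for t
      using \<open>\<And>x. h x \<noteq> 0 \<Longrightarrow> norm (x - z) \<le> R\<close>[OF that] tangent_simps(5)[OF n] by simp
  qed
  show ?thesis unfolding line_int_def using *[OF f(1) z(1)] *[OF f(2) z(2)] by simp
qed

text \<open>The vector \<open>g\<close> is decomposed into its tangential and normal part; symmetry turns the off-diagonal term into \<open>M\<^sub>n\<^sub>s\<close>.\<close>

lemma inner_matrix_sym:
  fixes A :: "real^2^2"
  assumes "A $ 1 $ 2 = A $ 2 $ 1" "norm n = 1"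
  shows "n \<bullet> (A *v g) = (tangent n \<bullet> (A *v n)) * (g \<bullet> tangent n) + (n \<bullet> (A *v n)) * (g \<bullet> n)"
proof -
  have "n \<bullet> (A *v g) = (A *v n) \<bullet> g"
    using assms(1) by (simp add: inner_vec_def sum_2 matrix_vector_mult_def algebra_simps)
  also have "\<dots> = (A *v n) \<bullet> ((g \<bullet> tangent n) *\<^sub>R tangent n + (g \<bullet> n) *\<^sub>R n)"
    using frame_decompose[OF assms(2), of g] by simp
  finally show ?thesis by (simp only: inner_add_right inner_scaleR_right) (simp add: inner_commute mult.commute)
qed

text \<open>The density equals \<open>A(p) v\<close> plus the divergence of the field \<open>W = v Q - M \<nabla>v\<close>. On the boundary line
\<open>W \<bullet> n = Q\<^sub>n v - M\<^sub>n\<^sub>s \<partial>\<^sub>s v - M\<^sub>n\<^sub>n \<partial>\<^sub>n v\<close>, and the middle term is integrated by parts along the line, which turns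
\<open>Q\<^sub>n\<close> into the Kirchhoff shear force \<open>V\<^sub>n\<close>. There are no corner terms since \<open>v\<close> has compact support.\<close>

lemma green_halfplane:
  assumes n: "norm n = 1" and p: "smooth p" and v: "smooth v"
    and z: "\<And>x. v x \<noteq> 0 \<Longrightarrow> norm (x - z) \<le> R"
  shows "(\<integral>x. indicator (halfplane z n) x * (moment P pd p x \<bullet> curvature pd v x) \<partial>lborel)
     = (\<integral>x. indicator (halfplane z n) x * (plate_op P p x * v x) \<partial>lborel)
       + line_int z n (\<lambda>x. V_n P n p x * v x - M_nn P n p x * (grad pd v x \<bullet> n))"
proof -
  define M where "M i j x = moment P pd p x $ i $ j" for i j x
  define Q where "Q i x = shear P p x $ i" for i x
  define W where "W i x = v x * Q i x - (M i 1 x * pd 1 v x + M i 2 x * pd 2 v x)" for i x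
  have sM: "smooth (M i j)" for i j unfolding M_def[abs_def] by (rule smooth_moment[OF p])
  have sQ: "smooth (Q i)" for i unfolding Q_def[abs_def] by (rule smooth_shear[OF p])
  have sW: "smooth (W i)" for i unfolding W_def[abs_def] by (intro smooth_intros v sM sQ)
  have Msym: "M 2 1 = M 1 2" by (rule ext) (simp add: M_def moment_sym)
  have Qe: "Q i x = pd 1 (M i 1) x + pd 2 (M i 2) x" for i x
    by (simp add: Q_def shear_def sum_2 M_def[abs_def])
  have Ae: "plate_op P p x = - (pd 1 (Q 1) x + pd 2 (Q 2) x)" for x
    by (simp add: plate_op_def sum_2 Q_def[abs_def])
  have zp: "pd i v x \<noteq> 0 \<Longrightarrow> norm (x - z) \<le> R" for i x using pd_support[OF z] by blast
  have zW: "W i x \<noteq> 0 \<Longrightarrow> norm (x - z) \<le> R" for i x using z[of x] zp[of 1 x] zp[of 2 x] by (force simp: W_def)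
  have dW: "pd i (W i) x = v x * pd i (Q i) x + pd i v x * Q i x
      - (M i 1 x * pd i (pd 1 v) x + pd i (M i 1) x * pd 1 v x + (M i 2 x * pd i (pd 2 v) x + pd i (M i 2) x * pd 2 v x))" for i x
    by (simp add: W_def[abs_def] pd_diff pd_add pd_mult smooth_intros v sM sQ)
  have dens: "moment P pd p x \<bullet> curvature pd v x = plate_op P p x * v x + (pd 1 (W 1) x + pd 2 (W 2) x)" for x
  proof -
    have "moment P pd p x \<bullet> curvature pd v x = - (M 1 1 x * pd 1 (pd 1 v) x + M 1 2 x * pd 1 (pd 2 v) x
        + M 1 2 x * pd 2 (pd 1 v) x + M 2 2 x * pd 2 (pd 2 v) x)"
      using Msym by (simp add: inner_vec_def sum_2 M_def[symmetric] curvature_component algebra_simps)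
    then show ?thesis unfolding dW Ae Qe[of 1] Qe[of 2] Msym by (simp add: algebra_simps)
  qed
  have iA: "integrable lborel (\<lambda>x. plate_op P p x * v x)"
    by (rule smooth_integrable[where z=z and R=R]) (use z in \<open>auto intro!: smooth_intros smooth_plate_op p v\<close>)
  have sd: "smooth (\<lambda>x. pd 1 (W 1) x + pd 2 (W 2) x)" by (intro smooth_intros sW)
  have iD: "integrable lborel (\<lambda>x. pd 1 (W 1) x + pd 2 (W 2) x)"
  proof (rule smooth_integrable[OF sd, of z R])
    fix x assume "pd 1 (W 1) x + pd 2 (W 2) x \<noteq> 0"
    then have "pd 1 (W 1) x \<noteq> 0 \<or> pd 2 (W 2) x \<noteq> 0" by auto
    then show "norm (x - z) \<le> R" using pd_support[of "W 1" z R, OF zW[of 1]] pd_support[of "W 2" z R, OF zW[of 2]] by blast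
  qed
  have 1: "(\<integral>x. indicator (halfplane z n) x * (moment P pd p x \<bullet> curvature pd v x) \<partial>lborel)
     = (\<integral>x. indicator (halfplane z n) x * (plate_op P p x * v x) \<partial>lborel)
       + line_int z n (\<lambda>x. W 1 x * n $ 1 + W 2 x * n $ 2)"
    using Bochner_Integration.integral_add[OF integrable_halfplane[OF iA, of z n] integrable_halfplane[OF iD, of z n]]
      halfplane_divergence[OF n sW sW zW zW]
    by (simp only: dens distrib_left[of "indicator (halfplane z n) _" "plate_op P p _ * v _"])
  define T where "T x = M_ns P n p x * (grad pd v x \<bullet> tangent n) + (tangent n \<bullet> grad pd (M_ns P n p) x) * v x" for x
  have Wn: "W 1 x * n $ 1 + W 2 x * n $ 2 = (V_n P n p x * v x - M_nn P n p x * (grad pd v x \<bullet> n)) - T x" for x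
  proof -
    have a: "moment P pd p x $ 1 $ 2 = moment P pd p x $ 2 $ 1" by (rule moment_sym)
    have "W 1 x * n $ 1 + W 2 x * n $ 2 = v x * Q_n P n p x - n \<bullet> (moment P pd p x *v grad pd v x)"
      by (simp add: W_def Q_n_def Q_def inner_vec_def sum_2 matrix_vector_mult_def grad_def M_def algebra_simps)
    also have "n \<bullet> (moment P pd p x *v grad pd v x) = M_ns P n p x * (grad pd v x \<bullet> tangent n) + M_nn P n p x * (grad pd v x \<bullet> n)"
      unfolding M_ns_def M_nn_def by (rule inner_matrix_sym[OF a n])
    finally show ?thesis by (simp add: T_def V_n_def algebra_simps)
  qed
  have sT: "smooth T" unfolding T_def[abs_def] inner_commute[of "tangent n"]
    by (intro smooth_intros smooth_grad_inner smooth_M_ns p v)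
  have zg: "grad pd v x \<bullet> a \<noteq> 0 \<Longrightarrow> norm (x - z) \<le> R" for a x
    using zp[of 1 x] zp[of 2 x] by (force simp: grad_def inner_vec_def sum_2)
  have zT: "T x \<noteq> 0 \<Longrightarrow> norm (x - z) \<le> R" for x using z[of x] zg[of x] by (force simp: T_def)
  have sL: "smooth (\<lambda>x. V_n P n p x * v x - M_nn P n p x * (grad pd v x \<bullet> n))"
    by (intro smooth_intros smooth_grad_inner smooth_V_n smooth_M_nn p v)
  have zL: "V_n P n p x * v x - M_nn P n p x * (grad pd v x \<bullet> n) \<noteq> 0 \<Longrightarrow> norm (x - z) \<le> R" for x using z[of x] zg[of x] by force
  have T0: "line_int z n T = 0"
  proof -
    let ?F = "\<lambda>x. M_ns P n p x * v x"
    have sF: "smooth ?F" by (intro smooth_intros smooth_M_ns p v)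
    have Tg: "T x = grad pd ?F x \<bullet> tangent n" for x
      by (simp add: T_def grad_def inner_vec_def sum_2 pd_mult smooth_M_ns p v algebra_simps)
    have "(\<integral>t. grad pd ?F (frame z n (t, 0)) \<bullet> tangent n \<partial>lborel) = 0"
    proof (rule integral_derivative_compact_support(1)[OF frame_deriv(1)[OF smooth_has_derivative[OF sF]]])
      show "continuous_on UNIV (\<lambda>t. grad pd ?F (frame z n (t, 0)) \<bullet> tangent n)"
        unfolding frame_def by (intro continuous_intros continuous_on_compose2[OF grad_continuous[OF sF, of UNIV]]) auto
      show "\<bar>t\<bar> \<le> R" if "M_ns P n p (frame z n (t, 0)) * v (frame z n (t, 0)) \<noteq> 0" for t
        using z[of "frame z n (t, 0)"] that tangent_simps(5)[OF n] by (simp add: frame_def)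
    qed
    then show ?thesis by (simp add: line_int_def Tg frame_def)
  qed
  have "line_int z n (\<lambda>x. W 1 x * n $ 1 + W 2 x * n $ 2)
     = line_int z n (\<lambda>x. V_n P n p x * v x - M_nn P n p x * (grad pd v x \<bullet> n)) - line_int z n T"
    unfolding Wn by (rule line_int_diff[OF n sL sT zL zT])
  then show ?thesis using 1 T0 by simp
qed

section \<open>Bumps with polynomial profile\<close>

text \<open>Being a member of the family \<open>bump\<close>, it is smooth without further work.\<close>

definition mono_bump :: "nat \<Rightarrow> real \<Rightarrow> real" where
  "mono_bump i = bump 1 (monom 1 i) 0"

lemma mono_bump_eq: "mono_bump i t = t ^ i * weight t"
  by (simp add: mono_bump_def bump_def weight_eq poly_monom)

lemma smooth1_mono_bump: "smooth1 (mono_bump i)"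
  unfolding mono_bump_def by (rule smooth1_bump) simp

lemma smooth1_bounded:
  assumes "smooth1 h" "\<And>t. h t \<noteq> 0 \<Longrightarrow> \<bar>t\<bar> \<le> 1"
  shows "\<exists>B. \<forall>t. \<bar>h t\<bar> \<le> B" "deriv h t \<noteq> 0 \<Longrightarrow> \<bar>t\<bar> \<le> 1"
proof -
  have "bounded (h ` {-1..1})"
    by (intro compact_imp_bounded compact_continuous_image smooth1_continuous assms) auto
  then obtain B where B: "\<And>t. t \<in> {-1..1} \<Longrightarrow> \<bar>h t\<bar> \<le> B" unfolding bounded_iff by force
  have "\<bar>h t\<bar> \<le> \<bar>B\<bar>" for t
  proof (cases "h t = 0")
    case False
    then have "t \<in> {-1..1}" using assms(2)[of t] by auto
    then show ?thesis using B[of t] by linarith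
  qed simp
  then show "\<exists>B. \<forall>t. \<bar>h t\<bar> \<le> B" by blast
  show "\<bar>t\<bar> \<le> 1" if d: "deriv h t \<noteq> 0"
  proof (rule ccontr)
    assume t: "\<not> \<bar>t\<bar> \<le> 1"
    have "((\<lambda>t. 0) has_real_derivative deriv h t) (at t)"
      by (rule has_field_derivative_transform_within_open[OF smooth1_deriv(2)[OF assms(1)], of "- {-1..1}"])
         (use t assms(2) in \<open>force+\<close>)
    then have "deriv h t = 0" by (rule DERIV_unique) simp
    then show False using d by simp
  qed
qed

text \<open>In the coordinates \<open>(a, b)\<close> scaled by \<open>\<rho>\<close> this is \<open>weight a * weight b * (\<Sum>i\<le>N. \<Sum>j\<le>N. c i j * a ^ i * b ^ j)\<close>; written as a sum of products of ridge functions it can be differentiated term by term.\<close>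

definition edge_test :: "nat \<Rightarrow> (nat \<Rightarrow> nat \<Rightarrow> real) \<Rightarrow> plane \<Rightarrow> plane \<Rightarrow> real \<Rightarrow> field" where
  "edge_test N c z n \<rho> x = (\<Sum>i\<le>N. \<Sum>j\<le>N. c i j *
     (mono_bump i ((x - z) \<bullet> ((1/\<rho>) *\<^sub>R tangent n)) * mono_bump j ((x - z) \<bullet> ((1/\<rho>) *\<^sub>R n))))"

lemma smooth_edge_test: "smooth (edge_test N c z n \<rho>)"
  unfolding edge_test_def[abs_def]
  by (intro smooth_sum smooth_cmult smooth_mult smooth_ridge smooth1_mono_bump)

definition open_square :: "plane \<Rightarrow> plane \<Rightarrow> real \<Rightarrow> plane set" where
  "open_square z n \<rho> = {x. \<bar>(x - z) \<bullet> tangent n\<bar> < \<rho> \<and> \<bar>(x - z) \<bullet> n\<bar> < \<rho>}"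

lemma edge_test_support:
  assumes "\<rho> > 0" "edge_test N c z n \<rho> x \<noteq> 0"
  shows "x \<in> open_square z n \<rho>"
proof (rule ccontr)
  assume "x \<notin> open_square z n \<rho>"
  then have "mono_bump i ((x - z) \<bullet> ((1/\<rho>) *\<^sub>R tangent n)) * mono_bump j ((x - z) \<bullet> ((1/\<rho>) *\<^sub>R n)) = 0" for i j
    using assms(1) by (auto simp: open_square_def mono_bump_eq weight_eq abs_mult not_less field_simps)
  then have "edge_test N c z n \<rho> x = 0" unfolding edge_test_def by (simp only: mult_zero_right sum.neutral_const)
  then show False using assms(2) by simp
qed

lemma edge_test_frame:
  assumes "norm n = 1" "\<rho> > 0"
  shows "edge_test N c z n \<rho> (frame z n (\<rho> * a, \<rho> * b)) = weight a * weight b * (\<Sum>i\<le>N. \<Sum>j\<le>N. c i j * a ^ i * b ^ j)"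
  using assms by (simp add: edge_test_def frame_coords mono_bump_eq sum_distrib_left mult_ac)

lemma pd_edge_test:
  "pd k (edge_test N c z n \<rho>) x = (\<Sum>i\<le>N. \<Sum>j\<le>N. c i j * (
      mono_bump i ((x - z) \<bullet> ((1/\<rho>) *\<^sub>R tangent n)) * (n $ k / \<rho> * deriv (mono_bump j) ((x - z) \<bullet> ((1/\<rho>) *\<^sub>R n)))
      + (tangent n $ k / \<rho> * deriv (mono_bump i) ((x - z) \<bullet> ((1/\<rho>) *\<^sub>R tangent n))) * mono_bump j ((x - z) \<bullet> ((1/\<rho>) *\<^sub>R n))))"
  unfolding edge_test_def[abs_def]
  by (simp add: pd_sum pd_cmult pd_mult pd_ridge smooth_sum smooth_cmult smooth_mult smooth_ridge smooth1_mono_bump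
        del: inner_scaleR_right)

text \<open>The weight has its maximum at the origin.\<close>

lemma deriv_weight_0: "deriv weight 0 = 0"
proof (rule DERIV_local_max)
  show "(weight has_real_derivative deriv weight 0) (at 0)"
    unfolding weight_def by (intro smooth1_deriv(2) smooth1_bump) simp
  show "\<forall>y. \<bar>0 - y\<bar> < 1 \<longrightarrow> weight y \<le> weight 0"
  proof (intro allI impI)
    fix y :: real assume "\<bar>0 - y\<bar> < 1"
    then have y: "\<bar>y\<bar> < 1" by simp
    then have "0 < 1 - y\<^sup>2" "1 - y\<^sup>2 \<le> 1" by (auto simp: abs_square_less_1)
    then show "weight y \<le> weight 0" using y by (simp add: weight_eq field_simps)
  qed
qed simp

text \<open>These are the traces on the edge: the profile \<open>j = 0\<close> has value \<open>exp (- 1)\<close> and derivative zero across the edge, the profile \<open>j = 1\<close> value zero and derivative \<open>exp (- 1)\<close>.\<close>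

lemma mono_bump_at_0:
  "mono_bump 0 0 = exp (-1)" "mono_bump 1 0 = 0" "deriv (mono_bump 0) 0 = 0" "deriv (mono_bump 1) 0 = exp (-1)"
proof -
  show "mono_bump 0 0 = exp (-1)" "mono_bump 1 0 = 0" by (simp_all add: mono_bump_eq weight_eq)
  have "mono_bump 0 = weight" by (rule ext) (simp add: mono_bump_eq)
  then show "deriv (mono_bump 0) 0 = 0" by (simp add: deriv_weight_0)
  have "(weight has_real_derivative deriv weight 0) (at 0)"
    unfolding weight_def by (intro smooth1_deriv(2) smooth1_bump) simp
  from DERIV_mult'[OF DERIV_ident this] have "((\<lambda>t. t * weight t) has_real_derivative exp (-1)) (at 0)"
    by (simp add: weight_eq)
  moreover have "mono_bump 1 = (\<lambda>t. t * weight t)" by (rule ext) (simp add: mono_bump_eq)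
  ultimately show "deriv (mono_bump 1) 0 = exp (-1)" using DERIV_imp_deriv by metis
qed

definition coeff_sum :: "nat \<Rightarrow> (nat \<Rightarrow> nat \<Rightarrow> real) \<Rightarrow> real" where
  "coeff_sum N c = (\<Sum>i\<le>N. \<Sum>j\<le>N. \<bar>c i j\<bar>)"

lemma double_sum_bound:
  assumes "\<And>i j. i \<le> N \<Longrightarrow> j \<le> N \<Longrightarrow> \<bar>f i j\<bar> \<le> B"
  shows "\<bar>\<Sum>i\<le>N. \<Sum>j\<le>N. c i j * f i j\<bar> \<le> B * coeff_sum N c"
proof -
  have "\<bar>\<Sum>i\<le>N. \<Sum>j\<le>N. c i j * f i j\<bar> \<le> (\<Sum>i\<le>N. \<bar>\<Sum>j\<le>N. c i j * f i j\<bar>)" by (rule sum_abs)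
  also have "\<dots> \<le> (\<Sum>i\<le>N. \<Sum>j\<le>N. \<bar>c i j * f i j\<bar>)" by (intro sum_mono sum_abs)
  also have "\<dots> \<le> (\<Sum>i\<le>N. \<Sum>j\<le>N. B * \<bar>c i j\<bar>)"
    using assms by (intro sum_mono) (simp add: abs_mult mult.commute[of "\<bar>c _ _\<bar>"] mult_right_mono)
  finally show ?thesis by (simp add: coeff_sum_def sum_distrib_left)
qed

text \<open>Every derivative falls on a profile of fixed shape and brings out one factor \<open>1 / \<rho>\<close>, so that \<open>B\<close> depends on \<open>N\<close> only.\<close>

lemma edge_test_bounds:
  "\<exists>B>0. \<forall>c z n \<rho> x k l. norm n = 1 \<and> \<rho> > 0 \<longrightarrow>
     \<bar>edge_test N c z n \<rho> x\<bar> \<le> B * coeff_sum N c \<and>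
     \<bar>pd l (pd k (edge_test N c z n \<rho>)) x\<bar> \<le> B / \<rho>\<^sup>2 * coeff_sum N c"
proof -
  have "\<exists>B. \<forall>t. \<bar>mono_bump i t\<bar> \<le> B \<and> \<bar>deriv (mono_bump i) t\<bar> \<le> B \<and> \<bar>deriv (deriv (mono_bump i)) t\<bar> \<le> B" for i
  proof -
    have s: "mono_bump i t \<noteq> 0 \<Longrightarrow> \<bar>t\<bar> \<le> 1" for t by (auto simp: mono_bump_eq weight_eq split: if_splits)
    note s0 = smooth1_mono_bump[of i] and s1 = smooth1_deriv(1)[OF smooth1_mono_bump[of i]]
    note s2 = smooth1_deriv(1)[OF s1]
    note z1 = smooth1_bounded(2)[OF s0 s]
    note z2 = smooth1_bounded(2)[OF s1 z1]
    obtain B0 where "\<And>t. \<bar>mono_bump i t\<bar> \<le> B0" using smooth1_bounded(1)[OF s0 s] by auto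
    moreover obtain B1 where "\<And>t. \<bar>deriv (mono_bump i) t\<bar> \<le> B1" using smooth1_bounded(1)[OF s1 z1] by auto
    moreover obtain B2 where "\<And>t. \<bar>deriv (deriv (mono_bump i)) t\<bar> \<le> B2" using smooth1_bounded(1)[OF s2 z2] by auto
    ultimately show ?thesis by (intro exI[of _ "max B0 (max B1 B2)"]) (auto simp: le_max_iff_disj)
  qed
  then obtain b where b: "\<And>i t. \<bar>mono_bump i t\<bar> \<le> b i" "\<And>i t. \<bar>deriv (mono_bump i) t\<bar> \<le> b i"
     "\<And>i t. \<bar>deriv (deriv (mono_bump i)) t\<bar> \<le> b i" by metis
  define G where "G = (\<Sum>i\<le>N. \<bar>b i\<bar>) + 1"
  have G1: "G \<ge> 1" by (simp add: G_def sum_nonneg)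
  have bG: "b i \<le> G" if "i \<le> N" for i
  proof -
    have "\<bar>b i\<bar> \<le> (\<Sum>i\<le>N. \<bar>b i\<bar>)" using that by (intro member_le_sum) auto
    then show ?thesis by (simp add: G_def)
  qed
  note bb = order_trans[OF b(1) bG] order_trans[OF b(2) bG] order_trans[OF b(3) bG]
  have prod: "\<bar>u * v\<bar> \<le> G * G" if "\<bar>u\<bar> \<le> G" "\<bar>v\<bar> \<le> G" for u v
    unfolding abs_mult using that G1 by (intro mult_mono) auto
  show ?thesis
  proof (intro exI[of _ "4 * (G * G)"] conjI allI impI)
    show "0 < 4 * (G * G)" using G1 by simp
    fix c z n \<rho> x k l assume "norm (n :: plane) = 1 \<and> (\<rho> :: real) > 0"
    then have n: "norm n = 1" and r: "\<rho> > 0" by auto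
    have cs: "coeff_sum N c \<ge> 0" by (simp add: coeff_sum_def sum_nonneg)
    have "\<bar>edge_test N c z n \<rho> x\<bar> \<le> (G * G) * coeff_sum N c"
      unfolding edge_test_def by (rule double_sum_bound) (intro prod bb)
    also have "\<dots> \<le> 4 * (G * G) * coeff_sum N c" using cs G1 by (intro mult_right_mono) auto
    finally show "\<bar>edge_test N c z n \<rho> x\<bar> \<le> 4 * (G * G) * coeff_sum N c" .
    define a b where "a = (1/\<rho>) *\<^sub>R tangent n" and "b = (1/\<rho>) *\<^sub>R n"
    have comp: "\<bar>a $ k\<bar> \<le> 1/\<rho>" "\<bar>b $ k\<bar> \<le> 1/\<rho>" for k
      using component_le_norm_cart[of n k] component_le_norm_cart[of "tangent n" k] n tangent_simps(5)[OF n] r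
      by (auto simp: a_def b_def abs_mult divide_simps)
    define f0 f1 f2 where "f0 i x = mono_bump i ((x - z) \<bullet> a)" and "f1 i x = deriv (mono_bump i) ((x - z) \<bullet> a)"
      and "f2 i x = deriv (deriv (mono_bump i)) ((x - z) \<bullet> a)" for i and x :: plane
    define g0 g1 g2 where "g0 i x = mono_bump i ((x - z) \<bullet> b)" and "g1 i x = deriv (mono_bump i) ((x - z) \<bullet> b)"
      and "g2 i x = deriv (deriv (mono_bump i)) ((x - z) \<bullet> b)" for i and x :: plane
    have sm: "smooth (f0 i)" "smooth (f1 i)" "smooth (g0 i)" "smooth (g1 i)" for i
      unfolding f0_def[abs_def] f1_def[abs_def] g0_def[abs_def] g1_def[abs_def]
      by (intro smooth_ridge smooth1_deriv smooth1_mono_bump)+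
    have d: "pd k (f0 i) x = a $ k * f1 i x" "pd k (f1 i) x = a $ k * f2 i x"
      "pd k (g0 i) x = b $ k * g1 i x" "pd k (g1 i) x = b $ k * g2 i x" for k i x
      unfolding f0_def[abs_def] f1_def[abs_def] g0_def[abs_def] g1_def[abs_def] f2_def g2_def
      by (intro pd_ridge smooth1_deriv smooth1_mono_bump)+
    have E: "edge_test N c z n \<rho> = (\<lambda>x. \<Sum>i\<le>N. \<Sum>j\<le>N. c i j * (f0 i x * g0 j x))"
      by (simp only: edge_test_def[abs_def] f0_def g0_def a_def b_def)
    have D1: "pd k (edge_test N c z n \<rho>) = (\<lambda>x. \<Sum>i\<le>N. \<Sum>j\<le>N. c i j * (f0 i x * (b $ k * g1 j x) + (a $ k * f1 i x) * g0 j x))"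
      unfolding E by (rule ext) (simp add: pd_sum pd_cmult pd_mult d smooth_sum smooth_cmult smooth_mult sm)
    have D2: "pd l (pd k (edge_test N c z n \<rho>)) x = (\<Sum>i\<le>N. \<Sum>j\<le>N. c i j * (
          (b $ k * b $ l) * (f0 i x * g2 j x) + (b $ k * a $ l) * (f1 i x * g1 j x)
        + (a $ k * b $ l) * (f1 i x * g1 j x) + (a $ k * a $ l) * (f2 i x * g0 j x)))"
      unfolding D1 by (simp add: pd_sum pd_cmult pd_mult pd_add d smooth_sum smooth_cmult smooth_mult smooth_add sm)
        (simp add: algebra_simps)
    have eq: "4 * (1 / \<rho>\<^sup>2 * (G * G)) = 4 * (G * G) / \<rho>\<^sup>2" by simp
    show "\<bar>pd l (pd k (edge_test N c z n \<rho>)) x\<bar> \<le> 4 * (G * G) / \<rho>\<^sup>2 * coeff_sum N c"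
      unfolding D2 eq[symmetric]
    proof (rule double_sum_bound)
      fix i j assume ij: "i \<le> N" "j \<le> N"
      have pr: "\<bar>(u * v) * (w * y)\<bar> \<le> 1 / \<rho>\<^sup>2 * (G * G)" if "\<bar>u\<bar> \<le> 1/\<rho>" "\<bar>v\<bar> \<le> 1/\<rho>" "\<bar>w\<bar> \<le> G" "\<bar>y\<bar> \<le> G" for u v w y
      proof -
        have uv: "\<bar>u\<bar> * \<bar>v\<bar> \<le> (1/\<rho>) * (1/\<rho>)" using that r by (intro mult_mono) auto
        have wy: "\<bar>w * y\<bar> \<le> G * G" using that by (intro prod)
        have "(\<bar>u\<bar> * \<bar>v\<bar>) * \<bar>w * y\<bar> \<le> ((1/\<rho>) * (1/\<rho>)) * (G * G)"
          by (rule mult_mono[OF uv wy]) (use r in auto)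
        then show ?thesis by (simp add: abs_mult power2_eq_square)
      qed
      have four: "\<bar>a1 + a2 + a3 + a4\<bar> \<le> 4 * X" if "\<bar>a1\<bar> \<le> X" "\<bar>a2\<bar> \<le> X" "\<bar>a3\<bar> \<le> X" "\<bar>a4\<bar> \<le> X" for a1 a2 a3 a4 X :: real
        using that by linarith
      show "\<bar>(b $ k * b $ l) * (f0 i x * g2 j x) + (b $ k * a $ l) * (f1 i x * g1 j x)
        + (a $ k * b $ l) * (f1 i x * g1 j x) + (a $ k * a $ l) * (f2 i x * g0 j x)\<bar> \<le> 4 * (1 / \<rho>\<^sup>2 * (G * G))"
        unfolding f0_def f1_def f2_def g0_def g1_def g2_def
        by (intro four pr comp bb ij)
    qed
  qed
qed

section \<open>Truncated test functions\<close>

lemma integrable_on_mono: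
  fixes f :: field
  assumes "integrable (lebesgue_on S) f" "T \<subseteq> S" "S \<in> sets lebesgue" "T \<in> sets lebesgue"
  shows "integrable (lebesgue_on T) f"
proof -
  have "integrable lebesgue (\<lambda>x. if x \<in> S then f x else 0)"
    using assms by (simp add: Lebesgue_Measure.integrable_restrict_UNIV)
  then have "integrable lebesgue (\<lambda>x. indicator T x *\<^sub>R (if x \<in> S then f x else 0))"
    using assms by (intro integrable_mult_indicator)
  also have "(\<lambda>x. indicator T x *\<^sub>R (if x \<in> S then f x else 0)) = (\<lambda>x. if x \<in> T then f x else 0)"
    using assms by (auto simp: fun_eq_iff indicator_def)
  finally show ?thesis using assms by (simp add: Lebesgue_Measure.integrable_restrict_UNIV)
qed

lemma integral_on_null_diff:
  fixes f :: field
  assumes "negligible (S - T)" "negligible (T - S)" "S \<in> sets lebesgue" "T \<in> sets lebesgue"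
  shows "(\<integral>x. f x \<partial>lebesgue_on S) = (\<integral>x. f x \<partial>lebesgue_on T)"
proof -
  have "AE x in lebesgue. x \<notin> (S - T) \<and> x \<notin> (T - S)"
    using AE_not_negligible[OF assms(1)] AE_not_negligible[OF assms(2)] by eventually_elim auto
  then have "AE x in lebesgue. (if x \<in> S then f x else 0) = (if x \<in> T then f x else 0)"
    by eventually_elim auto
  then have "AE x in lebesgue_on UNIV. (if x \<in> S then f x else 0) = (if x \<in> T then f x else 0)"
    by (simp only: lebesgue_on_UNIV_eq)
  then have "(\<integral>x. (if x \<in> S then f x else 0) \<partial>lebesgue_on UNIV) = (\<integral>x. (if x \<in> T then f x else 0) \<partial>lebesgue_on UNIV)"
    by (rule integral_AE_on) simp
  then show ?thesis using assms unfolding lebesgue_on_UNIV_eq by (simp add: Lebesgue_Measure.integral_restrict_UNIV)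
qed

definition supported_in :: "plane set \<Rightarrow> field \<Rightarrow> bool" where
  "supported_in U w \<longleftrightarrow> smooth w \<and> (\<forall>x. x \<notin> U \<longrightarrow> w x = 0)"

text \<open>Squares have this property; it ensures that a smooth function that vanishes outside \<open>U\<close> has derivatives that vanish outside \<open>U\<close>, including the boundary of \<open>U\<close>.\<close>

definition regular_open :: "plane set \<Rightarrow> bool" where
  "regular_open U \<longleftrightarrow> interior (closure U) = U"

lemma supported_in_pd:
  assumes "regular_open U" "supported_in U w" shows "supported_in U (pd i w)"
proof -
  have s: "smooth w" and z: "\<And>x. x \<notin> U \<Longrightarrow> w x = 0" using assms by (auto simp: supported_in_def)
  have "pd i w x = 0" if "x \<notin> closure U" for x
  proof -
    have "pd i w x = pd i (\<lambda>x. 0) x"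
      by (rule pd_cong_open[of "- closure U"]) (use that z closure_subset in auto)
    then show ?thesis by (simp add: pd_const)
  qed
  then have "- closure U \<subseteq> {x. pd i w x = 0}" by auto
  moreover have "closed {x. pd i w x = 0}"
    using smooth_continuous[OF smooth_pd[OF s], of UNIV i] by (intro closed_Collect_eq continuous_intros) auto
  ultimately have "closure (- closure U) \<subseteq> {x. pd i w x = 0}" by (rule closure_minimal)
  then have "- U \<subseteq> {x. pd i w x = 0}" using assms(1) by (simp add: regular_open_def closure_complement)
  then show ?thesis using s by (auto simp: supported_in_def smooth_pd)
qed

text \<open>Extension of the restriction to \<open>T\<close> by zero, also outside the domain.\<close>

definition cut :: "plane set \<Rightarrow> field \<Rightarrow> field" where
  "cut T w x = (if x \<in> T then w x else 0)"

text \<open>The rest \<open>T'\<close> of the closed domain touches \<open>T\<close> only outside \<open>U\<close>. A function supported in \<open>U\<close> therefore vanishes, with its derivatives, where \<open>T\<close> and \<open>T'\<close> meet, and truncation to \<open>T\<close> keeps it smooth.\<close>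

definition cut_region :: "plane set \<Rightarrow> plane set \<Rightarrow> plane set \<Rightarrow> bool" where
  "cut_region \<Omega> T U \<longleftrightarrow> closed T \<and> (\<exists>T'. closed T' \<and> closure \<Omega> = T \<union> T' \<and> T \<inter> T' \<inter> U = {})"

lemma cut_regionE:
  assumes "cut_region \<Omega> T U"
  obtains T' where "closed T" "closed T'" "closure \<Omega> = T \<union> T'" "T \<inter> T' \<inter> U = {}"
proof -
  obtain T' where "closed T'" "closure \<Omega> = T \<union> T'" "T \<inter> T' \<inter> U = {}" "closed T"
    using assms unfolding cut_region_def by blast
  then show thesis using that[of T'] by blast
qed

lemma cut_continuous:
  assumes "cut_region \<Omega> T U" "supported_in U w"
  shows "continuous_on (closure \<Omega>) (cut T w)"
proof -
  obtain T' where T: "closed T" "closed T'" "closure \<Omega> = T \<union> T'" "T \<inter> T' \<inter> U = {}"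
    using assms(1) by (rule cut_regionE)
  have "continuous_on T (cut T w)"
    by (rule continuous_on_eq[OF smooth_continuous]) (use assms in \<open>auto simp: supported_in_def cut_def\<close>)
  moreover have "continuous_on T' (cut T w)"
    by (rule continuous_on_eq[OF continuous_on_const[of _ 0]]) (use assms(2) T(4) in \<open>auto simp: supported_in_def cut_def\<close>)
  ultimately show ?thesis unfolding T(3) using T by (intro continuous_on_closed_Un)
qed

text \<open>The delicate points are those common to \<open>T\<close> and the rest: there \<open>w\<close> and its gradient vanish, and the truncated function is dominated by \<open>w\<close>.\<close>

lemma cut_has_derivative:
  assumes o: "open \<Omega>" and c: "cut_region \<Omega> T U" and r: "regular_open U" and w: "supported_in U w" and x: "x \<in> \<Omega>"
  shows "(cut T w has_derivative (\<lambda>h. (\<chi> i. cut T (pd i w) x) \<bullet> h)) (at x)"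
proof -
  obtain T' where T: "closed T" "closed T'" "closure \<Omega> = T \<union> T'" "T \<inter> T' \<inter> U = {}"
    using c by (rule cut_regionE)
  have sub: "\<Omega> \<subseteq> T \<union> T'" using T(3) closure_subset by blast
  have s: "smooth w" and z: "\<And>x. x \<notin> U \<Longrightarrow> w x = 0" using w by (auto simp: supported_in_def)
  have zp: "x \<notin> U \<Longrightarrow> pd i w x = 0" for x i using supported_in_pd[OF r w] by (auto simp: supported_in_def)
  note d = smooth_has_derivative[OF s]
  consider "x \<in> T" "x \<notin> T'" | "x \<notin> T" | "x \<in> T" "x \<in> T'" by blast
  then show ?thesis
  proof cases
    case 1
    have "(cut T w has_derivative (\<lambda>h. grad pd w x \<bullet> h)) (at x)"
      by (rule has_derivative_transform_within_open[OF d, of "\<Omega> - T'"])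
         (use o T 1 x sub in \<open>auto simp: cut_def open_Diff\<close>)
    also have "grad pd w x = (\<chi> i. cut T (pd i w) x)" using 1 by (simp add: grad_def cut_def)
    finally show ?thesis .
  next
    case 2
    have "(cut T w has_derivative (\<lambda>h. 0)) (at x)"
      by (rule has_derivative_transform_within_open[OF has_derivative_const[of 0], of "- T"])
         (use T 2 in \<open>auto simp: cut_def\<close>)
    moreover have "(\<chi> i. cut T (pd i w) x) = 0" using 2 by (simp add: cut_def vec_eq_iff)
    ultimately show ?thesis by simp
  next
    case 3
    then have xU: "x \<notin> U" using T(4) by blast
    then have g0: "grad pd w x = 0" and w0: "w x = 0" using zp z by (auto simp: grad_def vec_eq_iff)
    have lim: "(\<lambda>y. norm (w y - w x - grad pd w x \<bullet> (y - x)) / norm (y - x)) \<midarrow>x\<rightarrow> 0"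
      using d[of x] unfolding has_derivative_iff_norm by blast
    have "(cut T w has_derivative (\<lambda>h. 0)) (at x)"
      unfolding has_derivative_iff_norm
    proof (intro conjI)
      show "((\<lambda>y. norm (cut T w y - cut T w x - 0) / norm (y - x)) \<longlongrightarrow> 0) (at x)"
      proof (rule Lim_null_comparison[OF always_eventually lim], intro allI)
        fix y
        show "norm (norm (cut T w y - cut T w x - 0) / norm (y - x)) \<le> norm (w y - w x - grad pd w x \<bullet> (y - x)) / norm (y - x)"
          using w0 g0 by (auto simp: cut_def intro!: divide_right_mono)
      qed
    qed simp
    moreover have "(\<chi> i. cut T (pd i w) x) = 0" using xU zp by (simp add: cut_def vec_eq_iff)
    ultimately show ?thesis by simp
  qed
qed

text \<open>The truncated function is continuously differentiable in the domain.\<close>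

lemma cut_weak_pd:
  assumes o: "open \<Omega>" and c: "cut_region \<Omega> T U" and r: "regular_open U" and w: "supported_in U w"
  shows "has_weak_pd \<Omega> i (cut T w) (cut T (pd i w))"
proof -
  have "continuous_on \<Omega> (\<lambda>x. \<chi> i. cut T (pd i w) x)"
    by (intro continuous_on_vec_lambda continuous_on_subset[OF cut_continuous[OF c supported_in_pd[OF r w]] closure_subset])
  from has_weak_pd_classical[OF o cut_has_derivative[OF o c r w] this, of i]
  show ?thesis by simp
qed

lemma cut_L2:
  assumes o: "open \<Omega>" and b: "bounded \<Omega>" and c: "cut_region \<Omega> T U" and w: "supported_in U w"
  shows "cut T w \<in> L2 \<Omega>"
proof -
  note cc = cut_continuous[OF c w]
  have "compact (closure \<Omega>)" using b by simp
  then have "integrable (lebesgue_on (closure \<Omega>)) (\<lambda>x. (cut T w x)\<^sup>2)"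
    by (rule integrable_on_continuous_compact) (intro continuous_intros cc)
  then have "integrable (lebesgue_on \<Omega>) (\<lambda>x. (cut T w x)\<^sup>2)"
    by (rule integrable_on_mono) (use o closure_subset in auto)
  moreover have "cut T w \<in> borel_measurable (lebesgue_on \<Omega>)"
    by (rule continuous_imp_measurable_on_sets_lebesgue) (use o continuous_on_subset[OF cc closure_subset] in auto)
  ultimately show ?thesis by (simp add: L2_def)
qed

lemma H1_AE:
  assumes o: "open \<Omega>" and w: "w \<in> H1 \<Omega>" and ae: "AE x in lebesgue_on \<Omega>. w x = w' x"
  shows "w' \<in> H1 \<Omega>"
proof -
  have "w \<in> L2 \<Omega>" using w by (simp add: H1_def)
  from L2_AE[OF this _ ae] have "w' \<in> L2 \<Omega>" using o by auto
  moreover have "\<exists>g\<in>L2 \<Omega>. has_weak_pd \<Omega> i w' g" for i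
  proof -
    obtain g where "g \<in> L2 \<Omega>" "has_weak_pd \<Omega> i w g" using w unfolding H1_def by blast
    then show ?thesis using has_weak_pd_AE[OF o _ ae, of i g] by blast
  qed
  ultimately show ?thesis by (simp add: H1_def)
qed

lemma cut_H1:
  assumes o: "open \<Omega>" and b: "bounded \<Omega>" and c: "cut_region \<Omega> T U" and r: "regular_open U" and w: "supported_in U w"
  shows "cut T w \<in> H1 \<Omega>"
  using cut_L2[OF o b c w] cut_L2[OF o b c supported_in_pd[OF r w]] cut_weak_pd[OF o c r w] unfolding H1_def by blast

lemma cut_wpd:
  assumes o: "open \<Omega>" and c: "cut_region \<Omega> T U" and r: "regular_open U" and w: "supported_in U w"
  shows "AE x in lebesgue_on \<Omega>. wpd \<Omega> i (cut T w) x = cut T (pd i w) x"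
  by (rule wpd_AE[OF o cut_weak_pd[OF o c r w]]) simp

lemma cut_wpd2:
  assumes o: "open \<Omega>" and c: "cut_region \<Omega> T U" and r: "regular_open U" and w: "supported_in U w"
  shows "AE x in lebesgue_on \<Omega>. wpd \<Omega> j (wpd \<Omega> i (cut T w)) x = cut T (pd j (pd i w)) x"
proof (rule wpd_AE[OF o cut_weak_pd[OF o c r supported_in_pd[OF r w]]])
  show "AE x in lebesgue_on \<Omega>. cut T (pd i w) x = wpd \<Omega> i (cut T w) x"
    using cut_wpd[OF o c r w, of i] by eventually_elim simp
qed

lemma cut_H2:
  assumes o: "open \<Omega>" and b: "bounded \<Omega>" and c: "cut_region \<Omega> T U" and r: "regular_open U" and w: "supported_in U w"
  shows "cut T w \<in> H2 \<Omega>"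
proof -
  have "wpd \<Omega> i (cut T w) \<in> H1 \<Omega>" for i
  proof (rule H1_AE[OF o cut_H1[OF o b c r supported_in_pd[OF r w]]])
    show "AE x in lebesgue_on \<Omega>. cut T (pd i w) x = wpd \<Omega> i (cut T w) x"
      using cut_wpd[OF o c r w, of i] by eventually_elim simp
  qed
  then show ?thesis using cut_H1[OF o b c r w] continuous_on_subset[OF cut_continuous[OF c w] closure_subset]
    by (simp add: H2_def)
qed

lemma L2norm_zero: "A \<in> sets lebesgue \<Longrightarrow> AE x in lebesgue_on A. w x = 0 \<Longrightarrow> L2norm A w = 0"
  using L2norm_AE[of A w "\<lambda>x. 0"] by (simp add: L2norm_def)

lemma H1norm_zero:
  assumes o: "open \<Omega>" and ae: "AE x in lebesgue_on \<Omega>. w x = 0"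
  shows "H1norm \<Omega> w = 0"
proof -
  have "has_weak_pd \<Omega> i (\<lambda>x. 0) (\<lambda>x. (0::plane) $ i)" for i by (rule has_weak_pd_classical[OF o]) auto
  then have h: "has_weak_pd \<Omega> i (\<lambda>x. 0) (\<lambda>x. 0)" for i by simp
  have "AE x in lebesgue_on \<Omega>. (0::real) = w x" using ae by eventually_elim simp
  from wpd_AE[OF o h this] have "L2norm \<Omega> (wpd \<Omega> i w) = 0" for i using o by (intro L2norm_zero) auto
  moreover have "L2norm \<Omega> w = 0" using o ae by (intro L2norm_zero) auto
  ultimately show ?thesis by (simp add: H1norm_def)
qed

lemma seg_ends:
  assumes "is_segment E"
  shows "E = closed_segment (fst (seg_ends E)) (snd (seg_ends E))" "fst (seg_ends E) \<noteq> snd (seg_ends E)"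
proof -
  obtain a b where ab: "a \<noteq> b" "E = closed_segment a b" using assms by (auto simp: is_segment_def)
  have "\<exists>p. E = closed_segment (fst p) (snd p)" using ab by (intro exI[of _ "(a, b)"]) simp
  then show *: "E = closed_segment (fst (seg_ends E)) (snd (seg_ends E))" unfolding seg_ends_def by (rule someI_ex)
  show "fst (seg_ends E) \<noteq> snd (seg_ends E)"
  proof
    assume "fst (seg_ends E) = snd (seg_ends E)"
    then have "closed_segment a b = {snd (seg_ends E)}" using * ab by simp
    then have "a \<in> {snd (seg_ends E)}" "b \<in> {snd (seg_ends E)}" using ends_in_segment[of a b] by blast+
    then show False using ab by simp
  qed
qed

lemma seg_param_in: "is_segment E \<Longrightarrow> t \<in> {0..1} \<Longrightarrow> seg_param E t \<in> E"
  by (subst seg_ends(1), assumption) (auto simp: seg_param_def in_segment algebra_simps intro!: exI[of _ t])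

text \<open>The parametrisation of the segment is injective, so the integrand vanishes off finitely many parameters.\<close>

lemma seg_norm_zero:
  assumes E: "is_segment E" and f: "finite {x \<in> E. w x \<noteq> 0}"
  shows "seg_norm E w = 0"
proof -
  define N where "N = {t \<in> {0..1}. w (seg_param E t) \<noteq> 0}"
  have inj: "inj_on (seg_param E) N" using seg_ends(2)[OF E] by (auto simp: inj_on_def seg_param_def)
  have "seg_param E ` N \<subseteq> {x \<in> E. w x \<noteq> 0}" using seg_param_in[OF E] by (auto simp: N_def)
  then have "finite N" using f inj finite_imageD finite_subset by blast
  then have "AE t in lebesgue. t \<notin> N" using AE_not_in[of N lebesgue] finite_imp_null_set_lborel null_sets_completionI by blast
  then have "AE t in lebesgue. t \<in> {0..1} \<longrightarrow> (w (seg_param E t))\<^sup>2 = 0"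
    by eventually_elim (auto simp: N_def)
  then have "AE t in lebesgue_on {0..1}. (w (seg_param E t))\<^sup>2 = 0"
    by (simp add: AE_restrict_space_iff)
  then have "(\<integral>t. (w (seg_param E t))\<^sup>2 \<partial>lebesgue_on {0..1}) = 0" by (rule integral_eq_zero_AE)
  then show ?thesis by (simp add: seg_norm_def seg_int_def)
qed

text \<open>A constant approximating sequence suffices, because the representative \<open>\<phi>\<close> is continuous up to the boundary. Finitely many exceptional points are allowed, since parts of the boundary may share end points.\<close>

lemma zero_traceI:
  assumes o: "open \<Omega>" and E: "is_segment E" and \<phi>: "\<phi> \<in> H1 \<Omega>" "continuous_on (closure \<Omega>) \<phi>"
    and ae: "AE x in lebesgue_on \<Omega>. \<phi> x = w x" and f: "finite {x \<in> E. \<phi> x \<noteq> 0}"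
  shows "zero_trace \<Omega> E w"
proof -
  have "AE x in lebesgue_on \<Omega>. w x - \<phi> x = 0" using ae by eventually_elim simp
  then have "H1norm \<Omega> (\<lambda>x. w x - \<phi> x) = 0" by (rule H1norm_zero[OF o])
  moreover have "seg_norm E \<phi> = 0" by (rule seg_norm_zero[OF E f])
  ultimately show ?thesis unfolding zero_trace_def using H1_AE[OF o \<phi>(1) ae] \<phi>
    by (intro conjI exI[of _ "\<lambda>k. \<phi>"]) auto
qed

lemma supported_in_grad_inner:
  assumes "regular_open U" "supported_in U w"
  shows "supported_in U (\<lambda>x. grad pd w x \<bullet> n)"
  using supported_in_pd[OF assms, of 1] supported_in_pd[OF assms, of 2] assms(2)
    smooth_grad_inner[of w n]
  by (auto simp: supported_in_def grad_def inner_vec_def sum_2)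

text \<open>Both boundary conditions follow from the continuity of the truncated function and of its truncated gradient up to the boundary.\<close>

lemma cut_plate_space:
  assumes o: "open \<Omega>" and b: "bounded \<Omega>" and c: "cut_region \<Omega> T U" and r: "regular_open U" and w: "supported_in U w"
    and f: "finite {x \<in> \<Gamma>c \<union> \<Gamma>s. cut T w x \<noteq> 0}" and g: "finite (\<Gamma>c \<inter> T \<inter> U)"
  shows "cut T w \<in> plate_space \<Omega> \<Gamma>c \<Gamma>s"
  unfolding plate_space_def
proof (intro CollectI conjI allI impI)
  show "cut T w \<in> H2 \<Omega>" by (rule cut_H2[OF o b c r w])
  show "zero_trace \<Omega> E (cut T w)" if "is_segment E \<and> E \<subseteq> \<Gamma>c \<union> \<Gamma>s" for E
  proof (rule zero_traceI[OF o _ cut_H1[OF o b c r w] cut_continuous[OF c w]])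
    show "finite {x \<in> E. cut T w x \<noteq> 0}" by (rule finite_subset[OF _ f]) (use that in auto)
  qed (use that in auto)
  fix E n assume E: "is_segment E \<and> E \<subseteq> \<Gamma>c \<and> norm n = 1 \<and> (\<forall>x\<in>E. \<forall>y\<in>E. n \<bullet> (y - x) = 0)"
  note wg = supported_in_grad_inner[OF r w, of n]
  show "zero_trace \<Omega> E (\<lambda>x. grad (wpd \<Omega>) (cut T w) x \<bullet> n)"
  proof (rule zero_traceI[OF o _ cut_H1[OF o b c r wg] cut_continuous[OF c wg]])
    show "AE x in lebesgue_on \<Omega>. cut T (\<lambda>x. grad pd w x \<bullet> n) x = grad (wpd \<Omega>) (cut T w) x \<bullet> n"
      using cut_wpd[OF o c r w, of 1] cut_wpd[OF o c r w, of 2]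
      by eventually_elim (simp add: grad_def inner_vec_def sum_2 cut_def)
    have "{x \<in> E. cut T (\<lambda>x. grad pd w x \<bullet> n) x \<noteq> 0} \<subseteq> \<Gamma>c \<inter> T \<inter> U"
      using E wg by (auto simp: cut_def supported_in_def split: if_splits)
    then show "finite {x \<in> E. cut T (\<lambda>x. grad pd w x \<bullet> n) x \<noteq> 0}" using g finite_subset by blast
  qed (use E in auto)
qed

section \<open>The energy form\<close>

lemma L2_add:
  assumes "f \<in> L2 A" "g \<in> L2 A" shows "(\<lambda>x. f x + g x) \<in> L2 A"
proof -
  have m: "f \<in> borel_measurable (lebesgue_on A)" "g \<in> borel_measurable (lebesgue_on A)" 
    and i: "integrable (lebesgue_on A) (\<lambda>x. (f x)\<^sup>2)" "integrable (lebesgue_on A) (\<lambda>x. (g x)\<^sup>2)"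
    using assms by (auto simp: L2_def)
  have "integrable (lebesgue_on A) (\<lambda>x. (f x)\<^sup>2 + 2 * (f x * g x) + (g x)\<^sup>2)"
    using integral_Cauchy_Schwarz(1)[OF m i] i by auto
  also have "(\<lambda>x. (f x)\<^sup>2 + 2 * (f x * g x) + (g x)\<^sup>2) = (\<lambda>x. (f x + g x)\<^sup>2)" by (simp add: power2_sum algebra_simps)
  finally show ?thesis using m by (simp add: L2_def)
qed

lemma L2_cmult: "f \<in> L2 A \<Longrightarrow> (\<lambda>x. c * f x) \<in> L2 A"
  by (auto simp: L2_def power_mult_distrib)

lemma L2_diff: "f \<in> L2 A \<Longrightarrow> g \<in> L2 A \<Longrightarrow> (\<lambda>x. f x - g x) \<in> L2 A"
  using L2_add[of f A "\<lambda>x. -1 * g x"] L2_cmult[of g A "-1"] by simp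

lemma L2_integrable_mult: "f \<in> L2 A \<Longrightarrow> g \<in> L2 A \<Longrightarrow> integrable (lebesgue_on A) (\<lambda>x. f x * g x)"
  by (auto simp: L2_def intro: integral_Cauchy_Schwarz(1))

lemma L2_subset:
  assumes "f \<in> L2 S" "T \<subseteq> S" "S \<in> sets lebesgue" "T \<in> sets lebesgue" shows "f \<in> L2 T"
proof -
  have "(\<lambda>x. if x \<in> S then f x else 0) \<in> borel_measurable lebesgue" using assms by (auto simp: L2_def borel_measurable_if)
  then have "(\<lambda>x. indicator T x *\<^sub>R (if x \<in> S then f x else 0)) \<in> borel_measurable lebesgue"
    using assms by (intro borel_measurable_scaleR borel_measurable_indicator)
  also have "(\<lambda>x. indicator T x *\<^sub>R (if x \<in> S then f x else 0)) = (\<lambda>x. if x \<in> T then f x else 0)"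
    using assms by (auto simp: fun_eq_iff indicator_def)
  finally have "f \<in> borel_measurable (lebesgue_on T)" using assms by (simp add: borel_measurable_if)
  then show ?thesis using assms integrable_on_mono[OF _ assms(2-4)] by (auto simp: L2_def)
qed

text \<open>Written in components, so that only the three independent curvatures and their trace appear; both arguments may use any notion of derivative.\<close>

lemma density_eq:
  "moment P D w x \<bullet> curvature D v x = stiffness P * (curvature D w x $ 1 $ 1 * curvature D v x $ 1 $ 1
     + 2 * (curvature D w x $ 1 $ 2 * curvature D v x $ 1 $ 2) + curvature D w x $ 2 $ 2 * curvature D v x $ 2 $ 2
     + coupling P * ((curvature D w x $ 1 $ 1 + curvature D w x $ 2 $ 2) * (curvature D v x $ 1 $ 1 + curvature D v x $ 2 $ 2)))"
proof -
  have "curvature D w x $ 2 $ 1 = curvature D w x $ 1 $ 2" "curvature D v x $ 2 $ 1 = curvature D v x $ 1 $ 2"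
    by (simp_all add: curvature_component add.commute)
  then show ?thesis by (simp add: inner_vec_def sum_2 moment_component algebra_simps)
qed

definition energy_bound :: "plate \<Rightarrow> real" where
  "energy_bound P = 2 * \<bar>stiffness P\<bar> * (1 + \<bar>coupling P\<bar>)"

lemma density_bound:
  assumes "\<And>i j. \<bar>D j (D i v) x\<bar> \<le> B"
  shows "\<bar>moment P D w x \<bullet> curvature D v x\<bar> \<le> energy_bound P * B * (\<Sum>i\<in>UNIV. \<Sum>j\<in>UNIV. \<bar>D j (D i w) x\<bar>)"
proof -
  define S where "S = (\<Sum>i\<in>UNIV. \<Sum>j\<in>UNIV. \<bar>D j (D i w) x\<bar>)"
  define a b c where "a = curvature D w x $ 1 $ 1" and "b = curvature D w x $ 1 $ 2" and "c = curvature D w x $ 2 $ 2"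
  define a' b' c' where "a' = curvature D v x $ 1 $ 1" and "b' = curvature D v x $ 1 $ 2" and "c' = curvature D v x $ 2 $ 2"
  have S: "\<bar>a\<bar> + 2 * \<bar>b\<bar> + \<bar>c\<bar> \<le> S" by (simp add: a_def b_def c_def S_def curvature_component sum_2)
  have B: "\<bar>a'\<bar> \<le> B" "\<bar>b'\<bar> \<le> B" "\<bar>c'\<bar> \<le> B"
    using assms[of 1 1] assms[of 1 2] assms[of 2 1] assms[of 2 2] by (auto simp: a'_def b'_def c'_def curvature_component)
  have S0: "S \<ge> 0" by (simp add: S_def sum_nonneg)
  have B0: "B \<ge> 0" using B by linarith
  have 1: "\<bar>a * a' + 2 * (b * b') + c * c'\<bar> \<le> S * B"
  proof -
    have "\<bar>a * a' + 2 * (b * b') + c * c'\<bar> \<le> \<bar>a\<bar> * \<bar>a'\<bar> + 2 * (\<bar>b\<bar> * \<bar>b'\<bar>) + \<bar>c\<bar> * \<bar>c'\<bar>"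
      unfolding abs_mult[symmetric] by linarith
    also have "\<dots> \<le> \<bar>a\<bar> * B + 2 * (\<bar>b\<bar> * B) + \<bar>c\<bar> * B" using B by (intro add_mono mult_left_mono) auto
    also have "\<dots> = (\<bar>a\<bar> + 2 * \<bar>b\<bar> + \<bar>c\<bar>) * B" by (simp add: algebra_simps)
    also have "\<dots> \<le> S * B" using S B0 by (intro mult_right_mono)
    finally show ?thesis .
  qed
  have 2: "\<bar>(a + c) * (a' + c')\<bar> \<le> S * (2 * B)"
  proof -
    have "\<bar>a + c\<bar> \<le> S" "\<bar>a' + c'\<bar> \<le> 2 * B" using S B by linarith+
    then show ?thesis unfolding abs_mult using S0 by (intro mult_mono) auto
  qed
  have "\<bar>moment P D w x \<bullet> curvature D v x\<bar> = \<bar>stiffness P\<bar> * \<bar>(a * a' + 2 * (b * b') + c * c') + coupling P * ((a + c) * (a' + c'))\<bar>"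
    unfolding density_eq abs_mult[symmetric] a_def b_def c_def a'_def b'_def c'_def by simp
  also have "\<dots> \<le> \<bar>stiffness P\<bar> * (S * B + \<bar>coupling P\<bar> * (S * (2 * B)))"
  proof (rule mult_left_mono)
    have "\<bar>coupling P * ((a + c) * (a' + c'))\<bar> \<le> \<bar>coupling P\<bar> * (S * (2 * B))"
      unfolding abs_mult[of "coupling P"] using 2 by (intro mult_left_mono) auto
    then show "\<bar>(a * a' + 2 * (b * b') + c * c') + coupling P * ((a + c) * (a' + c'))\<bar> \<le> S * B + \<bar>coupling P\<bar> * (S * (2 * B))"
      using 1 abs_triangle_ineq[of "a * a' + 2 * (b * b') + c * c'" "coupling P * ((a + c) * (a' + c'))"] by linarith
  qed simp
  also have "\<dots> \<le> energy_bound P * B * S"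
  proof -
    have "\<bar>stiffness P\<bar> * (S * B) \<le> 2 * (\<bar>stiffness P\<bar> * (S * B))" using S0 B0 by simp
    then show ?thesis by (simp add: energy_bound_def algebra_simps)
  qed
  finally show ?thesis unfolding S_def .
qed

lemma H2_wpd2:
  assumes o: "open \<Omega>" and w: "w \<in> H2 \<Omega>"
  shows "wpd \<Omega> j (wpd \<Omega> i w) \<in> L2 \<Omega>" "has_weak_pd \<Omega> i w (wpd \<Omega> i w)" "has_weak_pd \<Omega> j (wpd \<Omega> i w) (wpd \<Omega> j (wpd \<Omega> i w))"
  using w H1_wpd[OF o, of "wpd \<Omega> i w" j] H1_wpd[OF o, of w i] by (auto simp: H2_def)

lemma curvature_L2:
  assumes "open \<Omega>" "w \<in> H2 \<Omega>" shows "(\<lambda>x. curvature (wpd \<Omega>) w x $ i $ j) \<in> L2 \<Omega>"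
  unfolding curvature_component by (intro L2_cmult L2_add H2_wpd2[OF assms])

lemma density_integrable:
  assumes "open \<Omega>" "w \<in> H2 \<Omega>" "v \<in> H2 \<Omega>"
  shows "integrable (lebesgue_on \<Omega>) (\<lambda>x. moment P (wpd \<Omega>) w x \<bullet> curvature (wpd \<Omega>) v x)"
  unfolding density_eq
  by (intro integrable_mult_right Bochner_Integration.integrable_add L2_integrable_mult L2_add curvature_L2 assms)

lemma wpd2_diff:
  assumes o: "open \<Omega>" and u: "u \<in> H2 \<Omega>" and v: "v \<in> H2 \<Omega>"
  shows "AE x in lebesgue_on \<Omega>. wpd \<Omega> j (wpd \<Omega> i (\<lambda>x. u x - v x)) x = wpd \<Omega> j (wpd \<Omega> i u) x - wpd \<Omega> j (wpd \<Omega> i v) x"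
    and "wpd \<Omega> j (wpd \<Omega> i (\<lambda>x. u x - v x)) \<in> L2 \<Omega>"
proof -
  have "AE x in lebesgue_on \<Omega>. wpd \<Omega> i (\<lambda>x. u x - v x) x = wpd \<Omega> i u x - wpd \<Omega> i v x"
    by (rule wpd_AE[OF o has_weak_pd_diff[OF o H2_wpd2(2)[OF o u] H2_wpd2(2)[OF o v]]]) simp
  then have "AE x in lebesgue_on \<Omega>. wpd \<Omega> i u x - wpd \<Omega> i v x = wpd \<Omega> i (\<lambda>x. u x - v x) x" by eventually_elim simp
  then show 1: "AE x in lebesgue_on \<Omega>. wpd \<Omega> j (wpd \<Omega> i (\<lambda>x. u x - v x)) x = wpd \<Omega> j (wpd \<Omega> i u) x - wpd \<Omega> j (wpd \<Omega> i v) x"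
    by (rule wpd_AE[OF o has_weak_pd_diff[OF o H2_wpd2(3)[OF o u] H2_wpd2(3)[OF o v]]])
  show "wpd \<Omega> j (wpd \<Omega> i (\<lambda>x. u x - v x)) \<in> L2 \<Omega>"
  proof (rule L2_AE[OF L2_diff[OF H2_wpd2(1)[OF o u] H2_wpd2(1)[OF o v]]])
    show "AE x in lebesgue_on \<Omega>. wpd \<Omega> j (wpd \<Omega> i u) x - wpd \<Omega> j (wpd \<Omega> i v) x = wpd \<Omega> j (wpd \<Omega> i (\<lambda>x. u x - v x)) x"
      using 1 by eventually_elim simp
  qed (use o in auto)
qed

lemma L2norm_le_H2norm: "L2norm A (wpd \<Omega> j (wpd \<Omega> i w)) \<le> H2norm \<Omega> A w"
proof -
  have "(L2norm A (wpd \<Omega> j (wpd \<Omega> i w)))\<^sup>2 \<le> (\<Sum>j\<in>UNIV. (L2norm A (wpd \<Omega> j (wpd \<Omega> i w)))\<^sup>2)"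
    by (rule member_le_sum) auto
  also have "\<dots> \<le> (\<Sum>i\<in>UNIV. \<Sum>j\<in>UNIV. (L2norm A (wpd \<Omega> j (wpd \<Omega> i w)))\<^sup>2)"
    by (rule member_le_sum[of i _ "\<lambda>i. \<Sum>j\<in>UNIV. (L2norm A (wpd \<Omega> j (wpd \<Omega> i w)))\<^sup>2"]) (auto intro: sum_nonneg)
  also have "\<dots> \<le> (L2norm A w)\<^sup>2 + (\<Sum>i\<in>UNIV. (L2norm A (wpd \<Omega> i w))\<^sup>2) + (\<Sum>i\<in>UNIV. \<Sum>j\<in>UNIV. (L2norm A (wpd \<Omega> j (wpd \<Omega> i w)))\<^sup>2)"
    by (simp add: sum_nonneg)
  finally show ?thesis unfolding H2norm_def by (rule real_le_rsqrt)
qed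

lemma L2_local_bound:
  assumes o: "\<Omega> \<in> sets lebesgue" and g: "g \<in> L2 \<Omega>" and A: "A \<in> sets lebesgue" "negligible (A - \<Omega>)" and U: "U \<in> lmeasurable"
  shows "integrable (lebesgue_on \<Omega>) (\<lambda>x. indicator (U \<inter> A) x * \<bar>g x\<bar>)"
    "(\<integral>x. indicator (U \<inter> A) x * \<bar>g x\<bar> \<partial>lebesgue_on \<Omega>) \<le> sqrt (measure lebesgue U) * L2norm A g"
proof -
  have gm: "g \<in> borel_measurable (lebesgue_on \<Omega>)" and gi: "integrable (lebesgue_on \<Omega>) (\<lambda>x. (g x)\<^sup>2)" using g by (auto simp: L2_def)
  have Us: "U \<in> sets lebesgue" using U by (rule fmeasurableD)
  have mU: "(indicator U :: field) \<in> borel_measurable (lebesgue_on \<Omega>)" and mA: "(indicator A :: field) \<in> borel_measurable (lebesgue_on \<Omega>)"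
    by (intro measurable_restrict_space1 borel_measurable_indicator Us A)+
  define f1 :: field where "f1 = indicator U"
  define f2 where "f2 x = indicator A x * \<bar>g x\<bar>" for x
  have f1sq: "(f1 x)\<^sup>2 = indicator U x" for x by (simp add: f1_def indicator_def)
  have "integrable lebesgue (indicator U :: field)"
    by (rule integrable_real_indicator) (use U in \<open>auto simp: fmeasurable_def\<close>)
  then have i1': "integrable lebesgue (\<lambda>x. (f1 x)\<^sup>2)" by (simp add: f1sq)
  have i1: "integrable (lebesgue_on \<Omega>) (\<lambda>x. (f1 x)\<^sup>2)"
    using integrable_mult_indicator[OF o i1'] o by (simp add: integrable_restrict_space)
  have m1: "f1 \<in> borel_measurable (lebesgue_on \<Omega>)" using mU by (simp add: f1_def)
  have m2: "f2 \<in> borel_measurable (lebesgue_on \<Omega>)" unfolding f2_def[abs_def] using mA gm by (intro borel_measurable_times borel_measurable_abs)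
  have i2: "integrable (lebesgue_on \<Omega>) (\<lambda>x. (f2 x)\<^sup>2)"
  proof (rule Bochner_Integration.integrable_bound[OF gi])
    show "(\<lambda>x. (f2 x)\<^sup>2) \<in> borel_measurable (lebesgue_on \<Omega>)" using m2 by (intro borel_measurable_power)
    show "AE x in lebesgue_on \<Omega>. norm ((f2 x)\<^sup>2) \<le> norm ((g x)\<^sup>2)"
      by (intro AE_I2) (simp add: f2_def power_mult_distrib indicator_def)
  qed
  have eq: "(\<lambda>x. indicator (U \<inter> A) x * \<bar>g x\<bar>) = (\<lambda>x. f1 x * f2 x)" by (auto simp: f1_def f2_def fun_eq_iff indicator_def)
  show "integrable (lebesgue_on \<Omega>) (\<lambda>x. indicator (U \<inter> A) x * \<bar>g x\<bar>)"
    unfolding eq by (rule integral_Cauchy_Schwarz(1)[OF m1 m2 i1 i2])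
  have "(\<integral>x. (f1 x)\<^sup>2 \<partial>lebesgue_on \<Omega>) = (\<integral>x. indicator \<Omega> x *\<^sub>R (f1 x)\<^sup>2 \<partial>lebesgue)" using o by (subst integral_restrict_space) auto
  also have "\<dots> \<le> (\<integral>x. (f1 x)\<^sup>2 \<partial>lebesgue)"
    by (intro Bochner_Integration.integral_mono integrable_mult_indicator o i1') (simp add: indicator_def)
  also have "\<dots> = measure lebesgue U" using Us by (simp add: f1sq)
  finally have n1: "(\<integral>x. (f1 x)\<^sup>2 \<partial>lebesgue_on \<Omega>) \<le> measure lebesgue U" .
  have "(\<integral>x. (f2 x)\<^sup>2 \<partial>lebesgue_on \<Omega>) = (\<integral>x. (f2 x)\<^sup>2 \<partial>lebesgue_on (\<Omega> \<inter> A))"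
    using o A by (intro integral_on_subset) (auto simp: f2_def)
  also have "\<dots> = (\<integral>x. (g x)\<^sup>2 \<partial>lebesgue_on (\<Omega> \<inter> A))"
    by (intro Bochner_Integration.integral_cong) (auto simp: f2_def)
  also have "\<dots> = (\<integral>x. (g x)\<^sup>2 \<partial>lebesgue_on A)"
    using o A by (intro integral_on_null_diff) (auto simp: Diff_Int negligible_subset)
  finally have n2: "sqrt (\<integral>x. (f2 x)\<^sup>2 \<partial>lebesgue_on \<Omega>) = L2norm A g" by (simp add: L2norm_def)
  have "(\<integral>x. indicator (U \<inter> A) x * \<bar>g x\<bar> \<partial>lebesgue_on \<Omega>) \<le> sqrt (\<integral>x. (f1 x)\<^sup>2 \<partial>lebesgue_on \<Omega>) * sqrt (\<integral>x. (f2 x)\<^sup>2 \<partial>lebesgue_on \<Omega>)"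
    unfolding eq using integral_Cauchy_Schwarz(2)[OF m1 m2 i1 i2] by linarith
  also have "\<dots> \<le> sqrt (measure lebesgue U) * L2norm A g"
    unfolding n2 using n1 by (intro mult_right_mono) (auto simp: L2norm_def)
  finally show "(\<integral>x. indicator (U \<inter> A) x * \<bar>g x\<bar> \<partial>lebesgue_on \<Omega>) \<le> sqrt (measure lebesgue U) * L2norm A g" .
qed

text \<open>The form is bounded, and the second derivatives of the test function are bounded by \<open>B\<close> on \<open>U \<inter> A\<close> and vanish elsewhere; the Cauchy-Schwarz inequality on \<open>U \<inter> A\<close> gives the root of the area of \<open>U\<close>.\<close>

lemma energy_residual_bound:
  assumes o: "open \<Omega>" and u: "u \<in> H2 \<Omega>" and v: "v \<in> H2 \<Omega>" and t: "t \<in> H2 \<Omega>"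
    and A: "A \<in> sets lebesgue" "negligible (A - \<Omega>)" and U: "U \<in> lmeasurable" and B: "B \<ge> 0"
    and tb: "AE x in lebesgue_on \<Omega>. \<forall>i j. \<bar>wpd \<Omega> j (wpd \<Omega> i t) x\<bar> \<le> B * indicator (U \<inter> A) x"
  shows "\<bar>plate_form P \<Omega> u t - plate_form P \<Omega> v t\<bar>
     \<le> 4 * energy_bound P * B * sqrt (measure lebesgue U) * H2norm \<Omega> A (\<lambda>x. u x - v x)"
proof -
  let ?e = "\<lambda>x. u x - v x" and ?M = "lebesgue_on \<Omega>"
  define S where "S x = (\<Sum>i\<in>UNIV. \<Sum>j\<in>UNIV. indicator (U \<inter> A) x * \<bar>wpd \<Omega> j (wpd \<Omega> i ?e) x\<bar>)" for x
  have os: "\<Omega> \<in> sets lebesgue" using o by auto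
  have eb: "energy_bound P \<ge> 0" by (simp add: energy_bound_def)
  have iS: "integrable ?M S" unfolding S_def[abs_def]
    by (intro Bochner_Integration.integrable_sum L2_local_bound(1)[OF os _ A U] wpd2_diff(2) o u v)
  have pf: "plate_form P \<Omega> u t - plate_form P \<Omega> v t
     = (\<integral>x. moment P (wpd \<Omega>) u x \<bullet> curvature (wpd \<Omega>) t x - moment P (wpd \<Omega>) v x \<bullet> curvature (wpd \<Omega>) t x \<partial>?M)"
    unfolding plate_form_def by (rule Bochner_Integration.integral_diff[symmetric]) (intro density_integrable o u v t)+
  have "\<bar>plate_form P \<Omega> u t - plate_form P \<Omega> v t\<bar> \<le> (\<integral>x. energy_bound P * B * S x \<partial>?M)"
    unfolding pf
  proof (rule order_trans[OF integral_abs_bound integral_mono_AE])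
    show "integrable ?M (\<lambda>x. \<bar>moment P (wpd \<Omega>) u x \<bullet> curvature (wpd \<Omega>) t x - moment P (wpd \<Omega>) v x \<bullet> curvature (wpd \<Omega>) t x\<bar>)"
      by (intro integrable_abs Bochner_Integration.integrable_diff density_integrable o u v t)
    show "integrable ?M (\<lambda>x. energy_bound P * B * S x)" using iS by simp
    have d: "AE x in ?M. \<forall>i j. wpd \<Omega> j (wpd \<Omega> i ?e) x = wpd \<Omega> j (wpd \<Omega> i u) x - wpd \<Omega> j (wpd \<Omega> i v) x"
      unfolding forall_2 by (intro eventually_conj wpd2_diff(1)[OF o u v])
    show "AE x in ?M. \<bar>moment P (wpd \<Omega>) u x \<bullet> curvature (wpd \<Omega>) t x - moment P (wpd \<Omega>) v x \<bullet> curvature (wpd \<Omega>) t x\<bar> \<le> energy_bound P * B * S x"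
      using d tb
    proof eventually_elim
      fix x
      assume dx: "\<forall>i j. wpd \<Omega> j (wpd \<Omega> i ?e) x = wpd \<Omega> j (wpd \<Omega> i u) x - wpd \<Omega> j (wpd \<Omega> i v) x"
        and tx: "\<forall>i j. \<bar>wpd \<Omega> j (wpd \<Omega> i t) x\<bar> \<le> B * indicator (U \<inter> A) x"
      have k: "curvature (wpd \<Omega>) ?e x $ i $ j = curvature (wpd \<Omega>) u x $ i $ j - curvature (wpd \<Omega>) v x $ i $ j" for i j
        by (simp add: curvature_component dx field_simps)
      have m: "moment P (wpd \<Omega>) u x \<bullet> curvature (wpd \<Omega>) t x - moment P (wpd \<Omega>) v x \<bullet> curvature (wpd \<Omega>) t x
         = moment P (wpd \<Omega>) ?e x \<bullet> curvature (wpd \<Omega>) t x"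
        unfolding density_eq k by (simp only: algebra_simps)
      have "\<bar>moment P (wpd \<Omega>) ?e x \<bullet> curvature (wpd \<Omega>) t x\<bar> \<le> energy_bound P * (B * indicator (U \<inter> A) x) * (\<Sum>i\<in>UNIV. \<Sum>j\<in>UNIV. \<bar>wpd \<Omega> j (wpd \<Omega> i ?e) x\<bar>)"
        by (rule density_bound) (use tx in blast)
      also have "\<dots> = energy_bound P * B * S x" by (simp add: S_def sum_distrib_left mult.assoc)
      finally show "\<bar>moment P (wpd \<Omega>) u x \<bullet> curvature (wpd \<Omega>) t x - moment P (wpd \<Omega>) v x \<bullet> curvature (wpd \<Omega>) t x\<bar> \<le> energy_bound P * B * S x" unfolding m .
    qed
  qed
  also have "\<dots> = energy_bound P * B * (\<integral>x. S x \<partial>?M)" by simp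
  also have "\<dots> \<le> energy_bound P * B * (4 * (sqrt (measure lebesgue U) * H2norm \<Omega> A ?e))"
  proof (rule mult_left_mono)
    have "(\<integral>x. S x \<partial>?M) = (\<Sum>i\<in>UNIV. \<Sum>j\<in>UNIV. \<integral>x. indicator (U \<inter> A) x * \<bar>wpd \<Omega> j (wpd \<Omega> i ?e) x\<bar> \<partial>?M)"
      unfolding S_def
      by (subst Bochner_Integration.integral_sum; (intro Bochner_Integration.integrable_sum L2_local_bound(1)[OF os _ A U] wpd2_diff(2) o u v sum.cong refl Bochner_Integration.integral_sum)?)
    also have "\<dots> \<le> (\<Sum>i\<in>(UNIV :: 2 set). \<Sum>j\<in>(UNIV :: 2 set). sqrt (measure lebesgue U) * H2norm \<Omega> A ?e)"
      by (intro sum_mono order_trans[OF L2_local_bound(2)[OF os _ A U]] wpd2_diff(2) o u v mult_left_mono L2norm_le_H2norm) auto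
    finally show "(\<integral>x. S x \<partial>?M) \<le> 4 * (sqrt (measure lebesgue U) * H2norm \<Omega> A ?e)" by simp
    show "0 \<le> energy_bound P * B" using eb B by simp
  qed
  finally show ?thesis by (simp add: mult_ac)
qed

section \<open>Squares\<close>

lemma open_square_eq: "open_square z n \<rho> = {x. \<bar>(x - z) \<bullet> tangent n\<bar> < \<rho>} \<inter> {x. \<bar>(x - z) \<bullet> n\<bar> < \<rho>}"
  by (auto simp: open_square_def)

lemma open_open_square: "open (open_square z n \<rho>)"
  unfolding open_square_eq by (intro open_Int open_Collect_less continuous_intros)

lemma convex_open_square: "convex (open_square z n \<rho>)"
proof -
  have "convex {x. \<bar>(x - z) \<bullet> a\<bar> < \<rho>}" for a
  proof -
    have "{x. \<bar>(x - z) \<bullet> a\<bar> < \<rho>} = {x. a \<bullet> x < \<rho> + z \<bullet> a} \<inter> {x. (- a) \<bullet> x < \<rho> - z \<bullet> a}"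
      by (auto simp: inner_diff_left inner_commute[of a] abs_less_iff)
    then show ?thesis by (simp only: convex_Int convex_halfspace_lt)
  qed
  then show ?thesis unfolding open_square_eq by (intro convex_Int)
qed

lemma regular_open_square: "regular_open (open_square z n \<rho>)"
  using convex_interior_closure[OF convex_open_square] open_open_square by (simp add: regular_open_def interior_open)

lemma norm_le_frame:
  assumes "norm n = 1" shows "norm x \<le> \<bar>x \<bullet> tangent n\<bar> + \<bar>x \<bullet> n\<bar>"
proof -
  have "norm x = norm ((x \<bullet> tangent n) *\<^sub>R tangent n + (x \<bullet> n) *\<^sub>R n)" using frame_decompose[OF assms, of x] by simp
  also have "\<dots> \<le> \<bar>x \<bullet> tangent n\<bar> + \<bar>x \<bullet> n\<bar>"
    using norm_triangle_ineq[of "(x \<bullet> tangent n) *\<^sub>R tangent n" "(x \<bullet> n) *\<^sub>R n"] assms tangent_simps(5)[OF assms] by simp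
  finally show ?thesis .
qed

lemma open_square_norm: "norm n = 1 \<Longrightarrow> x \<in> open_square z n \<rho> \<Longrightarrow> norm (x - z) < 2 * \<rho>"
  using norm_le_frame[of n "x - z"] by (auto simp: open_square_def)

lemma measure_open_square:
  assumes "norm n = 1" "\<rho> > 0"
  shows "open_square z n \<rho> \<in> lmeasurable" "sqrt (measure lebesgue (open_square z n \<rho>)) \<le> 4 * \<rho>"
proof -
  define u v where "u = z - (\<chi> i. 2 * \<rho>)" and "v = z + (\<chi> i. 2 * \<rho>)"
  have sub: "open_square z n \<rho> \<subseteq> cbox u v"
  proof
    fix x assume "x \<in> open_square z n \<rho>"
    then have "norm (x - z) < 2 * \<rho>" using open_square_norm assms by blast
    then have "\<bar>x $ i - z $ i\<bar> \<le> 2 * \<rho>" for i using component_le_norm_cart[of "x - z" i] by simp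
    then have "z $ i - 2 * \<rho> \<le> x $ i \<and> x $ i \<le> z $ i + 2 * \<rho>" for i by (smt (verit))
    then show "x \<in> cbox u v" by (simp add: mem_box_cart u_def v_def)
  qed
  have "bounded (open_square z n \<rho>)" using sub bounded_subset bounded_cbox by blast
  then show m: "open_square z n \<rho> \<in> lmeasurable" using lmeasurable_open open_open_square by blast
  have "measure lebesgue (open_square z n \<rho>) \<le> measure lebesgue (cbox u v)"
    using m sub by (intro measure_mono_fmeasurable) (auto simp: fmeasurableD)
  also have "\<dots> = measure lborel (cbox u v)" by simp
  also have "\<dots> = (\<Prod>b\<in>Basis. v \<bullet> b - u \<bullet> b)"
    by (rule content_cbox) (use assms in \<open>auto simp: Basis_plane inner_axis u_def v_def\<close>)
  also have "\<dots> = (4 * \<rho>)\<^sup>2" by (simp add: Basis_plane axis_eq_axis inner_axis u_def v_def power2_eq_square)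
  finally show "sqrt (measure lebesgue (open_square z n \<rho>)) \<le> 4 * \<rho>"
    using assms by (intro real_le_lsqrt) auto
qed

section \<open>Edges of shape regular triangles\<close>

definition edge_mid :: "plane set \<Rightarrow> plane" where
  "edge_mid E = (1/2) *\<^sub>R (fst (seg_ends E) + snd (seg_ends E))"

text \<open>The half side length of the square at an edge, in units of the edge length. It is chosen so that \<open>square_ratio \<kappa> * (1 + \<kappa>\<^sup>2) = 1 / 4\<close>, the relation used to see that half of the square lies in the triangle.\<close>

definition square_ratio :: "real \<Rightarrow> real" where
  "square_ratio \<kappa> = 1 / (4 * (1 + \<kappa>\<^sup>2))"

lemma square_ratio_bounds: "0 < square_ratio \<kappa>" "square_ratio \<kappa> \<le> 1/4" "\<kappa> \<ge> 1 \<Longrightarrow> square_ratio \<kappa> * \<kappa> \<le> 1/8"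
proof -
  have p: "0 < 1 + \<kappa>\<^sup>2" by (simp add: add_pos_nonneg)
  show "0 < square_ratio \<kappa>" "square_ratio \<kappa> \<le> 1/4" using p by (simp_all add: square_ratio_def field_simps)
  have "0 \<le> (\<kappa> - 1)\<^sup>2" by simp
  then have "2 * \<kappa> \<le> 1 + \<kappa>\<^sup>2" by (simp add: power2_diff)
  then show "square_ratio \<kappa> * \<kappa> \<le> 1/8" using p by (simp add: square_ratio_def field_simps)
qed

text \<open>All that the proof needs to know about an edge \<open>E\<close> of a triangle \<open>K\<close>: in the orthonormal frame at the midpoint, \<open>E\<close> is a centred interval, \<open>K\<close> lies on one side of it, and half of the square of \<open>E\<close> lies in \<open>K\<close>.\<close>

definition edge_frame :: "real \<Rightarrow> plane set \<Rightarrow> plane set \<Rightarrow> plane \<Rightarrow> bool" where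
  "edge_frame \<kappa> K E n \<longleftrightarrow> norm n = 1 \<and> n = outward_normal K E \<and> 0 < diameter E \<and>
     E = {edge_mid E + t *\<^sub>R tangent n |t. \<bar>t\<bar> \<le> diameter E / 2} \<and>
     (\<forall>y\<in>K. (y - edge_mid E) \<bullet> n \<le> 0) \<and>
     {y \<in> open_square (edge_mid E) n (square_ratio \<kappa> * diameter E). (y - edge_mid E) \<bullet> n < 0} \<subseteq> interior K"

lemma edge_of_triangle:
  assumes K: "2 simplex K" and E: "E edge_of K"
  obtains c where "is_segment E" "K = convex hull {fst (seg_ends E), snd (seg_ends E), c}"
proof -
  obtain C where C: "\<not> affine_dependent C" "int (card C) = 2 + 1" "K = convex hull C" using K by (auto simp: simplex_def)
  obtain D where D: "D \<subseteq> C" "E = convex hull D"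
    using E C face_of_convex_hull_affine_independent[OF C(1), of E] by (auto simp: edge_of_def)
  have "\<not> affine_dependent D" using C(1) D(1) affine_independent_subset by blast
  then have "of_nat (card D) = aff_dim D + 1" by (rule aff_dim_affine_independent)
  moreover have "aff_dim D = 1" using E D(2) aff_dim_convex_hull[of D] by (simp add: edge_of_def)
  ultimately have "card D = 2" by linarith
  then obtain a b where ab: "D = {a, b}" "a \<noteq> b" by (auto simp: card_2_iff)
  have fC: "finite C" "card C = 3" using C(1,2) aff_independent_finite by auto
  have "card (C - D) = 1" using fC ab D(1) \<open>card D = 2\<close> by (subst card_Diff_subset) auto
  then obtain c where c: "C - D = {c}" by (auto simp: card_1_singleton_iff)
  have Cc: "C = {a, b, c}" using c ab D(1) by auto
  have Eab: "E = closed_segment a b" using D(2) ab by (simp add: segment_convex_hull)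
  then have seg: "is_segment E" using ab by (auto simp: is_segment_def)
  have "closed_segment a b = closed_segment (fst (seg_ends E)) (snd (seg_ends E))" using seg_ends(1)[OF seg] Eab by simp
  then have "{a, b} = {fst (seg_ends E), snd (seg_ends E)}" by (simp add: closed_segment_eq)
  then have "K = convex hull {fst (seg_ends E), snd (seg_ends E), c}" using C(3) Cc by (metis insert_commute insert_is_Un)
  then show thesis using that seg by blast
qed

text \<open>The disc of radius \<open>r\<close> in \<open>K\<close> forces both the height \<open>H\<close> over \<open>E\<close> and the length \<open>h\<close> of \<open>E\<close> to be at least \<open>2 r\<close>,
whereas the diameter is at most \<open>2 \<kappa> r\<close>. A point of the half square at depth \<open>\<mu> H\<close> is the convex combination, with weights
\<open>\<mu>\<close> and \<open>1 - \<mu>\<close>, of the opposite vertex and a point of the line of \<open>E\<close>, and these bounds place the latter in \<open>E\<close>.\<close>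

lemma edge_frame_exists:
  assumes K: "2 simplex K" and E: "E edge_of K" and x: "r > 0" "cball x r \<subseteq> K" and d: "diameter K \<le> \<kappa> * (2 * r)"
  shows "edge_frame \<kappa> K E (outward_normal K E)" "\<kappa> \<ge> 1" "diameter E \<le> diameter K"
proof -
  obtain c where seg: "is_segment E" and Kc: "K = convex hull {fst (seg_ends E), snd (seg_ends E), c}"
    using edge_of_triangle[OF K E] by blast
  define p q where "p = fst (seg_ends E)" and "q = snd (seg_ends E)"
  have Epq: "E = closed_segment p q" and pq: "p \<noteq> q" using seg_ends[OF seg] by (auto simp: p_def q_def)
  have Kh: "K = convex hull {p, q, c}" using Kc by (simp add: p_def q_def)
  define z where "z = edge_mid E"
  have z: "z = (1/2) *\<^sub>R (p + q)" by (simp add: z_def edge_mid_def p_def q_def)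
  define h where "h = norm (q - p)"
  have h: "h > 0" using pq by (simp add: h_def)
  define s where "s = (1/h) *\<^sub>R (q - p)"
  have s: "norm s = 1" using h by (simp add: s_def h_def)
  define n1 :: plane where "n1 = vector [s $ 2, - (s $ 1)]"
  have tn1: "tangent n1 = s" by (simp add: n1_def tangent_def vec_eq_iff forall_2)
  have "n1 \<bullet> n1 = s \<bullet> s" by (simp add: n1_def inner_vec_def sum_2)
  then have n1: "norm n1 = 1" using s by (simp add: norm_eq_1)
  define n where "n = (if (c - z) \<bullet> n1 \<le> 0 then n1 else - n1)"
  have n: "norm n = 1" using n1 by (simp add: n_def)
  have cn: "(c - z) \<bullet> n \<le> 0" by (auto simp: n_def)
  obtain \<epsilon> :: real where eps: "\<epsilon> = 1 \<or> \<epsilon> = -1" and ts: "s = \<epsilon> *\<^sub>R tangent n"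
    using tn1 tangent_uminus[of n1] by (cases "(c - z) \<bullet> n1 \<le> 0") (force simp: n_def)+
  note t = tangent_simps[OF n]
  have qp: "q - p = (\<epsilon> * h) *\<^sub>R tangent n" 
  proof -
    have "q - p = h *\<^sub>R s" using h by (simp add: s_def)
    also have "\<dots> = (\<epsilon> * h) *\<^sub>R tangent n" by (subst ts) (simp add: mult.commute)
    finally show ?thesis .
  qed
  have pz: "p = z - (\<epsilon> * h / 2) *\<^sub>R tangent n" and qz: "q = z + (\<epsilon> * h / 2) *\<^sub>R tangent n"
  proof -
    have "p = z - (1/2) *\<^sub>R (q - p)" "q = z + (1/2) *\<^sub>R (q - p)"
      unfolding z by (simp_all add: vec_eq_iff field_simps)
    then show "p = z - (\<epsilon> * h / 2) *\<^sub>R tangent n" "q = z + (\<epsilon> * h / 2) *\<^sub>R tangent n" unfolding qp by simp_all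
  qed
  have Eset: "E = {z + a *\<^sub>R tangent n |a. \<bar>a\<bar> \<le> h / 2}"
  proof (intro equalityI subsetI)
    fix y assume "y \<in> E"
    then obtain u where u: "0 \<le> u" "u \<le> 1" "y = (1 - u) *\<^sub>R p + u *\<^sub>R q" unfolding Epq by (auto simp: in_segment)
    have "y = z + (\<epsilon> * (u - 1/2) * h) *\<^sub>R tangent n" unfolding u(3) pz qz by (simp add: vec_eq_iff field_simps)
    moreover have "\<bar>\<epsilon> * (u - 1/2) * h\<bar> \<le> h / 2"
    proof -
      have "\<bar>\<epsilon> * (u - 1/2) * h\<bar> = \<bar>u - 1/2\<bar> * h" using eps h by (auto simp: abs_mult)
      also have "\<dots> \<le> (1/2) * h" using u h by (intro mult_right_mono) linarith+
      finally show ?thesis by simp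
    qed
    ultimately show "y \<in> {z + a *\<^sub>R tangent n |a. \<bar>a\<bar> \<le> h / 2}" by blast
  next
    fix y assume "y \<in> {z + a *\<^sub>R tangent n |a. \<bar>a\<bar> \<le> h / 2}"
    then obtain a where a: "\<bar>a\<bar> \<le> h / 2" "y = z + a *\<^sub>R tangent n" by blast
    define u where "u = 1/2 + \<epsilon> * a / h"
    have e2: "\<epsilon> * \<epsilon> = 1" using eps by auto
    have "\<bar>\<epsilon> * a / h\<bar> \<le> 1/2" using a h eps by (auto simp: abs_mult field_simps)
    then have "- (1/2) \<le> \<epsilon> * a / h" "\<epsilon> * a / h \<le> 1/2" by linarith+
    then have u: "0 \<le> u" "u \<le> 1" unfolding u_def by linarith+
    have "(1 - u) *\<^sub>R p + u *\<^sub>R q = z + ((\<epsilon> * h) * (u - 1/2)) *\<^sub>R tangent n"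
      unfolding pz qz by (simp add: vec_eq_iff field_simps)
    also have "(\<epsilon> * h) * (u - 1/2) = a" using h e2 by (simp add: u_def mult.assoc[symmetric]) 
    finally have "y = (1 - u) *\<^sub>R p + u *\<^sub>R q" using a by simp
    then show "y \<in> E" unfolding Epq using u by (auto simp: in_segment)
  qed
  have cK: "convex K" "compact K" "bounded K" "c \<in> K" "p \<in> K" "q \<in> K"
    using convex_simplex[OF K] compact_simplex[OF K] compact_imp_bounded[OF compact_simplex[OF K]] by (auto simp: Kh hull_inc)
  have EK: "E \<subseteq> K" using E edge_of_imp_subset by blast
  have zE: "z \<in> E" unfolding Eset using h by (auto intro!: exI[of _ 0])
  define H where "H = - ((c - z) \<bullet> n)"
  have coord: "\<exists>u v w. 0 \<le> u \<and> 0 \<le> v \<and> 0 \<le> w \<and> u + v + w = 1 \<and> y = u *\<^sub>R p + v *\<^sub>R q + w *\<^sub>R c" if "y \<in> K" for y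
    using that unfolding Kh convex_hull_3 by blast
  have nval: "(u *\<^sub>R p + v *\<^sub>R q + w *\<^sub>R c - z) \<bullet> n = - w * H" if "u + v + w = 1" for u v w
  proof -
    have "u *\<^sub>R p + v *\<^sub>R q + w *\<^sub>R c - z = u *\<^sub>R (p - z) + v *\<^sub>R (q - z) + w *\<^sub>R (c - z) + (u + v + w - 1) *\<^sub>R z"
      by (simp add: algebra_simps)
    also have "\<dots> \<bullet> n = - w * H" using that by (simp add: inner_add_left inner_diff_left pz qz t H_def algebra_simps)
    finally show ?thesis .
  qed
  have H0: "H \<ge> 0" using cn by (simp add: H_def)
  have Kn: "(y - z) \<bullet> n \<le> 0" "(y - z) \<bullet> n \<ge> - H" if y: "y \<in> K" for y
  proof -
    obtain u v w where w: "0 \<le> u" "0 \<le> v" "0 \<le> w" "u + v + w = 1" "y = u *\<^sub>R p + v *\<^sub>R q + w *\<^sub>R c" using coord[OF y] by blast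
    have "(y - z) \<bullet> n = - w * H" using nval[OF w(4)] w(5) by simp
    moreover have "w \<le> 1" using w by linarith
    ultimately show "(y - z) \<bullet> n \<le> 0" "(y - z) \<bullet> n \<ge> - H" using w(3) H0 mult_right_mono[of w 1 H] by auto
  qed
  have ball: "x + a *\<^sub>R w \<in> K" if "norm w = 1" "\<bar>a\<bar> \<le> r" for a w
    using that x(2) by (intro subsetD[OF x(2)]) (simp add: dist_norm)
  have "(x + r *\<^sub>R n - z) \<bullet> n \<le> 0" "(x + (-r) *\<^sub>R n - z) \<bullet> n \<ge> - H"
    using Kn(1)[OF ball[OF n, of r]] Kn(2)[OF ball[OF n, of "-r"]] x by auto
  then have H2: "H \<ge> 2 * r" using t by (simp add: inner_diff_left inner_add_left)
  have Hpos: "H > 0" using H2 x by linarith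
  have h2: "h \<ge> 2 * r"
  proof -
    obtain u v w where w: "0 \<le> u" "0 \<le> v" "0 \<le> w" "u + v + w = 1" "x + r *\<^sub>R tangent n = u *\<^sub>R p + v *\<^sub>R q + w *\<^sub>R c"
      using coord[OF ball[OF t(5), of r]] x by auto
    obtain u' v' w' where w': "0 \<le> u'" "0 \<le> v'" "0 \<le> w'" "u' + v' + w' = 1" "x + (-r) *\<^sub>R tangent n = u' *\<^sub>R p + v' *\<^sub>R q + w' *\<^sub>R c"
      using coord[OF ball[OF t(5), of "-r"]] x by auto
    have "(x + r *\<^sub>R tangent n - z) \<bullet> n = (x + (-r) *\<^sub>R tangent n - z) \<bullet> n" using t by (simp add: inner_diff_left inner_add_left)
    then have "w * H = w' * H" unfolding w(5) w'(5) nval[OF w(4)] nval[OF w'(4)] by simp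
    then have ww: "w = w'" using Hpos by simp
    have "(2 * r) *\<^sub>R tangent n = (x + r *\<^sub>R tangent n) - (x + (-r) *\<^sub>R tangent n)" by (simp add: vec_eq_iff)
    also have "\<dots> = (v - v') *\<^sub>R (q - p) + (u + v - (u' + v')) *\<^sub>R p" unfolding w(5) w'(5) ww by (simp add: algebra_simps)
    also have "u + v - (u' + v') = 0" using w(4) w'(4) ww by linarith
    finally have "(2 * r) *\<^sub>R tangent n = ((v - v') * (\<epsilon> * h)) *\<^sub>R tangent n" by (simp add: qp)
    moreover have "tangent n \<noteq> 0" using t(5) by auto
    ultimately have "2 * r = (v - v') * (\<epsilon> * h)" by (simp only: scaleR_cancel_right) blast
    also have "\<dots> \<le> \<bar>v - v'\<bar> * h" using eps h mult_right_mono[of "v - v'" "\<bar>v - v'\<bar>" h] mult_right_mono[of "v' - v" "\<bar>v - v'\<bar>" h]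
      by (auto simp: algebra_simps)
    also have "\<dots> \<le> 1 * h" using w w' h by (intro mult_right_mono) linarith+
    finally show ?thesis by simp
  qed
  have diam: "dist y y' \<le> 2 * \<kappa> * r" if "y \<in> K" "y' \<in> K" for y y'
    using diameter_bounded_bound[OF cK(3) that] d by simp
  have hk: "h \<le> 2 * \<kappa> * r" using diam[OF cK(5,6)] by (simp add: h_def dist_norm norm_minus_commute)
  have "1 * (2 * r) \<le> \<kappa> * (2 * r)" using hk h2 by linarith
  then show kap: "\<kappa> \<ge> 1" by (rule mult_right_le_imp_le) (use x in simp)
  have dE: "diameter E = h"
  proof (rule antisym)
    show "diameter E \<le> h"
    proof (rule diameter_le)
      fix y y' assume "y \<in> E" "y' \<in> E"
      then obtain a a' where a: "\<bar>a\<bar> \<le> h/2" "\<bar>a'\<bar> \<le> h/2" "y = z + a *\<^sub>R tangent n" "y' = z + a' *\<^sub>R tangent n"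
        unfolding Eset by blast
      have "y - y' = (a - a') *\<^sub>R tangent n" using a by (simp add: algebra_simps)
      then have "norm (y - y') = \<bar>a - a'\<bar>" using t(5) by simp
      then show "norm (y - y') \<le> h" using a by linarith
    qed (use zE in auto)
    have "bounded E" using EK cK(3) bounded_subset by blast
    then have "dist p q \<le> diameter E" by (rule diameter_bounded_bound) (auto simp: Epq)
    then show "h \<le> diameter E" by (simp add: h_def dist_norm norm_minus_commute)
  qed
  show "diameter E \<le> diameter K" using diameter_subset[OF EK cK(3)] .
  define \<theta> where "\<theta> = square_ratio \<kappa>"
  have th: "\<theta> > 0" "\<theta> * \<kappa> \<le> 1/8" "\<theta> * (1 + \<kappa>\<^sup>2) = 1/4"
  proof -
    show "\<theta> > 0" "\<theta> * \<kappa> \<le> 1/8" using square_ratio_bounds[of \<kappa>] kap by (auto simp: \<theta>_def)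
    have "0 < 1 + \<kappa>\<^sup>2" by (simp add: add_pos_nonneg)
    then show "\<theta> * (1 + \<kappa>\<^sup>2) = 1/4" by (simp add: \<theta>_def square_ratio_def)
  qed
  have half: "{y \<in> open_square z n (\<theta> * h). (y - z) \<bullet> n < 0} \<subseteq> K"
  proof
    fix y assume "y \<in> {y \<in> open_square z n (\<theta> * h). (y - z) \<bullet> n < 0}"
    then have y: "\<bar>(y - z) \<bullet> tangent n\<bar> < \<theta> * h" "\<bar>(y - z) \<bullet> n\<bar> < \<theta> * h" "(y - z) \<bullet> n < 0" by (auto simp: open_square_def)
    define \<sigma> \<tau> \<sigma>0 \<mu> where "\<sigma> = (y - z) \<bullet> tangent n" and "\<tau> = (y - z) \<bullet> n" and "\<sigma>0 = (c - z) \<bullet> tangent n" and "\<mu> = - \<tau> / H"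
    have yd: "y - z = \<sigma> *\<^sub>R tangent n + \<tau> *\<^sub>R n" unfolding \<sigma>_def \<tau>_def by (rule frame_decompose[OF n])
    have cd: "c - z = \<sigma>0 *\<^sub>R tangent n + (- H) *\<^sub>R n" using frame_decompose[OF n, of "c - z"] by (simp add: \<sigma>0_def H_def)
    have mu0: "\<mu> > 0" unfolding \<mu>_def \<tau>_def by (rule divide_pos_pos) (use y Hpos in auto)
    have mu1: "\<mu> \<le> \<theta> * \<kappa>"
    proof -
      have "- \<tau> \<le> \<theta> * h" using y by (simp add: \<tau>_def)
      also have "\<dots> \<le> \<theta> * (2 * \<kappa> * r)" using hk th by (intro mult_left_mono) auto
      also have "\<dots> = (\<theta> * \<kappa>) * (2 * r)" by simp
      also have "\<dots> \<le> (\<theta> * \<kappa>) * H" using H2 th kap by (intro mult_left_mono) auto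
      finally show ?thesis unfolding \<mu>_def by (simp only: pos_divide_le_eq[OF Hpos])
    qed
    have mu8: "\<mu> \<le> 1/8" using mu1 th by linarith
    have s0: "\<bar>\<sigma>0\<bar> \<le> \<kappa> * h"
    proof -
      have "\<bar>\<sigma>0\<bar> \<le> norm (c - z)" using Cauchy_Schwarz_ineq2[of "c - z" "tangent n"] t by (simp add: \<sigma>0_def)
      also have "\<dots> \<le> 2 * \<kappa> * r" using diam[of c z] cK zE EK by (auto simp: dist_norm)
      also have "\<dots> \<le> \<kappa> * h" using h2 kap mult_left_mono[of "2 * r" h \<kappa>] by simp
      finally show ?thesis .
    qed
    define \<xi> where "\<xi> = (\<sigma> - \<mu> * \<sigma>0) / (1 - \<mu>)"
    have "\<bar>\<sigma> - \<mu> * \<sigma>0\<bar> \<le> \<bar>\<sigma>\<bar> + \<mu> * \<bar>\<sigma>0\<bar>" using mu0 abs_triangle_ineq4[of \<sigma> "\<mu> * \<sigma>0"] by (simp add: abs_mult)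
    also have "\<dots> \<le> \<theta> * h + (\<theta> * \<kappa>) * (\<kappa> * h)" using y mu1 mu0 s0 th kap by (intro add_mono mult_mono) (auto simp: \<sigma>_def)
    also have "\<dots> = (\<theta> * (1 + \<kappa>\<^sup>2)) * h" by (simp add: algebra_simps power2_eq_square)
    also have "\<dots> = h / 4" by (subst th(3)) simp
    finally have num: "\<bar>\<sigma> - \<mu> * \<sigma>0\<bar> \<le> h / 4" .
    have "\<bar>\<xi>\<bar> = \<bar>\<sigma> - \<mu> * \<sigma>0\<bar> / (1 - \<mu>)" using mu8 by (simp add: \<xi>_def)
    also have "\<dots> \<le> (h / 4) / (1/2)" using num mu8 h by (intro frac_le) auto
    finally have "\<bar>\<xi>\<bar> \<le> h / 2" by simp
    then have e: "z + \<xi> *\<^sub>R tangent n \<in> K" using EK unfolding Eset by blast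
    have "\<mu> * H = - \<tau>" using Hpos by (simp add: \<mu>_def)
    moreover have "(1 - \<mu>) * \<xi> = \<sigma> - \<mu> * \<sigma>0" using mu8 by (simp add: \<xi>_def)
    ultimately have co: "\<mu> * \<sigma>0 + (1 - \<mu>) * \<xi> = \<sigma>" "- (\<mu> * H) = \<tau>" by simp_all
    have "\<mu> *\<^sub>R (c - z) + ((1 - \<mu>) * \<xi>) *\<^sub>R tangent n = (\<mu> * \<sigma>0 + (1 - \<mu>) * \<xi>) *\<^sub>R tangent n + (- (\<mu> * H)) *\<^sub>R n"
      unfolding cd by (simp add: vec_eq_iff algebra_simps)
    then have yz: "y - z = \<mu> *\<^sub>R (c - z) + ((1 - \<mu>) * \<xi>) *\<^sub>R tangent n" unfolding co yd by simp
    have "y = z + (y - z)" by simp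
    also have "\<dots> = \<mu> *\<^sub>R c + (1 - \<mu>) *\<^sub>R (z + \<xi> *\<^sub>R tangent n)" unfolding yz by (simp add: vec_eq_iff algebra_simps)
    finally have "y = \<mu> *\<^sub>R c + (1 - \<mu>) *\<^sub>R (z + \<xi> *\<^sub>R tangent n)" .
    then show "y \<in> K" using convexD[OF cK(1) cK(4) e, of \<mu> "1 - \<mu>"] mu0 mu8 by simp
  qed
  moreover have "open {y \<in> open_square z n (\<theta> * h). (y - z) \<bullet> n < 0}"
  proof -
    have "{y \<in> open_square z n (\<theta> * h). (y - z) \<bullet> n < 0} = open_square z n (\<theta> * h) \<inter> {y. (y - z) \<bullet> n < 0}" by auto
    moreover have "open (open_square z n (\<theta> * h) \<inter> {y. (y - z) \<bullet> n < 0})"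
      by (intro open_Int open_open_square open_Collect_less continuous_intros)
    ultimately show ?thesis by simp
  qed
  ultimately have half': "{y \<in> open_square z n (\<theta> * h). (y - z) \<bullet> n < 0} \<subseteq> interior K" by (rule interior_maximal)
  have "outward_normal K E = n"
    unfolding outward_normal_def
  proof (rule the_equality)
    have "n \<bullet> (y - x) \<le> 0" if xE: "x \<in> E" and yK: "y \<in> K" for x y
    proof -
      obtain a where "x = z + a *\<^sub>R tangent n" using xE unfolding Eset by blast
      then have "n \<bullet> (y - x) = (y - z) \<bullet> n" using t by (simp add: inner_diff_right inner_add_right inner_diff_left inner_commute)
      then show ?thesis using Kn(1)[OF yK] by simp
    qed
    then show "norm n = 1 \<and> (\<forall>x\<in>E. \<forall>y\<in>K. n \<bullet> (y - x) \<le> 0)" using n by blast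
    fix m assume m: "norm m = 1 \<and> (\<forall>x\<in>E. \<forall>y\<in>K. m \<bullet> (y - x) \<le> 0)"
    have pqE: "p \<in> E" "q \<in> E" by (auto simp: Epq)
    have "m \<bullet> (q - p) \<le> 0" "m \<bullet> (p - q) \<le> 0" using m pqE cK by auto
    then have "m \<bullet> (q - p) = 0" by (simp add: inner_diff_right)
    then have mt: "m \<bullet> tangent n = 0" using qp h eps by auto
    have mn: "m = (m \<bullet> n) *\<^sub>R n" using frame_decompose[OF n, of m] unfolding mt by (simp only: scaleR_zero_left add_0)
    have "norm m = \<bar>m \<bullet> n\<bar> * norm n" using arg_cong[OF mn, of norm] by (simp only: norm_scaleR)
    then have ab: "\<bar>m \<bullet> n\<bar> = 1" using m n by simp
    have "m \<bullet> (c - z) \<le> 0" using m zE cK by auto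
    moreover have "m \<bullet> (c - z) = (m \<bullet> n) * (n \<bullet> (c - z))"
      using arg_cong[OF mn, of "\<lambda>v. v \<bullet> (c - z)"] by (simp only: inner_scaleR_left)
    moreover have "n \<bullet> (c - z) = - H" by (simp add: H_def inner_commute)
    ultimately have "(m \<bullet> n) * H \<ge> 0" by simp
    then have "m \<bullet> n \<ge> 0" using Hpos by (simp add: zero_le_mult_iff)
    then have m1: "m \<bullet> n = 1" using ab by simp
    show "m = n" using mn unfolding m1 by simp
  qed
  then have on: "outward_normal K E = n" .
  show "edge_frame \<kappa> K E (outward_normal K E)"
    unfolding edge_frame_def on dE z_def[symmetric] \<theta>_def[symmetric]
    using n Kn(1) half' Eset h by blast
qed

section \<open>Triangulations\<close>

text \<open>The intersection of the two triangles is a face of each; if it contains an interior point of one of them it is that triangle, and a triangle has no proper face of dimension two.\<close>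

lemma mesh_interior_unique:
  assumes tr: "triangulation \<C>" and s2: "\<forall>K\<in>\<C>. 2 simplex K" and K: "K \<in> \<C>" "K' \<in> \<C>" and y: "y \<in> interior K" "y \<in> K'"
  shows "K = K'"
proof -
  have f: "(K \<inter> K') face_of K" "(K' \<inter> K) face_of K'" using tr K by (auto simp: triangulation_def)
  have "K \<inter> K' = K" using face_of_disjoint_interior[OF f(1)] y interior_subset by blast
  then have fK: "K face_of K'" using f(2) by (simp add: Int_commute)
  have "aff_dim K = 2" "aff_dim K' = 2" using s2 K aff_dim_simplex by blast+
  then show ?thesis using face_of_aff_dim_lt[OF convex_simplex fK, of 2] s2 K by force
qed

text \<open>A face that contains a relative interior point of a segment in \<open>S\<close> contains its end points.\<close>

lemma face_contains_edge:
  fixes z v :: plane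
  assumes F: "F face_of S" and E: "E = {z + t *\<^sub>R v |t. \<bar>t\<bar> \<le> l}" "E \<subseteq> S" and l: "l > 0" "v \<noteq> 0"
    and a: "\<bar>a\<bar> < l" "z + a *\<^sub>R v \<in> F"
  shows "E \<subseteq> F"
proof
  define p q where "p = z - l *\<^sub>R v" and "q = z + l *\<^sub>R v"
  have seg: "z + t *\<^sub>R v = (1 - (t + l) / (2 * l)) *\<^sub>R p + ((t + l) / (2 * l)) *\<^sub>R q" for t
  proof -
    have "(1 - (t + l) / (2 * l)) *\<^sub>R p + ((t + l) / (2 * l)) *\<^sub>R q = z + (2 * l * ((t + l) / (2 * l)) - l) *\<^sub>R v"
      using l by (simp add: p_def q_def vec_eq_iff field_simps)
    also have "2 * l * ((t + l) / (2 * l)) - l = t" using l by simp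
    finally show ?thesis by simp
  qed
  have pS: "p \<in> S" "q \<in> S"
  proof -
    have "z + (- l) *\<^sub>R v \<in> E" unfolding E(1) using l by (intro CollectI exI[of _ "- l"]) simp
    moreover have "z + l *\<^sub>R v \<in> E" unfolding E(1) using l by (intro CollectI exI[of _ l]) simp
    ultimately
    show "p \<in> S" "q \<in> S" using E(2) by (auto simp: p_def q_def)
  qed
  have "p \<noteq> q"
  proof
    assume "p = q"
    then have "q - p = 0" by simp
    moreover have "q - p = (2 * l) *\<^sub>R v" by (simp add: p_def q_def vec_eq_iff)
    ultimately show False using l by simp
  qed
  moreover have "0 < (a + l) / (2 * l)" "(a + l) / (2 * l) < 1" using a l by (auto simp: field_simps abs_less_iff)
  ultimately have "z + a *\<^sub>R v \<in> open_segment p q" using seg[of a] by (auto simp: in_segment intro!: exI[of _ "(a + l) / (2 * l)"])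
  then have pF: "p \<in> F" "q \<in> F" using F a(2) pS unfolding face_of_def by blast+
  fix y assume "y \<in> E"
  then obtain t where t: "\<bar>t\<bar> \<le> l" "y = z + t *\<^sub>R v" using E by blast
  have "0 \<le> (t + l) / (2 * l)" "(t + l) / (2 * l) \<le> 1" using t l by (auto simp: field_simps abs_le_iff)
  then have "y \<in> closed_segment p q" using seg[of t] t by (auto simp: in_segment intro!: exI[of _ "(t + l) / (2 * l)"])
  then show "y \<in> F" using closed_segment_subset[OF pF face_of_imp_convex[OF F]] by blast
qed

lemma edge_frame_line:
  assumes "edge_frame \<kappa> K E n"
  shows "E = {edge_mid E + t *\<^sub>R tangent n |t. \<bar>t\<bar> \<le> diameter E / 2}" "0 < diameter E / 2" "tangent n \<noteq> 0"
    "norm n = 1" "n = outward_normal K E" "edge_mid E \<in> E"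
proof -
  show 1: "E = {edge_mid E + t *\<^sub>R tangent n |t. \<bar>t\<bar> \<le> diameter E / 2}" and 2: "0 < diameter E / 2" and n: "norm n = 1"
    and "n = outward_normal K E"
    using assms unfolding edge_frame_def by auto
  show "tangent n \<noteq> 0" using tangent_simps(5)[OF n] by auto
  have "edge_mid E = edge_mid E + 0 *\<^sub>R tangent n" by simp
  then show "edge_mid E \<in> E" using 1 2 by (metis (mono_tags, lifting) abs_zero less_imp_le mem_Collect_eq)
qed

lemma edge_frame_mem:
  "edge_frame \<kappa> K E n \<Longrightarrow> \<bar>a\<bar> \<le> diameter E / 2 \<Longrightarrow> edge_mid E + a *\<^sub>R tangent n \<in> E"
  using edge_frame_line(1) by blast

text \<open>The intersection of the two elements is a face of each and contains an inner point of \<open>E\<close>, hence all of \<open>E\<close>; it has dimension one, so it is \<open>E\<close>.\<close>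

lemma mesh_edge_shared:
  assumes tr: "triangulation \<C>" and s2: "\<forall>K\<in>\<C>. 2 simplex K" and K: "K \<in> \<C>" "K' \<in> \<C>" and E: "E edge_of K"
    and ef: "edge_frame \<kappa> K E n" and a: "\<bar>a\<bar> < diameter E / 2" "edge_mid E + a *\<^sub>R tangent n \<in> K'"
  shows "E edge_of K'"
proof (cases "K = K'")
  case False
  have f: "(K \<inter> K') face_of K" "(K' \<inter> K) face_of K'" using tr K by (auto simp: triangulation_def)
  note el = edge_frame_line[OF ef]
  have EK: "E \<subseteq> K" using E edge_of_imp_subset by blast
  have y: "edge_mid E + a *\<^sub>R tangent n \<in> K \<inter> K'" using EK edge_frame_mem[OF ef less_imp_le[OF a(1)]] a(2) by blast
  have EF: "E \<subseteq> K \<inter> K'" by (rule face_contains_edge[OF f(1) el(1) EK el(2,3) a(1) y])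
  have ad: "aff_dim K = 2" "aff_dim K' = 2" using s2 K aff_dim_simplex by blast+
  have cv: "convex K" "convex K'" using s2 K convex_simplex by blast+
  have "K \<inter> K' \<noteq> K"
  proof
    assume "K \<inter> K' = K"
    then have "K face_of K'" using f(2) by (simp add: Int_commute)
    then show False using face_of_aff_dim_lt[OF cv(2)] ad False by force
  qed
  then have lt: "aff_dim (K \<inter> K') < 2" using face_of_aff_dim_lt[OF cv(1) f(1)] ad by simp
  have fE: "E face_of (K \<inter> K')" using E EF face_of_subset[of E K "K \<inter> K'"] by (auto simp: edge_of_def)
  have "E = K \<inter> K'"
  proof (rule ccontr)
    assume "E \<noteq> K \<inter> K'"
    then have "aff_dim E < aff_dim (K \<inter> K')" using face_of_aff_dim_lt[OF _ fE] cv convex_Int by blast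
    then show False using lt E by (simp add: edge_of_def)
  qed
  then show ?thesis using f(2) E by (simp add: Int_commute edge_of_def)
qed (use E in simp)

lemma square_cases:
  assumes ef: "edge_frame \<kappa> K E n" and y: "y \<in> open_square (edge_mid E) n (square_ratio \<kappa> * diameter E)"
  shows "(y - edge_mid E) \<bullet> n < 0 \<Longrightarrow> y \<in> interior K"
    and "(y - edge_mid E) \<bullet> n = 0 \<Longrightarrow> \<exists>a. \<bar>a\<bar> < diameter E / 2 \<and> y = edge_mid E + a *\<^sub>R tangent n"
proof -
  show "(y - edge_mid E) \<bullet> n < 0 \<Longrightarrow> y \<in> interior K" using ef y unfolding edge_frame_def by blast
  assume 0: "(y - edge_mid E) \<bullet> n = 0"
  have n: "norm n = 1" and d: "0 < diameter E" using edge_frame_line[OF ef] by auto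
  have "y - edge_mid E = ((y - edge_mid E) \<bullet> tangent n) *\<^sub>R tangent n" using frame_decompose[OF n, of "y - edge_mid E"] 0 by simp
  then have ye: "y = edge_mid E + ((y - edge_mid E) \<bullet> tangent n) *\<^sub>R tangent n" by (metis add.commute diff_add_cancel)
  have "square_ratio \<kappa> * diameter E \<le> 1/4 * diameter E" using square_ratio_bounds(2)[of \<kappa>] d by (intro mult_right_mono) auto
  moreover have "\<bar>(y - edge_mid E) \<bullet> tangent n\<bar> < square_ratio \<kappa> * diameter E" using y by (simp add: open_square_def)
  ultimately have "\<bar>(y - edge_mid E) \<bullet> tangent n\<bar> < diameter E / 2" using d by linarith
  then show "\<exists>a. \<bar>a\<bar> < diameter E / 2 \<and> y = edge_mid E + a *\<^sub>R tangent n" using ye by blast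
qed

lemma open_square_uminus: "open_square z (- n) \<rho> = open_square z n \<rho>"
  by (simp add: open_square_def tangent_uminus)

text \<open>Both unit normals are orthogonal to \<open>E\<close>. Were they equal, the two elements would contain the same half square.\<close>

lemma opposite_normals:
  assumes tr: "triangulation \<C>" and s2: "\<forall>K\<in>\<C>. 2 simplex K" and K: "K \<in> \<C>" "K' \<in> \<C>" "K \<noteq> K'"
    and ef: "edge_frame \<kappa> K E n" "edge_frame \<kappa> K' E n'"
  shows "n' = - n"
proof -
  define z h where "z = edge_mid E" and "h = diameter E"
  have n: "norm n = 1" "norm n' = 1" and h: "h > 0" using ef unfolding edge_frame_def h_def by auto
  note t = tangent_simps[OF n(1)]
  have "z + (h/2) *\<^sub>R tangent n' \<in> E" using edge_frame_mem[OF ef(2), of "h/2"] h unfolding z_def h_def by simp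
  then obtain a where "z + (h/2) *\<^sub>R tangent n' = z + a *\<^sub>R tangent n"
    using edge_frame_line(1)[OF ef(1)] unfolding z_def h_def by blast
  then have "(h/2) *\<^sub>R tangent n' = a *\<^sub>R tangent n" by simp
  then have "((h/2) *\<^sub>R tangent n') \<bullet> n = 0" using t by simp
  then have tn: "tangent n' \<bullet> n = 0" using h by simp
  then have tn': "n' \<bullet> tangent n = 0" by (simp add: tangent_def inner_vec_def sum_2 algebra_simps)
  then have eq: "n' = (n' \<bullet> n) *\<^sub>R n" using frame_decompose[OF n(1), of n'] by simp
  have "norm n' = \<bar>n' \<bullet> n\<bar> * norm n" using arg_cong[OF eq, of norm] by (simp only: norm_scaleR)
  then have "\<bar>n' \<bullet> n\<bar> = 1" using n by simp
  then have "n' \<bullet> n = 1 \<or> n' \<bullet> n = -1" by linarith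
  then have "n' = n \<or> n' = - n" using eq by (metis scaleR_minus1_left scaleR_one)
  moreover have "n' \<noteq> n"
  proof
    assume nn: "n' = n"
    define \<rho> where "\<rho> = square_ratio \<kappa> * h"
    have r: "\<rho> > 0" using h square_ratio_bounds(1) by (simp add: \<rho>_def)
    define y where "y = z - (\<rho>/2) *\<^sub>R n"
    have y: "y \<in> open_square z n \<rho>" "(y - z) \<bullet> n < 0" using r t by (auto simp: y_def open_square_def)
    have "y \<in> interior K" "y \<in> interior K'" using ef y nn unfolding edge_frame_def z_def h_def \<rho>_def by blast+
    then show False using mesh_interior_unique[OF tr s2 K(1,2)] K(3) interior_subset by blast
  qed
  ultimately show ?thesis by blast
qed

text \<open>Below the line the square consists of interior points of \<open>K\<close>, on the line of inner points of \<open>E\<close>, and neither kind of point lies on another edge.\<close>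

lemma other_edge_avoids_square:
  assumes tr: "triangulation \<C>" and s2: "\<forall>K\<in>\<C>. 2 simplex K" and K: "K \<in> \<C>" "E edge_of K" and ef: "edge_frame \<kappa> K E n"
    and E': "K1 \<in> \<C>" "E' edge_of K1" "E' \<noteq> E"
    and y: "y \<in> E'" "y \<in> open_square (edge_mid E) n (square_ratio \<kappa> * diameter E)"
  shows "(y - edge_mid E) \<bullet> n > 0"
proof (rule ccontr)
  assume "\<not> (y - edge_mid E) \<bullet> n > 0"
  then consider "(y - edge_mid E) \<bullet> n < 0" | "(y - edge_mid E) \<bullet> n = 0" by linarith
  then show False
  proof cases
    case 1
    then have yi: "y \<in> interior K" using square_cases(1)[OF ef y(2)] by blast
    have yK1: "y \<in> K1" using y(1) E' edge_of_imp_subset by blast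
    then have "K = K1" using mesh_interior_unique[OF tr s2 K(1) E'(1) yi] by blast
    then have "E' face_of K" "E' \<noteq> K" using E' s2 K(1) aff_dim_simplex[of 2 K] by (auto simp: edge_of_def)
    then show False using face_of_disjoint_interior yi y(1) by blast
  next
    case 2
    then obtain a where a: "\<bar>a\<bar> < diameter E / 2" "y = edge_mid E + a *\<^sub>R tangent n" using square_cases(2)[OF ef y(2)] by blast
    have yK1: "y \<in> K1" using y(1) E' edge_of_imp_subset by blast
    then have EK1: "E edge_of K1" using mesh_edge_shared[OF tr s2 K(1) E'(1) K(2) ef a(1)] a(2) by simp
    note el = edge_frame_line[OF ef]
    have sub: "E \<subseteq> E'"
    proof (rule face_contains_edge[OF _ el(1) _ el(2,3) a(1)])
      show "E' face_of K1" using E' by (simp add: edge_of_def)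
      show "E \<subseteq> K1" using EK1 edge_of_imp_subset by blast
      show "edge_mid E + a *\<^sub>R tangent n \<in> E'" using y(1) a(2) by simp
    qed
    have "E face_of E'" using face_of_subset[OF _ sub, of K1] EK1 E' by (auto simp: edge_of_def face_of_imp_subset)
    moreover have "convex E'" using E' face_of_imp_convex by (auto simp: edge_of_def)
    ultimately show False using face_of_aff_dim_lt[of E' E] E' EK1 by (auto simp: edge_of_def)
  qed
qed

lemma vertex_avoids_square:
  assumes tr: "triangulation \<C>" and s2: "\<forall>K\<in>\<C>. 2 simplex K" and K: "K \<in> \<C>" "E edge_of K" and ef: "edge_frame \<kappa> K E n"
    and x: "K1 \<in> \<C>" "x extreme_point_of K1"
    and y: "x \<in> open_square (edge_mid E) n (square_ratio \<kappa> * diameter E)"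
  shows "(x - edge_mid E) \<bullet> n > 0"
proof (rule ccontr)
  have fx: "{x} face_of K1" using x by (simp add: face_of_singleton)
  have xK1: "x \<in> K1" using x by (simp add: extreme_point_of_def)
  assume "\<not> (x - edge_mid E) \<bullet> n > 0"
  then consider "(x - edge_mid E) \<bullet> n < 0" | "(x - edge_mid E) \<bullet> n = 0" by linarith
  then show False
  proof cases
    case 1
    then have yi: "x \<in> interior K" using square_cases(1)[OF ef y] by blast
    then have "K = K1" using mesh_interior_unique[OF tr s2 K(1) x(1) yi xK1] by blast
    then have "{x} face_of K" "{x} \<noteq> K" using fx s2 K(1) aff_dim_simplex[of 2 K] by (auto simp: aff_dim_sing)
    then show False using face_of_disjoint_interior yi by blast
  next
    case 2
    then obtain a where a: "\<bar>a\<bar> < diameter E / 2" "x = edge_mid E + a *\<^sub>R tangent n" using square_cases(2)[OF ef y] by blast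
    then have EK1: "E edge_of K1" using mesh_edge_shared[OF tr s2 K(1) x(1) K(2) ef a(1)] xK1 by simp
    note el = edge_frame_line[OF ef]
    have "E \<subseteq> {x}"
    proof (rule face_contains_edge[OF fx el(1) _ el(2,3) a(1)])
      show "E \<subseteq> K1" using EK1 edge_of_imp_subset by blast
      show "edge_mid E + a *\<^sub>R tangent n \<in> {x}" using a(2) by simp
    qed
    then have "aff_dim E \<le> aff_dim {x}" by (rule aff_dim_subset)
    then show False using EK1 by (simp add: edge_of_def)
  qed
qed

section \<open>Uniqueness of the element polynomials\<close>

text \<open>Change of variables to the scaled frame, with Jacobian \<open>\<rho>\<^sup>2\<close>.\<close>

lemma sum_frame_integral:
  fixes w :: field
  assumes n: "norm n = 1" and r: "\<rho> > 0" and w: "continuous_on UNIV w"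
  shows "(\<integral>x. w x \<partial>lborel) = \<rho>\<^sup>2 * (\<integral>p. w (frame z n (\<rho> * fst p, \<rho> * snd p)) \<partial>(lborel \<Otimes>\<^sub>M lborel))"
proof -
  have wm[measurable]: "w \<in> borel_measurable borel" using w by (rule borel_measurable_continuous_onI)
  have scale: "(lborel :: (real \<times> real) measure) = density (distr lborel borel (\<lambda>x. 0 + (\<Sum>j\<in>Basis. (\<rho> * (x \<bullet> j)) *\<^sub>R j))) (\<lambda>_. (\<Prod>j\<in>(Basis :: (real \<times> real) set). \<bar>\<rho>\<bar>))"
    by (rule lborel_affine_euclidean[of "\<lambda>_. \<rho>" 0]) (use r in auto)
  have T: "(\<lambda>x :: real \<times> real. 0 + (\<Sum>j\<in>Basis. (\<rho> * (x \<bullet> j)) *\<^sub>R j)) = (\<lambda>x. \<rho> *\<^sub>R x)"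
  proof
    fix x :: "real \<times> real"
    have "(\<Sum>j\<in>Basis. (\<rho> * (x \<bullet> j)) *\<^sub>R j) = \<rho> *\<^sub>R (\<Sum>j\<in>Basis. (x \<bullet> j) *\<^sub>R j)" by (simp add: scaleR_sum_right)
    then show "0 + (\<Sum>j\<in>Basis. (\<rho> * (x \<bullet> j)) *\<^sub>R j) = \<rho> *\<^sub>R x" by (simp add: euclidean_representation)
  qed
  have c: "(\<Prod>j\<in>(Basis :: (real \<times> real) set). \<bar>\<rho>\<bar>) = \<rho>\<^sup>2" using r by (simp add: power2_eq_square)
  have fm: "(\<lambda>p. w (frame z n p)) \<in> borel_measurable borel"
    by (intro borel_measurable_continuous_onI continuous_on_compose2[OF w]) (auto simp: frame_def intro!: continuous_intros)
  have "(\<integral>x. w x \<partial>lborel) = (\<integral>p. w (frame z n p) \<partial>(lborel :: (real \<times> real) measure))"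
    by (subst integral_frame(1)[OF n, of _ z]) (auto simp: lborel_prod)
  also have "\<dots> = (\<integral>p. w (frame z n p) \<partial>density (distr lborel borel (\<lambda>x. \<rho> *\<^sub>R x)) (\<lambda>_. ennreal (\<rho>\<^sup>2)))"
    by (subst scale) (simp only: T c)
  also have "\<dots> = (\<integral>p. \<rho>\<^sup>2 *\<^sub>R w (frame z n p) \<partial>distr lborel borel (\<lambda>x. \<rho> *\<^sub>R x))"
    using fm by (subst integral_density) auto
  also have "\<dots> = (\<integral>p. \<rho>\<^sup>2 *\<^sub>R w (frame z n (\<rho> *\<^sub>R p)) \<partial>lborel)"
    using fm by (subst integral_distr) auto
  finally show ?thesis by (simp add: lborel_prod frame_def)
qed

text \<open>The weighted integral of the square vanishes, hence all coefficients do.\<close>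

lemma poly_le_zero_on_square:
  assumes p: "poly_le M d" and n: "norm n = 1" and r: "\<rho> > 0" and z: "\<And>x. x \<in> open_square z n \<rho> \<Longrightarrow> d x = 0"
  shows "d = (\<lambda>x. 0)"
proof
  fix x
  obtain C where C: "C > 0" "\<And>c i j. i \<le> M \<Longrightarrow> j \<le> M \<Longrightarrow> (c i j)\<^sup>2 \<le> C * (\<integral>p. weight (fst p) * weight (snd p) *
      (\<Sum>i\<le>M. \<Sum>j\<le>M. c i j * fst p ^ i * snd p ^ j)\<^sup>2 \<partial>(lborel \<Otimes>\<^sub>M lborel))"
    using coeff_le_weighted_L2_plane[of M] by blast
  obtain c where c: "\<And>a b. d (frame z n (\<rho> * a, \<rho> * b)) = (\<Sum>i\<le>M. \<Sum>j\<le>M. c i j * a ^ i * b ^ j)"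
    by (rule poly_le_frame[OF p, of z n \<rho>]) blast
  have W: "weight a * weight b * (\<Sum>i\<le>M. \<Sum>j\<le>M. c i j * a ^ i * b ^ j)\<^sup>2 = 0" for a b
  proof (cases "\<bar>a\<bar> < 1 \<and> \<bar>b\<bar> < 1")
    case True
    then have "frame z n (\<rho> * a, \<rho> * b) \<in> open_square z n \<rho>"
      using r by (simp add: open_square_def frame_coords[OF n] abs_mult)
    then show ?thesis using z[of "frame z n (\<rho> * a, \<rho> * b)"] c[of a b] by simp
  qed (auto simp: weight_eq)
  have "(c i j)\<^sup>2 \<le> 0" if "i \<le> M" "j \<le> M" for i j
    using C(2)[OF that, of c] unfolding W by simp
  then have c0: "c i j = 0" if "i \<le> M" "j \<le> M" for i j using that by simp
  define a b where "a = (x - z) \<bullet> tangent n / \<rho>" and "b = (x - z) \<bullet> n / \<rho>"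
  have "x = z + (x - z)" by simp
  also have "x - z = (\<rho> * a) *\<^sub>R tangent n + (\<rho> * b) *\<^sub>R n" using frame_decompose[OF n, of "x - z"] r by (simp add: a_def b_def)
  finally have "x = frame z n (\<rho> * a, \<rho> * b)" by (simp add: frame_def add.assoc)
  then show "d x = 0" using c[of a b] c0 by simp
qed

text \<open>Two polynomials that agree on \<open>K\<close> agree on a square inside the disc. This justifies the definite description.\<close>

lemma elem_poly_eq:
  assumes p: "poly_le m p" "\<And>x. x \<in> K \<Longrightarrow> v x = p x" and x: "r > 0" "cball x r \<subseteq> K"
  shows "elem_poly v K = p"
  unfolding elem_poly_def
proof (rule the_equality)
  show "(\<exists>m. poly_le m p) \<and> (\<forall>x\<in>K. p x = v x)" using p by auto
  fix q assume q: "(\<exists>m. poly_le m q) \<and> (\<forall>x\<in>K. q x = v x)"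
  then obtain m' where m': "poly_le m' q" by blast
  have d: "poly_le (max m m') (\<lambda>x. q x - p x)"
    using poly_le_mono[OF p(1), of "max m m'"] poly_le_mono[OF m', of "max m m'"] by (intro poly_le_diff) auto
  have n1: "norm (axis 1 1 :: plane) = 1" by simp
  have "(\<lambda>x. q x - p x) = (\<lambda>x. 0)"
  proof (rule poly_le_zero_on_square[OF d n1, of "r/2" x])
    fix y assume "y \<in> open_square x (axis 1 1) (r/2)"
    then have "norm (y - x) < r" using open_square_norm[OF n1, of y x "r/2"] by simp
    then have "y \<in> K" using x by (auto simp: dist_norm norm_minus_commute)
    then show "q y - p y = 0" using p q by auto
  qed (use x in auto)
  then show "q = p" by (auto simp: fun_eq_iff)
qed

section \<open>Integrals over pieces\<close>

lemma integral_pieces: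
  fixes h :: field
  assumes o: "\<Omega> \<in> sets lebesgue" and f: "finite \<K>" and I: "\<And>K. K \<in> \<K> \<Longrightarrow> I K \<subseteq> \<Omega>" "\<And>K. K \<in> \<K> \<Longrightarrow> I K \<in> sets lebesgue"
    and D: "\<And>K. K \<in> \<K> \<Longrightarrow> integrable (lebesgue_on (I K)) (D K)"
    and h: "AE x in lebesgue_on \<Omega>. h x = (\<Sum>K\<in>\<K>. indicator (I K) x * D K x)"
  shows "(\<integral>x. h x \<partial>lebesgue_on \<Omega>) = (\<Sum>K\<in>\<K>. \<integral>x. D K x \<partial>lebesgue_on (I K))"
proof -
  have 1: "(\<integral>x. indicator (I K) x * D K x \<partial>lebesgue_on \<Omega>) = (\<integral>x. D K x \<partial>lebesgue_on (I K))"
    "integrable (lebesgue_on \<Omega>) (\<lambda>x. indicator (I K) x * D K x)" if K: "K \<in> \<K>" for K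
  proof -
    have "(\<integral>x. indicator (I K) x * D K x \<partial>lebesgue_on \<Omega>) = (\<integral>x. indicator (I K) x * D K x \<partial>lebesgue_on (I K))"
      using I[OF K] o by (intro integral_on_subset) auto
    also have "\<dots> = (\<integral>x. D K x \<partial>lebesgue_on (I K))" by (intro Bochner_Integration.integral_cong) auto
    finally show "(\<integral>x. indicator (I K) x * D K x \<partial>lebesgue_on \<Omega>) = (\<integral>x. D K x \<partial>lebesgue_on (I K))" .
    have "integrable (lebesgue_on (I K)) (\<lambda>x. indicator (I K) x * D K x) \<longleftrightarrow> integrable (lebesgue_on (I K)) (D K)"
      by (intro Bochner_Integration.integrable_cong) auto
    then show "integrable (lebesgue_on \<Omega>) (\<lambda>x. indicator (I K) x * D K x)"
      using D[OF K] I[OF K] o by (subst integral_on_subset(2)[of "I K"]) auto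
  qed
  have "(\<integral>x. h x \<partial>lebesgue_on \<Omega>) = (\<integral>x. (\<Sum>K\<in>\<K>. indicator (I K) x * D K x) \<partial>lebesgue_on \<Omega>)"
    using h o by (rule integral_AE_on)
  also have "\<dots> = (\<Sum>K\<in>\<K>. \<integral>x. indicator (I K) x * D K x \<partial>lebesgue_on \<Omega>)"
    using 1(2) by (rule Bochner_Integration.integral_sum)
  finally show ?thesis using 1(1) by simp
qed

lemma L2_test_bound:
  assumes S: "S \<in> sets lebesgue" and g: "g \<in> L2 S" and U: "U \<in> lmeasurable"
    and w: "smooth w" "\<And>x. \<bar>w x\<bar> \<le> W" "\<And>x. x \<notin> U \<Longrightarrow> w x = 0"
  shows "integrable (lebesgue_on S) (\<lambda>x. g x * w x)"
    "\<bar>\<integral>x. g x * w x \<partial>lebesgue_on S\<bar> \<le> W * sqrt (measure lebesgue U) * L2norm S g"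
proof -
  note lb = L2_local_bound[OF S g S _ U]
  have W0: "W \<ge> 0" using w(2)[of 0] by linarith
  have b: "\<bar>g x * w x\<bar> \<le> W * (indicator (U \<inter> S) x * \<bar>g x\<bar>)" if "x \<in> S" for x
  proof (cases "x \<in> U")
    case True
    then show ?thesis using that mult_right_mono[OF w(2)[of x], of "\<bar>g x\<bar>"] by (simp add: abs_mult mult.commute[of "\<bar>g x\<bar>"])
  qed (simp add: w(3))
  have ib: "integrable (lebesgue_on S) (\<lambda>x. W * (indicator (U \<inter> S) x * \<bar>g x\<bar>))" using lb(1) by simp
  have gm: "g \<in> borel_measurable (lebesgue_on S)" using g by (simp add: L2_def)
  have wm: "w \<in> borel_measurable (lebesgue_on S)" by (rule borel_measurable_lebesgue_on[OF smooth_continuous[OF w(1)]])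
  show i: "integrable (lebesgue_on S) (\<lambda>x. g x * w x)"
    by (rule Bochner_Integration.integrable_bound[OF ib])
       (use gm wm b W0 in \<open>auto intro!: AE_I2 borel_measurable_times\<close>)
  have "\<bar>\<integral>x. g x * w x \<partial>lebesgue_on S\<bar> \<le> (\<integral>x. \<bar>g x * w x\<bar> \<partial>lebesgue_on S)" by (rule integral_abs_bound)
  also have "\<dots> \<le> (\<integral>x. W * (indicator (U \<inter> S) x * \<bar>g x\<bar>) \<partial>lebesgue_on S)"
    by (intro Bochner_Integration.integral_mono ib integrable_abs i) (use b in auto)
  also have "\<dots> = W * (\<integral>x. indicator (U \<inter> S) x * \<bar>g x\<bar> \<partial>lebesgue_on S)" by simp
  also have "\<dots> \<le> W * (sqrt (measure lebesgue U) * L2norm S g)" using lb(2) W0 by (intro mult_left_mono) auto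
  finally show "\<bar>\<integral>x. g x * w x \<partial>lebesgue_on S\<bar> \<le> W * sqrt (measure lebesgue U) * L2norm S g" by (simp add: mult.assoc)
qed

lemma L2norm_interior:
  assumes "convex K" "closed K"
  shows "L2norm (interior K) g = L2norm K g"
proof -
  have "frontier K = K - interior K" using assms(2) by (simp add: frontier_def)
  then have "negligible (K - interior K)" using negligible_convex_frontier[OF assms(1)] by simp
  moreover have "interior K - K = {}" using interior_subset by blast
  ultimately show ?thesis unfolding L2norm_def
    using assms by (subst integral_on_null_diff[of "interior K" K]) (auto simp: borel_closed)
qed

lemma smooth_density:
  assumes "smooth p" "smooth w" shows "smooth (\<lambda>x. moment P pd p x \<bullet> curvature pd w x)"
  unfolding density_eq curvature_component by (intro smooth_intros assms)

text \<open>Inside the square \<open>K\<close> is a half plane up to a null set, and the test function sees nothing else of \<open>K\<close>.\<close>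

lemma green_element:
  assumes n: "norm n = 1" and p: "smooth p" and r: "\<rho> > 0" and w: "supported_in (open_square z n \<rho>) w"
    and I: "{y \<in> open_square z n \<rho>. (y - z) \<bullet> n < 0} \<subseteq> I" "\<And>y. y \<in> I \<Longrightarrow> (y - z) \<bullet> n \<le> 0" "I \<in> sets borel"
  shows "(\<integral>x. moment P pd p x \<bullet> curvature pd w x \<partial>lebesgue_on I)
     = (\<integral>x. plate_op P p x * w x \<partial>lebesgue_on I) + line_int z n (\<lambda>x. V_n P n p x * w x - M_nn P n p x * (grad pd w x \<bullet> n))"
proof -
  have sw: "smooth w" and w0: "\<And>x. x \<notin> open_square z n \<rho> \<Longrightarrow> w x = 0" using w by (auto simp: supported_in_def)
  have sup: "w x \<noteq> 0 \<Longrightarrow> norm (x - z) \<le> 2 * \<rho>" for x using w0[of x] open_square_norm[OF n, of x z \<rho>] by fastforce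
  have *: "(\<integral>x. q x \<partial>lebesgue_on I) = (\<integral>x. indicator (halfplane z n) x * q x \<partial>lborel)" if q: "supported_in (open_square z n \<rho>) q" for q
  proof -
    have qm: "q \<in> borel_measurable borel" using q by (auto simp: supported_in_def intro!: borel_measurable_continuous_onI smooth_continuous)
    have "n \<noteq> 0" using n by auto
    then have "negligible {x. n \<bullet> x = n \<bullet> z}" by (intro negligible_hyperplane) simp
    then have "AE x in lebesgue. x \<notin> {x. n \<bullet> x = n \<bullet> z}" by (rule AE_not_negligible)
    then have ae: "AE x in lebesgue. indicator I x * q x = indicator (halfplane z n) x * q x"
    proof eventually_elim
      case (elim x)
      then have ne: "(x - z) \<bullet> n \<noteq> 0" by (simp add: inner_diff_left inner_diff_right inner_commute[of _ n])
      show ?case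
      proof (cases "x \<in> open_square z n \<rho>")
        case True
        then have "x \<in> I \<longleftrightarrow> x \<in> halfplane z n" using I(1) I(2)[of x] ne by (auto simp: halfplane_def)
        then show ?thesis by (simp add: indicator_def)
      next
        case False
        then have "q x = 0" using q by (simp add: supported_in_def)
        then show ?thesis by simp
      qed
    qed
    have m1: "(\<lambda>x. indicator I x * q x) \<in> borel_measurable lborel" using qm I(3) by auto
    have m2: "(\<lambda>x. indicator (halfplane z n) x * q x) \<in> borel_measurable lborel" using qm halfplane_borel by auto
    have "(\<integral>x. q x \<partial>lebesgue_on I) = (\<integral>x. indicator I x * q x \<partial>lborel)"
      by (rule integral_lebesgue_on_lborel[OF qm I(3)])
    also have "\<dots> = (\<integral>x. indicator I x * q x \<partial>lebesgue)" using m1 by (rule integral_completion[symmetric])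
    also have "\<dots> = (\<integral>x. indicator (halfplane z n) x * q x \<partial>lebesgue)"
      using ae m1 m2 by (intro integral_cong_AE) (auto intro: measurable_completion)
    also have "\<dots> = (\<integral>x. indicator (halfplane z n) x * q x \<partial>lborel)" using m2 by (rule integral_completion)
    finally show ?thesis .
  qed
  have pdw: "x \<notin> open_square z n \<rho> \<Longrightarrow> pd j (pd i w) x = 0" for x i j
    using supported_in_pd[OF regular_open_square supported_in_pd[OF regular_open_square w]] by (auto simp: supported_in_def)
  have s1: "supported_in (open_square z n \<rho>) (\<lambda>x. moment P pd p x \<bullet> curvature pd w x)"
    using pdw smooth_density[OF p sw] by (auto simp: supported_in_def density_eq curvature_component)
  have s2: "supported_in (open_square z n \<rho>) (\<lambda>x. plate_op P p x * w x)"
    using w0 smooth_mult[OF smooth_plate_op[OF p] sw] by (auto simp: supported_in_def)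
  show ?thesis unfolding *[OF s1] *[OF s2] by (rule green_halfplane[OF n p sw sup])
qed

section \<open>The discrete problem\<close>

lemma L2norm_triangle:
  assumes "f \<in> L2 A" "g \<in> L2 A"
  shows "L2norm A (\<lambda>x. f x + g x) \<le> L2norm A f + L2norm A g"
proof -
  have m: "f \<in> borel_measurable (lebesgue_on A)" "g \<in> borel_measurable (lebesgue_on A)"
    and i: "integrable (lebesgue_on A) (\<lambda>x. (f x)\<^sup>2)" "integrable (lebesgue_on A) (\<lambda>x. (g x)\<^sup>2)"
    using assms by (auto simp: L2_def)
  note cs = integral_Cauchy_Schwarz[OF m i]
  have "(\<integral>x. (f x + g x)\<^sup>2 \<partial>lebesgue_on A) = (\<integral>x. (f x)\<^sup>2 + 2 * (f x * g x) + (g x)\<^sup>2 \<partial>lebesgue_on A)"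
    by (intro Bochner_Integration.integral_cong) (auto simp: power2_sum)
  also have "\<dots> = (\<integral>x. (f x)\<^sup>2 \<partial>lebesgue_on A) + 2 * (\<integral>x. f x * g x \<partial>lebesgue_on A) + (\<integral>x. (g x)\<^sup>2 \<partial>lebesgue_on A)"
    using i cs(1) by simp
  also have "\<dots> \<le> (L2norm A f)\<^sup>2 + 2 * (L2norm A f * L2norm A g) + (L2norm A g)\<^sup>2"
    using cs(2) by (simp add: L2norm_def)
  also have "\<dots> = (L2norm A f + L2norm A g)\<^sup>2" by (simp add: power2_sum)
  finally show ?thesis unfolding L2norm_def[of A "\<lambda>x. f x + g x"]
    by (rule real_le_lsqrt[rotated -1]) (auto simp: L2norm_def)
qed

lemma L2norm_mono:
  assumes "f \<in> L2 B" "A \<subseteq> B" "A \<in> sets lebesgue" "B \<in> sets lebesgue"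
  shows "L2norm A f \<le> L2norm B f"
proof -
  have i: "integrable (lebesgue_on B) (\<lambda>x. (f x)\<^sup>2)" using assms by (simp add: L2_def)
  have iA: "integrable (lebesgue_on A) (\<lambda>x. (f x)\<^sup>2)" by (rule integrable_on_mono[OF i assms(2,4,3)])
  have "(\<integral>x. (f x)\<^sup>2 \<partial>lebesgue_on A) = (\<integral>x. (if x \<in> A then (f x)\<^sup>2 else 0) \<partial>lebesgue)"
    using assms by (simp add: Lebesgue_Measure.integral_restrict_UNIV)
  also have "\<dots> \<le> (\<integral>x. (if x \<in> B then (f x)\<^sup>2 else 0) \<partial>lebesgue)"
    by (rule Bochner_Integration.integral_mono)
       (use assms i iA in \<open>auto simp: Lebesgue_Measure.integrable_restrict_UNIV\<close>)
  also have "\<dots> = (\<integral>x. (f x)\<^sup>2 \<partial>lebesgue_on B)"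
    using assms by (simp add: Lebesgue_Measure.integral_restrict_UNIV)
  finally show ?thesis by (simp add: L2norm_def)
qed

lemma L2norm_null_diff:
  assumes "negligible (A - B)" "negligible (B - A)" "A \<in> sets lebesgue" "B \<in> sets lebesgue"
  shows "L2norm A f = L2norm B f"
  unfolding L2norm_def using integral_on_null_diff[OF assms] by simp

lemma L2norm_bounded:
  assumes A: "A \<in> lmeasurable" and f: "\<And>x. x \<in> A \<Longrightarrow> \<bar>f x\<bar> \<le> b" and b: "b \<ge> 0"
  shows "L2norm A f \<le> b * sqrt (measure lebesgue A)"
proof -
  have s: "A \<in> sets lebesgue" using A by (rule fmeasurableD)
  have "(\<integral>x. (f x)\<^sup>2 \<partial>lebesgue_on A) \<le> b\<^sup>2 * measure lebesgue A"
  proof (cases "integrable (lebesgue_on A) (\<lambda>x. (f x)\<^sup>2)")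
    case True
    have ic: "integrable (lebesgue_on A) (\<lambda>x. b\<^sup>2)"
      using A by (intro finite_measure.integrable_const finite_measure_lebesgue_on)
    have "(\<integral>x. (f x)\<^sup>2 \<partial>lebesgue_on A) \<le> (\<integral>x. b\<^sup>2 \<partial>lebesgue_on A)"
    proof (rule Bochner_Integration.integral_mono[OF True ic])
      fix x assume "x \<in> space (lebesgue_on A)"
      then have "\<bar>f x\<bar> \<le> b" using f by simp
      then show "(f x)\<^sup>2 \<le> b\<^sup>2" using abs_le_square_iff[of "f x" b] b by simp
    qed
    also have "\<dots> = b\<^sup>2 * measure lebesgue A" using s by (simp add: measure_restrict_space)
    finally show ?thesis .
  qed (simp add: not_integrable_integral_eq)
  then have "L2norm A f \<le> sqrt (b\<^sup>2 * measure lebesgue A)" unfolding L2norm_def by (rule real_sqrt_le_mono)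
  then show ?thesis using b by (simp add: real_sqrt_mult)
qed

lemma H2norm_nonneg: "0 \<le> H2norm \<Omega> A w"
  by (simp add: H2norm_def sum_nonneg)

text \<open>Each coefficient is at most \<open>sqrt X\<close>, and there are \<open>(N + 1)\<^sup>2\<close> of them.\<close>

lemma coeff_sum_bound:
  assumes X: "\<And>i j. i \<le> N \<Longrightarrow> j \<le> N \<Longrightarrow> (c i j)\<^sup>2 \<le> X"
  shows "(coeff_sum N c)\<^sup>2 \<le> (real (N + 1) ^ 4) * X"
proof -
  have X0: "X \<ge> 0" using X[of 0 0] by (meson le0 order_trans zero_le_power2)
  have "\<bar>c i j\<bar> \<le> sqrt X" if "i \<le> N" "j \<le> N" for i j using X[OF that] real_le_rsqrt[of "\<bar>c i j\<bar>" X] by simp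
  then have "coeff_sum N c \<le> (\<Sum>i\<le>N. \<Sum>j\<le>N. sqrt X)" unfolding coeff_sum_def by (intro sum_mono) auto
  also have "\<dots> = (real (N + 1))\<^sup>2 * sqrt X" by (simp add: power2_eq_square algebra_simps)
  finally have "(coeff_sum N c)\<^sup>2 \<le> ((real (N + 1))\<^sup>2 * sqrt X)\<^sup>2"
    by (intro power_mono) (auto simp: coeff_sum_def sum_nonneg)
  also have "\<dots> = (real (N + 1) ^ 4) * X" using X0 by (simp add: power_mult_distrib flip: power_mult)
  finally show ?thesis .
qed

text \<open>The residual is tested with itself, so both sides of each estimate contain one more factor \<open>s\<close> than is wanted.\<close>

lemma cancel_square:
  fixes s :: real
  assumes "s \<ge> 0" "s\<^sup>2 \<le> s * X" "X \<ge> 0" shows "s \<le> X"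
  using assms by (cases "s = 0") (auto simp: power2_eq_square)

text \<open>The data of the discrete problem, together with the numbers \<open>N\<close>, \<open>B\<close> and \<open>Cw\<close> that are chosen before the mesh and the loads.
Every constant defined in this context is a function of \<open>P\<close>, \<open>\<kappa>\<close>, \<open>N\<close>, \<open>B\<close> and \<open>Cw\<close>, and therefore independent of the mesh.\<close>

locale plate_fem =
  fixes P :: plate and \<Omega> \<Gamma>c \<Gamma>s \<Gamma>f :: "plane set" and \<kappa> :: real and m q :: nat
    and \<C> :: "plane set set" and S :: "plane set" and x\<^sub>0 :: plane and f g :: field and F :: real
    and Vh :: "field set" and fh :: field and gh :: "plane set \<Rightarrow> field" and u vh :: field
    and N :: nat and B Cw :: real
  assumes domain: "polygonal_domain \<Omega>"
    and parts: "boundary_partition \<Omega> \<Gamma>c \<Gamma>s \<Gamma>f"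
    and mesh: "plate_mesh \<kappa> \<Omega> \<Gamma>c \<Gamma>s \<Gamma>f \<C>"
    and x0: "x\<^sub>0 \<in> \<Omega>" "\<exists>K\<in>\<C>. x\<^sub>0 extreme_point_of K"
    and f: "f \<in> L2 \<Omega>" and g: "\<forall>E \<in> line_edges \<C> S. g \<in> seg_L2 E"
    and Vh: "conforming_space m \<Omega> (plate_space \<Omega> \<Gamma>c \<Gamma>s) \<C> Vh"
    and fh: "fh \<in> Vh" and gh: "\<forall>E \<in> line_edges \<C> S. poly_le q (gh E)"
    and u: "u \<in> plate_space \<Omega> \<Gamma>c \<Gamma>s"
    and galerkin: "\<forall>v \<in> plate_space \<Omega> \<Gamma>c \<Gamma>s. plate_form P \<Omega> u v = load \<Omega> f (line_edges \<C> S) g F x\<^sub>0 v"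
    and vh: "vh \<in> Vh"
    and N: "m \<le> N" "q \<le> N" and B: "B > 0" and Cw: "Cw > 0"
    and test_bound: "\<And>c z n \<rho> x k l. norm n = 1 \<Longrightarrow> \<rho> > 0 \<Longrightarrow>
     \<bar>edge_test N c z n \<rho> x\<bar> \<le> B * coeff_sum N c \<and>
     \<bar>pd l (pd k (edge_test N c z n \<rho>)) x\<bar> \<le> B / \<rho>\<^sup>2 * coeff_sum N c"
    and weight1: "\<And>c i. i \<le> N \<Longrightarrow> (c i)\<^sup>2 \<le> Cw * (\<integral>t. weight t * (\<Sum>i\<le>N. c i * t ^ i)\<^sup>2 \<partial>lborel)"
    and weight2: "\<And>c i j. i \<le> N \<Longrightarrow> j \<le> N \<Longrightarrow> (c i j)\<^sup>2 \<le> Cw * (\<integral>p. weight (fst p) * weight (snd p) *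
      (\<Sum>i\<le>N. \<Sum>j\<le>N. c i j * fst p ^ i * snd p ^ j)\<^sup>2 \<partial>(lborel \<Otimes>\<^sub>M lborel))"
begin

abbreviation V where "V \<equiv> plate_space \<Omega> \<Gamma>c \<Gamma>s"
abbreviation err where "err \<equiv> (\<lambda>x. u x - vh x)"

lemma open_dom: "open \<Omega>" and bounded_dom: "bounded \<Omega>" and regular_dom: "interior (closure \<Omega>) = \<Omega>"
  using domain by (auto simp: polygonal_domain_def)

lemma tri: "triangulation \<C>" and simplices: "\<forall>K\<in>\<C>. 2 simplex K" and cover: "\<Union>\<C> = closure \<Omega>" and finite_mesh: "finite \<C>"
  using mesh by (auto simp: plate_mesh_def triangulation_def)

lemma element_ball:
  assumes "K \<in> \<C>" obtains x r where "r > 0" "cball x r \<subseteq> K" "diameter K \<le> \<kappa> * (2 * r)"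
  using mesh assms unfolding plate_mesh_def shape_regular_def by blast

lemma element_facts:
  assumes "K \<in> \<C>"
  shows "convex K" "compact K" "closed K" "bounded K" "interior K \<subseteq> \<Omega>" "K \<subseteq> closure \<Omega>" "K \<in> sets lebesgue"
proof -
  have s: "2 simplex K" using simplices assms by blast
  show "convex K" "compact K" "closed K" using convex_simplex[OF s] compact_simplex[OF s] compact_imp_closed by blast+
  then show "bounded K" "K \<in> sets lebesgue" using compact_imp_bounded by (auto simp: borel_closed)
  show "K \<subseteq> closure \<Omega>" using cover assms by blast
  then show "interior K \<subseteq> \<Omega>" using interior_mono[of K "closure \<Omega>"] regular_dom by simp
qed

text \<open>The boundary lies in finitely many lines. So closed elements, which may reach the boundary, differ from a subset of the domain by a null set.\<close>

lemma closure_null: "negligible (closure \<Omega> - \<Omega>)"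
proof -
  have fr: "frontier \<Omega> = closure \<Omega> - \<Omega>" using open_dom by (simp add: frontier_def interior_open)
  obtain SS where SS: "finite SS" "\<And>E. E \<in> SS \<Longrightarrow> is_segment E" "frontier \<Omega> = \<Union>SS"
    using domain unfolding polygonal_domain_def segment_union_def by blast
  have "negligible E" if E: "E \<in> SS" for E
  proof -
    obtain a b where ab: "a \<noteq> b" "E = closed_segment a b" using SS(2)[OF E] by (auto simp: is_segment_def)
    define t where "t = tangent (b - a)"
    have "t \<noteq> 0" using ab(1) by (auto simp: t_def tangent_def vec_eq_iff forall_2)
    then have h: "negligible {x. t \<bullet> x = t \<bullet> a}" by (intro negligible_hyperplane) simp
    have "E \<subseteq> {x. t \<bullet> x = t \<bullet> a}"
    proof
      fix x assume "x \<in> E"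
      then obtain s where "x = (1 - s) *\<^sub>R a + s *\<^sub>R b" using ab by (auto simp: in_segment)
      then have "x = a + s *\<^sub>R (b - a)" by (simp add: algebra_simps)
      then show "x \<in> {x. t \<bullet> x = t \<bullet> a}" by (simp add: inner_add_right t_def) (simp add: tangent_def inner_vec_def sum_2 algebra_simps)
    qed
    then show ?thesis using h negligible_subset by blast
  qed
  then show ?thesis using SS fr by (metis negligible_Union)
qed

lemma discrete_H2: "v \<in> Vh \<Longrightarrow> v \<in> H2 \<Omega>" and continuous_H2: "v \<in> V \<Longrightarrow> v \<in> H2 \<Omega>"
  using Vh by (auto simp: conforming_space_def plate_space_def)

lemma elem_poly_props:
  assumes K: "K \<in> \<C>" and v: "v \<in> Vh"
  shows "poly_le m (elem_poly v K)" "x \<in> K \<Longrightarrow> elem_poly v K x = v x" "smooth (elem_poly v K)"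
proof -
  obtain p where p: "poly_le m p" "\<And>x. x \<in> K \<Longrightarrow> v x = p x"
  proof -
    have "\<forall>v\<in>Vh. C1_closure \<Omega> v \<and> (\<forall>K\<in>\<C>. \<exists>p. poly_le m p \<and> (\<forall>x\<in>K. v x = p x))"
      using Vh by (simp add: conforming_space_def)
    then have "\<exists>p. poly_le m p \<and> (\<forall>x\<in>K. v x = p x)" using v K by simp
    then show thesis using that by auto
  qed
  obtain z r where z: "r > 0" "cball z r \<subseteq> K" "diameter K \<le> \<kappa> * (2 * r)" by (rule element_ball[OF K])
  have e: "elem_poly v K = p" by (rule elem_poly_eq[OF p z(1,2)])
  show "poly_le m (elem_poly v K)" "smooth (elem_poly v K)" unfolding e using p(1) smooth_poly_le[OF p(1)] by auto
  show "x \<in> K \<Longrightarrow> elem_poly v K x = v x" unfolding e using p(2) by simp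
qed

text \<open>Inside \<open>K\<close> the discrete function is the element polynomial, and weak derivatives are local.\<close>

lemma elem_wpd2:
  assumes K: "K \<in> \<C>" and v: "v \<in> Vh"
  shows "AE x in lebesgue_on (interior K). wpd \<Omega> j (wpd \<Omega> i v) x = pd j (pd i (elem_poly v K)) x"
proof -
  let ?p = "elem_poly v K" and ?I = "interior K"
  have oi: "open ?I" by simp
  note p = elem_poly_props[OF K v]
  have sub: "?I \<subseteq> \<Omega>" using element_facts(5)[OF K] .
  have cl: "has_weak_pd ?I k w (pd k w)" if "smooth w" for k w
    using has_weak_pd_classical[OF oi smooth_has_derivative[OF that] grad_continuous[OF that], of k] by (simp add: grad_def)
  note h = H2_wpd2[OF open_dom discrete_H2[OF v]]
  have "AE x in lebesgue_on ?I. wpd \<Omega> i v x = pd i ?p x"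
  proof (rule weak_pd_unique[OF oi has_weak_pd_subset[OF open_dom oi sub h(2)] cl[OF p(3)]])
    show "AE x in lebesgue_on ?I. v x = ?p x"
      using p(2) interior_subset[of K] by (intro AE_I2) auto
  qed
  then show ?thesis
    by (rule weak_pd_unique[OF oi has_weak_pd_subset[OF open_dom oi sub h(3)] cl[OF smooth_pd[OF p(3)]]])
qed

definition line_load :: "field \<Rightarrow> real" where
  "line_load t = (\<Sum>E\<in>line_edges \<C> S. seg_int E (\<lambda>x. g x * t x)) + F * t x\<^sub>0"

lemma AE_in_dom:
  assumes I: "I \<subseteq> \<Omega>" "I \<in> sets lebesgue" and "AE x in lebesgue_on I. Q x"
  shows "AE x in lebesgue_on \<Omega>. x \<in> I \<longrightarrow> Q x"
  using assms open_dom by (auto simp: AE_restrict_space_iff elim!: eventually_mono)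

text \<open>The Galerkin identity for \<open>u\<close>, tested with the truncated function, before integration by parts: up to a null set \<open>Z\<close> the support is covered by
the interiors of the elements in \<open>\<K>\<close>, so both integrals split into contributions of these elements. The factor on the right is \<open>\<rho>\<close> and not
\<open>\<rho>\<^sup>2\<close> because the root of the area of the square enters.\<close>

lemma residual:
  assumes \<K>: "\<K> \<subseteq> \<C>" and n: "norm n = 1" and r: "\<rho> > 0" and w: "supported_in (open_square z n \<rho>) w"
    and T: "cut_region \<Omega> T (open_square z n \<rho>)" "cut T w \<in> V" "\<And>K. K \<in> \<K> \<Longrightarrow> K \<subseteq> T"
    and Z: "negligible Z" "\<And>x. x \<in> open_square z n \<rho> \<Longrightarrow> x \<in> T \<Longrightarrow> x \<in> \<Omega> \<Longrightarrow> x \<notin> Z \<Longrightarrow> \<exists>K\<in>\<K>. x \<in> interior K"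
    and A: "A \<in> sets lebesgue" "A \<subseteq> closure \<Omega>" "\<Union>\<K> \<subseteq> A"
    and D: "\<And>x i j. \<bar>pd j (pd i w) x\<bar> \<le> D" and W: "\<And>x. \<bar>w x\<bar> \<le> W"
  shows "\<bar>(\<Sum>K\<in>\<K>. \<integral>x. moment P pd (elem_poly vh K) x \<bullet> curvature pd w x \<partial>lebesgue_on (interior K))
      - (\<Sum>K\<in>\<K>. \<integral>x. f x * w x \<partial>lebesgue_on (interior K)) - line_load (cut T w)\<bar>
    \<le> 16 * energy_bound P * D * \<rho> * H2norm \<Omega> A err"
proof -
  define U where "U = open_square z n \<rho>"
  define t where "t = cut T w"
  have o: "\<Omega> \<in> sets lebesgue" using open_dom by auto
  have fin: "finite \<K>" using \<K> finite_mesh finite_subset by blast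
  have sw: "smooth w" and w0: "\<And>x. x \<notin> U \<Longrightarrow> w x = 0" using w by (auto simp: supported_in_def U_def)
  have w2: "x \<notin> U \<Longrightarrow> pd j (pd i w) x = 0" for x i j
    using supported_in_pd[OF regular_open_square supported_in_pd[OF regular_open_square w]] by (auto simp: supported_in_def U_def)
  note tw = cut_wpd2[OF open_dom T(1) regular_open_square w]
  have AEt: "AE x in lebesgue_on \<Omega>. \<forall>i j. wpd \<Omega> j (wpd \<Omega> i t) x = cut T (pd j (pd i w)) x"
    unfolding forall_2 t_def by (intro eventually_conj tw)
  have AEZ: "AE x in lebesgue_on \<Omega>. x \<notin> Z \<and> x \<in> \<Omega>"
    using AE_not_negligible[OF Z(1)] o by (auto simp: AE_restrict_space_iff elim!: eventually_mono)
  have AEK: "AE x in lebesgue_on \<Omega>. \<forall>K\<in>\<K>. x \<in> interior K \<longrightarrow> (\<forall>i j. wpd \<Omega> j (wpd \<Omega> i vh) x = pd j (pd i (elem_poly vh K)) x)"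
  proof (rule eventually_ball_finite[OF fin], intro ballI)
    fix K assume "K \<in> \<K>"
    then have K: "K \<in> \<C>" using \<K> by blast
    show "AE x in lebesgue_on \<Omega>. x \<in> interior K \<longrightarrow> (\<forall>i j. wpd \<Omega> j (wpd \<Omega> i vh) x = pd j (pd i (elem_poly vh K)) x)"
    proof (rule AE_in_dom)
      show "AE x in lebesgue_on (interior K). \<forall>i j. wpd \<Omega> j (wpd \<Omega> i vh) x = pd j (pd i (elem_poly vh K)) x"
        unfolding forall_2 by (intro eventually_conj elem_wpd2[OF K vh])
    qed (use element_facts(5)[OF K] in auto)
  qed
  have uniq: "K = K0" if "K \<in> \<K>" "K0 \<in> \<K>" "x \<in> interior K" "x \<in> interior K0" for x K K0
    using mesh_interior_unique[OF tri simplices, of K K0 x] that \<K> interior_subset by blast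
  have pick: "(\<Sum>K\<in>\<K>. indicator (interior K) x * \<phi> K) = \<phi> K0" if "K0 \<in> \<K>" "x \<in> interior K0" for x K0 and \<phi> :: "plane set \<Rightarrow> real"
  proof -
    have "(\<Sum>K\<in>\<K>. indicator (interior K) x * \<phi> K) = (\<Sum>K\<in>\<K>. if K = K0 then \<phi> K else 0)"
      by (rule sum.cong) (use uniq that in \<open>auto simp: indicator_def\<close>)
    then show ?thesis using fin that by simp
  qed
  have skip: "(\<Sum>K\<in>\<K>. indicator (interior K) x * \<phi> K) = 0" if "\<not> (\<exists>K\<in>\<K>. x \<in> interior K)" for x and \<phi> :: "plane set \<Rightarrow> real"
    using that by (intro sum.neutral) (auto simp: indicator_def)
  have KI: "interior K \<subseteq> \<Omega>" "interior K \<in> sets lebesgue" if "K \<in> \<K>" for K using element_facts(5) \<K> that by auto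
  have form: "plate_form P \<Omega> vh t = (\<Sum>K\<in>\<K>. \<integral>x. moment P pd (elem_poly vh K) x \<bullet> curvature pd w x \<partial>lebesgue_on (interior K))"
    unfolding plate_form_def
  proof (rule integral_pieces[OF o fin KI])
    fix K assume "K \<in> \<K>"
    then have K: "K \<in> \<C>" using \<K> by blast
    have "integrable (lebesgue_on K) (\<lambda>x. moment P pd (elem_poly vh K) x \<bullet> curvature pd w x)"
      by (rule integrable_on_continuous_compact[OF element_facts(2)[OF K] smooth_continuous[OF smooth_density[OF elem_poly_props(3)[OF K vh] sw]]])
    then show "integrable (lebesgue_on (interior K)) (\<lambda>x. moment P pd (elem_poly vh K) x \<bullet> curvature pd w x)"
      by (rule integrable_on_mono) (use element_facts(7)[OF K] interior_subset in auto)
  next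
    show "AE x in lebesgue_on \<Omega>. moment P (wpd \<Omega>) vh x \<bullet> curvature (wpd \<Omega>) t x
       = (\<Sum>K\<in>\<K>. indicator (interior K) x * (moment P pd (elem_poly vh K) x \<bullet> curvature pd w x))"
      using AEt AEZ AEK
    proof eventually_elim
      case (elim x)
      show ?case
      proof (cases "\<exists>K\<in>\<K>. x \<in> interior K")
        case True
        then obtain K where K: "K \<in> \<K>" "x \<in> interior K" by blast
        then have xT: "x \<in> T" using T(3) interior_subset by blast
        have c1: "curvature (wpd \<Omega>) vh x $ i $ j = curvature pd (elem_poly vh K) x $ i $ j" for i j
          using elim(3) K by (simp add: curvature_component)
        have c2: "curvature (wpd \<Omega>) t x $ i $ j = curvature pd w x $ i $ j" for i j
          using elim(1) xT by (simp add: curvature_component cut_def)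
        show ?thesis unfolding pick[OF K] unfolding density_eq c1 c2 ..
      next
        case False
        then have "x \<notin> T \<or> x \<notin> U" using Z(2)[of x] elim(2) by (auto simp: U_def)
        then have "cut T (pd j (pd i w)) x = 0" for i j using w2 by (auto simp: cut_def)
        then have c2: "curvature (wpd \<Omega>) t x $ i $ j = 0" for i j
          using elim(1) by (simp add: curvature_component)
        show ?thesis unfolding skip[OF False] unfolding density_eq c2 by simp
      qed
    qed
  qed auto
  have Um: "U \<in> lmeasurable" "sqrt (measure lebesgue U) \<le> 4 * \<rho>" using measure_open_square[OF n r] by (auto simp: U_def)
  have fload: "(\<integral>x. f x * t x \<partial>lebesgue_on \<Omega>) = (\<Sum>K\<in>\<K>. \<integral>x. f x * w x \<partial>lebesgue_on (interior K))"
  proof (rule integral_pieces[OF o fin KI])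
    fix K assume K: "K \<in> \<K>"
    show "integrable (lebesgue_on (interior K)) (\<lambda>x. f x * w x)"
      by (rule L2_test_bound(1)[OF KI(2)[OF K] L2_subset[OF f KI(1)[OF K] o KI(2)[OF K]] Um(1) sw W w0])
  next
    show "AE x in lebesgue_on \<Omega>. f x * t x = (\<Sum>K\<in>\<K>. indicator (interior K) x * (f x * w x))"
      using AEZ
    proof eventually_elim
      case (elim x)
      show ?case
      proof (cases "\<exists>K\<in>\<K>. x \<in> interior K")
        case True
        then obtain K where K: "K \<in> \<K>" "x \<in> interior K" by blast
        then have "x \<in> T" using T(3) interior_subset by blast
        then show ?thesis unfolding pick[OF K, of "\<lambda>K. f x * w x"] by (simp add: t_def cut_def)
      next
        case False
        then have "x \<notin> T \<or> x \<notin> U" using Z(2)[of x] elim by (auto simp: U_def)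
        then have "t x = 0" using w0 by (auto simp: t_def cut_def)
        then show ?thesis unfolding skip[OF False] by simp
      qed
    qed
  qed auto
  have D0: "D \<ge> 0" using D[of 1 1 0] by linarith
  have "\<bar>plate_form P \<Omega> u t - plate_form P \<Omega> vh t\<bar> \<le> 4 * energy_bound P * D * sqrt (measure lebesgue U) * H2norm \<Omega> A err"
  proof (rule energy_residual_bound[OF open_dom continuous_H2[OF u] discrete_H2[OF vh] continuous_H2 A(1) _ Um(1) D0])
    show "t \<in> V" using T(2) by (simp add: t_def)
    show "negligible (A - \<Omega>)" by (rule negligible_subset[OF closure_null]) (use A in auto)
    show "AE x in lebesgue_on \<Omega>. \<forall>i j. \<bar>wpd \<Omega> j (wpd \<Omega> i t) x\<bar> \<le> D * indicator (U \<inter> A) x"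
      using AEt AEZ
    proof eventually_elim
      case (elim x)
      have "\<bar>cut T (pd j (pd i w)) x\<bar> \<le> D * indicator (U \<inter> A) x" for i j
      proof (cases "x \<in> T \<and> x \<in> U")
        case True
        then obtain K where "K \<in> \<K>" "x \<in> interior K" using Z(2)[of x] elim(2) by (auto simp: U_def)
        then have "x \<in> A" using A(3) interior_subset by blast
        then show ?thesis using True D[of j i x] by (simp add: cut_def)
      next
        case False
        then have "cut T (pd j (pd i w)) x = 0" using w2 by (auto simp: cut_def)
        then show ?thesis using D0 by simp
      qed
      then show ?case using elim(1) by simp
    qed
  qed
  also have "\<dots> \<le> 4 * energy_bound P * D * (4 * \<rho>) * H2norm \<Omega> A err"
    using Um(2) D0 H2norm_nonneg by (intro mult_right_mono mult_left_mono) (auto simp: energy_bound_def)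
  finally have "\<bar>plate_form P \<Omega> u t - plate_form P \<Omega> vh t\<bar> \<le> 16 * energy_bound P * D * \<rho> * H2norm \<Omega> A err" by simp
  moreover have "plate_form P \<Omega> u t = (\<Sum>K\<in>\<K>. \<integral>x. f x * w x \<partial>lebesgue_on (interior K)) + line_load t"
    using galerkin T(2) by (simp add: t_def[symmetric] load_def line_load_def fload)
  ultimately show ?thesis unfolding form t_def[symmetric] by linarith
qed

lemma line_load_0:
  assumes "\<And>E. E \<in> line_edges \<C> S \<Longrightarrow> is_segment E \<and> (\<forall>x\<in>E. t x = 0)" "t x\<^sub>0 = 0"
  shows "line_load t = 0"
proof -
  have "seg_int E (\<lambda>x. g x * t x) = 0" if "E \<in> line_edges \<C> S" for E
  proof -
    have "(\<integral>s. g (seg_param E s) * t (seg_param E s) \<partial>lebesgue_on {0..1}) = (\<integral>s. 0 \<partial>lebesgue_on {0..1::real})"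
      by (intro Bochner_Integration.integral_cong refl) (use assms(1)[OF that] seg_param_in in auto)
    then show ?thesis by (simp add: seg_int_def)
  qed
  then show ?thesis using assms(2) by (simp add: line_load_def)
qed

lemma line_edgeD:
  assumes "E \<in> line_edges \<C> S"
  obtains K where "K \<in> \<C>" "E edge_of K" "is_segment E"
proof -
  obtain K where K: "K \<in> \<C>" "E edge_of K" using assms by (auto simp: line_edges_def interior_edges_def elements_at_def)
  obtain c where "is_segment E" using edge_of_triangle[of K E] K simplices by metis
  then show thesis using that K by blast
qed

lemma edge_not_interior:
  assumes K: "K \<in> \<C>" "K1 \<in> \<C>" and E: "E edge_of K1" and y: "y \<in> E" "y \<in> interior K"
  shows False
proof -
  have yK1: "y \<in> K1" using y(1) E edge_of_imp_subset by blast
  then have "K = K1" using mesh_interior_unique[OF tri simplices K y(2)] by blast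
  then have "E face_of K" "E \<noteq> K" using E simplices K(1) aff_dim_simplex[of 2 K] by (auto simp: edge_of_def)
  then show False using face_of_disjoint_interior y by blast
qed

lemma L2_poly: "smooth p \<Longrightarrow> K \<in> \<C> \<Longrightarrow> p \<in> L2 K"
  unfolding L2_def
  by (intro CollectI conjI borel_measurable_lebesgue_on[OF smooth_continuous] integrable_on_continuous_compact[OF element_facts(2)]
      continuous_intros smooth_continuous)

lemma L2_load: assumes "K \<in> \<C>" shows "f \<in> L2 K"
proof -
  have os: "\<Omega> \<in> sets lebesgue" using open_dom by auto
  have KO: "K \<inter> \<Omega> \<in> sets lebesgue" "K \<in> sets lebesgue" using element_facts(7)[OF assms] os by (auto intro: sets.Int)
  have fi: "f \<in> L2 (K \<inter> \<Omega>)" by (rule L2_subset[OF f Int_lower2 os KO(1)])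
  have null: "negligible (K - \<Omega>)" by (rule negligible_subset[OF closure_null]) (use element_facts(6)[OF assms] in auto)
  have ae: "AE x in lebesgue. (if x \<in> K \<inter> \<Omega> then h x else 0) = (if x \<in> K then h x else (0::real))" for h
    using AE_not_negligible[OF null] by eventually_elim auto
  have m: "(\<lambda>x. if x \<in> K \<inter> \<Omega> then h x else 0) \<in> borel_measurable lebesgue" if "h \<in> borel_measurable (lebesgue_on (K \<inter> \<Omega>))" for h :: field
    using that by (subst borel_measurable_if[OF KO(1)])
  have "f \<in> borel_measurable (lebesgue_on (K \<inter> \<Omega>))" using fi by (simp add: L2_def)
  from borel_measurable_AE[OF m[OF this] ae] have fm: "f \<in> borel_measurable (lebesgue_on K)"
    by (subst (asm) borel_measurable_if[OF KO(2)])
  have "integrable lebesgue (\<lambda>x. if x \<in> K \<inter> \<Omega> then (f x)\<^sup>2 else 0)"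
    using fi KO unfolding L2_def by (simp only: mem_Collect_eq Lebesgue_Measure.integrable_restrict_UNIV)
  moreover have "(\<lambda>x. if x \<in> K then (f x)\<^sup>2 else 0) \<in> borel_measurable lebesgue"
    using fm KO by (simp add: borel_measurable_if borel_measurable_power)
  ultimately have "integrable lebesgue (\<lambda>x. if x \<in> K then (f x)\<^sup>2 else 0)"
    using ae[of "\<lambda>x. (f x)\<^sup>2"] by (rule integrable_cong_AE_imp)
  then have "integrable (lebesgue_on K) (\<lambda>x. (f x)\<^sup>2)" using KO by (simp only: Lebesgue_Measure.integrable_restrict_UNIV)
  then show ?thesis using fm by (simp add: L2_def)
qed

lemma smooth_elem_op: "K \<in> \<C> \<Longrightarrow> smooth (elem_op P vh K)"
  unfolding elem_op_def by (intro smooth_plate_op elem_poly_props vh)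

text \<open>Obtained by collecting the factors in \<open>element_estimate\<close>; the summand \<open>1\<close> is the coefficient of the oscillation in the final triangle inequality.\<close>

definition element_const :: real where
  "element_const = 512 * \<kappa> ^ 3 * (4 * \<kappa>) ^ (2 * N) * (real (N + 1) ^ 4 * Cw * B * (16 * energy_bound P + 4)) + 1"

end

section \<open>The element residual\<close>

lemma poly_le_cmult_right: "poly_le k h \<Longrightarrow> poly_le k (\<lambda>x. h x * c)"
  using poly_le_cmult[of k h c] by (simp add: mult.commute)

lemma poly_le_moment: "poly_le k p \<Longrightarrow> poly_le k (\<lambda>x. moment P pd p x $ i $ j)"
  unfolding moment_component curvature_component
  by (intro poly_le_pd poly_le_cmult poly_le_add poly_le_cmult_right)

lemma poly_le_shear: assumes "poly_le k p" shows "poly_le k (\<lambda>x. shear P p x $ i)"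
proof -
  have "(\<lambda>x. shear P p x $ i) = (\<lambda>x. \<Sum>j\<in>UNIV. pd j (\<lambda>y. moment P pd p y $ i $ j) x)"
    by (rule ext) (simp add: shear_def)
  then show ?thesis by (simp only:) (intro poly_le_sum poly_le_pd poly_le_moment assms)
qed

lemma poly_le_plate_op: "poly_le k p \<Longrightarrow> poly_le k (plate_op P p)"
  unfolding plate_op_def[abs_def] by (intro poly_le_minus poly_le_sum poly_le_pd poly_le_shear)

lemma poly_le_bilinear: "poly_le k p \<Longrightarrow> poly_le k (\<lambda>x. a \<bullet> (moment P pd p x *v b))"
  unfolding inner_vec_def sum_2 matrix_vector_mult_def vec_lambda_beta inner_real_def
  by (intro poly_le_add poly_le_cmult poly_le_cmult_right poly_le_moment)

lemma poly_le_M_nn: "poly_le k p \<Longrightarrow> poly_le k (M_nn P n p)"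
  unfolding M_nn_def[abs_def] by (rule poly_le_bilinear)

lemma poly_le_M_ns: "poly_le k p \<Longrightarrow> poly_le k (M_ns P n p)"
  unfolding M_ns_def[abs_def] by (rule poly_le_bilinear)

lemma poly_le_V_n: "poly_le k p \<Longrightarrow> poly_le k (V_n P n p)"
  unfolding V_n_def[abs_def] Q_n_def grad_def inner_vec_def sum_2 vec_lambda_beta inner_real_def
  by (intro poly_le_add poly_le_cmult poly_le_cmult_right poly_le_shear poly_le_pd poly_le_M_ns)

lemma poly_sum_bound:
  assumes "\<bar>a\<bar> \<le> l" "\<bar>b\<bar> \<le> l" "1 \<le> (l::real)"
  shows "\<bar>\<Sum>i\<le>N. \<Sum>j\<le>N. c i j * a ^ i * b ^ j\<bar> \<le> l ^ (2 * N) * coeff_sum N c"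
proof -
  have "\<bar>\<Sum>i\<le>N. \<Sum>j\<le>N. c i j * (a ^ i * b ^ j)\<bar> \<le> l ^ (2 * N) * coeff_sum N c"
  proof (rule double_sum_bound)
    fix i j assume ij: "i \<le> N" "j \<le> N"
    have "\<bar>a\<bar> ^ i \<le> l ^ i" "\<bar>b\<bar> ^ j \<le> l ^ j" using assms by (auto intro: power_mono)
    moreover have "l ^ i \<le> l ^ N" "l ^ j \<le> l ^ N" using assms ij by (auto intro: power_increasing)
    ultimately have "\<bar>a\<bar> ^ i * \<bar>b\<bar> ^ j \<le> l ^ N * l ^ N" using assms by (intro mult_mono) auto
    then show "\<bar>a ^ i * b ^ j\<bar> \<le> l ^ (2 * N)" by (simp add: abs_mult power_abs mult_2 power_add)
  qed
  then show ?thesis by (simp add: mult.assoc)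
qed

context plate_fem
begin

lemma boundary_off_dom: "x \<in> \<Gamma>c \<union> \<Gamma>s \<union> \<Gamma>f \<Longrightarrow> x \<notin> \<Omega>"
  using parts open_dom frontier_disjoint_eq[of \<Omega>] by (auto simp: boundary_partition_def)

text \<open>A square inside the domain stays away from the boundary, so that truncation has no effect and all boundary conditions hold.\<close>

lemma inner_cut:
  assumes U: "open_square z n \<rho> \<subseteq> \<Omega>" and w: "supported_in (open_square z n \<rho>) w"
  shows "cut_region \<Omega> (closure \<Omega>) (open_square z n \<rho>)" "cut (closure \<Omega>) w \<in> V"
proof -
  show cr: "cut_region \<Omega> (closure \<Omega>) (open_square z n \<rho>)" unfolding cut_region_def by (intro conjI exI[of _ "{}"]) auto
  have z: "x \<notin> open_square z n \<rho>" if "x \<in> \<Gamma>c \<union> \<Gamma>s" for x using boundary_off_dom[of x] that U by blast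
  show "cut (closure \<Omega>) w \<in> V"
  proof (rule cut_plate_space[OF open_dom bounded_dom cr regular_open_square w])
    have "{x \<in> \<Gamma>c \<union> \<Gamma>s. cut (closure \<Omega>) w x \<noteq> 0} = {}" using z w by (auto simp: cut_def supported_in_def split: if_splits)
    then show "finite {x \<in> \<Gamma>c \<union> \<Gamma>s. cut (closure \<Omega>) w x \<noteq> 0}" by (simp only: finite.emptyI)
    have "\<Gamma>c \<inter> closure \<Omega> \<inter> open_square z n \<rho> = {}" using z by auto
    then show "finite (\<Gamma>c \<inter> closure \<Omega> \<inter> open_square z n \<rho>)" by simp
  qed
qed

lemma supported_edge_test: "\<rho> > 0 \<Longrightarrow> supported_in (open_square z n \<rho>) (edge_test N c z n \<rho>)"
  using smooth_edge_test edge_test_support unfolding supported_in_def by blast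

lemma vertex_not_interior: "K \<in> \<C> \<Longrightarrow> x\<^sub>0 \<notin> interior K"
proof
  assume K: "K \<in> \<C>" and y: "x\<^sub>0 \<in> interior K"
  obtain K1 where K1: "K1 \<in> \<C>" "x\<^sub>0 extreme_point_of K1" using x0(2) by blast
  then have "x\<^sub>0 \<in> K1" by (simp add: extreme_point_of_def)
  then have "K = K1" using mesh_interior_unique[OF tri simplices K K1(1) y] by blast
  then have "{x\<^sub>0} face_of K" "{x\<^sub>0} \<noteq> K" using K1 simplices K aff_dim_simplex[of 2 K] by (auto simp: face_of_singleton aff_dim_sing)
  then show False using face_of_disjoint_interior y by blast
qed

lemma eb_nonneg: "energy_bound P \<ge> 0"
  by (simp add: energy_bound_def)

text \<open>The polynomial \<open>R = A(v\<^sub>h) - f\<^sub>h\<close> is tested with itself, on a square in a disc contained in the element. With \<open>s\<close> the sum of the moduli of its coefficients in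
the scaled coordinates, the test gives \<open>\<rho>\<^sup>2 s\<^sup>2 \<lesssim> s (\<rho>\<^sup>-\<^sup>1 \<parallel>e\<parallel> + \<rho> \<parallel>f - f\<^sub>h\<parallel>)\<close>, and \<open>\<parallel>R\<parallel> \<lesssim> \<rho> s\<close> on \<open>K\<close>; the powers of \<open>\<rho>\<close> then match.\<close>

lemma element_estimate:
  assumes K: "K \<in> \<C>"
  shows "(diameter K)\<^sup>2 * L2norm K (\<lambda>x. elem_op P vh K x - f x) \<le> element_const * (H2norm \<Omega> K err + osc_elem f fh K)"
    and "element_const \<ge> 0"
proof -
  obtain x r where r: "r > 0" "cball x r \<subseteq> K" "diameter K \<le> \<kappa> * (2 * r)" by (rule element_ball[OF K])
  \<comment> \<open>Any orientation of the square will do.\<close>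
  define n :: plane where "n = axis 1 1"
  have n: "norm n = 1" by (simp add: n_def)
  \<comment> \<open>Half the radius, so that the square with half side length \<open>\<rho>\<close> fits into the disc.\<close>
  define \<rho> where "\<rho> = r / 2"
  have rho: "\<rho> > 0" using r by (simp add: \<rho>_def)
  define d where "d = diameter K"
  note ef = element_facts[OF K]
  have xn: "norm (r *\<^sub>R n) = r" using r n by simp
  have xK: "x \<in> K" "x + r *\<^sub>R n \<in> K" using r xn by (auto simp: subset_iff dist_norm)
  have rd: "r \<le> d" using diameter_bounded_bound[OF ef(4) xK] xn by (simp add: d_def dist_norm)
  have d4: "d \<le> 4 * \<kappa> * \<rho>" using r(3) by (simp add: d_def \<rho>_def)
  have pd: "\<rho> \<le> d" using rd r by (simp add: \<rho>_def)
  have k1: "\<kappa> \<ge> 1/2"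
  proof -
    have "1 * r \<le> (2 * \<kappa>) * r" using rd r(3) by (simp add: d_def)
    then have "1 \<le> 2 * \<kappa>" using r(1) by (rule mult_right_le_imp_le)
    then show ?thesis by simp
  qed
  define U where "U = open_square x n \<rho>"
  have UI: "U \<subseteq> interior K"
  proof -
    have "ball x r \<subseteq> interior K" by (rule interior_maximal) (use r in auto)
    moreover have "U \<subseteq> ball x r"
      using open_square_norm[OF n, of _ x \<rho>] by (auto simp: U_def \<rho>_def dist_norm norm_minus_commute)
    ultimately show ?thesis by blast
  qed
  define p fp where "p = elem_poly vh K" and "fp = elem_poly fh K"
  note pp = elem_poly_props[OF K vh, folded p_def] and fpp = elem_poly_props[OF K fh, folded fp_def]
  define R where "R y = plate_op P p y - fp y" for y
  have pR: "poly_le N R" unfolding R_def[abs_def]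
    by (intro poly_le_diff poly_le_plate_op poly_le_mono[OF pp(1) N(1)] poly_le_mono[OF fpp(1) N(1)])
  have sR: "smooth R" by (rule smooth_poly_le[OF pR])
  obtain c where c: "\<And>a b. R (frame x n (\<rho> * a, \<rho> * b)) = (\<Sum>i\<le>N. \<Sum>j\<le>N. c i j * a ^ i * b ^ j)"
    by (rule poly_le_frame[OF pR, of x n \<rho>]) blast
  define w where "w = edge_test N c x n \<rho>"
  define s where "s = coeff_sum N c"
  have s0: "s \<ge> 0" by (simp add: s_def coeff_sum_def sum_nonneg)
  have w: "supported_in U w" unfolding U_def w_def by (rule supported_edge_test[OF rho])
  have sw: "smooth w" and w0: "\<And>y. y \<notin> U \<Longrightarrow> w y = 0" using w by (auto simp: supported_in_def)
  have UO: "U \<subseteq> \<Omega>" using UI ef(5) by blast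
  have Wb: "\<bar>w y\<bar> \<le> B * s" for y using test_bound[OF n rho] by (simp add: w_def s_def)
  have Db: "\<bar>pd j (pd i w) y\<bar> \<le> B / \<rho>\<^sup>2 * s" for y i j using test_bound[OF n rho] by (simp add: w_def s_def)
  note ic = inner_cut[OF UO[unfolded U_def] w[unfolded U_def]]
  have l0: "line_load (cut (closure \<Omega>) w) = 0"
  proof (rule line_load_0)
    fix E assume "E \<in> line_edges \<C> S"
    then obtain K1 where K1: "K1 \<in> \<C>" "E edge_of K1" "is_segment E" by (rule line_edgeD)
    have "w y = 0" if "y \<in> E" for y using edge_not_interior[OF K K1(1,2) that] UI w0[of y] by blast
    then show "is_segment E \<and> (\<forall>y\<in>E. cut (closure \<Omega>) w y = 0)" using K1(3) by (simp add: cut_def)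
  next
    show "cut (closure \<Omega>) w x\<^sub>0 = 0" using vertex_not_interior[OF K] UI w0[of x\<^sub>0] by (auto simp: cut_def)
  qed
  define e where "e = H2norm \<Omega> K err"
  define \<phi> where "\<phi> = L2norm K (\<lambda>y. f y - fh y)"
  have e0: "e \<ge> 0" "\<phi> \<ge> 0" by (auto simp: e_def \<phi>_def H2norm_nonneg L2norm_def)
  have res: "\<bar>(\<integral>y. moment P pd p y \<bullet> curvature pd w y \<partial>lebesgue_on (interior K))
      - (\<integral>y. f y * w y \<partial>lebesgue_on (interior K))\<bar> \<le> 16 * energy_bound P * (B / \<rho>\<^sup>2 * s) * \<rho> * e"
    using residual[of "{K}" n \<rho> x w "closure \<Omega>" "{}" K "B / \<rho>\<^sup>2 * s" "B * s", OF _ n rho w[unfolded U_def] ic _ _ _ ef(7) ef(6) _ Db Wb]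
      K ef(6) UI l0 by (auto simp: U_def e_def p_def)
  have KI: "interior K \<in> sets lebesgue" "interior K \<subseteq> K" using interior_subset by auto
  note Um = measure_open_square[OF n rho, of x, folded U_def]
  have L2I: "h \<in> L2 (interior K)" if "h \<in> L2 K" for h by (rule L2_subset[OF that KI(2) ef(7) KI(1)])
  note tb = L2_test_bound[OF KI(1) L2I Um(1) sw Wb w0]
  have sp: "smooth (plate_op P p)" by (rule smooth_plate_op[OF pp(3)])
  have green: "(\<integral>y. moment P pd p y \<bullet> curvature pd w y \<partial>lebesgue_on (interior K)) = (\<integral>y. plate_op P p y * w y \<partial>lebesgue_on (interior K))"
  proof -
    \<comment> \<open>The boundary line is moved out of the square; Green's formula then has no boundary term.\<close>
    define z where "z = x + (2 * \<rho>) *\<^sub>R n"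
    note t = tangent_simps[OF n]
    have zc: "(y - z) \<bullet> tangent n = (y - x) \<bullet> tangent n" "(y - z) \<bullet> n = (y - x) \<bullet> n - 2 * \<rho>" for y
      using t by (simp_all add: z_def inner_diff_left inner_add_left)
    have Uz: "U \<subseteq> open_square z n (4 * \<rho>)" using rho by (auto simp: U_def open_square_def zc)
    have Uh: "U \<subseteq> halfplane z n" using rho by (auto simp: U_def open_square_def zc halfplane_def)
    have wz: "supported_in (open_square z n (4 * \<rho>)) w" using w Uz by (auto simp: supported_in_def)
    have pw: "y \<notin> U \<Longrightarrow> pd i w y = 0" for y i using supported_in_pd[OF regular_open_square w[unfolded U_def]] by (auto simp: supported_in_def U_def)
    have pw2: "y \<notin> U \<Longrightarrow> pd j (pd i w) y = 0" for y i j
      using supported_in_pd[OF regular_open_square supported_in_pd[OF regular_open_square w[unfolded U_def]]] by (auto simp: supported_in_def U_def)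
    have line: "line_int z n (\<lambda>y. V_n P n p y * w y - M_nn P n p y * (grad pd w y \<bullet> n)) = 0"
    proof -
      have "z + a *\<^sub>R tangent n \<notin> U" for a
        using rho t by (simp add: U_def open_square_def z_def inner_add_left)
      then have "w (z + a *\<^sub>R tangent n) = 0 \<and> grad pd w (z + a *\<^sub>R tangent n) = 0" for a
        using w0 pw by (simp add: grad_def vec_eq_iff)
      then show ?thesis by (simp add: line_int_def)
    qed
    have mv: "(\<integral>y. h y \<partial>lebesgue_on (halfplane z n)) = (\<integral>y. h y \<partial>lebesgue_on (interior K))" if "\<And>y. y \<notin> U \<Longrightarrow> h y = 0" for h :: field
    proof -
      have Us: "U \<in> sets lebesgue" using Um(1) by (rule fmeasurableD)
      have hs: "halfplane z n \<in> sets lebesgue" by auto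
      show ?thesis using integral_on_subset(1)[OF Uh hs Us, of h] integral_on_subset(1)[OF UI KI(1) Us, of h] that by auto
    qed
    have "(\<integral>y. moment P pd p y \<bullet> curvature pd w y \<partial>lebesgue_on (halfplane z n)) = (\<integral>y. plate_op P p y * w y \<partial>lebesgue_on (halfplane z n))"
    proof -
      have r4: "4 * \<rho> > 0" using rho by simp
      have I1: "{y \<in> open_square z n (4 * \<rho>). (y - z) \<bullet> n < 0} \<subseteq> halfplane z n" by (auto simp: halfplane_def)
      have I2: "(y - z) \<bullet> n \<le> 0" if "y \<in> halfplane z n" for y using that by (simp add: halfplane_def)
      have "(\<integral>y. moment P pd p y \<bullet> curvature pd w y \<partial>lebesgue_on (halfplane z n)) = (\<integral>y. plate_op P p y * w y \<partial>lebesgue_on (halfplane z n))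
          + line_int z n (\<lambda>y. V_n P n p y * w y - M_nn P n p y * (grad pd w y \<bullet> n))"
        by (rule green_element[OF n pp(3) r4 wz I1 I2 halfplane_borel])
      then show ?thesis using line by linarith
    qed
    then show ?thesis
      using mv[of "\<lambda>y. moment P pd p y \<bullet> curvature pd w y"] mv[of "\<lambda>y. plate_op P p y * w y"] w0 pw2
      by (simp add: density_eq curvature_component)
  qed
  define X where "X = (\<integral>y. R y * w y \<partial>lebesgue_on (interior K))"
  have X1: "X = ((\<integral>y. moment P pd p y \<bullet> curvature pd w y \<partial>lebesgue_on (interior K)) - (\<integral>y. f y * w y \<partial>lebesgue_on (interior K)))
     + (\<integral>y. (f y - fh y) * w y \<partial>lebesgue_on (interior K))"
  proof -
    have a: "X = (\<integral>y. plate_op P p y * w y \<partial>lebesgue_on (interior K)) - (\<integral>y. fp y * w y \<partial>lebesgue_on (interior K))"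
      unfolding X_def R_def left_diff_distrib
      by (intro Bochner_Integration.integral_diff tb(1) L2_poly[OF sp K] L2_poly[OF fpp(3) K])
    have b: "(\<integral>y. (f y - fp y) * w y \<partial>lebesgue_on (interior K)) = (\<integral>y. f y * w y \<partial>lebesgue_on (interior K)) - (\<integral>y. fp y * w y \<partial>lebesgue_on (interior K))"
      unfolding left_diff_distrib
      by (intro Bochner_Integration.integral_diff tb(1) L2_load[OF K] L2_poly[OF fpp(3) K])
    have "(\<integral>y. (f y - fp y) * w y \<partial>lebesgue_on (interior K)) = (\<integral>y. (f y - fh y) * w y \<partial>lebesgue_on (interior K))"
      by (intro Bochner_Integration.integral_cong refl) (use fpp(2) KI(2) in auto)
    then show ?thesis using a b green by simp
  qed
  have fhL: "(\<lambda>y. f y - fh y) \<in> L2 K"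
  proof -
    have "(\<lambda>y. f y - fp y) \<in> L2 K" by (rule L2_diff[OF L2_load[OF K] L2_poly[OF fpp(3) K]])
    then show ?thesis by (rule L2_AE[OF _ ef(7)]) (use fpp(2) in \<open>auto intro!: AE_I2\<close>)
  qed
  have "\<bar>\<integral>y. (f y - fh y) * w y \<partial>lebesgue_on (interior K)\<bar> \<le> B * s * sqrt (measure lebesgue U) * L2norm (interior K) (\<lambda>y. f y - fh y)"
    by (rule tb(2)[OF fhL])
  also have "\<dots> = B * s * sqrt (measure lebesgue U) * \<phi>" by (simp add: \<phi>_def L2norm_interior[OF ef(1,3)])
  also have "\<dots> \<le> B * s * (4 * \<rho>) * \<phi>" using Um(2) B s0 e0 by (intro mult_right_mono mult_left_mono) auto
  finally have X2: "X \<le> 16 * energy_bound P * (B / \<rho>\<^sup>2 * s) * \<rho> * e + B * s * (4 * \<rho>) * \<phi>"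
    using X1 res by linarith
  define I where "I = (\<integral>p. weight (fst p) * weight (snd p) * (\<Sum>i\<le>N. \<Sum>j\<le>N. c i j * fst p ^ i * snd p ^ j)\<^sup>2 \<partial>(lborel \<Otimes>\<^sub>M lborel))"
  have XI: "X = \<rho>\<^sup>2 * I"
  proof -
    have sRw: "smooth (\<lambda>y. R y * w y)" by (rule smooth_mult[OF sR sw])
    have "X = (\<integral>y. indicator (interior K) y * (R y * w y) \<partial>lborel)"
      unfolding X_def by (rule integral_lebesgue_on_lborel) (auto intro: borel_measurable_continuous_onI smooth_continuous[OF sRw])
    also have "\<dots> = (\<integral>y. R y * w y \<partial>lborel)"
      by (intro Bochner_Integration.integral_cong refl) (use w0 UI in \<open>auto simp: indicator_def\<close>)
    also have "\<dots> = \<rho>\<^sup>2 * (\<integral>p. R (frame x n (\<rho> * fst p, \<rho> * snd p)) * w (frame x n (\<rho> * fst p, \<rho> * snd p)) \<partial>(lborel \<Otimes>\<^sub>M lborel))"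
      by (rule sum_frame_integral[OF n rho smooth_continuous[OF sRw]])
    also have "(\<integral>p. R (frame x n (\<rho> * fst p, \<rho> * snd p)) * w (frame x n (\<rho> * fst p, \<rho> * snd p)) \<partial>(lborel \<Otimes>\<^sub>M lborel)) = I"
      unfolding I_def by (intro Bochner_Integration.integral_cong refl) (simp add: c w_def edge_test_frame[OF n rho] power2_eq_square)
    finally show ?thesis .
  qed
  define k0 where "k0 = real (N + 1) ^ 4 * Cw * B"
  have k00: "k0 \<ge> 0" using Cw B by (simp add: k0_def)
  have "s\<^sup>2 \<le> real (N + 1) ^ 4 * (Cw * I)"
    unfolding s_def by (rule coeff_sum_bound) (use weight2 in \<open>auto simp: I_def\<close>)
  also have "\<dots> = real (N + 1) ^ 4 * Cw * (X / \<rho>\<^sup>2)" using rho by (simp add: XI)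
  also have "\<dots> \<le> real (N + 1) ^ 4 * Cw * ((16 * energy_bound P * (B / \<rho>\<^sup>2 * s) * \<rho> * e + B * s * (4 * \<rho>) * \<phi>) / \<rho>\<^sup>2)"
    using X2 Cw by (intro mult_left_mono divide_right_mono) auto
  also have "\<dots> = s * (k0 * (16 * energy_bound P * e + 4 * \<rho>\<^sup>2 * \<phi>) / \<rho> ^ 3)"
    using rho by (simp add: k0_def field_simps power2_eq_square power3_eq_cube)
  finally have "s\<^sup>2 \<le> s * (k0 * (16 * energy_bound P * e + 4 * \<rho>\<^sup>2 * \<phi>) / \<rho> ^ 3)" .
  then have "s \<le> k0 * (16 * energy_bound P * e + 4 * \<rho>\<^sup>2 * \<phi>) / \<rho> ^ 3"
    by (rule cancel_square[OF s0]) (use k00 e0 rho eb_nonneg in auto)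
  then have "s * \<rho> ^ 3 \<le> k0 * (16 * energy_bound P * e + 4 * \<rho>\<^sup>2 * \<phi>)" using rho by (simp add: pos_le_divide_eq)
  also have "\<dots> \<le> k0 * ((16 * energy_bound P + 4) * (e + d\<^sup>2 * \<phi>))"
  proof (rule mult_left_mono[OF _ k00])
    have "\<rho>\<^sup>2 * \<phi> \<le> d\<^sup>2 * \<phi>" using pd rho e0 by (intro mult_right_mono power_mono) auto
    moreover have "0 \<le> energy_bound P * (d\<^sup>2 * \<phi>)" using eb_nonneg e0 by simp
    ultimately show "16 * energy_bound P * e + 4 * \<rho>\<^sup>2 * \<phi> \<le> (16 * energy_bound P + 4) * (e + d\<^sup>2 * \<phi>)"
      using e0 by (simp add: algebra_simps)
  qed
  finally have sb: "s * \<rho> ^ 3 \<le> k0 * (16 * energy_bound P + 4) * (e + d\<^sup>2 * \<phi>)" by (simp add: mult.assoc)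
  have Rb: "L2norm K R \<le> (4 * \<kappa>) ^ (2 * N) * s * (32 * \<kappa> * \<rho>)"
  proof -
    define Q where "Q = open_square x n (8 * \<kappa> * \<rho>)"
    have kr: "8 * \<kappa> * \<rho> > 0" using k1 rho by simp
    have KQ: "K \<subseteq> Q" and coord: "\<And>y. y \<in> K \<Longrightarrow> \<bar>(y - x) \<bullet> tangent n\<bar> \<le> 4 * \<kappa> * \<rho> \<and> \<bar>(y - x) \<bullet> n\<bar> \<le> 4 * \<kappa> * \<rho>"
    proof -
      show co: "\<bar>(y - x) \<bullet> tangent n\<bar> \<le> 4 * \<kappa> * \<rho> \<and> \<bar>(y - x) \<bullet> n\<bar> \<le> 4 * \<kappa> * \<rho>" if y: "y \<in> K" for y
      proof -
        have "norm (y - x) \<le> d" using diameter_bounded_bound[OF ef(4) y xK(1)] by (simp add: d_def dist_norm)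
        then show ?thesis
          using Cauchy_Schwarz_ineq2[of "y - x" "tangent n"] Cauchy_Schwarz_ineq2[of "y - x" n] tangent_simps(5)[OF n] n d4 by simp
      qed
      show "K \<subseteq> Q"
      proof
        fix y assume y: "y \<in> K"
        have "4 * \<kappa> * \<rho> < 8 * \<kappa> * \<rho>" using kr by simp
        then show "y \<in> Q" using co[OF y] unfolding Q_def open_square_def by auto
      qed
    qed
    note Qm = measure_open_square[OF n kr, of x, folded Q_def]
    have "K \<in> lmeasurable" using ef(2) by (rule lmeasurable_compact)
    moreover have "\<bar>R y\<bar> \<le> (4 * \<kappa>) ^ (2 * N) * s" if y: "y \<in> K" for y
    proof -
      define a b where "a = (y - x) \<bullet> tangent n / \<rho>" and "b = (y - x) \<bullet> n / \<rho>"
      have ab: "\<bar>a\<bar> \<le> 4 * \<kappa>" "\<bar>b\<bar> \<le> 4 * \<kappa>" using coord[OF y] rho by (auto simp: a_def b_def abs_divide pos_divide_le_eq)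
      have "y = x + (y - x)" by simp
      also have "y - x = (\<rho> * a) *\<^sub>R tangent n + (\<rho> * b) *\<^sub>R n" using frame_decompose[OF n, of "y - x"] rho by (simp add: a_def b_def)
      finally have "y = frame x n (\<rho> * a, \<rho> * b)" by (simp add: frame_def add.assoc)
      then show ?thesis using c[of a b] poly_sum_bound[OF ab, where N = N and c = c] k1 by (simp add: s_def)
    qed
    ultimately have "L2norm K R \<le> (4 * \<kappa>) ^ (2 * N) * s * sqrt (measure lebesgue K)"
      by (intro L2norm_bounded) (use s0 in auto)
    also have "sqrt (measure lebesgue K) \<le> sqrt (measure lebesgue Q)"
      using KQ ef(7) Qm(1) by (intro real_sqrt_le_mono measure_mono_fmeasurable)
    also have "\<dots> \<le> 32 * \<kappa> * \<rho>" using Qm(2) by simp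
    finally show ?thesis using s0 by (simp add: mult_left_mono)
  qed
  have osc: "osc_elem f fh K = d\<^sup>2 * \<phi>" by (simp add: osc_elem_def d_def \<phi>_def)
  have "L2norm K (\<lambda>y. elem_op P vh K y - f y) = L2norm K (\<lambda>y. R y + (fh y - f y))"
  proof -
    have "AE y in lebesgue_on K. elem_op P vh K y - f y = R y + (fh y - f y)"
      using fpp(2) by (intro AE_I2) (simp add: R_def elem_op_def p_def)
    then show ?thesis by (rule L2norm_AE[OF ef(7)])
  qed
  also have "\<dots> \<le> L2norm K R + L2norm K (\<lambda>y. fh y - f y)"
    using L2_cmult[OF fhL, of "-1"] by (intro L2norm_triangle L2_poly[OF sR K]) simp
  also have "L2norm K (\<lambda>y. fh y - f y) = \<phi>" unfolding \<phi>_def L2norm_def by (simp add: power2_commute)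
  finally have "d\<^sup>2 * L2norm K (\<lambda>y. elem_op P vh K y - f y) \<le> d\<^sup>2 * (L2norm K R + \<phi>)" by (intro mult_left_mono) auto
  also have "\<dots> \<le> (4 * \<kappa> * \<rho>)\<^sup>2 * ((4 * \<kappa>) ^ (2 * N) * s * (32 * \<kappa> * \<rho>)) + d\<^sup>2 * \<phi>"
  proof -
    have "d\<^sup>2 * L2norm K R \<le> (4 * \<kappa> * \<rho>)\<^sup>2 * ((4 * \<kappa>) ^ (2 * N) * s * (32 * \<kappa> * \<rho>))"
      using d4 pd rho Rb by (intro mult_mono power_mono) (auto simp: L2norm_def)
    then show ?thesis by (simp add: distrib_left)
  qed
  also have "(4 * \<kappa> * \<rho>)\<^sup>2 * ((4 * \<kappa>) ^ (2 * N) * s * (32 * \<kappa> * \<rho>)) = 512 * \<kappa> ^ 3 * (4 * \<kappa>) ^ (2 * N) * (s * \<rho> ^ 3)"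
    by (simp add: power2_eq_square power3_eq_cube)
  also have "\<dots> \<le> 512 * \<kappa> ^ 3 * (4 * \<kappa>) ^ (2 * N) * (k0 * (16 * energy_bound P + 4) * (e + d\<^sup>2 * \<phi>))"
    using sb k1 by (intro mult_left_mono) auto
  finally have fin: "d\<^sup>2 * L2norm K (\<lambda>y. elem_op P vh K y - f y) \<le>
     512 * \<kappa> ^ 3 * (4 * \<kappa>) ^ (2 * N) * (k0 * (16 * energy_bound P + 4) * (e + d\<^sup>2 * \<phi>)) + d\<^sup>2 * \<phi>" by simp
  show "(diameter K)\<^sup>2 * L2norm K (\<lambda>x. elem_op P vh K x - f x) \<le> element_const * (H2norm \<Omega> K err + osc_elem f fh K)"
    unfolding osc e_def[symmetric] d_def[symmetric]
  proof (rule order_trans[OF fin])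
    have ce: "element_const = 512 * \<kappa> ^ 3 * (4 * \<kappa>) ^ (2 * N) * (k0 * (16 * energy_bound P + 4)) + 1"
      by (simp add: element_const_def k0_def)
    show "512 * \<kappa> ^ 3 * (4 * \<kappa>) ^ (2 * N) * (k0 * (16 * energy_bound P + 4) * (e + d\<^sup>2 * \<phi>)) + d\<^sup>2 * \<phi>
       \<le> element_const * (e + d\<^sup>2 * \<phi>)"
      unfolding ce distrib_right using e0 by (simp add: mult.assoc)
  qed
  show "element_const \<ge> 0" using k1 Cw B eb_nonneg by (simp add: element_const_def)
qed

end

section \<open>Polynomials and test functions along an edge\<close>

text \<open>The end points may come in either order, whence the sign of \<open>\<epsilon>\<close>.\<close>

lemma seg_param_frame:
  assumes E: "is_segment E" and ef: "edge_frame \<kappa> K E n"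
  obtains \<epsilon> where "\<bar>\<epsilon>\<bar> = diameter E" "dist (fst (seg_ends E)) (snd (seg_ends E)) = diameter E"
    "\<And>\<tau>. seg_param E \<tau> = edge_mid E + (\<epsilon> * (\<tau> - 1/2)) *\<^sub>R tangent n"
proof -
  define a b z T where "a = fst (seg_ends E)" and "b = snd (seg_ends E)" and "z = edge_mid E" and "T = tangent n"
  note l = edge_frame_line[OF ef]
  have T1: "norm T = 1" using tangent_simps(5)[OF l(4)] by (simp add: T_def)
  have Eab: "E = closed_segment a b" using seg_ends(1)[OF E] by (simp add: a_def b_def)
  then have "a \<in> {z + t *\<^sub>R T |t. \<bar>t\<bar> \<le> diameter E / 2}" using l(1) by (auto simp: z_def T_def)
  then obtain t where t: "a = z + t *\<^sub>R T" "\<bar>t\<bar> \<le> diameter E / 2" by blast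
  have "z = (1/2) *\<^sub>R (a + b)" by (simp add: z_def edge_mid_def a_def b_def)
  then have "a + b = 2 *\<^sub>R z" by simp
  then have b: "b = z - t *\<^sub>R T" using t(1) by (simp add: algebra_simps scaleR_2)
  have "z + (diameter E / 2) *\<^sub>R T \<in> closed_segment a b"
    using edge_frame_mem[OF ef, of "diameter E / 2"] l(2) unfolding Eab[symmetric] z_def T_def by simp
  then obtain u where u: "0 \<le> u" "u \<le> 1" "z + (diameter E / 2) *\<^sub>R T = (1 - u) *\<^sub>R a + u *\<^sub>R b" by (auto simp: in_segment)
  have "(1 - u) *\<^sub>R a + u *\<^sub>R b = z + (t * (1 - 2 * u)) *\<^sub>R T" by (simp add: t(1) b vec_eq_iff algebra_simps)
  then have "(diameter E / 2) *\<^sub>R T = (t * (1 - 2 * u)) *\<^sub>R T" using u(3) by simp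
  then have "diameter E / 2 = t * (1 - 2 * u)" using T1 by auto
  then have "diameter E / 2 \<le> \<bar>t\<bar> * \<bar>1 - 2 * u\<bar>" by (simp flip: abs_mult)
  also have "\<dots> \<le> \<bar>t\<bar> * 1" using u by (intro mult_left_mono) auto
  finally have th: "\<bar>2 * t\<bar> = diameter E" using t(2) by (simp add: abs_mult)
  show thesis
  proof (rule that[of "- 2 * t"])
    show "\<bar>- 2 * t\<bar> = diameter E" using th by simp
    have "a - b = (2 * t) *\<^sub>R T" by (simp add: t(1) b algebra_simps flip: scaleR_add_left)
    then show "dist (fst (seg_ends E)) (snd (seg_ends E)) = diameter E"
      using th T1 by (simp add: a_def[symmetric] b_def[symmetric] dist_norm)
    show "seg_param E \<tau> = edge_mid E + (- 2 * t * (\<tau> - 1/2)) *\<^sub>R tangent n" for \<tau>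
    proof -
      have "seg_param E \<tau> = a + \<tau> *\<^sub>R (b - a)" by (simp add: seg_param_def a_def b_def)
      also have "b - a = (- 2 * t) *\<^sub>R T" by (simp add: t(1) b algebra_simps flip: scaleR_add_left)
      also have "a + \<tau> *\<^sub>R ((- 2 * t) *\<^sub>R T) = z + (t + \<tau> * (- 2 * t)) *\<^sub>R T"
        unfolding scaleR_add_left scaleR_scaleR t(1) by (rule add.assoc)
      also have "t + \<tau> * (- 2 * t) = - 2 * t * (\<tau> - 1/2)" by (simp add: algebra_simps)
      finally show ?thesis by (simp add: z_def T_def)
    qed
  qed
qed

lemma seg_int_line:
  assumes E: "is_segment E" and ef: "edge_frame \<kappa> K E n" and w: "continuous_on UNIV w"
    and z: "\<And>t. \<bar>t\<bar> \<ge> diameter E / 2 \<Longrightarrow> w (edge_mid E + t *\<^sub>R tangent n) = 0"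
  shows "seg_int E w = line_int (edge_mid E) n w"
proof -
  obtain \<epsilon> where e: "\<bar>\<epsilon>\<bar> = diameter E" "dist (fst (seg_ends E)) (snd (seg_ends E)) = diameter E"
    "\<And>\<tau>. seg_param E \<tau> = edge_mid E + (\<epsilon> * (\<tau> - 1/2)) *\<^sub>R tangent n" by (rule seg_param_frame[OF E ef]) blast
  define h where "h t = w (edge_mid E + t *\<^sub>R tangent n)" for t
  have hc: "continuous_on UNIV h" unfolding h_def by (intro continuous_on_compose2[OF w] continuous_intros) auto
  have d: "diameter E > 0" using edge_frame_line(2)[OF ef] by simp
  then have e0: "\<epsilon> \<noteq> 0" using e(1) by auto
  have out: "h (\<epsilon> * (\<tau> - 1/2)) = 0" if "\<tau> \<notin> {0..1}" for \<tau>
  proof -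
    have "1/2 \<le> \<bar>\<tau> - 1/2\<bar>" using that by auto
    then have "diameter E * (1/2) \<le> diameter E * \<bar>\<tau> - 1/2\<bar>" using d by (intro mult_left_mono) auto
    then show ?thesis using z[of "\<epsilon> * (\<tau> - 1/2)"] e(1) by (simp add: h_def abs_mult)
  qed
  have "(\<integral>\<tau>. w (seg_param E \<tau>) \<partial>lebesgue_on {0..1}) = (\<integral>\<tau>. (if \<tau> \<in> {0..1} then h (\<epsilon> * (\<tau> - 1/2)) else 0) \<partial>lebesgue)"
    unfolding e(3) h_def[symmetric] by (rule Lebesgue_Measure.integral_restrict_UNIV[symmetric]) simp
  also have "\<dots> = (\<integral>\<tau>. h (\<epsilon> * (\<tau> - 1/2)) \<partial>lebesgue)"
    by (intro Bochner_Integration.integral_cong refl) (use out in auto)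
  also have "\<dots> = (\<integral>\<tau>. h (\<epsilon> * (\<tau> - 1/2)) \<partial>lborel)"
    by (intro integral_completion)
       (auto intro!: borel_measurable_continuous_onI continuous_on_compose2[OF hc] continuous_intros)
  finally have "seg_int E w = \<bar>\<epsilon>\<bar> * (\<integral>\<tau>. h (\<epsilon> * (\<tau> - 1/2)) \<partial>lborel)" by (simp add: seg_int_def e(1,2))
  also have "\<dots> = (\<integral>t. h t \<partial>lborel)"
    using lborel_integral_real_affine[OF e0, of h "- \<epsilon> / 2"] by (simp add: algebra_simps)
  finally show ?thesis by (simp add: line_int_def h_def)
qed

lemma continuous_seg_L2:
  assumes w: "continuous_on UNIV w" shows "w \<in> seg_L2 E"
proof -
  have c: "continuous_on {0..1} (\<lambda>t. w (seg_param E t))" unfolding seg_param_def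
    by (intro continuous_on_compose2[OF w] continuous_intros) auto
  have "continuous_on {0..1} (\<lambda>t. (w (seg_param E t))\<^sup>2)" by (intro continuous_on_power c)
  then have "integrable (lebesgue_on {0..1}) (\<lambda>t. (w (seg_param E t))\<^sup>2)"
    by (intro continuous_imp_integrable_real) auto
  then show ?thesis using c by (simp add: seg_L2_def continuous_imp_measurable_on_sets_lebesgue)
qed

lemma seg_L2_diff:
  assumes "g \<in> seg_L2 E" "h \<in> seg_L2 E" shows "(\<lambda>x. g x - h x) \<in> seg_L2 E"
proof -
  have m[measurable]: "(\<lambda>t. g (seg_param E t)) \<in> borel_measurable (lebesgue_on {0..1})"
     "(\<lambda>t. h (seg_param E t)) \<in> borel_measurable (lebesgue_on {0..1})"
    and i: "integrable (lebesgue_on {0..1}) (\<lambda>t. (g (seg_param E t))\<^sup>2)" "integrable (lebesgue_on {0..1}) (\<lambda>t. (h (seg_param E t))\<^sup>2)"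
    using assms by (auto simp: seg_L2_def)
  note cs = integral_Cauchy_Schwarz(1)[OF m i]
  have "integrable (lebesgue_on {0..1}) (\<lambda>t. (g (seg_param E t))\<^sup>2 - 2 * (g (seg_param E t) * h (seg_param E t)) + (h (seg_param E t))\<^sup>2)"
    using i cs by (intro Bochner_Integration.integrable_add Bochner_Integration.integrable_diff integrable_mult_right) auto
  then show ?thesis by (simp add: seg_L2_def power2_diff algebra_simps)
qed

lemma seg_norm_eq:
  "seg_norm E w = sqrt (dist (fst (seg_ends E)) (snd (seg_ends E))) * sqrt (\<integral>t. (w (seg_param E t))\<^sup>2 \<partial>lebesgue_on {0..1})"
  by (simp add: seg_norm_def seg_int_def real_sqrt_mult)

lemma seg_norm_diff:
  assumes "g \<in> seg_L2 E" "h \<in> seg_L2 E"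
  shows "seg_norm E (\<lambda>x. g x - h x) \<le> seg_norm E g + seg_norm E h"
proof -
  define G H where "G t = g (seg_param E t)" and "H t = h (seg_param E t)" for t
  let ?M = "lebesgue_on {0..1::real}"
  have m[measurable]: "G \<in> borel_measurable ?M" "H \<in> borel_measurable ?M"
    and i: "integrable ?M (\<lambda>t. (G t)\<^sup>2)" "integrable ?M (\<lambda>t. (H t)\<^sup>2)"
    using assms by (auto simp: seg_L2_def G_def[abs_def] H_def[abs_def])
  define \<alpha> \<beta> where "\<alpha> = sqrt (\<integral>t. (G t)\<^sup>2 \<partial>?M)" and "\<beta> = sqrt (\<integral>t. (H t)\<^sup>2 \<partial>?M)"
  note cs = integral_Cauchy_Schwarz[OF m i, folded \<alpha>_def \<beta>_def]
  have ab: "\<alpha> \<ge> 0" "\<beta> \<ge> 0" "\<alpha>\<^sup>2 = (\<integral>t. (G t)\<^sup>2 \<partial>?M)" "\<beta>\<^sup>2 = (\<integral>t. (H t)\<^sup>2 \<partial>?M)"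
    by (auto simp: \<alpha>_def \<beta>_def)
  have "(\<integral>t. (G t - H t)\<^sup>2 \<partial>?M) = (\<integral>t. (G t)\<^sup>2 - 2 * (G t * H t) + (H t)\<^sup>2 \<partial>?M)"
    by (intro Bochner_Integration.integral_cong refl) (simp add: power2_diff)
  also have "\<dots> = \<alpha>\<^sup>2 - 2 * (\<integral>t. G t * H t \<partial>?M) + \<beta>\<^sup>2"
    unfolding ab using i cs(1) by simp
  also have "\<dots> \<le> (\<alpha> + \<beta>)\<^sup>2" using cs(2) by (simp add: power2_sum)
  finally have "sqrt (\<integral>t. (G t - H t)\<^sup>2 \<partial>?M) \<le> \<alpha> + \<beta>" using ab by (intro real_le_lsqrt) auto
  then have "sqrt (dist (fst (seg_ends E)) (snd (seg_ends E))) * sqrt (\<integral>t. (G t - H t)\<^sup>2 \<partial>?M)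
     \<le> sqrt (dist (fst (seg_ends E)) (snd (seg_ends E))) * (\<alpha> + \<beta>)" by (intro mult_left_mono) auto
  then show ?thesis unfolding seg_norm_eq \<alpha>_def \<beta>_def G_def H_def by (simp add: distrib_left)
qed

lemma seg_square_le:
  assumes b: "\<And>t. t \<in> {0..1} \<Longrightarrow> \<bar>w (seg_param E t)\<bar> \<le> b"
  shows "sqrt (\<integral>t. (w (seg_param E t))\<^sup>2 \<partial>lebesgue_on {0..1}) \<le> b"
proof -
  have b0: "b \<ge> 0" using b[of 0] by simp
  have "(\<integral>t. (w (seg_param E t))\<^sup>2 \<partial>lebesgue_on {0..1}) \<le> b\<^sup>2"
  proof (cases "integrable (lebesgue_on {0..1}) (\<lambda>t. (w (seg_param E t))\<^sup>2)")
    case True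
    have c: "integrable (lebesgue_on {0..1::real}) (\<lambda>t. b\<^sup>2)" by (intro continuous_imp_integrable_real) auto
    have "(\<integral>t. (w (seg_param E t))\<^sup>2 \<partial>lebesgue_on {0..1}) \<le> (\<integral>t. b\<^sup>2 \<partial>lebesgue_on {0..1::real})"
    proof (rule Bochner_Integration.integral_mono[OF True c])
      fix t :: real assume "t \<in> space (lebesgue_on {0..1})"
      then have "\<bar>w (seg_param E t)\<bar> \<le> b" using b by simp
      then show "(w (seg_param E t))\<^sup>2 \<le> b\<^sup>2" using abs_le_square_iff[of "w (seg_param E t)" b] b0 by simp
    qed
    then show ?thesis by (simp add: measure_restrict_space)
  qed (simp add: not_integrable_integral_eq)
  then show ?thesis using b0 by (rule real_le_lsqrt[rotated]) 
qed

lemma seg_norm_le: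
  assumes E: "is_segment E" and ef: "edge_frame \<kappa> K E n" and b: "\<And>x. x \<in> E \<Longrightarrow> \<bar>w x\<bar> \<le> b"
  shows "seg_norm E w \<le> sqrt (diameter E) * b"
proof -
  obtain \<epsilon> where e: "dist (fst (seg_ends E)) (snd (seg_ends E)) = diameter E" by (rule seg_param_frame[OF E ef]) blast
  show ?thesis unfolding seg_norm_eq e
    by (intro mult_left_mono seg_square_le b seg_param_in[OF E]) (use edge_frame_line(2)[OF ef] in auto)
qed

lemma seg_int_mult_le:
  assumes E: "is_segment E" and ef: "edge_frame \<kappa> K E n" and d: "d \<in> seg_L2 E"
    and w: "continuous_on UNIV w" "\<And>x. \<bar>w x\<bar> \<le> W"
  shows "\<bar>seg_int E (\<lambda>x. d x * w x)\<bar> \<le> sqrt (diameter E) * seg_norm E d * W"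
    and "integrable (lebesgue_on {0..1}) (\<lambda>t. d (seg_param E t) * w (seg_param E t))"
proof -
  obtain \<epsilon> where e: "dist (fst (seg_ends E)) (snd (seg_ends E)) = diameter E" by (rule seg_param_frame[OF E ef]) blast
  have h: "diameter E > 0" using edge_frame_line(2)[OF ef] by simp
  define D U where "D t = d (seg_param E t)" and "U t = w (seg_param E t)" for t
  let ?M = "lebesgue_on {0..1::real}"
  have m: "D \<in> borel_measurable ?M" "U \<in> borel_measurable ?M"
    and i: "integrable ?M (\<lambda>t. (D t)\<^sup>2)" "integrable ?M (\<lambda>t. (U t)\<^sup>2)"
    using d continuous_seg_L2[OF w(1), of E] by (auto simp: seg_L2_def D_def[abs_def] U_def[abs_def])
  note cs = integral_Cauchy_Schwarz[OF m i]
  show "integrable ?M (\<lambda>t. d (seg_param E t) * w (seg_param E t))" using cs(1) by (simp add: D_def U_def)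
  have "\<bar>\<integral>t. D t * U t \<partial>?M\<bar> \<le> sqrt (\<integral>t. (D t)\<^sup>2 \<partial>?M) * sqrt (\<integral>t. (U t)\<^sup>2 \<partial>?M)" by (rule cs(2))
  also have "\<dots> \<le> sqrt (\<integral>t. (D t)\<^sup>2 \<partial>?M) * W"
    unfolding U_def by (intro mult_left_mono seg_square_le w(2)) auto
  finally have "diameter E * \<bar>\<integral>t. D t * U t \<partial>?M\<bar> \<le> diameter E * (sqrt (\<integral>t. (D t)\<^sup>2 \<partial>?M) * W)"
    using h by (intro mult_left_mono) auto
  also have "\<dots> = sqrt (diameter E) * (sqrt (diameter E) * sqrt (\<integral>t. (D t)\<^sup>2 \<partial>?M)) * W" using h by simp
  finally show "\<bar>seg_int E (\<lambda>x. d x * w x)\<bar> \<le> sqrt (diameter E) * seg_norm E d * W"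
    using h by (simp add: seg_int_def seg_norm_eq e abs_mult D_def U_def)
qed

text \<open>Polynomials in \<open>a\<close> times \<open>b ^ J\<close>.\<close>

definition edge_coeffs :: "nat \<Rightarrow> (nat \<Rightarrow> real) \<Rightarrow> nat \<Rightarrow> nat \<Rightarrow> real" where
  "edge_coeffs J c i j = (if j = J then c i else 0)"

lemma coeff_sum_edge: "J \<le> N \<Longrightarrow> coeff_sum N (edge_coeffs J c) = (\<Sum>i\<le>N. \<bar>c i\<bar>)"
  by (simp add: coeff_sum_def edge_coeffs_def if_distrib[of abs] cong: if_cong)

lemma edge_test_on_line:
  fixes z n :: plane and c :: "nat \<Rightarrow> real"
  assumes n: "norm n = 1" and r: "\<rho> > 0" and J: "J \<le> N"
  defines "w \<equiv> edge_test N (edge_coeffs J c) z n \<rho>"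
  shows "w (z + (\<rho> * a) *\<^sub>R tangent n) = mono_bump J 0 * (weight a * (\<Sum>i\<le>N. c i * a ^ i))"
    and "grad pd w (z + (\<rho> * a) *\<^sub>R tangent n) \<bullet> n = deriv (mono_bump J) 0 / \<rho> * (weight a * (\<Sum>i\<le>N. c i * a ^ i))"
proof -
  define x where "x = z + (\<rho> * a) *\<^sub>R tangent n"
  note t = tangent_simps[OF n]
  have x: "(x - z) \<bullet> ((1/\<rho>) *\<^sub>R tangent n) = a" "(x - z) \<bullet> ((1/\<rho>) *\<^sub>R n) = 0"
    using r t by (simp_all add: x_def)
  have one: "(\<Sum>i\<le>N. \<Sum>j\<le>N. edge_coeffs J c i j * F i j) = (\<Sum>i\<le>N. c i * F i J)" for F :: "nat \<Rightarrow> nat \<Rightarrow> real"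
    using J by (simp add: edge_coeffs_def if_distrib[of "\<lambda>u. u * _"] cong: if_cong)
  show "w (z + (\<rho> * a) *\<^sub>R tangent n) = mono_bump J 0 * (weight a * (\<Sum>i\<le>N. c i * a ^ i))"
    unfolding x_def[symmetric] w_def edge_test_def one x mono_bump_eq[of _ a] by (simp add: sum_distrib_left mult_ac)
  have p: "pd k w x = (\<Sum>i\<le>N. c i * (mono_bump i a * (n $ k / \<rho> * deriv (mono_bump J) 0)
      + (tangent n $ k / \<rho> * deriv (mono_bump i) a) * mono_bump J 0))" for k
    unfolding w_def pd_edge_test one x by simp
  define A B where "A = (\<Sum>i\<le>N. c i * mono_bump i a) * (deriv (mono_bump J) 0 / \<rho>)"
    and "B = (\<Sum>i\<le>N. c i * deriv (mono_bump i) a) * (mono_bump J 0 / \<rho>)"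
  have "pd k w x = A * n $ k + B * tangent n $ k" for k
    unfolding p A_def B_def by (simp add: sum_distrib_right sum_distrib_left algebra_simps sum.distrib)
  then have "grad pd w x = A *\<^sub>R n + B *\<^sub>R tangent n" by (simp add: grad_def vec_eq_iff)
  then have "grad pd w x \<bullet> n = A" using t by (simp add: inner_add_left)
  then show "grad pd w (z + (\<rho> * a) *\<^sub>R tangent n) \<bullet> n = deriv (mono_bump J) 0 / \<rho> * (weight a * (\<Sum>i\<le>N. c i * a ^ i))"
    by (simp add: x_def A_def mono_bump_eq sum_distrib_left sum_distrib_right mult_ac)
qed

context plate_fem
begin

text \<open>The common core of all edge estimates, in one dimension. The function \<open>W\<close> is the test function (or its normal derivative), whose trace is \<open>\<beta>\<close> times the
weighted polynomial \<open>p\<close>; so the hypothesis bounds \<open>\<rho> \<beta>\<close> times the weighted integral of \<open>p\<^sup>2\<close>, hence the coefficients, hence \<open>p\<close> on all of \<open>E\<close>.\<close>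

lemma edge_poly_bound:
  assumes E: "is_segment E" and ef: "edge_frame \<kappa> K E n" and p: "poly_le N p"
    and r: "\<rho> = square_ratio \<kappa> * diameter E" and b: "\<beta> > 0" and X: "X \<ge> 0"
    and w: "\<And>c. \<exists>W. \<bar>line_int (edge_mid E) n (\<lambda>x. p x * W x)\<bar> \<le> X * (\<Sum>i\<le>N. \<bar>c i\<bar>) \<and>
      (\<forall>a. W (edge_mid E + (\<rho> * a) *\<^sub>R tangent n) = \<beta> * (weight a * (\<Sum>i\<le>N. c i * a ^ i)))"
  shows "sqrt (diameter E) * seg_norm E p
    \<le> diameter E * (1 / (2 * square_ratio \<kappa>)) ^ N * (real (N + 1) ^ 4 * Cw) * X / (\<rho> * \<beta>)"
proof -
  \<comment> \<open>In the scaled coordinate the edge is the interval from \<open>- l\<close> to \<open>l\<close>.\<close>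
  define z h \<theta> l where "z = edge_mid E" and "h = diameter E" and "\<theta> = square_ratio \<kappa>" and "l = 1 / (2 * \<theta>)"
  have h: "h > 0" using edge_frame_line(2)[OF ef] by (simp add: h_def)
  have th: "\<theta> > 0" "\<theta> \<le> 1/4" using square_ratio_bounds[of \<kappa>] by (auto simp: \<theta>_def)
  have l1: "l \<ge> 1" using th by (simp add: l_def)
  have r0: "\<rho> > 0" and rh: "\<rho> = \<theta> * h" using r h th by (auto simp: \<theta>_def h_def)
  obtain c0 where "\<And>a b. p (frame z n (\<rho> * a, \<rho> * b)) = (\<Sum>i\<le>N. \<Sum>j\<le>N. c0 i j * a ^ i * b ^ j)"
    "\<And>a. p (z + (\<rho> * a) *\<^sub>R tangent n) = (\<Sum>i\<le>N. c0 i 0 * a ^ i)"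
    by (rule poly_le_frame[OF p, of z n \<rho>]) blast
  then obtain c where c: "\<And>a. p (z + (\<rho> * a) *\<^sub>R tangent n) = (\<Sum>i\<le>N. c i * a ^ i)" by (metis (no_types))
  define s where "s = (\<Sum>i\<le>N. \<bar>c i\<bar>)"
  have s0: "s \<ge> 0" by (simp add: s_def sum_nonneg)
  obtain W where W: "\<bar>line_int z n (\<lambda>x. p x * W x)\<bar> \<le> X * s"
    "\<And>a. W (z + (\<rho> * a) *\<^sub>R tangent n) = \<beta> * (weight a * (\<Sum>i\<le>N. c i * a ^ i))"
    using w[of c] unfolding z_def[symmetric] s_def[symmetric] by blast
  define I where "I = (\<integral>t. weight t * (\<Sum>i\<le>N. c i * t ^ i)\<^sup>2 \<partial>lborel)"
  have "line_int z n (\<lambda>x. p x * W x) = \<rho> * (\<integral>a. p (z + (\<rho> * a) *\<^sub>R tangent n) * W (z + (\<rho> * a) *\<^sub>R tangent n) \<partial>lborel)"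
    using lborel_integral_real_affine[of \<rho> "\<lambda>t. p (z + t *\<^sub>R tangent n) * W (z + t *\<^sub>R tangent n)" 0] r0
    by (simp add: line_int_def)
  also have "(\<integral>a. p (z + (\<rho> * a) *\<^sub>R tangent n) * W (z + (\<rho> * a) *\<^sub>R tangent n) \<partial>lborel)
     = (\<integral>a. \<beta> * (weight a * (\<Sum>i\<le>N. c i * a ^ i)\<^sup>2) \<partial>lborel)"
    unfolding c W(2) by (intro Bochner_Integration.integral_cong refl) (simp add: power2_eq_square)
  also have "\<dots> = \<beta> * I" by (simp add: I_def)
  finally have I: "\<rho> * (\<beta> * I) \<le> X * s" using W(1) by linarith
  have "(coeff_sum N (edge_coeffs 0 c))\<^sup>2 \<le> real (N + 1) ^ 4 * (Cw * I)"
  proof (rule coeff_sum_bound)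
    fix i j assume "i \<le> N"
    have "(c i)\<^sup>2 \<le> Cw * I" using weight1[OF \<open>i \<le> N\<close>, of c] by (simp add: I_def)
    moreover from this have "0 \<le> Cw * I" using zero_le_power2[of "c i"] by linarith
    ultimately show "(edge_coeffs 0 c i j)\<^sup>2 \<le> Cw * I" by (simp add: edge_coeffs_def)
  qed
  then have "s\<^sup>2 \<le> real (N + 1) ^ 4 * (Cw * I)" by (simp add: coeff_sum_edge s_def)
  also have "\<dots> \<le> real (N + 1) ^ 4 * (Cw * (X * s / (\<rho> * \<beta>)))"
    using I r0 b Cw by (intro mult_left_mono) (auto simp: field_simps)
  also have "\<dots> = s * (real (N + 1) ^ 4 * Cw * X / (\<rho> * \<beta>))" by simp
  finally have "s \<le> real (N + 1) ^ 4 * Cw * X / (\<rho> * \<beta>)"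
    using X Cw r0 b by (intro cancel_square[OF s0]) auto
  note sb = this
  have "\<bar>p x\<bar> \<le> l ^ N * s" if x: "x \<in> E" for x
  proof -
    have "x \<in> {z + t *\<^sub>R tangent n |t. \<bar>t\<bar> \<le> h / 2}" using x edge_frame_line(1)[OF ef] by (simp add: z_def h_def)
    then obtain t where t: "x = z + t *\<^sub>R tangent n" "\<bar>t\<bar> \<le> h / 2" by blast
    define a where "a = t / \<rho>"
    have "x = z + (\<rho> * a) *\<^sub>R tangent n" using t(1) r0 by (simp add: a_def)
    then have px: "p x = (\<Sum>i\<le>N. c i * a ^ i)" using c by simp
    have "\<bar>a\<bar> = \<bar>t\<bar> / \<rho>" using r0 by (simp add: a_def abs_divide)
    also have "\<dots> \<le> (h / 2) / \<rho>" using t(2) r0 by (intro divide_right_mono) auto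
    also have "\<dots> = l" using h th by (simp add: rh l_def)
    finally have a: "\<bar>a\<bar> \<le> l" .
    have "\<bar>p x\<bar> \<le> (\<Sum>i\<le>N. \<bar>c i * a ^ i\<bar>)" unfolding px by (rule sum_abs)
    also have "\<dots> \<le> (\<Sum>i\<le>N. \<bar>c i\<bar> * l ^ N)"
    proof (rule sum_mono)
      fix i assume "i \<in> {..N}"
      then have "\<bar>a\<bar> ^ i \<le> l ^ N" using power_mono[OF a, of i] power_increasing[of i N l] l1 by simp
      then show "\<bar>c i * a ^ i\<bar> \<le> \<bar>c i\<bar> * l ^ N" by (simp add: abs_mult power_abs mult_left_mono)
    qed
    also have "\<dots> = l ^ N * s" by (simp add: s_def sum_distrib_left mult.commute)
    finally show ?thesis .
  qed
  then have "seg_norm E p \<le> sqrt h * (l ^ N * s)" using seg_norm_le[OF E ef] by (simp add: h_def)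
  then have "sqrt h * seg_norm E p \<le> sqrt h * (sqrt h * (l ^ N * s))" using h by (intro mult_left_mono) auto
  also have "\<dots> = h * l ^ N * s" using h by simp
  also have "\<dots> \<le> h * l ^ N * (real (N + 1) ^ 4 * Cw * X / (\<rho> * \<beta>))" using h l1 sb by (intro mult_left_mono) auto
  finally show ?thesis by (simp add: h_def l_def \<theta>_def)
qed

end

section \<open>The residual tested across an edge\<close>

lemma supported_in_mult: "smooth p \<Longrightarrow> supported_in U w \<Longrightarrow> supported_in U (\<lambda>x. p x * w x)"
  by (auto simp: supported_in_def smooth_mult)

lemma line_int_supported:
  assumes n: "norm n = 1" and f: "supported_in (open_square z n \<rho>) f" and g: "supported_in (open_square z n \<rho>) g"
  shows "line_int z n (\<lambda>x. f x - g x) = line_int z n f - line_int z n g"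
    and "line_int z n (\<lambda>x. f x + g x) = line_int z n f + line_int z n g"
proof -
  have s: "norm (x - z) \<le> 2 * \<rho>" if "h x \<noteq> 0" "supported_in (open_square z n \<rho>) h" for h x
  proof -
    have "x \<in> open_square z n \<rho>" using that by (auto simp: supported_in_def)
    then show ?thesis using open_square_norm[OF n] by (simp add: less_imp_le)
  qed
  have sm: "smooth f" "smooth g" using f g by (auto simp: supported_in_def)
  show "line_int z n (\<lambda>x. f x - g x) = line_int z n f - line_int z n g"
    by (rule line_int_diff[OF n sm]) (use s f g in auto)
  have "line_int z n (\<lambda>x. f x - (- g x)) = line_int z n f - line_int z n (\<lambda>x. - g x)"
    by (rule line_int_diff[OF n sm(1) smooth_minus[OF sm(2)]]) (use s f g in auto)
  then show "line_int z n (\<lambda>x. f x + g x) = line_int z n f + line_int z n g" by (simp add: line_int_def)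
qed

lemma line_int_zero: "(\<And>t. F (z + t *\<^sub>R tangent n) = 0) \<Longrightarrow> line_int z n F = 0"
  by (simp add: line_int_def)

lemma powr_halves:
  fixes h :: real
  assumes "h > 0"
  shows "h powr (1/2) = sqrt h" "h powr (3/2) = h * sqrt h"
proof -
  show 1: "h powr (1/2) = sqrt h" using assms by (simp add: powr_half_sqrt)
  have "h powr (3/2) = h powr (1 + 1/2)" by simp
  also have "\<dots> = h * sqrt h" unfolding powr_add 1 using assms by simp
  finally show "h powr (3/2) = h * sqrt h" .
qed

context plate_fem
begin

lemma element_at:
  assumes "K \<in> elements_at \<C> E"
  shows "K \<in> \<C>" "E edge_of K" "edge_frame \<kappa> K E (outward_normal K E)" "\<kappa> \<ge> 1" "diameter E \<le> diameter K"
    "is_segment E" "E \<subseteq> K"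
proof -
  show K: "K \<in> \<C>" and E: "E edge_of K" using assms by (auto simp: elements_at_def)
  have s: "2 simplex K" using simplices K by blast
  obtain x r where x: "r > 0" "cball x r \<subseteq> K" "diameter K \<le> \<kappa> * (2 * r)" by (rule element_ball[OF K])
  note e = edge_frame_exists[OF s E x]
  show "edge_frame \<kappa> K E (outward_normal K E)" "\<kappa> \<ge> 1" "diameter E \<le> diameter K" by (fact e)+
  show "is_segment E" by (rule edge_of_triangle[OF s E])
  show "E \<subseteq> K" by (rule edge_of_imp_subset[OF E])
qed

lemma err_L2: "err \<in> L2 \<Omega>" "wpd \<Omega> i err \<in> L2 \<Omega>" "wpd \<Omega> j (wpd \<Omega> i err) \<in> L2 \<Omega>"
proof -
  note uH = continuous_H2[OF u] and vH = discrete_H2[OF vh]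
  have H: "u \<in> H1 \<Omega>" "vh \<in> H1 \<Omega>" using uH vH by (auto simp: H2_def)
  show "err \<in> L2 \<Omega>" using H by (intro L2_diff) (auto simp: H1_def)
  show "wpd \<Omega> j (wpd \<Omega> i err) \<in> L2 \<Omega>" by (rule wpd2_diff(2)[OF open_dom uH vH])
  have "AE x in lebesgue_on \<Omega>. wpd \<Omega> i err x = wpd \<Omega> i u x - wpd \<Omega> i vh x"
    by (rule wpd_AE[OF open_dom has_weak_pd_diff[OF open_dom H1_wpd(1)[OF open_dom H(1)] H1_wpd(1)[OF open_dom H(2)]]]) simp
  then have a: "AE x in lebesgue_on \<Omega>. wpd \<Omega> i u x - wpd \<Omega> i vh x = wpd \<Omega> i err x" by eventually_elim simp
  have o: "\<Omega> \<in> sets lebesgue" using open_dom by auto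
  show "wpd \<Omega> i err \<in> L2 \<Omega>"
    by (rule L2_AE[OF L2_diff[OF H1_wpd(2)[OF open_dom H(1)] H1_wpd(2)[OF open_dom H(2)]] o a])
qed

text \<open>The larger set is not contained in the domain, but it exceeds it by a null set only.\<close>

lemma L2norm_region_mono:
  assumes h: "h \<in> L2 \<Omega>" and A: "A \<subseteq> A'" "A' \<subseteq> closure \<Omega>" "A \<in> sets lebesgue" "A' \<in> sets lebesgue"
  shows "L2norm A h \<le> L2norm A' h"
proof -
  have o: "\<Omega> \<in> sets lebesgue" using open_dom by auto
  have sub: "X - X \<inter> \<Omega> \<subseteq> closure \<Omega> - \<Omega>" if "X \<subseteq> A'" for X using that A(2) by auto
  have nl: "negligible (X - X \<inter> \<Omega>)" if "X \<subseteq> A'" for X by (rule negligible_subset[OF closure_null sub[OF that]])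
  have e: "L2norm X h = L2norm (X \<inter> \<Omega>) h" if "X \<subseteq> A'" "X \<in> sets lebesgue" for X
    by (rule L2norm_null_diff[OF nl[OF that(1)] _ that(2)]) (use that o in auto)
  have s: "A \<inter> \<Omega> \<in> sets lebesgue" "A' \<inter> \<Omega> \<in> sets lebesgue" using A o by auto
  have "L2norm (A \<inter> \<Omega>) h \<le> L2norm (A' \<inter> \<Omega>) h"
    by (rule L2norm_mono[OF L2_subset[OF h Int_lower2 o s(2)] _ s]) (use A in blast)
  then show ?thesis using e[of A] e[of A'] A by simp
qed

lemma H2norm_region_mono:
  assumes "A \<subseteq> A'" "A' \<subseteq> closure \<Omega>" "A \<in> sets lebesgue" "A' \<in> sets lebesgue"
  shows "H2norm \<Omega> A err \<le> H2norm \<Omega> A' err"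
  unfolding H2norm_def
  by (intro real_sqrt_le_mono add_mono sum_mono power_mono L2norm_region_mono assms err_L2) (simp_all add: L2norm_def)

lemma patch_facts: "patch \<C> E \<in> sets lebesgue" "patch \<C> E \<subseteq> closure \<Omega>" "K \<in> elements_at \<C> E \<Longrightarrow> K \<subseteq> patch \<C> E"
proof -
  have sub: "elements_at \<C> E \<subseteq> \<C>" by (auto simp: elements_at_def)
  then have "finite (elements_at \<C> E)" using finite_mesh finite_subset by blast
  then show "patch \<C> E \<in> sets lebesgue" unfolding patch_def
    by (intro sets.finite_Union) (use sub element_facts(7) in auto)
  show "patch \<C> E \<subseteq> closure \<Omega>" unfolding patch_def using sub element_facts(6) by blast
  show "K \<in> elements_at \<C> E \<Longrightarrow> K \<subseteq> patch \<C> E" unfolding patch_def by blast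
qed

definition edge_error :: "plane set \<Rightarrow> real" where
  "edge_error E = H2norm \<Omega> (patch \<C> E) err + osc_patch f fh \<C> E"

lemma osc_elem_nonneg: "0 \<le> osc_elem f fh K"
  by (simp add: osc_elem_def L2norm_def)

lemma edge_error_nonneg: "0 \<le> edge_error E"
  by (simp add: edge_error_def osc_patch_def sum_nonneg osc_elem_nonneg H2norm_nonneg)

text \<open>The element estimate bounds \<open>d\<^sup>2 \<parallel>A(v\<^sub>h) - f\<parallel>\<close>, and \<open>4 \<rho> \<le> d\<^sup>2 / \<rho>\<close> trades the root of the area of the square for it.\<close>

lemma test_element_residual:
  assumes K: "K \<in> \<C>" and U: "U \<in> lmeasurable" "sqrt (measure lebesgue U) \<le> 4 * \<rho>"
    and w: "smooth w" "\<And>x. \<bar>w x\<bar> \<le> W" "\<And>x. x \<notin> U \<Longrightarrow> w x = 0"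
    and r: "\<rho> > 0" "4 * \<rho> \<le> diameter K"
  shows "\<bar>(\<integral>x. plate_op P (elem_poly vh K) x * w x \<partial>lebesgue_on (interior K)) - (\<integral>x. f x * w x \<partial>lebesgue_on (interior K))\<bar>
    \<le> W / \<rho> * (element_const * (H2norm \<Omega> K err + osc_elem f fh K))"
proof -
  define d where "d = diameter K"
  define R where "R x = elem_op P vh K x - f x" for x
  note ef = element_facts[OF K]
  have I: "interior K \<in> sets lebesgue" "interior K \<subseteq> K" using interior_subset by auto
  note so = smooth_elem_op[OF K]
  have RL: "R \<in> L2 K" unfolding R_def by (rule L2_diff[OF L2_poly[OF so K] L2_load[OF K]])
  have sub: "h \<in> L2 (interior K)" if "h \<in> L2 K" for h by (rule L2_subset[OF that I(2) ef(7) I(1)])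
  have W0: "W \<ge> 0" using w(2)[of 0] by linarith
  have "(\<integral>x. R x * w x \<partial>lebesgue_on (interior K))
     = (\<integral>x. elem_op P vh K x * w x \<partial>lebesgue_on (interior K)) - (\<integral>x. f x * w x \<partial>lebesgue_on (interior K))"
    unfolding R_def left_diff_distrib
    by (intro Bochner_Integration.integral_diff L2_test_bound(1)[OF I(1) sub U(1) w] L2_poly[OF so K] L2_load[OF K])
  then have e: "(\<integral>x. plate_op P (elem_poly vh K) x * w x \<partial>lebesgue_on (interior K)) - (\<integral>x. f x * w x \<partial>lebesgue_on (interior K))
     = (\<integral>x. R x * w x \<partial>lebesgue_on (interior K))" by (simp add: elem_op_def)
  have "\<bar>\<integral>x. R x * w x \<partial>lebesgue_on (interior K)\<bar> \<le> W * sqrt (measure lebesgue U) * L2norm (interior K) R"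
    by (rule L2_test_bound(2)[OF I(1) sub[OF RL] U(1) w])
  also have "\<dots> \<le> W * (4 * \<rho>) * L2norm K R" unfolding L2norm_interior[OF ef(1,3)]
    using U(2) W0 by (intro mult_right_mono mult_left_mono) (auto simp: L2norm_def)
  also have "\<dots> \<le> W / \<rho> * (d\<^sup>2 * L2norm K R)"
  proof -
    have "(4 * \<rho>) * \<rho> \<le> d * d" using r by (intro mult_mono) (auto simp: d_def)
    then have "4 * \<rho> \<le> d\<^sup>2 / \<rho>" using r(1) by (simp add: pos_le_divide_eq power2_eq_square)
    then have "4 * \<rho> * (W * L2norm K R) \<le> d\<^sup>2 / \<rho> * (W * L2norm K R)"
      using W0 by (intro mult_right_mono) (auto simp: L2norm_def)
    then show ?thesis by (simp add: mult_ac)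
  qed
  also have "\<dots> \<le> W / \<rho> * (element_const * (H2norm \<Omega> K err + osc_elem f fh K))"
    using element_estimate(1)[OF K] W0 r by (intro mult_left_mono) (auto simp: d_def R_def[abs_def])
  finally show ?thesis unfolding e .
qed

definition edge_const :: real where
  "edge_const = B * (16 * energy_bound P + 2 * element_const)"

text \<open>The two elements at an edge see it with opposite normals, and the square is symmetric.\<close>

lemma same_square:
  assumes "K \<in> elements_at \<C> E" "K' \<in> elements_at \<C> E"
  shows "open_square z (outward_normal K' E) \<rho> = open_square z (outward_normal K E) \<rho>"
proof (cases "K = K'")
  case False
  then show ?thesis
    using opposite_normals[OF tri simplices element_at(1)[OF assms(1)] element_at(1)[OF assms(2)] False
       element_at(3)[OF assms(1)] element_at(3)[OF assms(2)]] by (simp add: open_square_uminus)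
qed simp

text \<open>The residual identity after integration by parts in the elements at \<open>E\<close>. The set \<open>\<K>\<close> consists of both elements for an interior edge and of the only one for a boundary edge.
What remains besides the boundary integrals is the error and the element residuals.\<close>

lemma edge_residual:
  assumes K: "K \<in> elements_at \<C> E" and n: "n = outward_normal K E" and z: "z = edge_mid E"
    and \<rho>: "\<rho> = square_ratio \<kappa> * diameter E" and w: "w = edge_test N c z n \<rho>"
    and \<K>: "\<K> \<subseteq> elements_at \<C> E" "card \<K> \<le> 2"
    and T: "cut_region \<Omega> T (open_square z n \<rho>)" "cut T w \<in> V" "\<And>K. K \<in> \<K> \<Longrightarrow> K \<subseteq> T"
    and cov: "\<And>x. x \<in> open_square z n \<rho> \<Longrightarrow> x \<in> T \<Longrightarrow> (x - z) \<bullet> n \<noteq> 0 \<Longrightarrow> \<exists>K\<in>\<K>. x \<in> interior K"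
  shows "\<bar>(\<Sum>K'\<in>\<K>. line_int z (outward_normal K' E) (\<lambda>x. elem_Vn P vh K' E x * w x
      - elem_Mnn P vh K' E x * (grad pd w x \<bullet> outward_normal K' E))) - line_load (cut T w)\<bar>
    \<le> edge_const * coeff_sum N c / \<rho> * edge_error E"
proof -
  define U where "U = open_square z n \<rho>"
  define s where "s = coeff_sum N c"
  define e where "e = H2norm \<Omega> (patch \<C> E) err"
  note eK = element_at[OF K]
  have n1: "norm n = 1" using edge_frame_line(4)[OF eK(3)] by (simp add: n)
  have h: "diameter E > 0" using edge_frame_line(2)[OF eK(3)] by simp
  have r: "\<rho> > 0" "4 * \<rho> \<le> diameter E" using square_ratio_bounds[of \<kappa>] h mult_right_mono[of "square_ratio \<kappa>" "1/4" "diameter E"] by (auto simp: \<rho>)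
  have s0: "s \<ge> 0" by (simp add: s_def coeff_sum_def sum_nonneg)
  have e0: "e \<ge> 0" by (simp add: e_def H2norm_nonneg)
  have wU: "supported_in U w" using supported_edge_test[OF r(1)] by (simp add: U_def w)
  have sw: "smooth w" and w0: "\<And>x. x \<notin> U \<Longrightarrow> w x = 0" using wU by (auto simp: supported_in_def)
  have tb: "\<And>x k l. \<bar>w x\<bar> \<le> B * s \<and> \<bar>pd l (pd k w) x\<bar> \<le> B / \<rho>\<^sup>2 * s" using test_bound[OF n1 r(1)] by (simp add: w s_def)
  have \<K>C: "\<K> \<subseteq> \<C>" using \<K>(1) by (auto simp: elements_at_def)
  have fin: "finite (elements_at \<C> E)" using finite_mesh by (simp add: elements_at_def)
  have fin\<K>: "finite \<K>" using \<K>(1) fin finite_subset by blast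
  define M L O' F' where "M K' = (\<integral>x. moment P pd (elem_poly vh K') x \<bullet> curvature pd w x \<partial>lebesgue_on (interior K'))"
    and "L K' = line_int z (outward_normal K' E) (\<lambda>x. elem_Vn P vh K' E x * w x
      - elem_Mnn P vh K' E x * (grad pd w x \<bullet> outward_normal K' E))"
    and "O' K' = (\<integral>x. plate_op P (elem_poly vh K') x * w x \<partial>lebesgue_on (interior K'))"
    and "F' K' = (\<integral>x. f x * w x \<partial>lebesgue_on (interior K'))" for K'
  have "n \<noteq> 0" using n1 by auto
  then have Z: "negligible {x. n \<bullet> x = n \<bullet> z}" by (intro negligible_hyperplane) simp
  have res: "\<bar>(\<Sum>K'\<in>\<K>. M K') - (\<Sum>K'\<in>\<K>. F' K') - line_load (cut T w)\<bar> \<le> 16 * energy_bound P * (B / \<rho>\<^sup>2 * s) * \<rho> * e"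
    unfolding M_def F'_def e_def
  proof (rule residual[OF \<K>C n1 r(1) wU[unfolded U_def] T Z _ patch_facts(1,2)])
    fix x assume "x \<in> open_square z n \<rho>" "x \<in> T" "x \<in> \<Omega>" "x \<notin> {x. n \<bullet> x = n \<bullet> z}"
    moreover from this have "(x - z) \<bullet> n \<noteq> 0" unfolding inner_commute[of _ n] inner_diff_right by simp
    ultimately show "\<exists>K\<in>\<K>. x \<in> interior K" using cov by blast
  next
    show "\<Union>\<K> \<subseteq> patch \<C> E" using \<K>(1) patch_facts(3) by blast
    show "\<bar>pd j (pd i w) x\<bar> \<le> B / \<rho>\<^sup>2 * s" for x i j using tb by blast
    show "\<bar>w x\<bar> \<le> B * s" for x using tb by blast
  qed
  note Um = measure_open_square[OF n1 r(1), of z, folded U_def]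
  have each: "M K' = O' K' + L K' \<and> \<bar>O' K' - F' K'\<bar> \<le> B * s / \<rho> * (element_const * (e + osc_elem f fh K'))"
    if K': "K' \<in> \<K>" for K'
  proof
    have K'E: "K' \<in> elements_at \<C> E" using K' \<K>(1) by blast
    note eK' = element_at[OF K'E]
    define n' where "n' = outward_normal K' E"
    have n'1: "norm n' = 1" using edge_frame_line(4)[OF eK'(3)] by (simp add: n'_def)
    have sq: "open_square z n' \<rho> = U" using same_square[OF K K'E] by (simp add: n'_def U_def n)
    note p = elem_poly_props(3)[OF eK'(1) vh]
    have wn': "supported_in (open_square z n' \<rho>) w" using wU sq by simp
    have I1: "{y \<in> open_square z n' \<rho>. (y - z) \<bullet> n' < 0} \<subseteq> interior K'"
      using eK'(3) unfolding edge_frame_def n'_def[symmetric] z \<rho> by blast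
    have I2: "(y - z) \<bullet> n' \<le> 0" if "y \<in> interior K'" for y
      using eK'(3) that interior_subset[of K'] unfolding edge_frame_def n'_def[symmetric] z by blast
    have "M K' = O' K' + line_int z n' (\<lambda>x. V_n P n' (elem_poly vh K') x * w x - M_nn P n' (elem_poly vh K') x * (grad pd w x \<bullet> n'))"
      unfolding M_def O'_def by (rule green_element[OF n'1 p r(1) wn' I1 I2]) auto
    then show "M K' = O' K' + L K'" by (simp add: L_def elem_Vn_def elem_Mnn_def n'_def)
    have r': "4 * \<rho> \<le> diameter K'" using r(2) eK'(5) by linarith
    have "\<bar>O' K' - F' K'\<bar> \<le> B * s / \<rho> * (element_const * (H2norm \<Omega> K' err + osc_elem f fh K'))"
      unfolding O'_def F'_def by (rule test_element_residual[OF eK'(1) Um sw _ w0 r(1) r']) (use tb in auto)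
    also have "\<dots> \<le> B * s / \<rho> * (element_const * (e + osc_elem f fh K'))"
    proof -
      have "H2norm \<Omega> K' err \<le> e" unfolding e_def
        by (rule H2norm_region_mono[OF patch_facts(3)[OF K'E] patch_facts(2) element_facts(7)[OF eK'(1)] patch_facts(1)])
      then show ?thesis using B s0 r(1) element_estimate(2)[OF eK'(1)] by (intro mult_left_mono add_right_mono) auto
    qed
    finally show "\<bar>O' K' - F' K'\<bar> \<le> B * s / \<rho> * (element_const * (e + osc_elem f fh K'))" .
  qed
  define D where "D = B * s / \<rho> * element_const"
  have D0: "D \<ge> 0" using B s0 r(1) element_estimate(2)[OF eK(1)] by (simp add: D_def)
  have "\<bar>(\<Sum>K'\<in>\<K>. O' K') - (\<Sum>K'\<in>\<K>. F' K')\<bar> \<le> (\<Sum>K'\<in>\<K>. D * e + D * osc_elem f fh K')"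
    unfolding sum_subtractf[symmetric]
    by (rule order_trans[OF sum_abs sum_mono]) (use each in \<open>auto simp: D_def distrib_left mult.assoc\<close>)
  also have "\<dots> = real (card \<K>) * (D * e) + D * (\<Sum>K'\<in>\<K>. osc_elem f fh K')"
    by (simp add: sum.distrib sum_distrib_left)
  also have "\<dots> \<le> 2 * (D * e) + D * osc_patch f fh \<C> E"
  proof (intro add_mono mult_right_mono mult_left_mono D0)
    show "(\<Sum>K'\<in>\<K>. osc_elem f fh K') \<le> osc_patch f fh \<C> E" unfolding osc_patch_def
      by (rule sum_mono2[OF fin \<K>(1)]) (simp add: osc_elem_nonneg)
  qed (use \<K>(2) D0 e0 in auto)
  finally have OF: "\<bar>(\<Sum>K'\<in>\<K>. O' K') - (\<Sum>K'\<in>\<K>. F' K')\<bar> \<le> 2 * (D * e) + D * osc_patch f fh \<C> E" .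
  have "(\<Sum>K'\<in>\<K>. M K') = (\<Sum>K'\<in>\<K>. O' K') + (\<Sum>K'\<in>\<K>. L K')" using each by (simp flip: sum.distrib)
  then have "\<bar>(\<Sum>K'\<in>\<K>. L K') - line_load (cut T w)\<bar>
     \<le> 16 * energy_bound P * (B / \<rho>\<^sup>2 * s) * \<rho> * e + (2 * (D * e) + D * osc_patch f fh \<C> E)"
    using res OF by linarith
  also have "16 * energy_bound P * (B / \<rho>\<^sup>2 * s) * \<rho> * e = (B * s / \<rho>) * (16 * energy_bound P) * e"
    using r(1) by (simp add: field_simps power2_eq_square)
  also have "(B * s / \<rho>) * (16 * energy_bound P) * e + (2 * (D * e) + D * osc_patch f fh \<C> E)
     \<le> (B * s / \<rho>) * (16 * energy_bound P) * edge_error E + 2 * D * edge_error E"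
  proof -
    have os: "0 \<le> osc_patch f fh \<C> E" by (simp add: osc_patch_def sum_nonneg osc_elem_nonneg)
    have "0 \<le> (B * s / \<rho>) * (16 * energy_bound P)" using B s0 r(1) eb_nonneg by simp
    then have "(B * s / \<rho>) * (16 * energy_bound P) * e \<le> (B * s / \<rho>) * (16 * energy_bound P) * edge_error E"
      using os by (intro mult_left_mono) (auto simp: edge_error_def e_def)
    moreover have "0 \<le> D * osc_patch f fh \<C> E" using D0 os by simp
    ultimately show ?thesis by (simp add: edge_error_def e_def[symmetric] distrib_left)
  qed
  also have "\<dots> = edge_const * s / \<rho> * edge_error E" by (simp add: edge_const_def D_def algebra_simps add_divide_distrib)
  finally show ?thesis by (simp add: L_def s_def)
qed

text \<open>The factor from \<open>edge_poly_bound\<close>, where \<open>exp 1\<close> compensates the value \<open>exp (- 1)\<close> of the profiles on the edge.\<close>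

definition trace_const :: real where
  "trace_const = (1 / (2 * square_ratio \<kappa>)) ^ N * (real (N + 1) ^ 4 * Cw) * exp 1 / square_ratio \<kappa>"

lemma edge_const_nonneg: "K \<in> \<C> \<Longrightarrow> edge_const \<ge> 0"
  using B eb_nonneg element_estimate(2) by (simp add: edge_const_def)

text \<open>The normal derivative of the test function has the trace factor \<open>exp (- 1) / \<rho>\<close>, larger by \<open>1 / \<rho>\<close> than that of a value; this is why the moment needs the weight \<open>h\<^sup>1\<^sup>/\<^sup>2\<close> instead of \<open>h\<^sup>3\<^sup>/\<^sup>2\<close>.\<close>

lemma moment_trace_bound:
  assumes K: "K \<in> elements_at \<C> E" and n: "n = outward_normal K E" and z: "z = edge_mid E"
    and \<rho>: "\<rho> = square_ratio \<kappa> * diameter E" and p: "poly_le N p" and N1: "1 \<le> N"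
    and b: "\<And>c w. w = edge_test N (edge_coeffs 1 c) z n \<rho> \<Longrightarrow>
       \<bar>line_int z n (\<lambda>x. p x * (grad pd w x \<bullet> n))\<bar> \<le> edge_const * coeff_sum N (edge_coeffs 1 c) / \<rho> * edge_error E"
  shows "diameter E powr (1/2) * seg_norm E p \<le> trace_const * edge_const * edge_error E"
proof -
  note eK = element_at[OF K]
  have n1: "norm n = 1" using edge_frame_line(4)[OF eK(3)] by (simp add: n)
  have h: "diameter E > 0" using edge_frame_line(2)[OF eK(3)] by simp
  have th: "square_ratio \<kappa> > 0" using square_ratio_bounds[of \<kappa>] by simp
  have r: "\<rho> > 0" using th h by (simp add: \<rho>)
  define X where "X = edge_const / \<rho> * edge_error E"
  have X: "X \<ge> 0" using edge_const_nonneg[OF eK(1)] edge_error_nonneg r by (simp add: X_def)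
  have be: "exp (- 1) / \<rho> > 0" using r by simp
  have "sqrt (diameter E) * seg_norm E p
    \<le> diameter E * (1 / (2 * square_ratio \<kappa>)) ^ N * (real (N + 1) ^ 4 * Cw) * X / (\<rho> * (exp (-1) / \<rho>))"
  proof (rule edge_poly_bound[OF eK(6) eK(3)[folded n] p \<rho> be X])
    fix c
    define w where "w = edge_test N (edge_coeffs 1 c) z n \<rho>"
    have "\<bar>line_int z n (\<lambda>x. p x * (grad pd w x \<bullet> n))\<bar> \<le> X * (\<Sum>i\<le>N. \<bar>c i\<bar>)"
      using b[OF w_def] unfolding coeff_sum_edge[OF N1] by (simp add: X_def mult_ac)
    moreover have "grad pd w (z + (\<rho> * a) *\<^sub>R tangent n) \<bullet> n = exp (-1) / \<rho> * (weight a * (\<Sum>i\<le>N. c i * a ^ i))" for a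
      using edge_test_on_line(2)[OF n1 r N1, of c z a] mono_bump_at_0 by (simp add: w_def)
    ultimately show "\<exists>W. \<bar>line_int (edge_mid E) n (\<lambda>x. p x * W x)\<bar> \<le> X * (\<Sum>i\<le>N. \<bar>c i\<bar>) \<and>
       (\<forall>a. W (edge_mid E + (\<rho> * a) *\<^sub>R tangent n) = exp (- 1) / \<rho> * (weight a * (\<Sum>i\<le>N. c i * a ^ i)))"
      unfolding z by (intro exI[of _ "\<lambda>x. grad pd w x \<bullet> n"]) simp
  qed
  also have "\<dots> = trace_const * edge_const * edge_error E"
    using h th by (simp add: X_def trace_const_def \<rho> exp_minus field_simps)
  finally show ?thesis using powr_halves(1)[OF h] by simp
qed

text \<open>The number \<open>\<delta>\<close> is the distance of the line load from its polynomial approximation, and zero off the loaded line.\<close>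

lemma shear_trace_bound:
  assumes K: "K \<in> elements_at \<C> E" and n: "n = outward_normal K E" and z: "z = edge_mid E"
    and \<rho>: "\<rho> = square_ratio \<kappa> * diameter E" and p: "poly_le N p" and d: "\<delta> \<ge> 0"
    and b: "\<And>c w. w = edge_test N (edge_coeffs 0 c) z n \<rho> \<Longrightarrow> \<bar>line_int z n (\<lambda>x. p x * w x)\<bar>
       \<le> edge_const * coeff_sum N (edge_coeffs 0 c) / \<rho> * edge_error E + sqrt (diameter E) * \<delta> * (B * coeff_sum N (edge_coeffs 0 c))"
  shows "diameter E powr (3/2) * seg_norm E p
     \<le> trace_const / square_ratio \<kappa> * edge_const * edge_error E + trace_const * B * (diameter E powr (3/2) * \<delta>)"
proof -
  note eK = element_at[OF K]
  have n1: "norm n = 1" using edge_frame_line(4)[OF eK(3)] by (simp add: n)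
  define h where "h = diameter E"
  have h: "h > 0" using edge_frame_line(2)[OF eK(3)] by (simp add: h_def)
  have th: "square_ratio \<kappa> > 0" using square_ratio_bounds[of \<kappa>] by simp
  have r: "\<rho> > 0" and rh: "\<rho> = square_ratio \<kappa> * h" using th h by (auto simp: \<rho> h_def)
  define X where "X = edge_const / \<rho> * edge_error E + sqrt h * \<delta> * B"
  have X: "X \<ge> 0" using edge_const_nonneg[OF eK(1)] edge_error_nonneg r d B h by (simp add: X_def)
  have be: "exp (- 1) > (0::real)" by simp
  have "sqrt (diameter E) * seg_norm E p
    \<le> diameter E * (1 / (2 * square_ratio \<kappa>)) ^ N * (real (N + 1) ^ 4 * Cw) * X / (\<rho> * exp (-1))"
  proof (rule edge_poly_bound[OF eK(6) eK(3)[folded n] p \<rho> be X])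
    fix c
    define w where "w = edge_test N (edge_coeffs 0 c) z n \<rho>"
    have "\<bar>line_int z n (\<lambda>x. p x * w x)\<bar> \<le> X * (\<Sum>i\<le>N. \<bar>c i\<bar>)"
      using b[OF w_def] unfolding coeff_sum_edge[OF le0] by (simp add: X_def h_def algebra_simps)
    moreover have "w (z + (\<rho> * a) *\<^sub>R tangent n) = exp (-1) * (weight a * (\<Sum>i\<le>N. c i * a ^ i))" for a
      using edge_test_on_line(1)[OF n1 r le0, of N c z a] mono_bump_at_0 by (simp add: w_def)
    ultimately show "\<exists>W. \<bar>line_int (edge_mid E) n (\<lambda>x. p x * W x)\<bar> \<le> X * (\<Sum>i\<le>N. \<bar>c i\<bar>) \<and>
       (\<forall>a. W (edge_mid E + (\<rho> * a) *\<^sub>R tangent n) = exp (- 1) * (weight a * (\<Sum>i\<le>N. c i * a ^ i)))"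
      unfolding z by (intro exI[of _ w]) simp
  qed
  also have "\<dots> = trace_const * X"
    using h th by (simp add: trace_const_def rh h_def[symmetric] exp_minus field_simps)
  finally have "h * (sqrt h * seg_norm E p) \<le> h * (trace_const * X)" using h by (intro mult_left_mono) (auto simp: h_def)
  also have "\<dots> = trace_const / square_ratio \<kappa> * edge_const * edge_error E + trace_const * B * (h * sqrt h * \<delta>)"
    using h th by (simp add: X_def rh field_simps)
  finally show ?thesis using powr_halves(2)[OF h] by (simp add: h_def mult_ac)
qed

end

section \<open>Interior edges\<close>

context plate_fem
begin

lemma finite_line_edges: "finite (line_edges \<C> S)"
proof -
  have "finite {F. F face_of K}" if "K \<in> \<C>" for K
    using simplices that by (intro finite_polytope_faces simplex_imp_polytope) auto
  then have "finite (\<Union>K\<in>\<C>. {F. F face_of K})" using finite_mesh by auto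
  moreover have "line_edges \<C> S \<subseteq> (\<Union>K\<in>\<C>. {F. F face_of K})"
    by (auto simp: line_edges_def interior_edges_def elements_at_def edge_of_def)
  ultimately show ?thesis by (rule rev_finite_subset)
qed

text \<open>The test function of \<open>E\<close> vanishes on all other loaded edges and at the node \<open>x\<^sub>0\<close>.\<close>

lemma line_load_single:
  assumes z: "\<And>E'. E' \<in> line_edges \<C> S \<Longrightarrow> E' \<noteq> E \<Longrightarrow> \<forall>x\<in>E'. t x = 0" "t x\<^sub>0 = 0"
  shows "line_load t = (if E \<in> line_edges \<C> S then seg_int E (\<lambda>x. g x * t x) else 0)"
proof -
  have "seg_int E' (\<lambda>x. g x * t x) = (if E' = E then seg_int E (\<lambda>x. g x * t x) else 0)" if E': "E' \<in> line_edges \<C> S" for E'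
  proof (cases "E' = E")
    case False
    have sg: "is_segment E'" by (rule line_edgeD[OF E'])
    have "(\<integral>s. g (seg_param E' s) * t (seg_param E' s) \<partial>lebesgue_on {0..1}) = (\<integral>s. 0 \<partial>lebesgue_on {0..1::real})"
      by (intro Bochner_Integration.integral_cong refl) (use z(1)[OF E' False] seg_param_in[OF sg] in auto)
    then show ?thesis using False by (simp add: seg_int_def)
  qed simp
  then have "(\<Sum>E'\<in>line_edges \<C> S. seg_int E' (\<lambda>x. g x * t x)) = (\<Sum>E'\<in>line_edges \<C> S. if E' = E then seg_int E (\<lambda>x. g x * t x) else 0)"
    by (intro sum.cong refl)
  then show ?thesis using z(2) finite_line_edges by (simp add: line_load_def)
qed

lemma smooth_elem_Vn: "K \<in> \<C> \<Longrightarrow> smooth (elem_Vn P vh K E)"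
  and smooth_elem_Mnn: "K \<in> \<C> \<Longrightarrow> smooth (elem_Mnn P vh K E)"
  and poly_le_elem_Vn: "K \<in> \<C> \<Longrightarrow> poly_le N (elem_Vn P vh K E)"
  and poly_le_elem_Mnn: "K \<in> \<C> \<Longrightarrow> poly_le N (elem_Mnn P vh K E)"
  unfolding elem_Vn_def elem_Mnn_def
  using elem_poly_props[OF _ vh] poly_le_mono[OF _ N(1)]
  by (auto intro: smooth_V_n smooth_M_nn poly_le_V_n poly_le_M_nn)

lemma test_square:
  assumes K: "K \<in> elements_at \<C> E" and n: "n = outward_normal K E" and \<rho>: "\<rho> = square_ratio \<kappa> * diameter E"
  shows "norm n = 1" "\<rho> > 0" "\<rho> < diameter E / 2" "edge_mid E \<in> open_square (edge_mid E) n \<rho>"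
proof -
  note e = element_at(3)[OF K]
  show "norm n = 1" using edge_frame_line(4)[OF e] by (simp add: n)
  have h: "diameter E > 0" using edge_frame_line(2)[OF e] by simp
  then show r: "\<rho> > 0" using square_ratio_bounds[of \<kappa>] by (simp add: \<rho>)
  have "square_ratio \<kappa> * diameter E \<le> 1/4 * diameter E" using square_ratio_bounds[of \<kappa>] h by (intro mult_right_mono) auto
  then show "\<rho> < diameter E / 2" using h by (simp add: \<rho>)
  show "edge_mid E \<in> open_square (edge_mid E) n \<rho>" using r by (simp add: open_square_def)
qed

lemma vertex_in_square:
  assumes K: "K \<in> elements_at \<C> E" and y: "x\<^sub>0 \<in> open_square (edge_mid E) (outward_normal K E) (square_ratio \<kappa> * diameter E)"
  shows "(x\<^sub>0 - edge_mid E) \<bullet> outward_normal K E > 0"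
proof -
  obtain K1 where K1: "K1 \<in> \<C>" "x\<^sub>0 extreme_point_of K1" using x0(2) by blast
  show ?thesis
    by (rule vertex_avoids_square[OF tri simplices element_at(1,2)[OF K] element_at(3)[OF K] K1 y])
qed

lemma line_edge_in_square:
  assumes K: "K \<in> elements_at \<C> E" and E': "E' \<in> line_edges \<C> S" "E' \<noteq> E" "y \<in> E'"
    and y: "y \<in> open_square (edge_mid E) (outward_normal K E) (square_ratio \<kappa> * diameter E)"
  shows "(y - edge_mid E) \<bullet> outward_normal K E > 0"
proof -
  obtain K1 where K1: "K1 \<in> \<C>" "E' edge_of K1" by (rule line_edgeD[OF E'(1)])
  show ?thesis
    by (rule other_edge_avoids_square[OF tri simplices element_at(1,2)[OF K] element_at(3)[OF K] K1 E'(2,3) y])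
qed

text \<open>The two half squares and the part of \<open>E\<close> between them lie in the closed domain. The open square then lies in its interior, which is the domain itself. A point that is strictly on the outer side of \<open>E\<close> for both elements does not exist, which excludes other edges and nodes.\<close>

lemma interior_pair:
  assumes K: "K \<in> elements_at \<C> E" "K' \<in> elements_at \<C> E" "K \<noteq> K'" and n: "n = outward_normal K E"
    and \<rho>: "\<rho> = square_ratio \<kappa> * diameter E"
  shows "outward_normal K' E = - n"
    and "x \<in> open_square (edge_mid E) n \<rho> \<Longrightarrow> (x - edge_mid E) \<bullet> n \<noteq> 0 \<Longrightarrow> x \<in> interior K \<or> x \<in> interior K'"
    and "open_square (edge_mid E) n \<rho> \<subseteq> \<Omega>"
    and "x\<^sub>0 \<notin> open_square (edge_mid E) n \<rho>"
    and "E' \<in> line_edges \<C> S \<Longrightarrow> E' \<noteq> E \<Longrightarrow> y \<in> E' \<Longrightarrow> y \<notin> open_square (edge_mid E) n \<rho>"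
proof -
  define z U where "z = edge_mid E" and "U = open_square z n \<rho>"
  note e = element_at[OF K(1)] and e' = element_at[OF K(2)]
  show nn: "outward_normal K' E = - n" unfolding n
    by (rule opposite_normals[OF tri simplices e(1) e'(1) K(3) e(3) e'(3)])
  have U': "open_square z (outward_normal K' E) \<rho> = U" unfolding nn U_def by (rule open_square_uminus)
  have side: "x \<in> interior K" if "x \<in> U" "(x - z) \<bullet> n < 0" for x
    using square_cases(1)[OF e(3), of x] that by (simp add: U_def z_def n \<rho>)
  have side': "x \<in> interior K'" if "x \<in> U" "(x - z) \<bullet> n > 0" for x
  proof -
    have "x \<in> open_square z (outward_normal K' E) \<rho>" using that(1) U' by simp
    moreover have "(x - z) \<bullet> outward_normal K' E < 0" using that(2) nn by simp
    ultimately show ?thesis using square_cases(1)[OF e'(3), of x] by (simp add: z_def \<rho>)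
  qed
  show two: "x \<in> interior K \<or> x \<in> interior K'" if "x \<in> open_square (edge_mid E) n \<rho>" "(x - edge_mid E) \<bullet> n \<noteq> 0" for x
    using side[of x] side'[of x] that unfolding U_def z_def by (meson linorder_neqE_linordered_idom)
  have "U \<subseteq> closure \<Omega>"
  proof
    fix x assume x: "x \<in> U"
    show "x \<in> closure \<Omega>"
    proof (cases "(x - z) \<bullet> n = 0")
      case True
      then obtain a where a: "\<bar>a\<bar> < diameter E / 2" "x = edge_mid E + a *\<^sub>R tangent (outward_normal K E)"
        using square_cases(2)[OF e(3), of x] x by (auto simp: U_def z_def n \<rho>)
      then have "x \<in> E" using edge_frame_mem[OF e(3), of a] by simp
      then show ?thesis using e(7) element_facts(6)[OF e(1)] by blast
    next
      case False
      then have "x \<in> K \<or> x \<in> K'" using two[of x] x interior_subset by (auto simp: U_def z_def)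
      then show ?thesis using element_facts(6)[OF e(1)] element_facts(6)[OF e'(1)] by blast
    qed
  qed
  then have "U \<subseteq> interior (closure \<Omega>)" by (rule interior_maximal) (simp add: U_def open_open_square)
  then show "open_square (edge_mid E) n \<rho> \<subseteq> \<Omega>" by (simp add: regular_dom U_def z_def)
  show "x\<^sub>0 \<notin> open_square (edge_mid E) n \<rho>"
  proof
    assume x: "x\<^sub>0 \<in> open_square (edge_mid E) n \<rho>"
    then have "(x\<^sub>0 - edge_mid E) \<bullet> n > 0" using vertex_in_square[OF K(1)] by (simp add: n \<rho>)
    moreover have "(x\<^sub>0 - edge_mid E) \<bullet> outward_normal K' E > 0"
      using vertex_in_square[OF K(2)] x U' by (simp add: U_def z_def \<rho>)
    ultimately show False using nn by simp
  qed
  show "y \<notin> open_square (edge_mid E) n \<rho>" if E': "E' \<in> line_edges \<C> S" "E' \<noteq> E" "y \<in> E'"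
  proof
    assume y: "y \<in> open_square (edge_mid E) n \<rho>"
    then have "(y - edge_mid E) \<bullet> n > 0" using line_edge_in_square[OF K(1) E'] by (simp add: n \<rho>)
    moreover have "(y - edge_mid E) \<bullet> outward_normal K' E > 0"
      using line_edge_in_square[OF K(2) E'] y U' by (simp add: U_def z_def \<rho>)
    ultimately show False using nn by simp
  qed
qed

text \<open>The normals of the two elements are opposite; so the shear terms add up to the jump of \<open>V\<^sub>n\<close>, and the moment terms to the jump of \<open>M\<^sub>n\<^sub>n\<close> times one normal derivative.\<close>

lemma interior_functional:
  assumes K: "K \<in> elements_at \<C> E" "K' \<in> elements_at \<C> E" "K \<noteq> K'" and n: "n = outward_normal K E"
    and z: "z = edge_mid E" and \<rho>: "\<rho> = square_ratio \<kappa> * diameter E" and w: "w = edge_test N c z n \<rho>"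
  shows "\<bar>line_int z n (\<lambda>x. jump_Vn P vh K K' E x * w x) - line_int z n (\<lambda>x. jump_Mnn P vh K K' E x * (grad pd w x \<bullet> n))
      - (if E \<in> line_edges \<C> S then seg_int E (\<lambda>x. g x * w x) else 0)\<bar>
    \<le> edge_const * coeff_sum N c / \<rho> * edge_error E"
proof -
  define U where "U = open_square z n \<rho>"
  note e = element_at[OF K(1)] and e' = element_at[OF K(2)]
  note q = test_square[OF K(1) n \<rho>, folded z]
  note ip = interior_pair[OF K n \<rho>, folded z, folded U_def]
  have wU: "supported_in U w" using supported_edge_test[OF q(2)] by (simp add: U_def w)
  have w0: "x \<notin> U \<Longrightarrow> w x = 0" for x using wU by (auto simp: supported_in_def)
  note ic = inner_cut[OF ip(3)[unfolded U_def] wU[unfolded U_def]]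
  define t where "t = cut (closure \<Omega>) w"
  have ll: "line_load t = (if E \<in> line_edges \<C> S then seg_int E (\<lambda>x. g x * w x) else 0)"
  proof -
    have "\<forall>x\<in>E'. t x = 0" if "E' \<in> line_edges \<C> S" "E' \<noteq> E" for E'
      using ip(5)[OF that] w0 by (simp add: t_def cut_def)
    moreover have "t x\<^sub>0 = 0" using ip(4) w0 by (simp add: t_def cut_def)
    moreover have "seg_int E (\<lambda>x. g x * t x) = seg_int E (\<lambda>x. g x * w x)"
    proof -
      have "seg_param E s \<in> closure \<Omega>" if "s \<in> {0..1}" for s
        using seg_param_in[OF e(6) that] e(7) element_facts(6)[OF e(1)] by blast
      then have "(\<integral>s. g (seg_param E s) * t (seg_param E s) \<partial>lebesgue_on {0..1}) = (\<integral>s. g (seg_param E s) * w (seg_param E s) \<partial>lebesgue_on {0..1})"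
        by (intro Bochner_Integration.integral_cong refl) (auto simp: t_def cut_def)
      then show ?thesis by (simp add: seg_int_def)
    qed
    ultimately show ?thesis using line_load_single[of E t] by simp
  qed
  define L where "L K' = line_int z (outward_normal K' E) (\<lambda>x. elem_Vn P vh K' E x * w x
      - elem_Mnn P vh K' E x * (grad pd w x \<bullet> outward_normal K' E))" for K'
  have "\<bar>(\<Sum>K'\<in>{K, K'}. L K') - line_load t\<bar> \<le> edge_const * coeff_sum N c / \<rho> * edge_error E"
    unfolding t_def L_def
  proof (rule edge_residual[OF K(1) n z \<rho> w _ _ ic])
    show "{K, K'} \<subseteq> elements_at \<C> E" using K by simp
    show "card {K, K'} \<le> 2" by (simp add: card_insert_if)
    show "K1 \<subseteq> closure \<Omega>" if "K1 \<in> {K, K'}" for K1 using that element_facts(6) e(1) e'(1) by blast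
    show "\<exists>K\<in>{K, K'}. x \<in> interior K" if "x \<in> open_square z n \<rho>" "(x - z) \<bullet> n \<noteq> 0" for x
      using ip(2)[of x] that by (auto simp: U_def)
  qed
  then have main: "\<bar>L K + L K' - line_load t\<bar> \<le> edge_const * coeff_sum N c / \<rho> * edge_error E" using K(3) by simp
  have gU: "supported_in U (\<lambda>x. grad pd w x \<bullet> n)"
    unfolding U_def by (rule supported_in_grad_inner[OF regular_open_square wU[unfolded U_def]])
  note s = supported_in_mult[OF smooth_elem_Vn[OF e(1), of E] wU[unfolded U_def]] supported_in_mult[OF smooth_elem_Vn[OF e'(1), of E] wU[unfolded U_def]]
    supported_in_mult[OF smooth_elem_Mnn[OF e(1), of E] gU[unfolded U_def]] supported_in_mult[OF smooth_elem_Mnn[OF e'(1), of E] gU[unfolded U_def]]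
  have L1: "L K = line_int z n (\<lambda>x. elem_Vn P vh K E x * w x) - line_int z n (\<lambda>x. elem_Mnn P vh K E x * (grad pd w x \<bullet> n))"
    unfolding L_def n[symmetric] by (rule line_int_supported(1)[OF q(1) s(1) s(3)])
  have "L K' = line_int z n (\<lambda>x. elem_Vn P vh K' E x * w x + elem_Mnn P vh K' E x * (grad pd w x \<bullet> n))"
    unfolding L_def ip(1) line_int_uminus by simp
  also have "\<dots> = line_int z n (\<lambda>x. elem_Vn P vh K' E x * w x) + line_int z n (\<lambda>x. elem_Mnn P vh K' E x * (grad pd w x \<bullet> n))"
    by (rule line_int_supported(2)[OF q(1) s(2) s(4)])
  finally have L2: "L K' = line_int z n (\<lambda>x. elem_Vn P vh K' E x * w x) + line_int z n (\<lambda>x. elem_Mnn P vh K' E x * (grad pd w x \<bullet> n))" .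
  have J1: "line_int z n (\<lambda>x. jump_Vn P vh K K' E x * w x)
     = line_int z n (\<lambda>x. elem_Vn P vh K E x * w x) + line_int z n (\<lambda>x. elem_Vn P vh K' E x * w x)"
    unfolding jump_Vn_def distrib_right by (rule line_int_supported(2)[OF q(1) s(1) s(2)])
  have J2: "line_int z n (\<lambda>x. jump_Mnn P vh K K' E x * (grad pd w x \<bullet> n))
     = line_int z n (\<lambda>x. elem_Mnn P vh K E x * (grad pd w x \<bullet> n)) - line_int z n (\<lambda>x. elem_Mnn P vh K' E x * (grad pd w x \<bullet> n))"
    unfolding jump_Mnn_def left_diff_distrib by (rule line_int_supported(1)[OF q(1) s(3) s(4)])
  have "L K + L K' = line_int z n (\<lambda>x. jump_Vn P vh K K' E x * w x) - line_int z n (\<lambda>x. jump_Mnn P vh K K' E x * (grad pd w x \<bullet> n))"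
    using L1 L2 J1 J2 by linarith
  then show ?thesis using main unfolding ll by simp
qed

text \<open>This decouples the moment from the shear force.\<close>

lemma test_vanishes_on_line:
  assumes n: "norm n = 1" and r: "\<rho> > 0"
  shows "1 \<le> N \<Longrightarrow> edge_test N (edge_coeffs 1 c) z n \<rho> (z + t *\<^sub>R tangent n) = 0"
    and "grad pd (edge_test N (edge_coeffs 0 c) z n \<rho>) (z + t *\<^sub>R tangent n) \<bullet> n = 0"
proof -
  have t: "t = \<rho> * (t / \<rho>)" using r by simp
  show "1 \<le> N \<Longrightarrow> edge_test N (edge_coeffs 1 c) z n \<rho> (z + t *\<^sub>R tangent n) = 0"
    by (subst t) (simp only: edge_test_on_line(1)[OF n r] mono_bump_at_0 mult_zero_left)
  show "grad pd (edge_test N (edge_coeffs 0 c) z n \<rho>) (z + t *\<^sub>R tangent n) \<bullet> n = 0"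
    by (subst t) (simp only: edge_test_on_line(2)[OF n r le0] mono_bump_at_0 mult_zero_left div_0)
qed

lemma jump_Mnn_estimate:
  assumes K: "K \<in> elements_at \<C> E" "K' \<in> elements_at \<C> E" "K \<noteq> K'" and N1: "1 \<le> N"
  shows "diameter E powr (1/2) * seg_norm E (jump_Mnn P vh K K' E) \<le> trace_const * edge_const * edge_error E"
proof -
  define n z \<rho> where n: "n = outward_normal K E" and z: "z = edge_mid E" and \<rho>: "\<rho> = square_ratio \<kappa> * diameter E"
  note q = test_square[OF K(1) n \<rho>]
  have p: "poly_le N (jump_Mnn P vh K K' E)" unfolding jump_Mnn_def[abs_def]
    by (intro poly_le_diff poly_le_elem_Mnn element_at(1)[OF K(1)] element_at(1)[OF K(2)])
  show ?thesis
  proof (rule moment_trace_bound[OF K(1) n z \<rho> p N1])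
    fix c w assume w: "w = edge_test N (edge_coeffs 1 c) z n \<rho>"
    have w0: "w (z + t *\<^sub>R tangent n) = 0" for t unfolding w by (rule test_vanishes_on_line(1)[OF q(1,2) N1])
    have a: "line_int z n (\<lambda>x. jump_Vn P vh K K' E x * w x) = 0" by (rule line_int_zero) (simp add: w0)
    have b: "(if E \<in> line_edges \<C> S then seg_int E (\<lambda>x. g x * w x) else 0) = 0"
    proof -
      have "w (seg_param E s) = 0" for s
      proof -
        obtain \<epsilon> where "\<And>\<tau>. seg_param E \<tau> = edge_mid E + (\<epsilon> * (\<tau> - 1/2)) *\<^sub>R tangent (outward_normal K E)"
          by (rule seg_param_frame[OF element_at(6)[OF K(1)] element_at(3)[OF K(1)]]) blast
        then show ?thesis using w0 by (simp add: z n)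
      qed
      then show ?thesis by (simp add: seg_int_def)
    qed
    show "\<bar>line_int z n (\<lambda>x. jump_Mnn P vh K K' E x * (grad pd w x \<bullet> n))\<bar>
        \<le> edge_const * coeff_sum N (edge_coeffs 1 c) / \<rho> * edge_error E"
      using interior_functional[OF K n z \<rho> w] unfolding a b by simp
  qed
qed

lemma jump_Vn_estimate:
  assumes K: "K \<in> elements_at \<C> E" "K' \<in> elements_at \<C> E" "K \<noteq> K'" and E: "E \<notin> line_edges \<C> S"
  shows "diameter E powr (3/2) * seg_norm E (jump_Vn P vh K K' E)
    \<le> trace_const / square_ratio \<kappa> * edge_const * edge_error E"
proof -
  define n z \<rho> where n: "n = outward_normal K E" and z: "z = edge_mid E" and \<rho>: "\<rho> = square_ratio \<kappa> * diameter E"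
  note q = test_square[OF K(1) n \<rho>]
  have p: "poly_le N (jump_Vn P vh K K' E)" unfolding jump_Vn_def[abs_def]
    by (intro poly_le_add poly_le_elem_Vn element_at(1)[OF K(1)] element_at(1)[OF K(2)])
  have "diameter E powr (3/2) * seg_norm E (jump_Vn P vh K K' E)
    \<le> trace_const / square_ratio \<kappa> * edge_const * edge_error E + trace_const * B * (diameter E powr (3/2) * 0)"
  proof (rule shear_trace_bound[OF K(1) n z \<rho> p order_refl])
    fix c w assume w: "w = edge_test N (edge_coeffs 0 c) z n \<rho>"
    have "grad pd w (z + t *\<^sub>R tangent n) \<bullet> n = 0" for t unfolding w by (rule test_vanishes_on_line(2)[OF q(1,2)])
    then have a: "line_int z n (\<lambda>x. jump_Mnn P vh K K' E x * (grad pd w x \<bullet> n)) = 0" by (intro line_int_zero) simp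
    show "\<bar>line_int z n (\<lambda>x. jump_Vn P vh K K' E x * w x)\<bar> \<le> edge_const * coeff_sum N (edge_coeffs 0 c) / \<rho> * edge_error E
       + sqrt (diameter E) * 0 * (B * coeff_sum N (edge_coeffs 0 c))"
      using interior_functional[OF K n z \<rho> w] E unfolding a by simp
  qed
  then show ?thesis by simp
qed

text \<open>Only a polynomial can be tested with itself; so the jump is compared with \<open>g\<^sub>h\<close> first, and \<open>g - g\<^sub>h\<close> is added in the end by the triangle inequality.\<close>

lemma line_jump_estimate:
  assumes K: "K \<in> elements_at \<C> E" "K' \<in> elements_at \<C> E" "K \<noteq> K'" and E: "E \<in> line_edges \<C> S"
  shows "diameter E powr (3/2) * seg_norm E (\<lambda>x. jump_Vn P vh K K' E x - g x)
    \<le> trace_const / square_ratio \<kappa> * edge_const * edge_error E + (trace_const * B + 1) * osc_edge g (gh E) E"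
proof -
  define n z \<rho> where n: "n = outward_normal K E" and z: "z = edge_mid E" and \<rho>: "\<rho> = square_ratio \<kappa> * diameter E"
  note q = test_square[OF K(1) n \<rho>] and e = element_at[OF K(1)]
  define J G where "J = jump_Vn P vh K K' E" and "G = gh E"
  have gG: "g \<in> seg_L2 E" "poly_le N G" using g gh E poly_le_mono[OF _ N(2)] by (auto simp: G_def)
  have pJ: "poly_le N J" unfolding J_def jump_Vn_def[abs_def]
    by (intro poly_le_add poly_le_elem_Vn element_at(1)[OF K(1)] element_at(1)[OF K(2)])
  have p: "poly_le N (\<lambda>x. J x - G x)" by (rule poly_le_diff[OF pJ gG(2)])
  note sJ = smooth_poly_le[OF pJ] and sG = smooth_poly_le[OF gG(2)]
  define \<delta> where "\<delta> = seg_norm E (\<lambda>x. g x - G x)"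
  have d0: "\<delta> \<ge> 0" by (simp add: \<delta>_def seg_norm_def seg_int_def)
  have GL: "(\<lambda>x. g x - G x) \<in> seg_L2 E" by (rule seg_L2_diff[OF gG(1) continuous_seg_L2[OF smooth_continuous[OF sG]]])
  have 1: "diameter E powr (3/2) * seg_norm E (\<lambda>x. J x - G x)
    \<le> trace_const / square_ratio \<kappa> * edge_const * edge_error E + trace_const * B * (diameter E powr (3/2) * \<delta>)"
  proof (rule shear_trace_bound[OF K(1) n z \<rho> p d0])
    fix c w assume w: "w = edge_test N (edge_coeffs 0 c) z n \<rho>"
    have "grad pd w (z + t *\<^sub>R tangent n) \<bullet> n = 0" for t unfolding w by (rule test_vanishes_on_line(2)[OF q(1,2)])
    then have a: "line_int z n (\<lambda>x. jump_Mnn P vh K K' E x * (grad pd w x \<bullet> n)) = 0" by (intro line_int_zero) simp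
    have wU: "supported_in (open_square z n \<rho>) w" unfolding w by (rule supported_edge_test[OF q(2)])
    have sw: "smooth w" using wU by (simp add: supported_in_def)
    have wB: "\<bar>w x\<bar> \<le> B * coeff_sum N (edge_coeffs 0 c)" for x using test_bound[OF q(1,2)] by (simp add: w)
    have w0: "w (z + t *\<^sub>R tangent n) = 0" if "\<bar>t\<bar> \<ge> diameter E / 2" for t
    proof -
      have "z + t *\<^sub>R tangent n \<notin> open_square z n \<rho>" using that q(3) tangent_simps[OF q(1)] by (simp add: open_square_def)
      then show ?thesis using wU by (auto simp: supported_in_def)
    qed
    have Gl: "seg_int E (\<lambda>x. G x * w x) = line_int z n (\<lambda>x. G x * w x)"
      unfolding z
    proof (rule seg_int_line[OF e(6) e(3)[folded n]])
      show "continuous_on UNIV (\<lambda>x. G x * w x)" by (rule smooth_continuous[OF smooth_mult[OF sG sw]])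
      show "G (edge_mid E + t *\<^sub>R tangent n) * w (edge_mid E + t *\<^sub>R tangent n) = 0" if "\<bar>t\<bar> \<ge> diameter E / 2" for t
        using w0[OF that] by (simp add: z)
    qed
    note sm = seg_int_mult_le[OF e(6) e(3)[folded n] _ smooth_continuous[OF sw] wB]
    have split: "seg_int E (\<lambda>x. g x * w x) = seg_int E (\<lambda>x. (g x - G x) * w x) + seg_int E (\<lambda>x. G x * w x)"
    proof -
      have "(\<integral>s. g (seg_param E s) * w (seg_param E s) \<partial>lebesgue_on {0..1})
        = (\<integral>s. (g (seg_param E s) - G (seg_param E s)) * w (seg_param E s) + G (seg_param E s) * w (seg_param E s) \<partial>lebesgue_on {0..1})"
        by (simp add: algebra_simps)
      also have "\<dots> = (\<integral>s. (g (seg_param E s) - G (seg_param E s)) * w (seg_param E s) \<partial>lebesgue_on {0..1})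
         + (\<integral>s. G (seg_param E s) * w (seg_param E s) \<partial>lebesgue_on {0..1})"
        by (rule Bochner_Integration.integral_add[OF sm(2)[OF GL] sm(2)[OF continuous_seg_L2[OF smooth_continuous[OF sG]]]])
      finally show ?thesis unfolding seg_int_def by (simp only: distrib_left)
    qed
    have D: "line_int z n (\<lambda>x. (J x - G x) * w x) = line_int z n (\<lambda>x. J x * w x) - line_int z n (\<lambda>x. G x * w x)"
      unfolding left_diff_distrib by (rule line_int_supported(1)[OF q(1) supported_in_mult[OF sJ wU] supported_in_mult[OF sG wU]])
    have b: "\<bar>seg_int E (\<lambda>x. (g x - G x) * w x)\<bar> \<le> sqrt (diameter E) * \<delta> * (B * coeff_sum N (edge_coeffs 0 c))"
      unfolding \<delta>_def by (rule sm(1)[OF GL])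
    have "\<bar>line_int z n (\<lambda>x. J x * w x) - seg_int E (\<lambda>x. g x * w x)\<bar> \<le> edge_const * coeff_sum N (edge_coeffs 0 c) / \<rho> * edge_error E"
      using interior_functional[OF K n z \<rho> w] E unfolding a by (simp add: J_def)
    then show "\<bar>line_int z n (\<lambda>x. (J x - G x) * w x)\<bar> \<le> edge_const * coeff_sum N (edge_coeffs 0 c) / \<rho> * edge_error E
       + sqrt (diameter E) * \<delta> * (B * coeff_sum N (edge_coeffs 0 c))"
      using b unfolding D split Gl by linarith
  qed
  have "seg_norm E (\<lambda>x. J x - g x) = seg_norm E (\<lambda>x. (J x - G x) - (g x - G x))" by simp
  also have "\<dots> \<le> seg_norm E (\<lambda>x. J x - G x) + \<delta>" unfolding \<delta>_def
    by (rule seg_norm_diff[OF continuous_seg_L2[OF smooth_continuous[OF smooth_diff[OF sJ sG]]] GL])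
  finally have "diameter E powr (3/2) * seg_norm E (\<lambda>x. J x - g x)
     \<le> diameter E powr (3/2) * (seg_norm E (\<lambda>x. J x - G x) + \<delta>)" by (intro mult_left_mono) auto
  also have "\<dots> = diameter E powr (3/2) * seg_norm E (\<lambda>x. J x - G x) + osc_edge g (gh E) E"
    by (simp add: distrib_left osc_edge_def \<delta>_def G_def)
  also have "\<dots> \<le> trace_const / square_ratio \<kappa> * edge_const * edge_error E + (trace_const * B + 1) * osc_edge g (gh E) E"
    using 1 by (simp add: osc_edge_def \<delta>_def G_def distrib_right)
  finally show ?thesis by (simp add: J_def)
qed

end

section \<open>Boundary edges\<close>

context plate_fem
begin

text \<open>No other element meets the half square, because that lies in the interior of \<open>K\<close>. If another element contained an inner point of \<open>E\<close>, then \<open>E\<close> would be an interior edge, its square would lie in the domain, and the midpoint of \<open>E\<close> could not be a boundary point.\<close>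

lemma boundary_element:
  assumes K: "K \<in> elements_at \<C> E" and E: "E \<subseteq> frontier \<Omega>" and n: "n = outward_normal K E"
    and \<rho>: "\<rho> = square_ratio \<kappa> * diameter E"
  shows "E \<notin> line_edges \<C> S"
    and "cut_region \<Omega> K (open_square (edge_mid E) n \<rho>)"
    and "x \<in> open_square (edge_mid E) n \<rho> \<Longrightarrow> x \<in> K \<Longrightarrow> (x - edge_mid E) \<bullet> n \<noteq> 0 \<Longrightarrow> x \<in> interior K"
    and "x \<in> open_square (edge_mid E) n \<rho> \<Longrightarrow> x \<in> K \<Longrightarrow> x \<in> frontier \<Omega> \<Longrightarrow> x \<in> E"
    and "x\<^sub>0 \<in> K \<Longrightarrow> x\<^sub>0 \<notin> open_square (edge_mid E) n \<rho>"
    and "E' \<in> line_edges \<C> S \<Longrightarrow> y \<in> E' \<Longrightarrow> y \<in> K \<Longrightarrow> y \<notin> open_square (edge_mid E) n \<rho>"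
proof -
  define z U where "z = edge_mid E" and "U = open_square z n \<rho>"
  note e = element_at[OF K] and q = test_square[OF K n \<rho>]
  have fr: "frontier \<Omega> \<inter> \<Omega> = {}" using open_dom frontier_disjoint_eq by blast
  have unique: "K' = K" if K': "K' \<in> elements_at \<C> E" for K'
  proof (rule ccontr)
    assume "K' \<noteq> K"
    then have "edge_mid E \<in> \<Omega>" using interior_pair(3)[OF K K' _ n \<rho>] q(4) by blast
    moreover have "edge_mid E \<in> frontier \<Omega>" using edge_frame_line(6)[OF e(3)] E by blast
    ultimately show False using fr by blast
  qed
  show El: "E \<notin> line_edges \<C> S"
  proof
    assume "E \<in> line_edges \<C> S"
    then obtain K1 K2 where "K1 \<in> elements_at \<C> E" "K2 \<in> elements_at \<C> E" "K1 \<noteq> K2"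
      by (auto simp: line_edges_def interior_edges_def)
    then show False using unique by metis
  qed
  have neg: "(x - z) \<bullet> n \<le> 0" if "x \<in> K" for x
    using e(3) that unfolding edge_frame_def n[symmetric] z_def[symmetric] by blast
  have side: "x \<in> interior K" if "x \<in> U" "(x - z) \<bullet> n < 0" for x
    using square_cases(1)[OF e(3), of x] that by (simp add: U_def z_def n \<rho>)
  have online: "\<exists>a. \<bar>a\<bar> < diameter E / 2 \<and> x = edge_mid E + a *\<^sub>R tangent (outward_normal K E)" if "x \<in> U" "(x - z) \<bullet> n = 0" for x
    using square_cases(2)[OF e(3), of x] that by (simp add: U_def z_def n \<rho>)
  show "x \<in> interior K" if "x \<in> open_square (edge_mid E) n \<rho>" "x \<in> K" "(x - edge_mid E) \<bullet> n \<noteq> 0" for x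
    using side[of x] neg[of x] that by (simp add: U_def z_def)
  show "x \<in> E" if x: "x \<in> open_square (edge_mid E) n \<rho>" "x \<in> K" "x \<in> frontier \<Omega>" for x
  proof -
    have xU: "x \<in> U" using x(1) by (simp add: U_def z_def)
    have "x \<notin> interior K" using x(3) element_facts(5)[OF e(1)] fr by blast
    then have "(x - z) \<bullet> n = 0" using side[OF xU] neg[OF x(2)] by fastforce
    then obtain a where a: "\<bar>a\<bar> < diameter E / 2" "x = edge_mid E + a *\<^sub>R tangent (outward_normal K E)" using online[OF xU] by blast
    have "\<bar>a\<bar> \<le> diameter E / 2" using a(1) by simp
    then show ?thesis unfolding a(2) by (rule edge_frame_mem[OF e(3)])
  qed
  show "x\<^sub>0 \<notin> open_square (edge_mid E) n \<rho>" if "x\<^sub>0 \<in> K"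
    using vertex_in_square[OF K] neg[OF that] by (auto simp: n \<rho> z_def)
  show "y \<notin> open_square (edge_mid E) n \<rho>" if "E' \<in> line_edges \<C> S" "y \<in> E'" "y \<in> K"
    using line_edge_in_square[OF K that(1) _ that(2)] neg[OF that(3)] El that(1) by (auto simp: n \<rho> z_def)
  show "cut_region \<Omega> K (open_square (edge_mid E) n \<rho>)"
    unfolding cut_region_def z_def[symmetric] U_def[symmetric]
  proof (intro conjI exI[of _ "\<Union>(\<C> - {K})"])
    show "closed K" by (rule element_facts(3)[OF e(1)])
    show "closed (\<Union>(\<C> - {K}))" using finite_mesh element_facts(3) by (intro closed_Union) auto
    show "closure \<Omega> = K \<union> \<Union>(\<C> - {K})" using cover e(1) by blast
    show "K \<inter> \<Union>(\<C> - {K}) \<inter> U = {}"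
    proof (rule ccontr)
      assume "K \<inter> \<Union>(\<C> - {K}) \<inter> U \<noteq> {}"
      then obtain y K2 where y: "y \<in> K" "y \<in> K2" "y \<in> U" "K2 \<in> \<C>" "K2 \<noteq> K" by blast
      show False
      proof (cases "(y - z) \<bullet> n = 0")
        case True
        then obtain a where a: "\<bar>a\<bar> < diameter E / 2" "y = edge_mid E + a *\<^sub>R tangent (outward_normal K E)" using online[OF y(3)] by blast
        have "E edge_of K2"
          by (rule mesh_edge_shared[OF tri simplices e(1) y(4) e(2) e(3) a(1) y(2)[unfolded a(2)]])
        then have "K2 \<in> elements_at \<C> E" using y(4) by (simp add: elements_at_def)
        then show False using unique y(5) by blast
      next
        case False
        then have "y \<in> interior K" using side[OF y(3)] neg[OF y(1)] by simp
        then show False using mesh_interior_unique[OF tri simplices e(1) y(4) _ y(2)] y(5) by simp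
      qed
    qed
  qed
qed

lemma boundary_functional:
  assumes K: "K \<in> elements_at \<C> E" and E: "E \<subseteq> frontier \<Omega>" and n: "n = outward_normal K E"
    and z: "z = edge_mid E" and \<rho>: "\<rho> = square_ratio \<kappa> * diameter E" and w: "w = edge_test N c z n \<rho>"
    and V: "cut K w \<in> V"
  shows "\<bar>line_int z n (\<lambda>x. elem_Vn P vh K E x * w x) - line_int z n (\<lambda>x. elem_Mnn P vh K E x * (grad pd w x \<bullet> n))\<bar>
    \<le> edge_const * coeff_sum N c / \<rho> * edge_error E"
proof -
  note e = element_at[OF K] and q = test_square[OF K n \<rho>] and be = boundary_element[OF K E n \<rho>, folded z]
  have wU: "supported_in (open_square z n \<rho>) w" unfolding w by (rule supported_edge_test[OF q(2)])
  then have w0: "x \<notin> open_square z n \<rho> \<Longrightarrow> w x = 0" for x by (auto simp: supported_in_def)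
  have ll: "line_load (cut K w) = 0"
  proof (rule line_load_0)
    fix E' assume E': "E' \<in> line_edges \<C> S"
    have "is_segment E'" by (rule line_edgeD[OF E'])
    then show "is_segment E' \<and> (\<forall>x\<in>E'. cut K w x = 0)" using be(6)[OF E'] w0 by (auto simp: cut_def)
  next
    show "cut K w x\<^sub>0 = 0" using be(5) w0 by (auto simp: cut_def)
  qed
  have "\<bar>(\<Sum>K'\<in>{K}. line_int z (outward_normal K' E) (\<lambda>x. elem_Vn P vh K' E x * w x
      - elem_Mnn P vh K' E x * (grad pd w x \<bullet> outward_normal K' E))) - line_load (cut K w)\<bar>
    \<le> edge_const * coeff_sum N c / \<rho> * edge_error E"
    by (rule edge_residual[OF K n z \<rho> w _ _ be(2) V]) (use K be(3) in auto)
  then have "\<bar>line_int z n (\<lambda>x. elem_Vn P vh K E x * w x - elem_Mnn P vh K E x * (grad pd w x \<bullet> n))\<bar>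
    \<le> edge_const * coeff_sum N c / \<rho> * edge_error E" by (simp add: ll flip: n)
  also have "line_int z n (\<lambda>x. elem_Vn P vh K E x * w x - elem_Mnn P vh K E x * (grad pd w x \<bullet> n))
     = line_int z n (\<lambda>x. elem_Vn P vh K E x * w x) - line_int z n (\<lambda>x. elem_Mnn P vh K E x * (grad pd w x \<bullet> n))"
    by (rule line_int_supported(1)[OF q(1) supported_in_mult[OF smooth_elem_Vn[OF e(1)] wU]
       supported_in_mult[OF smooth_elem_Mnn[OF e(1)] supported_in_grad_inner[OF regular_open_square wU]]])
  finally show ?thesis .
qed

text \<open>On the closed element the square meets the boundary of the domain only in \<open>E\<close>. So it meets the clamped part, and for a free edge also the simply supported part, in finitely many points; on a simply supported edge the value of the test function has to vanish, but not its slope.\<close>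

lemma boundary_cut:
  assumes K: "K \<in> elements_at \<C> E" and n: "n = outward_normal K E"
    and z: "z = edge_mid E" and \<rho>: "\<rho> = square_ratio \<kappa> * diameter E" and w: "w = edge_test N c z n \<rho>"
    and E: "E \<subseteq> \<Gamma>f \<or> E \<subseteq> \<Gamma>s \<and> (\<forall>x\<in>E. w x = 0)"
  shows "cut K w \<in> V"
proof -
  define U where "U = open_square z n \<rho>"
  have fr: "frontier \<Omega> = \<Gamma>c \<union> \<Gamma>s \<union> \<Gamma>f" and fin: "finite (\<Gamma>c \<inter> \<Gamma>s)" "finite (\<Gamma>c \<inter> \<Gamma>f)" "finite (\<Gamma>s \<inter> \<Gamma>f)"
    using parts by (auto simp: boundary_partition_def)
  have Ef: "E \<subseteq> frontier \<Omega>" using E fr by blast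
  note q = test_square[OF K n \<rho>] and be = boundary_element[OF K Ef n \<rho>, folded z, folded U_def]
  have wU: "supported_in U w" unfolding w U_def by (rule supported_edge_test[OF q(2)])
  have inE: "x \<in> E" if "x \<in> \<Gamma>c \<union> \<Gamma>s" "x \<in> K" "x \<in> U" for x using be(4)[OF that(3,2)] that(1) fr by blast
  show ?thesis
  proof (rule cut_plate_space[OF open_dom bounded_dom be(2) _ wU])
    show "regular_open U" unfolding U_def by (rule regular_open_square)
    show "finite {x \<in> \<Gamma>c \<union> \<Gamma>s. cut K w x \<noteq> 0}"
    proof (rule finite_subset)
      show "{x \<in> \<Gamma>c \<union> \<Gamma>s. cut K w x \<noteq> 0} \<subseteq> (\<Gamma>c \<inter> \<Gamma>f) \<union> (\<Gamma>s \<inter> \<Gamma>f)"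
      proof
        fix x assume "x \<in> {x \<in> \<Gamma>c \<union> \<Gamma>s. cut K w x \<noteq> 0}"
        then have x: "x \<in> \<Gamma>c \<union> \<Gamma>s" "x \<in> K" "w x \<noteq> 0" by (auto simp: cut_def split: if_splits)
        then have "x \<in> E" using inE wU by (auto simp: supported_in_def)
        then show "x \<in> (\<Gamma>c \<inter> \<Gamma>f) \<union> (\<Gamma>s \<inter> \<Gamma>f)" using E x by blast
      qed
    qed (use fin in blast)
    show "finite (\<Gamma>c \<inter> K \<inter> U)"
    proof (rule finite_subset)
      show "\<Gamma>c \<inter> K \<inter> U \<subseteq> (\<Gamma>c \<inter> \<Gamma>f) \<union> (\<Gamma>c \<inter> \<Gamma>s)" using inE E by blast
    qed (use fin in blast)
  qed
qed

lemma boundary_Mnn_estimate: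
  assumes K: "K \<in> elements_at \<C> E" and E: "E \<subseteq> \<Gamma>f \<or> E \<subseteq> \<Gamma>s" and N1: "1 \<le> N"
  shows "diameter E powr (1/2) * seg_norm E (elem_Mnn P vh K E) \<le> trace_const * edge_const * edge_error E"
proof -
  define n z \<rho> where n: "n = outward_normal K E" and z: "z = edge_mid E" and \<rho>: "\<rho> = square_ratio \<kappa> * diameter E"
  note q = test_square[OF K n \<rho>] and e = element_at[OF K]
  have Ef: "E \<subseteq> frontier \<Omega>" using E parts by (auto simp: boundary_partition_def)
  show ?thesis
  proof (rule moment_trace_bound[OF K n z \<rho> poly_le_elem_Mnn[OF e(1)] N1])
    fix c w assume w: "w = edge_test N (edge_coeffs 1 c) z n \<rho>"
    have w0: "w (z + t *\<^sub>R tangent n) = 0" for t unfolding w by (rule test_vanishes_on_line(1)[OF q(1,2) N1])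
    have wE: "\<forall>x\<in>E. w x = 0"
    proof
      fix x assume "x \<in> E"
      then have "x \<in> {edge_mid E + t *\<^sub>R tangent (outward_normal K E) |t. \<bar>t\<bar> \<le> diameter E / 2}"
        using edge_frame_line(1)[OF e(3)] by simp
      then show "w x = 0" using w0 by (auto simp: z n)
    qed
    have a: "line_int z n (\<lambda>x. elem_Vn P vh K E x * w x) = 0" by (rule line_int_zero) (simp add: w0)
    have "cut K w \<in> V" by (rule boundary_cut[OF K n z \<rho> w]) (use E wE in blast)
    then show "\<bar>line_int z n (\<lambda>x. elem_Mnn P vh K E x * (grad pd w x \<bullet> n))\<bar>
        \<le> edge_const * coeff_sum N (edge_coeffs 1 c) / \<rho> * edge_error E"
      using boundary_functional[OF K Ef n z \<rho> w] unfolding a by simp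
  qed
qed

lemma boundary_Vn_estimate:
  assumes K: "K \<in> elements_at \<C> E" and E: "E \<subseteq> \<Gamma>f"
  shows "diameter E powr (3/2) * seg_norm E (elem_Vn P vh K E) \<le> trace_const / square_ratio \<kappa> * edge_const * edge_error E"
proof -
  define n z \<rho> where n: "n = outward_normal K E" and z: "z = edge_mid E" and \<rho>: "\<rho> = square_ratio \<kappa> * diameter E"
  note q = test_square[OF K n \<rho>] and e = element_at[OF K]
  have Ef: "E \<subseteq> frontier \<Omega>" using E parts by (auto simp: boundary_partition_def)
  have "diameter E powr (3/2) * seg_norm E (elem_Vn P vh K E)
     \<le> trace_const / square_ratio \<kappa> * edge_const * edge_error E + trace_const * B * (diameter E powr (3/2) * 0)"
  proof (rule shear_trace_bound[OF K n z \<rho> poly_le_elem_Vn[OF e(1)] order_refl])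
    fix c w assume w: "w = edge_test N (edge_coeffs 0 c) z n \<rho>"
    have "grad pd w (z + t *\<^sub>R tangent n) \<bullet> n = 0" for t unfolding w by (rule test_vanishes_on_line(2)[OF q(1,2)])
    then have a: "line_int z n (\<lambda>x. elem_Mnn P vh K E x * (grad pd w x \<bullet> n)) = 0" by (intro line_int_zero) simp
    have "cut K w \<in> V" by (rule boundary_cut[OF K n z \<rho> w]) (use E in blast)
    then show "\<bar>line_int z n (\<lambda>x. elem_Vn P vh K E x * w x)\<bar> \<le> edge_const * coeff_sum N (edge_coeffs 0 c) / \<rho> * edge_error E
       + sqrt (diameter E) * 0 * (B * coeff_sum N (edge_coeffs 0 c))"
      using boundary_functional[OF K Ef n z \<rho> w] unfolding a by simp
  qed
  then show ?thesis by simp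
qed

section \<open>All estimates with one constant\<close>

definition total_const :: real where
  "total_const = \<bar>element_const\<bar> + \<bar>trace_const * edge_const\<bar> + \<bar>trace_const / square_ratio \<kappa> * edge_const\<bar>
     + \<bar>trace_const * B + 1\<bar>"

lemma below_total_const:
  "element_const \<le> total_const" "trace_const * edge_const \<le> total_const"
  "trace_const / square_ratio \<kappa> * edge_const \<le> total_const" "trace_const * B + 1 \<le> total_const"
  unfolding total_const_def by linarith+

lemma estimates:
  assumes N1: "1 \<le> N" and C: "total_const \<le> C"
  shows "(\<forall>K \<in> \<C>. (diameter K)\<^sup>2 * L2norm K (\<lambda>x. elem_op P vh K x - f x)
          \<le> C * (H2norm \<Omega> K err + osc_elem f fh K)) \<and>
      (\<forall>E \<in> interior_edges \<C>. \<forall>K \<in> elements_at \<C> E. \<forall>K' \<in> elements_at \<C> E. K \<noteq> K' \<longrightarrow>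
          diameter E powr (1/2) * seg_norm E (jump_Mnn P vh K K' E)
          \<le> C * (H2norm \<Omega> (patch \<C> E) err + osc_patch f fh \<C> E)) \<and>
      (\<forall>E \<in> interior_edges \<C> - line_edges \<C> S.
        \<forall>K \<in> elements_at \<C> E. \<forall>K' \<in> elements_at \<C> E. K \<noteq> K' \<longrightarrow>
          diameter E powr (3/2) * seg_norm E (jump_Vn P vh K K' E)
          \<le> C * (H2norm \<Omega> (patch \<C> E) err + osc_patch f fh \<C> E)) \<and>
      (\<forall>E \<in> line_edges \<C> S. \<forall>K \<in> elements_at \<C> E. \<forall>K' \<in> elements_at \<C> E. K \<noteq> K' \<longrightarrow>
          diameter E powr (3/2) * seg_norm E (\<lambda>x. jump_Vn P vh K K' E x - g x)
          \<le> C * (H2norm \<Omega> (patch \<C> E) err + osc_patch f fh \<C> E + osc_edge g (gh E) E)) \<and>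
      (\<forall>E \<in> boundary_edges \<C> \<Gamma>f \<union> boundary_edges \<C> \<Gamma>s. \<forall>K \<in> elements_at \<C> E.
          diameter E powr (1/2) * seg_norm E (elem_Mnn P vh K E)
          \<le> C * (H2norm \<Omega> (patch \<C> E) err + osc_patch f fh \<C> E)) \<and>
      (\<forall>E \<in> boundary_edges \<C> \<Gamma>f. \<forall>K \<in> elements_at \<C> E.
          diameter E powr (3/2) * seg_norm E (elem_Vn P vh K E)
          \<le> C * (H2norm \<Omega> (patch \<C> E) err + osc_patch f fh \<C> E))"
proof (intro conjI ballI impI)
  have up: "a \<le> C * Y" if "a \<le> k * Y" "k \<le> total_const" "Y \<ge> 0" for a k Y
  proof -
    have "k * Y \<le> C * Y" using that C by (intro mult_right_mono) linarith+
    then show ?thesis using that(1) by linarith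
  qed
  note b = below_total_const and e = edge_error_nonneg
  have y: "0 \<le> H2norm \<Omega> K err + osc_elem f fh K" for K by (simp add: H2norm_nonneg osc_elem_nonneg)
  show "(diameter K)\<^sup>2 * L2norm K (\<lambda>x. elem_op P vh K x - f x) \<le> C * (H2norm \<Omega> K err + osc_elem f fh K)" if "K \<in> \<C>" for K
    by (rule up[OF element_estimate(1)[OF that] b(1) y])
  show "diameter E powr (1/2) * seg_norm E (jump_Mnn P vh K K' E) \<le> C * (H2norm \<Omega> (patch \<C> E) err + osc_patch f fh \<C> E)"
    if "K \<in> elements_at \<C> E" "K' \<in> elements_at \<C> E" "K \<noteq> K'" for E K K'
    unfolding edge_error_def[symmetric] by (rule up[OF jump_Mnn_estimate[OF that N1] b(2) e])
  show "diameter E powr (3/2) * seg_norm E (jump_Vn P vh K K' E) \<le> C * (H2norm \<Omega> (patch \<C> E) err + osc_patch f fh \<C> E)"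
    if "E \<in> interior_edges \<C> - line_edges \<C> S" and K: "K \<in> elements_at \<C> E" "K' \<in> elements_at \<C> E" "K \<noteq> K'" for E K K'
    unfolding edge_error_def[symmetric] by (rule up[OF jump_Vn_estimate[OF K] b(3) e]) (use that in blast)
  show "diameter E powr (3/2) * seg_norm E (\<lambda>x. jump_Vn P vh K K' E x - g x)
        \<le> C * (H2norm \<Omega> (patch \<C> E) err + osc_patch f fh \<C> E + osc_edge g (gh E) E)"
    if E: "E \<in> line_edges \<C> S" and K: "K \<in> elements_at \<C> E" "K' \<in> elements_at \<C> E" "K \<noteq> K'" for E K K'
  proof -
    have o: "0 \<le> osc_edge g (gh E) E" by (simp add: osc_edge_def seg_norm_def seg_int_def)
    have "trace_const / square_ratio \<kappa> * edge_const * edge_error E \<le> C * edge_error E" by (rule up[OF order_refl b(3) e])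
    moreover have "(trace_const * B + 1) * osc_edge g (gh E) E \<le> C * osc_edge g (gh E) E" by (rule up[OF order_refl b(4) o])
    ultimately show ?thesis using line_jump_estimate[OF K E] unfolding edge_error_def[symmetric] distrib_left[of C "edge_error E"] by linarith
  qed
  show "diameter E powr (1/2) * seg_norm E (elem_Mnn P vh K E) \<le> C * (H2norm \<Omega> (patch \<C> E) err + osc_patch f fh \<C> E)"
    if E: "E \<in> boundary_edges \<C> \<Gamma>f \<union> boundary_edges \<C> \<Gamma>s" and K: "K \<in> elements_at \<C> E" for E K
    unfolding edge_error_def[symmetric] by (rule up[OF boundary_Mnn_estimate[OF K _ N1] b(2) e]) (use E in \<open>auto simp: boundary_edges_def\<close>)
  show "diameter E powr (3/2) * seg_norm E (elem_Vn P vh K E) \<le> C * (H2norm \<Omega> (patch \<C> E) err + osc_patch f fh \<C> E)"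
    if E: "E \<in> boundary_edges \<C> \<Gamma>f" and K: "K \<in> elements_at \<C> E" for E K
    unfolding edge_error_def[symmetric] by (rule up[OF boundary_Vn_estimate[OF K] b(3) e]) (use E in \<open>auto simp: boundary_edges_def\<close>)
qed

end

theorem theorem3p2:
  fixes P :: plate and \<Omega> \<Gamma>c \<Gamma>s \<Gamma>f :: "plane set" and \<kappa> :: real and m q :: nat
  assumes "polygonal_domain \<Omega>"
    and "boundary_partition \<Omega> \<Gamma>c \<Gamma>s \<Gamma>f"
    and "admissible P"
    and "coercive_form P \<Omega> (plate_space \<Omega> \<Gamma>c \<Gamma>s)"
  shows "\<exists>C>0. \<forall>(\<C> :: plane set set) (S :: plane set) (x\<^sub>0 :: plane) (f :: field) (g :: field) (F :: real)
      (Vh :: field set) (fh :: field) (gh :: plane set \<Rightarrow> field) (u :: field).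
    plate_mesh \<kappa> \<Omega> \<Gamma>c \<Gamma>s \<Gamma>f \<C> \<and>
    S = \<Union>(line_edges \<C> S) \<and>
    x\<^sub>0 \<in> \<Omega> \<and> (\<exists>K\<in>\<C>. x\<^sub>0 extreme_point_of K) \<and>
    f \<in> L2 \<Omega> \<and> (\<forall>E \<in> line_edges \<C> S. g \<in> seg_L2 E) \<and>
    conforming_space m \<Omega> (plate_space \<Omega> \<Gamma>c \<Gamma>s) \<C> Vh \<and>
    fh \<in> Vh \<and> (\<forall>E \<in> line_edges \<C> S. poly_le q (gh E)) \<and>
    u \<in> plate_space \<Omega> \<Gamma>c \<Gamma>s \<and>
    (\<forall>v \<in> plate_space \<Omega> \<Gamma>c \<Gamma>s. plate_form P \<Omega> u v = load \<Omega> f (line_edges \<C> S) g F x\<^sub>0 v)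
    \<longrightarrow> (\<forall>vh \<in> Vh.
      (\<forall>K \<in> \<C>. (diameter K)\<^sup>2 * L2norm K (\<lambda>x. elem_op P vh K x - f x)
          \<le> C * (H2norm \<Omega> K (\<lambda>x. u x - vh x) + osc_elem f fh K)) \<and>
      (\<forall>E \<in> interior_edges \<C>. \<forall>K \<in> elements_at \<C> E. \<forall>K' \<in> elements_at \<C> E. K \<noteq> K' \<longrightarrow>
          diameter E powr (1/2) * seg_norm E (jump_Mnn P vh K K' E)
          \<le> C * (H2norm \<Omega> (patch \<C> E) (\<lambda>x. u x - vh x) + osc_patch f fh \<C> E)) \<and>
      (\<forall>E \<in> interior_edges \<C> - line_edges \<C> S.
        \<forall>K \<in> elements_at \<C> E. \<forall>K' \<in> elements_at \<C> E. K \<noteq> K' \<longrightarrow>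
          diameter E powr (3/2) * seg_norm E (jump_Vn P vh K K' E)
          \<le> C * (H2norm \<Omega> (patch \<C> E) (\<lambda>x. u x - vh x) + osc_patch f fh \<C> E)) \<and>
      (\<forall>E \<in> line_edges \<C> S. \<forall>K \<in> elements_at \<C> E. \<forall>K' \<in> elements_at \<C> E. K \<noteq> K' \<longrightarrow>
          diameter E powr (3/2) * seg_norm E (\<lambda>x. jump_Vn P vh K K' E x - g x)
          \<le> C * (H2norm \<Omega> (patch \<C> E) (\<lambda>x. u x - vh x) + osc_patch f fh \<C> E + osc_edge g (gh E) E)) \<and>
      (\<forall>E \<in> boundary_edges \<C> \<Gamma>f \<union> boundary_edges \<C> \<Gamma>s. \<forall>K \<in> elements_at \<C> E.
          diameter E powr (1/2) * seg_norm E (elem_Mnn P vh K E)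
          \<le> C * (H2norm \<Omega> (patch \<C> E) (\<lambda>x. u x - vh x) + osc_patch f fh \<C> E)) \<and>
      (\<forall>E \<in> boundary_edges \<C> \<Gamma>f. \<forall>K \<in> elements_at \<C> E.
          diameter E powr (3/2) * seg_norm E (elem_Vn P vh K E)
          \<le> C * (H2norm \<Omega> (patch \<C> E) (\<lambda>x. u x - vh x) + osc_patch f fh \<C> E)))"
proof -
  \<comment> \<open>The successor makes room for the factor \<open>b\<close> of the moment test functions.\<close>
  define N where "N = Suc (max m q)"
  have nN: "m \<le> N" "q \<le> N" "1 \<le> N" by (auto simp: N_def)
  obtain B where B: "B > 0" "\<And>c z n \<rho> x k l. norm n = 1 \<Longrightarrow> \<rho> > 0 \<Longrightarrow>
     \<bar>edge_test N c z n \<rho> x\<bar> \<le> B * coeff_sum N c \<and> \<bar>pd l (pd k (edge_test N c z n \<rho>)) x\<bar> \<le> B / \<rho>\<^sup>2 * coeff_sum N c"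
    using edge_test_bounds[of N] by auto
  define I1 where "I1 c = (\<integral>t. weight t * (\<Sum>i\<le>N. c i * t ^ i)\<^sup>2 \<partial>lborel)" for c :: "nat \<Rightarrow> real"
  define I2 where "I2 c = (\<integral>p. weight (fst p) * weight (snd p) *
      (\<Sum>i\<le>N. \<Sum>j\<le>N. c i j * fst p ^ i * snd p ^ j)\<^sup>2 \<partial>(lborel \<Otimes>\<^sub>M lborel))" for c :: "nat \<Rightarrow> nat \<Rightarrow> real"
  have I0: "I1 c \<ge> 0" "I2 d \<ge> 0" for c d
    by (simp_all add: I1_def I2_def weight_nonneg)
  obtain C1 where C1: "C1 > 0" "\<And>c i. i \<le> N \<Longrightarrow> (c i)\<^sup>2 \<le> C1 * I1 c"
    using coeff_le_weighted_L2[of N] unfolding I1_def by auto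
  obtain C2 where C2: "C2 > 0" "\<And>c i j. i \<le> N \<Longrightarrow> j \<le> N \<Longrightarrow> (c i j)\<^sup>2 \<le> C2 * I2 c"
    using coeff_le_weighted_L2_plane[of N] unfolding I2_def by auto
  \<comment> \<open>One constant for the norm equivalences on the edge and on the square.\<close>
  define Cw where "Cw = C1 + C2"
  have Cw: "Cw > 0" using C1(1) C2(1) by (simp add: Cw_def)
  have w1: "(c i)\<^sup>2 \<le> Cw * I1 c" if "i \<le> N" for c i
    using C1(2)[OF that, of c] I0(1)[of c] mult_nonneg_nonneg[OF less_imp_le[OF C2(1)], of "I1 c"] by (simp add: Cw_def distrib_right)
  have w2: "(c i j)\<^sup>2 \<le> Cw * I2 c" if "i \<le> N" "j \<le> N" for c i j
    using C2(2)[OF that, of c] I0(2)[of c] mult_nonneg_nonneg[OF less_imp_le[OF C1(1)], of "I2 c"] by (simp add: Cw_def distrib_right)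
  \<comment> \<open>The maximum is positive for every \<open>\<kappa>\<close>, also if no mesh with this shape constant exists.\<close>
  define C where "C = max 1 (plate_fem.total_const P \<kappa> N B Cw)"
  have fem: "plate_fem P \<Omega> \<Gamma>c \<Gamma>s \<Gamma>f \<kappa> m q \<C> S x\<^sub>0 f g F Vh fh gh u vh N B Cw"
    if H: "plate_mesh \<kappa> \<Omega> \<Gamma>c \<Gamma>s \<Gamma>f \<C> \<and>
      S = \<Union>(line_edges \<C> S) \<and>
      x\<^sub>0 \<in> \<Omega> \<and> (\<exists>K\<in>\<C>. x\<^sub>0 extreme_point_of K) \<and>
      f \<in> L2 \<Omega> \<and> (\<forall>E \<in> line_edges \<C> S. g \<in> seg_L2 E) \<and>
      conforming_space m \<Omega> (plate_space \<Omega> \<Gamma>c \<Gamma>s) \<C> Vh \<and>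
      fh \<in> Vh \<and> (\<forall>E \<in> line_edges \<C> S. poly_le q (gh E)) \<and>
      u \<in> plate_space \<Omega> \<Gamma>c \<Gamma>s \<and>
      (\<forall>v \<in> plate_space \<Omega> \<Gamma>c \<Gamma>s. plate_form P \<Omega> u v = load \<Omega> f (line_edges \<C> S) g F x\<^sub>0 v)"
      and vh: "vh \<in> Vh" for \<C> S x\<^sub>0 f g F Vh fh gh u vh
    by (unfold_locales; (fact assms(1,2) B Cw nN w1[unfolded I1_def] w2[unfolded I2_def] vh)?; use H in blast)
  have C1: "plate_fem.total_const P \<kappa> N B Cw \<le> C" by (simp add: C_def)
  show ?thesis
  proof (intro exI[of _ C] conjI allI impI)
    show "C > 0" by (simp add: C_def)
  qed (rule ballI, rule plate_fem.estimates[OF fem nN(3) C1])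
qed

end
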